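(* Let $q>0$ and $\tau=(\tau_1,\dots,\tau_r)\in Z(G)^r$. Then the representation category of the compact quantum group $G_q^\tau$ is unitarily monoidally equivalent to $\operatorname{Rep}(G_q)^{\Phi^\tau}$, the representation category of $G_q$ with associativity morphisms defined by $\Phi^\tau$.
   Context: Setting. $G$ is a semisimple simply connected compact Lie group of rank $r$, $\mathfrak g$ its complexified Lie algebra, $T\subset G$ a maximal torus, $P=\hat T$ the weight lattice, $Q\subset P$ the root lattice, $\alpha_1,\dots,\alpha_r$ the simple roots, $(a_{ij})$ the Cartan matrix. The center $Z(G)\subset T$ is identified with the Pontryagin dual of $P/Q$, and $\langle t,\lambda\rangle$ denotes the pairing of $t\in T$ with $\lambda\in P$. An ad-invariant symmetric form on $\mathfrak g$, negative definite on the real Lie algebra of $G$, is fixed (if $G$ is simple, normalized so that $(\alpha,\alpha)=2$ for short roots). Put $q_i=q^{(\alpha_i,\alpha_i)/2}$. For $q>0$, $q\ne1$, $\mathcal U_q(\mathfrak g)$ is the algebra generated by $E_i,F_i,K_i^{\pm1}$ ($1\le i\le r$) with commuting $K_i$, $K_iE_jK_i^{-1}=q_i^{a_{ij}}E_j$, $K_iF_jK_i^{-1}=q_i^{-a_{ij}}F_j$, $[E_i,F_j]=\delta_{ij}\frac{K_i-K_i^{-1}}{q_i-q_i^{-1}}$ and the quantum Serre relations for the $E_i$ and for the $F_i$. It is a Hopf $*$-algebra with $\hat\Delta_q(E_i)=E_i\otimes1+K_i\otimes E_i$, $\hat\Delta_q(F_i)=F_i\otimes K_i^{-1}+1\otimes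 F_i$, $\hat\Delta_q(K_i)=K_i\otimes K_i$, $E_i^*=F_iK_i$, $K_i^*=K_i$. For $q=1$, $\mathcal U_1(\mathfrak g)=\mathcal U(\mathfrak g)$ with Chevalley generators $E_i,F_i,H_i$, $E_i^*=F_i$, $H_i^*=H_i$. A representation on $V$ is admissible if $V=\bigoplus_{\chi\in P}V_\chi$ with $K_i$ acting on $V_\chi$ by $q^{(\alpha_i,\chi)}$ (for $q=1$: $H_i$ acting by $2(\alpha_i,\chi)/(\alpha_i,\alpha_i)$). The compact quantum group $G_q$ is the one defined (Tannaka–Krein–Woronowicz) by the finite dimensional admissible $*$-representations with the forgetful functor. For a compact quantum group $\mathbb G$, $\operatorname{Rep}(\mathbb G)$ is the C$^*$-tensor category of its finite dimensional unitary representations. $\tilde{\mathcal U}_q(\mathfrak g)$ is the universal $*$-algebra generated by $\mathcal U_q(\mathfrak g)$ and unitary central elements $C_1,\dots,C_r$; it is a Hopf $*$-algebra with $\hat\Delta(E_i)=E_i\otimes C_i+K_i\otimes E_i$, $\hat\Delta(K_i)=K_i\otimes K_i$, $\hat\Delta(C_i)=C_i\otimes C_i$ (for $q=1$: $\hat\Delta(E_i)=E_i\otimes C_i+1\otimes E_i$, $\hat\Delta(H_i)=H_i\otimes1+1\otimes H_i$). A representation of $\tilde{\mathcal U}_q(\mathfrak g)$ is $\tau$-admissible if its restriction to $\mathcal U_q(\mathfrak g)$ is admissible and $C_i$ acts on each weight space $V_\chi$ by $\langle\tau_i,\chi\rangle$. $G_q^\tau$ is the compact quantum group defined by the C$^*$-tensor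 category of finite dimensional $\tau$-admissible $*$-representations with its forgetful functor. The cocycle $\Phi^\tau$. Choose $f\colon P\times P\to\mathbb T$ with $f(\lambda,\mu+\alpha)=f(\lambda,\mu)$ for $\alpha\in Q$ and $f(\lambda+\alpha_i,\mu)=\langle\tau_i,\mu\rangle f(\lambda,\mu)$. Then $(\partial f)(\lambda,\mu,\nu)=f(\mu,\nu)f(\lambda+\mu,\nu)^{-1}f(\lambda,\mu+\nu)f(\lambda,\mu)^{-1}$ is $Q$-invariant in each variable and so is a $\mathbb T$-valued $3$-cocycle on $P/Q=\widehat{Z(G)}$; put $\Phi^\tau=\overline{\partial f}$ (another choice of $f$ changes it by a coboundary on $P/Q$). $\operatorname{Rep}(G_q)^{\Phi^\tau}$ is the category $\operatorname{Rep}(G_q)$ with the same tensor product, but with associativity morphism $(U\otimes V)\otimes W\to U\otimes(V\otimes W)$ acting, for irreducible $U,V,W$ on which $Z(G)$ acts by characters $\chi_U,\chi_V,\chi_W\in P/Q$, as multiplication by the scalar $\Phi^\tau(\chi_U,\chi_V,\chi_W)$. *)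

theory Defs
  imports
    "HOL-Analysis.Euclidean_Space"
    "HOL-Library.FuncSet"
    "Jordan_Normal_Form.Matrix"
    "Jordan_Normal_Form.Schur_Decomposition"
begin

section \<open>C*-tensor categories and unitary monoidal equivalence\<close>

text \<open>
  Morphisms need not know their source and target, so everything that depends on these takes the
  objects as arguments.  \<open>Assoc U V W\<close> goes from \<open>(U \<otimes> V) \<otimes> W\<close> to \<open>U \<otimes> (V \<otimes> W)\<close>, and
  \<open>LUnit U\<close>, \<open>RUnit U\<close> go from \<open>1 \<otimes> U\<close>, \<open>U \<otimes> 1\<close> to \<open>U\<close>.
\<close>

record ('o, 'm) tensor_cat =
  Obj :: "'o set"
  Hom :: "'o \<Rightarrow> 'o \<Rightarrow> 'm set"
  Idm :: "'o \<Rightarrow> 'm"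
  Comp :: "'m \<Rightarrow> 'm \<Rightarrow> 'm"
  Add :: "'m \<Rightarrow> 'm \<Rightarrow> 'm"
  Scale :: "complex \<Rightarrow> 'm \<Rightarrow> 'm"
  Adj :: "'m \<Rightarrow> 'm"
  TensO :: "'o \<Rightarrow> 'o \<Rightarrow> 'o"
  TensM :: "'m \<Rightarrow> 'm \<Rightarrow> 'm"
  One :: "'o"
  Assoc :: "'o \<Rightarrow> 'o \<Rightarrow> 'o \<Rightarrow> 'm"
  LUnit :: "'o \<Rightarrow> 'm"
  RUnit :: "'o \<Rightarrow> 'm"

definition unitary_mor :: "('o, 'm) tensor_cat \<Rightarrow> 'o \<Rightarrow> 'o \<Rightarrow> 'm \<Rightarrow> bool" where
  "unitary_mor \<C> U V T \<longleftrightarrow> T \<in> Hom \<C> U V \<and>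
     Comp \<C> (Adj \<C> T) T = Idm \<C> U \<and> Comp \<C> T (Adj \<C> T) = Idm \<C> V"

definition linear_star_functor ::
  "('o, 'm) tensor_cat \<Rightarrow> ('p, 'n) tensor_cat \<Rightarrow> ('o \<Rightarrow> 'p) \<Rightarrow> ('o \<Rightarrow> 'o \<Rightarrow> 'm \<Rightarrow> 'n) \<Rightarrow> bool" where
  "linear_star_functor \<C> \<D> F0 F1 \<longleftrightarrow>
     (\<forall>U\<in>Obj \<C>. F0 U \<in> Obj \<D> \<and> F1 U U (Idm \<C> U) = Idm \<D> (F0 U)) \<and>
     (\<forall>U\<in>Obj \<C>. \<forall>V\<in>Obj \<C>. \<forall>S\<in>Hom \<C> U V.
        F1 U V S \<in> Hom \<D> (F0 U) (F0 V) \<and>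
        F1 V U (Adj \<C> S) = Adj \<D> (F1 U V S) \<and>
        (\<forall>c. F1 U V (Scale \<C> c S) = Scale \<D> c (F1 U V S)) \<and>
        (\<forall>T\<in>Hom \<C> U V. F1 U V (Add \<C> S T) = Add \<D> (F1 U V S) (F1 U V T)) \<and>
        (\<forall>W\<in>Obj \<C>. \<forall>T\<in>Hom \<C> V W. F1 U W (Comp \<C> T S) = Comp \<D> (F1 V W T) (F1 U V S)))"

definition equivalence_functor ::
  "('o, 'm) tensor_cat \<Rightarrow> ('p, 'n) tensor_cat \<Rightarrow> ('o \<Rightarrow> 'p) \<Rightarrow> ('o \<Rightarrow> 'o \<Rightarrow> 'm \<Rightarrow> 'n) \<Rightarrow> bool" where
  "equivalence_functor \<C> \<D> F0 F1 \<longleftrightarrow>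
     (\<forall>U\<in>Obj \<C>. \<forall>V\<in>Obj \<C>. bij_betw (F1 U V) (Hom \<C> U V) (Hom \<D> (F0 U) (F0 V))) \<and>
     (\<forall>Y\<in>Obj \<D>. \<exists>U\<in>Obj \<C>. \<exists>T. unitary_mor \<D> (F0 U) Y T)"

text \<open>
  The tensor structure of a functor: a unitary \<open>e : 1 \<rightarrow> F(1)\<close> and natural unitaries
  \<open>m U V : F(U) \<otimes> F(V) \<rightarrow> F(U \<otimes> V)\<close> compatible with associativity and unit morphisms.
\<close>

definition unitary_tensor_structure ::
  "('o, 'm) tensor_cat \<Rightarrow> ('p, 'n) tensor_cat \<Rightarrow> ('o \<Rightarrow> 'p) \<Rightarrow> ('o \<Rightarrow> 'o \<Rightarrow> 'm \<Rightarrow> 'n) \<Rightarrow>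
   'n \<Rightarrow> ('o \<Rightarrow> 'o \<Rightarrow> 'n) \<Rightarrow> bool" where
  "unitary_tensor_structure \<C> \<D> F0 F1 e m \<longleftrightarrow>
     unitary_mor \<D> (One \<D>) (F0 (One \<C>)) e \<and>
     (\<forall>U\<in>Obj \<C>. \<forall>V\<in>Obj \<C>.
        unitary_mor \<D> (TensO \<D> (F0 U) (F0 V)) (F0 (TensO \<C> U V)) (m U V)) \<and>
     (\<forall>U\<in>Obj \<C>. \<forall>U'\<in>Obj \<C>. \<forall>V\<in>Obj \<C>. \<forall>V'\<in>Obj \<C>. \<forall>S\<in>Hom \<C> U U'. \<forall>T\<in>Hom \<C> V V'.
        Comp \<D> (m U' V') (TensM \<D> (F1 U U' S) (F1 V V' T)) =
        Comp \<D> (F1 (TensO \<C> U V) (TensO \<C> U' V') (TensM \<C> S T)) (m U V)) \<and>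
     (\<forall>U\<in>Obj \<C>. \<forall>V\<in>Obj \<C>. \<forall>W\<in>Obj \<C>.
        Comp \<D> (m U (TensO \<C> V W))
          (Comp \<D> (TensM \<D> (Idm \<D> (F0 U)) (m V W)) (Assoc \<D> (F0 U) (F0 V) (F0 W))) =
        Comp \<D> (F1 (TensO \<C> (TensO \<C> U V) W) (TensO \<C> U (TensO \<C> V W)) (Assoc \<C> U V W))
          (Comp \<D> (m (TensO \<C> U V) W) (TensM \<D> (m U V) (Idm \<D> (F0 W))))) \<and>
     (\<forall>U\<in>Obj \<C>.
        Comp \<D> (F1 (TensO \<C> (One \<C>) U) U (LUnit \<C> U))
          (Comp \<D> (m (One \<C>) U) (TensM \<D> e (Idm \<D> (F0 U)))) = LUnit \<D> (F0 U) \<and>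
        Comp \<D> (F1 (TensO \<C> U (One \<C>)) U (RUnit \<C> U))
          (Comp \<D> (m U (One \<C>)) (TensM \<D> (Idm \<D> (F0 U)) e)) = RUnit \<D> (F0 U))"

definition unitarily_monoidally_equivalent ::
  "('o, 'm) tensor_cat \<Rightarrow> ('p, 'n) tensor_cat \<Rightarrow> bool" where
  "unitarily_monoidally_equivalent \<C> \<D> \<longleftrightarrow>
     (\<exists>F0 F1 e m. linear_star_functor \<C> \<D> F0 F1 \<and> equivalence_functor \<C> \<D> F0 F1 \<and>
        unitary_tensor_structure \<C> \<D> F0 F1 e m)"


section \<open>Hopf *-algebras given by generators and relations\<close>

text \<open>
  The list \<open>[(c1, w1), \<dots>, (cn, wn)]\<close> stands for the element \<open>c1 w1 + \<dots> + cn wn\<close> of the free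
  algebra, and a list of triples \<open>(c, v, w)\<close> for the corresponding sum of \<open>c (v \<otimes> w)\<close>.
\<close>

type_synonym 'x lincomb = "(complex \<times> 'x list) list"
type_synonym 'x lincomb2 = "(complex \<times> 'x list \<times> 'x list) list"

record 'x hopf_pres =
  Gens :: "'x set"
  Rels :: "('x lincomb \<times> 'x lincomb) set"
  Coprod :: "'x \<Rightarrow> 'x lincomb2"
  Counit :: "'x \<Rightarrow> complex"
  Antipode :: "'x \<Rightarrow> 'x lincomb"
  Invol :: "'x \<Rightarrow> 'x lincomb"

definition lc_mult :: "'x lincomb \<Rightarrow> 'x lincomb \<Rightarrow> 'x lincomb" where
  "lc_mult p s = [(c * d, v @ w). (c, v) \<leftarrow> p, (d, w) \<leftarrow> s]"

fun coprod_word :: "('x \<Rightarrow> 'x lincomb2) \<Rightarrow> 'x list \<Rightarrow> 'x lincomb2" where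
  "coprod_word \<Delta> [] = [(1, [], [])]"
| "coprod_word \<Delta> (x # w) =
     [(c * d, u @ u', v @ v'). (c, u, v) \<leftarrow> \<Delta> x, (d, u', v') \<leftarrow> coprod_word \<Delta> w]"

fun antimult_word :: "('x \<Rightarrow> 'x lincomb) \<Rightarrow> 'x list \<Rightarrow> 'x lincomb" where
  "antimult_word s [] = [(1, [])]"
| "antimult_word s (x # w) = lc_mult (antimult_word s w) (s x)"

definition lc_star :: "('x \<Rightarrow> 'x lincomb) \<Rightarrow> 'x lincomb \<Rightarrow> 'x lincomb" where
  "lc_star s p = [(cnj c * d, w). (c, v) \<leftarrow> p, (d, w) \<leftarrow> antimult_word s v]"

definition word_mat :: "nat \<Rightarrow> ('x \<Rightarrow> complex mat) \<Rightarrow> 'x list \<Rightarrow> complex mat" where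
  "word_mat n \<rho> w = foldr (\<lambda>x M. \<rho> x * M) w (1\<^sub>m n)"

definition lc_mat :: "nat \<Rightarrow> ('x \<Rightarrow> complex mat) \<Rightarrow> 'x lincomb \<Rightarrow> complex mat" where
  "lc_mat n \<rho> p = foldr (\<lambda>(c, w) M. c \<cdot>\<^sub>m word_mat n \<rho> w + M) p (0\<^sub>m n n)"

text \<open>
  Finite dimensional *-representations; the Hilbert space is \<open>\<complex>\<^sup>n\<close> with its standard scalar product.
\<close>

definition star_rep :: "'x hopf_pres \<Rightarrow> nat \<Rightarrow> ('x \<Rightarrow> complex mat) \<Rightarrow> bool" where
  "star_rep A n \<rho> \<longleftrightarrow>
     (\<forall>x\<in>Gens A. \<rho> x \<in> carrier_mat n n) \<and>
     (\<forall>(p, s)\<in>Rels A. lc_mat n \<rho> p = lc_mat n \<rho> s) \<and>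
     (\<forall>x\<in>Gens A. lc_mat n \<rho> (Invol A x) = mat_adjoint (\<rho> x))"


section \<open>Compact quantum groups and their representation categories\<close>

text \<open>
  A compact quantum group \<open>G\<close> is given by the Hopf *-algebra \<open>\<complex>[G]\<close> of regular functions.  Here its
  elements are linear functionals on an algebra with generators of type \<open>'x\<close>, written as functions
  of words in the generators; an element of \<open>\<complex>[G] \<otimes> \<complex>[G]\<close> is then a function of two words.
\<close>

record 'x cqg =
  Fun :: "('x list \<Rightarrow> complex) set"
  FMult :: "('x list \<Rightarrow> complex) \<Rightarrow> ('x list \<Rightarrow> complex) \<Rightarrow> 'x list \<Rightarrow> complex"
  FOne :: "'x list \<Rightarrow> complex"
  FStar :: "('x list \<Rightarrow> complex) \<Rightarrow> 'x list \<Rightarrow> complex"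
  FComult :: "('x list \<Rightarrow> complex) \<Rightarrow> 'x list \<Rightarrow> 'x list \<Rightarrow> complex"

definition on_words :: "'x set \<Rightarrow> ('x list \<Rightarrow> complex) \<Rightarrow> 'x list \<Rightarrow> complex" where
  "on_words X a = (\<lambda>w. if w \<in> lists X then a w else 0)"

text \<open>
  Woronowicz's Tannaka--Krein reconstruction of a compact quantum group from a C*-tensor category of
  finite dimensional *-representations of a Hopf *-algebra \<open>A\<close>, with the forgetful functor: \<open>\<complex>[G]\<close> is
  spanned by the matrix coefficients of the objects, in the dual of \<open>A\<close>.  The product is
  \<open>(ab)(x) = (a \<otimes> b)(\<Delta>(x))\<close>, that is, the product of a coefficient of \<open>U\<close> and one of \<open>V\<close> is the
  coefficient of \<open>U \<otimes> V\<close>.  The coproduct comes from the product of \<open>A\<close>, the unit is the counit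
  of \<open>A\<close>, and the involution \<open>a\<^sup>*(x) = cnj (a(S(x)\<^sup>*))\<close> is the one for which the objects of the
  category become unitary.
\<close>

definition reconstruct ::
  "'x hopf_pres \<Rightarrow> (nat \<Rightarrow> ('x \<Rightarrow> complex mat) \<Rightarrow> bool) \<Rightarrow> 'x cqg" where
  "reconstruct A ob = \<lparr>
     Fun = {\<lambda>w. \<Sum>a\<in>M. c a * a w | M c. finite M \<and>
        M \<subseteq> {on_words (Gens A) (\<lambda>w. word_mat n \<rho> w $$ (i, j)) | n \<rho> i j. ob n \<rho> \<and> i < n \<and> j < n}},
     FMult = (\<lambda>a b. on_words (Gens A)
        (\<lambda>w. \<Sum>(c, u, v)\<leftarrow>coprod_word (Coprod A) w. c * a u * b v)),
     FOne = on_words (Gens A) (\<lambda>w. \<Prod>x\<leftarrow>w. Counit A x),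
     FStar = (\<lambda>a. on_words (Gens A)
        (\<lambda>w. cnj (\<Sum>(c, u)\<leftarrow>lc_star (Invol A) (antimult_word (Antipode A) w). c * a u))),
     FComult = (\<lambda>a v w. a (v @ w)) \<rparr>"

text \<open>
  A unitary representation on \<open>\<complex>\<^sup>n\<close> is a unitary \<open>n \<times> n\<close> matrix \<open>u\<close> over \<open>\<complex>[G]\<close> with
  \<open>\<Delta>(u\<^sub>i\<^sub>j) = \<Sum>\<^sub>k u\<^sub>i\<^sub>k \<otimes> u\<^sub>k\<^sub>j\<close>.
\<close>

type_synonym 'x corep = "('x list \<Rightarrow> complex) mat"

definition unitary_rep :: "'x cqg \<Rightarrow> 'x corep \<Rightarrow> bool" where
  "unitary_rep G u \<longleftrightarrow> dim_col u = dim_row u \<and>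
     (\<forall>i<dim_row u. \<forall>j<dim_row u.
        u $$ (i, j) \<in> Fun G \<and>
        FComult G (u $$ (i, j)) = (\<lambda>v w. \<Sum>k<dim_row u. (u $$ (i, k)) v * (u $$ (k, j)) w) \<and>
        (\<lambda>w. \<Sum>k<dim_row u. FMult G (u $$ (i, k)) (FStar G (u $$ (j, k))) w) =
          (if i = j then FOne G else (\<lambda>_. 0)) \<and>
        (\<lambda>w. \<Sum>k<dim_row u. FMult G (FStar G (u $$ (k, i))) (u $$ (k, j)) w) =
          (if i = j then FOne G else (\<lambda>_. 0)))"

definition intertwiners :: "'x corep \<Rightarrow> 'x corep \<Rightarrow> complex mat set" where
  "intertwiners u v = {T \<in> carrier_mat (dim_row v) (dim_row u).
     \<forall>i<dim_row v. \<forall>j<dim_row u. \<forall>w.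
       (\<Sum>k<dim_row u. T $$ (i, k) * (u $$ (k, j)) w) = (\<Sum>k<dim_row v. (v $$ (i, k)) w * T $$ (k, j))}"

text \<open>
  Kronecker products identify \<open>\<complex>\<^sup>m \<otimes> \<complex>\<^sup>n\<close> with \<open>\<complex>\<^sup>m\<^sup>n\<close>, so that the tensor product of Hilbert spaces
  is strictly associative.  The product \<open>f\<close> of the entries is a parameter, since those of a
  representation are multiplied in \<open>\<complex>[G]\<close>.
\<close>

definition kron_with :: "('a \<Rightarrow> 'a \<Rightarrow> 'a) \<Rightarrow> 'a mat \<Rightarrow> 'a mat \<Rightarrow> 'a mat" where
  "kron_with f A B = mat (dim_row A * dim_row B) (dim_col A * dim_col B)
     (\<lambda>(i, j). f (A $$ (i div dim_row B, j div dim_col B)) (B $$ (i mod dim_row B, j mod dim_col B)))"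

definition kron_vec :: "complex vec \<Rightarrow> complex vec \<Rightarrow> complex vec" where
  "kron_vec x y = vec (dim_vec x * dim_vec y) (\<lambda>i. x $ (i div dim_vec y) * y $ (i mod dim_vec y))"

definition Rep :: "'x cqg \<Rightarrow> ('x corep, complex mat) tensor_cat" where
  "Rep G = \<lparr>
     Obj = {u. unitary_rep G u},
     Hom = intertwiners,
     Idm = (\<lambda>u. 1\<^sub>m (dim_row u)),
     Comp = (*),
     Add = (+),
     Scale = (\<cdot>\<^sub>m),
     Adj = mat_adjoint,
     TensO = kron_with (FMult G),
     TensM = kron_with (*),
     One = mat 1 1 (\<lambda>_. FOne G),
     Assoc = (\<lambda>u v w. 1\<^sub>m (dim_row u * dim_row v * dim_row w)),
     LUnit = (\<lambda>u. 1\<^sub>m (dim_row u)),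
     RUnit = (\<lambda>u. 1\<^sub>m (dim_row u)) \<rparr>"


section \<open>Root data\<close>

text \<open>
  A simply connected semisimple compact Lie group with a maximal torus and an invariant form is given
  by a reduced crystallographic root system \<open>R\<close> in a Euclidean space: the space is the real span of
  the roots with the scalar product induced by the form.
\<close>

definition root_system :: "'e::euclidean_space set \<Rightarrow> bool" where
  "root_system R \<longleftrightarrow> finite R \<and> span R = UNIV \<and> 0 \<notin> R \<and>
     (\<forall>a\<in>R. \<forall>b\<in>R. b - (2 * inner a b / inner a a) *\<^sub>R a \<in> R \<and> 2 * inner a b / inner a a \<in> \<int>) \<and>
     (\<forall>a\<in>R. \<forall>c. c *\<^sub>R a \<in> R \<longrightarrow> c = 1 \<or> c = -1)"

definition simple_roots :: "'e::euclidean_space set \<Rightarrow> ('r::finite \<Rightarrow> 'e) \<Rightarrow> bool" where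
  "simple_roots R \<alpha> \<longleftrightarrow> inj \<alpha> \<and> independent (range \<alpha>) \<and> range \<alpha> \<subseteq> R \<and>
     (\<forall>b\<in>R. \<exists>c :: 'r \<Rightarrow> nat. b = (\<Sum>i\<in>UNIV. real (c i) *\<^sub>R \<alpha> i) \<or> b = - (\<Sum>i\<in>UNIV. real (c i) *\<^sub>R \<alpha> i))"

definition irreducible_roots :: "'e::euclidean_space set \<Rightarrow> bool" where
  "irreducible_roots R \<longleftrightarrow> R \<noteq> {} \<and>
     \<not> (\<exists>A B. A \<noteq> {} \<and> B \<noteq> {} \<and> A \<union> B = R \<and> A \<inter> B = {} \<and> (\<forall>a\<in>A. \<forall>b\<in>B. inner a b = 0))"

definition normalized_form :: "'e::euclidean_space set \<Rightarrow> bool" where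
  "normalized_form R \<longleftrightarrow> (irreducible_roots R \<longrightarrow> Min ((\<lambda>a. inner a a) ` R) = 2)"

definition weight_lattice :: "'e::euclidean_space set \<Rightarrow> 'e set" where
  "weight_lattice R = {\<kappa>. \<forall>a\<in>R. 2 * inner a \<kappa> / inner a a \<in> \<int>}"

definition root_lattice :: "('r::finite \<Rightarrow> 'e::euclidean_space) \<Rightarrow> 'e set" where
  "root_lattice \<alpha> = {\<Sum>i\<in>UNIV. of_int (c i) *\<^sub>R \<alpha> i | c :: 'r \<Rightarrow> int. True}"

definition cartan :: "('r \<Rightarrow> 'e::euclidean_space) \<Rightarrow> 'r \<Rightarrow> 'r \<Rightarrow> int" where
  "cartan \<alpha> i j = \<lfloor>2 * inner (\<alpha> i) (\<alpha> j) / inner (\<alpha> i) (\<alpha> i)\<rfloor>"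

text \<open>The maximal torus is the Pontryagin dual of the weight lattice; the pairing is evaluation.\<close>

definition torus :: "'e::euclidean_space set \<Rightarrow> ('e \<Rightarrow> complex) set" where
  "torus R = {t \<in> extensional (weight_lattice R).
     \<forall>\<kappa>\<in>weight_lattice R. cmod (t \<kappa>) = 1 \<and> (\<forall>\<mu>\<in>weight_lattice R. t (\<kappa> + \<mu>) = t \<kappa> * t \<mu>)}"

definition center :: "'e::euclidean_space set \<Rightarrow> ('r::finite \<Rightarrow> 'e) \<Rightarrow> ('e \<Rightarrow> complex) set" where
  "center R \<alpha> = {t \<in> torus R. \<forall>b\<in>root_lattice \<alpha>. t b = 1}"


section \<open>The quantized universal enveloping algebras\<close>

definition q_int :: "real \<Rightarrow> nat \<Rightarrow> real" where
  "q_int p n = (p ^ n - inverse p ^ n) / (p - inverse p)"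

definition q_fact :: "real \<Rightarrow> nat \<Rightarrow> real" where
  "q_fact p n = (\<Prod>k=1..n. q_int p k)"

definition q_binom :: "real \<Rightarrow> nat \<Rightarrow> nat \<Rightarrow> real" where
  "q_binom p n k = (if p = 1 then real (n choose k) else q_fact p n / (q_fact p k * q_fact p (n - k)))"

datatype 'r gen = Eg 'r | Fg 'r | Kg 'r | Kinv 'r | Hg 'r | Cg 'r | Cinv 'r

definition q_root :: "real \<Rightarrow> ('r \<Rightarrow> 'e::euclidean_space) \<Rightarrow> 'r \<Rightarrow> real" where
  "q_root q \<alpha> i = q powr (inner (\<alpha> i) (\<alpha> i) / 2)"

text \<open>
  The quantum Serre relation says that \<open>serre q \<alpha> X i j\<close> vanishes; for \<open>q = 1\<close> this is
  \<open>ad(X\<^sub>i)\<^bsup>1-a\<^esup>(X\<^sub>j) = 0\<close> up to sign, where \<open>a\<close> is the entry \<open>i j\<close> of the Cartan matrix.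
\<close>

definition serre :: "real \<Rightarrow> ('r \<Rightarrow> 'e::euclidean_space) \<Rightarrow> ('r \<Rightarrow> 'r gen) \<Rightarrow> 'r \<Rightarrow> 'r \<Rightarrow> 'r gen lincomb" where
  "serre q \<alpha> X i j = (let m = nat (1 - cartan \<alpha> i j) in
     [(complex_of_real ((-1) ^ k * q_binom (q_root q \<alpha> i) m k),
       replicate k (X i) @ [X j] @ replicate (m - k) (X i)). k \<leftarrow> [0..<Suc m]])"

definition serre_rels ::
  "real \<Rightarrow> ('r \<Rightarrow> 'e::euclidean_space) \<Rightarrow> ('r gen lincomb \<times> 'r gen lincomb) set" where
  "serre_rels q \<alpha> = {(serre q \<alpha> X i j, []) | X i j. (X = Eg \<or> X = Fg) \<and> i \<noteq> j}"

definition Uq_rels ::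
  "real \<Rightarrow> ('r \<Rightarrow> 'e::euclidean_space) \<Rightarrow> ('r gen lincomb \<times> 'r gen lincomb) set" where
  "Uq_rels q \<alpha> =
     {([(1, [Kg i, Kg j])], [(1, [Kg j, Kg i])]) | i j. True} \<union>
     {([(1, [Kg i, Kinv i])], [(1, [])]) | i. True} \<union>
     {([(1, [Kinv i, Kg i])], [(1, [])]) | i. True} \<union>
     {([(1, [Kg i, Eg j, Kinv i])], [(of_real (q_root q \<alpha> i powi cartan \<alpha> i j), [Eg j])]) | i j. True} \<union>
     {([(1, [Kg i, Fg j, Kinv i])], [(of_real (q_root q \<alpha> i powi (- cartan \<alpha> i j)), [Fg j])]) | i j. True} \<union>
     {([(1, [Eg i, Fg j]), (-1, [Fg j, Eg i])],
       if i = j then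
         (let d = complex_of_real (1 / (q_root q \<alpha> i - inverse (q_root q \<alpha> i)))
          in [(d, [Kg i]), (- d, [Kinv i])])
       else []) | i j. True} \<union>
     serre_rels q \<alpha>"

definition U1_rels ::
  "('r \<Rightarrow> 'e::euclidean_space) \<Rightarrow> ('r gen lincomb \<times> 'r gen lincomb) set" where
  "U1_rels \<alpha> =
     {([(1, [Hg i, Hg j])], [(1, [Hg j, Hg i])]) | i j. True} \<union>
     {([(1, [Hg i, Eg j]), (-1, [Eg j, Hg i])], [(of_int (cartan \<alpha> i j), [Eg j])]) | i j. True} \<union>
     {([(1, [Hg i, Fg j]), (-1, [Fg j, Hg i])], [(of_int (- cartan \<alpha> i j), [Fg j])]) | i j. True} \<union>
     {([(1, [Eg i, Fg j]), (-1, [Fg j, Eg i])], if i = j then [(1, [Hg i])] else []) | i j. True} \<union>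
     serre_rels 1 \<alpha>"

text \<open>
  With the convention \<open>K\<^sub>i = 1\<close> for \<open>q = 1\<close> the formulas for \<open>E\<^sub>i\<close> and \<open>F\<^sub>i\<close> in the two cases become
  the same.
\<close>

definition Kw :: "real \<Rightarrow> 'r \<Rightarrow> 'r gen list" where
  "Kw q i = (if q = 1 then [] else [Kg i])"

definition Kinvw :: "real \<Rightarrow> 'r \<Rightarrow> 'r gen list" where
  "Kinvw q i = (if q = 1 then [] else [Kinv i])"

definition Uq_gens :: "real \<Rightarrow> 'r gen set" where
  "Uq_gens q = range Eg \<union> range Fg \<union> (if q = 1 then range Hg else range Kg \<union> range Kinv)"

text \<open>
  The counit and the antipode are determined by the coproduct, and \<open>F\<^sub>i\<^sup>* = K\<^sub>i\<^sup>-\<^sup>1 E\<^sub>i\<close> follows from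
  \<open>E\<^sub>i\<^sup>* = F\<^sub>i K\<^sub>i\<close>.
\<close>

fun Uq_counit :: "'r gen \<Rightarrow> complex" where
  "Uq_counit (Kg i) = 1"
| "Uq_counit (Kinv i) = 1"
| "Uq_counit (Cg i) = 1"
| "Uq_counit (Cinv i) = 1"
| "Uq_counit _ = 0"

fun Uq_invol :: "real \<Rightarrow> 'r gen \<Rightarrow> 'r gen lincomb" where
  "Uq_invol q (Eg i) = [(1, [Fg i] @ Kw q i)]"
| "Uq_invol q (Fg i) = [(1, Kinvw q i @ [Eg i])]"
| "Uq_invol q (Kg i) = [(1, [Kg i])]"
| "Uq_invol q (Kinv i) = [(1, [Kinv i])]"
| "Uq_invol q (Hg i) = [(1, [Hg i])]"
| "Uq_invol q (Cg i) = [(1, [Cinv i])]"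
| "Uq_invol q (Cinv i) = [(1, [Cg i])]"

text \<open>The values on \<open>Cg\<close> and \<open>Cinv\<close> play no role for \<open>Uq\<close>, which does not have these generators.\<close>

fun Uq_coprod :: "real \<Rightarrow> 'r gen \<Rightarrow> 'r gen lincomb2" where
  "Uq_coprod q (Eg i) = [(1, [Eg i], []), (1, Kw q i, [Eg i])]"
| "Uq_coprod q (Fg i) = [(1, [Fg i], Kinvw q i), (1, [], [Fg i])]"
| "Uq_coprod q (Hg i) = [(1, [Hg i], []), (1, [], [Hg i])]"
| "Uq_coprod q x = [(1, [x], [x])]"

fun Uq_antipode :: "real \<Rightarrow> 'r gen \<Rightarrow> 'r gen lincomb" where
  "Uq_antipode q (Eg i) = [(-1, Kinvw q i @ [Eg i])]"
| "Uq_antipode q (Fg i) = [(-1, [Fg i] @ Kw q i)]"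
| "Uq_antipode q (Kg i) = [(1, [Kinv i])]"
| "Uq_antipode q (Kinv i) = [(1, [Kg i])]"
| "Uq_antipode q (Hg i) = [(-1, [Hg i])]"
| "Uq_antipode q (Cg i) = [(1, [Cinv i])]"
| "Uq_antipode q (Cinv i) = [(1, [Cg i])]"

definition Uq :: "real \<Rightarrow> ('r \<Rightarrow> 'e::euclidean_space) \<Rightarrow> 'r gen hopf_pres" where
  "Uq q \<alpha> = \<lparr> Gens = Uq_gens q, Rels = (if q = 1 then U1_rels \<alpha> else Uq_rels q \<alpha>),
     Coprod = Uq_coprod q, Counit = Uq_counit, Antipode = Uq_antipode q, Invol = Uq_invol q \<rparr>"

text \<open>
  The extension of \<open>Uq\<close> by unitary central elements \<open>C\<^sub>i\<close>.  The coproduct of \<open>F\<^sub>i\<close> follows from those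
  of \<open>E\<^sub>i\<^sup>* = F\<^sub>i K\<^sub>i\<close> and \<open>K\<^sub>i\<close>.
\<close>

fun Uqt_coprod :: "real \<Rightarrow> 'r gen \<Rightarrow> 'r gen lincomb2" where
  "Uqt_coprod q (Eg i) = [(1, [Eg i], [Cg i]), (1, Kw q i, [Eg i])]"
| "Uqt_coprod q (Fg i) = [(1, [Fg i], [Cinv i] @ Kinvw q i), (1, [], [Fg i])]"
| "Uqt_coprod q x = Uq_coprod q x"

fun Uqt_antipode :: "real \<Rightarrow> 'r gen \<Rightarrow> 'r gen lincomb" where
  "Uqt_antipode q (Eg i) = [(-1, Kinvw q i @ [Eg i, Cinv i])]"
| "Uqt_antipode q (Fg i) = [(-1, [Fg i] @ Kw q i @ [Cg i])]"
| "Uqt_antipode q x = Uq_antipode q x"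

definition central_gens :: "'r gen set" where
  "central_gens = range Cg \<union> range Cinv"

definition central_rels :: "real \<Rightarrow> ('r gen lincomb \<times> 'r gen lincomb) set" where
  "central_rels q =
     {([(1, [Cg i, Cinv i])], [(1, [])]) | i. True} \<union>
     {([(1, [Cinv i, Cg i])], [(1, [])]) | i. True} \<union>
     {([(1, [c, x])], [(1, [x, c])]) | c x. c \<in> central_gens \<and> x \<in> Uq_gens q \<union> central_gens}"

definition Uqt :: "real \<Rightarrow> ('r \<Rightarrow> 'e::euclidean_space) \<Rightarrow> 'r gen hopf_pres" where
  "Uqt q \<alpha> = \<lparr> Gens = Uq_gens q \<union> central_gens, Rels = Rels (Uq q \<alpha>) \<union> central_rels q,
     Coprod = Uqt_coprod q, Counit = Uq_counit, Antipode = Uqt_antipode q, Invol = Uq_invol q \<rparr>"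


section \<open>Admissible representations and the quantum groups they define\<close>

definition weight_space ::
  "real \<Rightarrow> ('r \<Rightarrow> 'e::euclidean_space) \<Rightarrow> nat \<Rightarrow> ('r gen \<Rightarrow> complex mat) \<Rightarrow> 'e \<Rightarrow> complex vec set" where
  "weight_space q \<alpha> n \<rho> \<chi> = {v \<in> carrier_vec n. \<forall>i.
     if q = 1 then \<rho> (Hg i) *\<^sub>v v = of_real (2 * inner (\<alpha> i) \<chi> / inner (\<alpha> i) (\<alpha> i)) \<cdot>\<^sub>v v
     else \<rho> (Kg i) *\<^sub>v v = of_real (q powr inner (\<alpha> i) \<chi>) \<cdot>\<^sub>v v}"

text \<open>
  The sum of the weight spaces is always direct, because different \<open>\<chi>\<close> give different systems of
  eigenvalues; so only its being everything has to be required.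
\<close>

definition admissible ::
  "'e::euclidean_space set \<Rightarrow> ('r \<Rightarrow> 'e) \<Rightarrow> real \<Rightarrow> nat \<Rightarrow> ('r gen \<Rightarrow> complex mat) \<Rightarrow> bool" where
  "admissible R \<alpha> q n \<rho> \<longleftrightarrow> (\<forall>v\<in>carrier_vec n. \<exists>M x. finite M \<and> M \<subseteq> weight_lattice R \<and>
     (\<forall>\<chi>\<in>M. x \<chi> \<in> weight_space q \<alpha> n \<rho> \<chi>) \<and> (\<forall>k<n. v $ k = (\<Sum>\<chi>\<in>M. x \<chi> $ k)))"

definition tau_admissible ::
  "'e::euclidean_space set \<Rightarrow> ('r \<Rightarrow> 'e) \<Rightarrow> real \<Rightarrow> ('r \<Rightarrow> 'e \<Rightarrow> complex) \<Rightarrow>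
   nat \<Rightarrow> ('r gen \<Rightarrow> complex mat) \<Rightarrow> bool" where
  "tau_admissible R \<alpha> q \<tau> n \<rho> \<longleftrightarrow> admissible R \<alpha> q n \<rho> \<and>
     (\<forall>\<chi>\<in>weight_lattice R. \<forall>v\<in>weight_space q \<alpha> n \<rho> \<chi>. \<forall>i. \<rho> (Cg i) *\<^sub>v v = \<tau> i \<chi> \<cdot>\<^sub>v v)"

definition Gq :: "'e::euclidean_space set \<Rightarrow> ('r \<Rightarrow> 'e) \<Rightarrow> real \<Rightarrow> 'r gen cqg" where
  "Gq R \<alpha> q = reconstruct (Uq q \<alpha>) (\<lambda>n \<rho>. star_rep (Uq q \<alpha>) n \<rho> \<and> admissible R \<alpha> q n \<rho>)"

definition Gq_tau ::
  "'e::euclidean_space set \<Rightarrow> ('r \<Rightarrow> 'e) \<Rightarrow> real \<Rightarrow> ('r \<Rightarrow> 'e \<Rightarrow> complex) \<Rightarrow> 'r gen cqg" where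
  "Gq_tau R \<alpha> q \<tau> =
     reconstruct (Uqt q \<alpha>) (\<lambda>n \<rho>. star_rep (Uqt q \<alpha>) n \<rho> \<and> tau_admissible R \<alpha> q \<tau> n \<rho>)"


section \<open>The cocycle and the twisted category\<close>

definition twist_function ::
  "'e::euclidean_space set \<Rightarrow> ('r::finite \<Rightarrow> 'e) \<Rightarrow> ('r \<Rightarrow> 'e \<Rightarrow> complex) \<Rightarrow> ('e \<Rightarrow> 'e \<Rightarrow> complex) \<Rightarrow> bool" where
  "twist_function R \<alpha> \<tau> f \<longleftrightarrow> (\<forall>\<kappa>\<in>weight_lattice R. \<forall>\<mu>\<in>weight_lattice R.
     cmod (f \<kappa> \<mu>) = 1 \<and> (\<forall>b\<in>root_lattice \<alpha>. f \<kappa> (\<mu> + b) = f \<kappa> \<mu>) \<and>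
     (\<forall>i. f (\<kappa> + \<alpha> i) \<mu> = \<tau> i \<mu> * f \<kappa> \<mu>))"

definition coboundary :: "('e::plus \<Rightarrow> 'e \<Rightarrow> complex) \<Rightarrow> 'e \<Rightarrow> 'e \<Rightarrow> 'e \<Rightarrow> complex" where
  "coboundary f \<kappa> \<mu> \<nu> = f \<mu> \<nu> * inverse (f (\<kappa> + \<mu>) \<nu>) * f \<kappa> (\<mu> + \<nu>) * inverse (f \<kappa> \<mu>)"

text \<open>The cocycle on \<open>P/Q\<close> is given as a function on \<open>P\<close> that is \<open>Q\<close>-invariant in each variable.\<close>

definition twist_cocycle :: "('e::plus \<Rightarrow> 'e \<Rightarrow> complex) \<Rightarrow> 'e \<Rightarrow> 'e \<Rightarrow> 'e \<Rightarrow> complex" where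
  "twist_cocycle f \<kappa> \<mu> \<nu> = cnj (coboundary f \<kappa> \<mu> \<nu>)"

definition corep_action :: "'x corep \<Rightarrow> 'x \<Rightarrow> complex mat" where
  "corep_action u x = map_mat (\<lambda>a. a [x]) u"

definition torus_action ::
  "'e::euclidean_space set \<Rightarrow> ('r \<Rightarrow> 'e) \<Rightarrow> real \<Rightarrow> 'r gen corep \<Rightarrow> ('e \<Rightarrow> complex) \<Rightarrow> complex mat" where
  "torus_action R \<alpha> q u t = (THE M. M \<in> carrier_mat (dim_row u) (dim_row u) \<and>
     (\<forall>\<kappa>\<in>weight_lattice R. \<forall>v\<in>weight_space q \<alpha> (dim_row u) (corep_action u) \<kappa>. M *\<^sub>v v = t \<kappa> \<cdot>\<^sub>v v))"

text \<open>The vectors on which the center acts by the character given by the class of \<open>\<kappa>\<close> in \<open>P/Q\<close>.\<close>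

definition isotypic ::
  "'e::euclidean_space set \<Rightarrow> ('r::finite \<Rightarrow> 'e) \<Rightarrow> real \<Rightarrow> 'r gen corep \<Rightarrow> 'e \<Rightarrow> complex vec set" where
  "isotypic R \<alpha> q u \<kappa> = {v \<in> carrier_vec (dim_row u).
     \<forall>t\<in>center R \<alpha>. torus_action R \<alpha> q u t *\<^sub>v v = t \<kappa> \<cdot>\<^sub>v v}"

text \<open>
  If the center acts on \<open>u\<close>, \<open>v\<close>, \<open>w\<close> by characters, in particular for irreducible ones, this is the
  scalar \<open>\<Phi> \<kappa> \<mu> \<nu>\<close>; in general, naturality prescribes this scalar on each tensor product of isotypic
  components.
\<close>

definition twisted_assoc ::
  "'e::euclidean_space set \<Rightarrow> ('r::finite \<Rightarrow> 'e) \<Rightarrow> real \<Rightarrow> ('e \<Rightarrow> 'e \<Rightarrow> 'e \<Rightarrow> complex) \<Rightarrow>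
   'r gen corep \<Rightarrow> 'r gen corep \<Rightarrow> 'r gen corep \<Rightarrow> complex mat" where
  "twisted_assoc R \<alpha> q \<Phi> u v w = (let N = dim_row u * dim_row v * dim_row w in
     THE M. M \<in> carrier_mat N N \<and>
       (\<forall>\<kappa>\<in>weight_lattice R. \<forall>\<mu>\<in>weight_lattice R. \<forall>\<nu>\<in>weight_lattice R.
        \<forall>x\<in>isotypic R \<alpha> q u \<kappa>. \<forall>y\<in>isotypic R \<alpha> q v \<mu>. \<forall>z\<in>isotypic R \<alpha> q w \<nu>.
          M *\<^sub>v kron_vec (kron_vec x y) z = \<Phi> \<kappa> \<mu> \<nu> \<cdot>\<^sub>v kron_vec (kron_vec x y) z))"

text \<open>
  The triangle axiom forces the unit morphisms, up to a common scalar, to be multiplication by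
  \<open>\<Phi>(0,0,\<chi>)\<^sup>-\<^sup>1\<close> on \<open>1 \<otimes> U\<close> and by \<open>\<Phi>(\<chi>,0,0)\<close> on \<open>U \<otimes> 1\<close>, if the center acts on \<open>U\<close> by \<open>\<chi>\<close>.  They
  are trivial if \<open>\<Phi>\<close> is a normalized cocycle.
\<close>

definition twisted_Rep ::
  "'e::euclidean_space set \<Rightarrow> ('r::finite \<Rightarrow> 'e) \<Rightarrow> real \<Rightarrow> ('e \<Rightarrow> 'e \<Rightarrow> 'e \<Rightarrow> complex) \<Rightarrow>
   ('r gen corep, complex mat) tensor_cat" where
  "twisted_Rep R \<alpha> q \<Phi> = (let \<C> = Rep (Gq R \<alpha> q) in
     \<C>\<lparr> Assoc := twisted_assoc R \<alpha> q \<Phi>,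
        LUnit := (\<lambda>u. mat_adjoint (twisted_assoc R \<alpha> q \<Phi> (One \<C>) (One \<C>) u)),
        RUnit := (\<lambda>u. twisted_assoc R \<alpha> q \<Phi> u (One \<C>) (One \<C>)) \<rparr>)"

end

(*
On the category level the two quantum groups have the same representations: on a tau-admissible
representation C_i acts on the vectors of weight chi by the scalar tau_i(chi), so it is determined
by the action of U_q(g), and it is central because tau_i is trivial on roots.  Restricting a
representation to U_q(g) is therefore an isomorphism of C*-categories.  It becomes monoidal if
the tensor products are identified by the unitaries that multiply vectors of weight (kappa, mu)
by f(kappa, mu):  the condition f(kappa + alpha_i, mu) = tau_i(mu) f(kappa, mu) absorbs the factor
C_i in the coproduct of E_i, and the failure of f to be a 2-cocycle is the associator Phi.

Two points need an argument.  A representation of the quantum group is only given as a matrix of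
functionals, each a linear combination of coefficients of admissible representations; it is
admissible because polynomials in the K_i (or H_i) that interpolate the projections onto finitely
many weight spaces satisfy the same identities in it.  And isotypic components for the center are
sums of weight spaces over cosets of the root lattice, since the characters
lambda |-> exp(2 pi i c_j(lambda)), for the coordinates c_j in the basis of simple roots, separate
these cosets.
*)

theory Submission
  imports Defs
begin

section \<open>Matrices\<close>

text \<open>A unitary representation of a reconstructed quantum group comes without a condition on
  the adjoints of the generators. It is recovered from unitarity: the star of the function algebra
  is defined through the involution, so unitarity at one generator ties the adjoint of one matrix to
  another generator; for E_i it amounts to \<open>E = K F^*\<close>. Conversely, unitarity is
  required on all words, and the antipode axioms have to be carried there from the generators. The
  torus action and the twisted associator are definite descriptions, and the twist needs an adjoint
  that is diagonal too. Therefore diagonal operators are built as polynomials in the self-adjoint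
  torus generators: existence and the eigenvalues of the adjoint come from one interpolation,
  uniqueness from the weight vectors spanning the space. Neither \<open>f\<close> nor the cocycle is
  normalized. At the unit object the coboundary leaves factors \<open>f 0 0\<close>, so the unit
  isomorphism of the functor is multiplication by \<open>inverse (f 0 0)\<close>, in general not the
  identity.\<close>

lemma mat_adjoint_dim [simp]:
  "dim_row (mat_adjoint A) = dim_col A" "dim_col (mat_adjoint A) = dim_row A"
  unfolding mat_adjoint_def by auto

lemma mat_adjoint_carrier [simp]: "A \<in> carrier_mat m n \<Longrightarrow> mat_adjoint A \<in> carrier_mat n m"
  by (auto intro!: carrier_matI)

lemma mat_adjoint_index [simp]:
  fixes A :: "complex mat"
  assumes "i < dim_col A" "j < dim_row A"
  shows "mat_adjoint A $$ (i, j) = cnj (A $$ (j, i))"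
  using assms unfolding mat_adjoint_def by (simp add: mat_of_rows_def conjugate_complex_def)

lemma mat_adjoint_adjoint [simp]: "mat_adjoint (mat_adjoint A) = (A :: complex mat)"
  by (rule eq_matI) auto

lemma mat_adjoint_one [simp]: "mat_adjoint (1\<^sub>m n) = (1\<^sub>m n :: complex mat)"
  by (rule eq_matI) auto

lemma mat_adjoint_zero [simp]: "mat_adjoint (0\<^sub>m n m) = (0\<^sub>m m n :: complex mat)"
  by (rule eq_matI) auto

lemma mat_adjoint_smult: "mat_adjoint (c \<cdot>\<^sub>m A) = cnj c \<cdot>\<^sub>m mat_adjoint (A :: complex mat)"
  by (rule eq_matI) auto

lemma mat_adjoint_add:
  fixes A :: "complex mat"
  assumes "A \<in> carrier_mat n m" "B \<in> carrier_mat n m"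
  shows "mat_adjoint (A + B) = mat_adjoint A + mat_adjoint B"
  using assms by (intro eq_matI) auto

lemma mat_adjoint_mult:
  fixes A :: "complex mat"
  assumes "A \<in> carrier_mat n m" "B \<in> carrier_mat m k"
  shows "mat_adjoint (A * B) = mat_adjoint B * mat_adjoint A"
proof (rule eq_matI)
  fix i j
  assume "i < dim_row (mat_adjoint B * mat_adjoint A)" "j < dim_col (mat_adjoint B * mat_adjoint A)"
  then have i: "i < k" and j: "j < n" using assms by auto
  show "mat_adjoint (A * B) $$ (i, j) = (mat_adjoint B * mat_adjoint A) $$ (i, j)"
    using assms i j by (auto simp: scalar_prod_def intro!: sum.cong)
qed (use assms in auto)

lemma mult_mat_index:
  assumes "A \<in> carrier_mat n m" "B \<in> carrier_mat m k" "i < n" "j < k"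
  shows "(A * B) $$ (i, j) = (\<Sum>l<m. A $$ (i, l) * B $$ (l, j))"
  using assms by (auto simp: scalar_prod_def lessThan_atLeast0 intro!: sum.cong)

lemma mult_mat_vec_index:
  assumes "A \<in> carrier_mat n m" "v \<in> carrier_vec m" "i < n"
  shows "(A *\<^sub>v v) $ i = (\<Sum>l<m. A $$ (i, l) * v $ l)"
  using assms by (auto simp: scalar_prod_def lessThan_atLeast0 intro!: sum.cong)

lemma mult_unit_vec_index:
  fixes A :: "'a :: comm_ring_1 mat"
  assumes "A \<in> carrier_mat n m" "i < n" "k < m"
  shows "(A *\<^sub>v unit_vec m k) $ i = A $$ (i, k)"
  using assms by simp

lemma mat_eq_on_unit_vecs:
  fixes A :: "'a :: comm_ring_1 mat"
  assumes "A \<in> carrier_mat n m" "B \<in> carrier_mat n m"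
    and "\<And>k. k < m \<Longrightarrow> A *\<^sub>v unit_vec m k = B *\<^sub>v unit_vec m k"
  shows "A = B"
  using assms by (intro eq_matI) (auto simp: mult_unit_vec_index simp flip: mult_unit_vec_index[of A n m] dest!: sym)

lemma smult_mult_mat_vec:
  fixes A :: "'a :: comm_ring_1 mat"
  assumes "A \<in> carrier_mat n m" "v \<in> carrier_vec m"
  shows "(c \<cdot>\<^sub>m A) *\<^sub>v v = c \<cdot>\<^sub>v (A *\<^sub>v v)"
  using assms by (intro eq_vecI) (auto simp: mult_mat_vec_index sum_distrib_left mult.assoc)

lemma zero_mult_mat_vec [simp]:
  "v \<in> carrier_vec m \<Longrightarrow> 0\<^sub>m n m *\<^sub>v v = (0\<^sub>v n :: 'a :: comm_ring_1 vec)"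
  by (intro eq_vecI) (auto simp: mult_mat_vec_index)

lemma mult_mat_zero_vec [simp]:
  "A \<in> carrier_mat n m \<Longrightarrow> A *\<^sub>v 0\<^sub>v m = (0\<^sub>v n :: 'a :: comm_ring_1 vec)"
  by (intro eq_vecI) (auto simp: mult_mat_vec_index)

lemma smult_zero_vec [simp]: "c \<cdot>\<^sub>v 0\<^sub>v n = (0\<^sub>v n :: 'a :: comm_ring_1 vec)"
  by (intro eq_vecI) auto

text \<open>Indexed by lists because elements of the free algebra are lists of terms, possibly with
  repetitions; the \<open>foldr\<close> form agrees with that of \<open>lc_mat\<close>.\<close>

definition mat_sum :: "nat \<Rightarrow> ('a \<Rightarrow> complex mat) \<Rightarrow> 'a list \<Rightarrow> complex mat" where
  "mat_sum n F xs = foldr (\<lambda>x M. F x + M) xs (0\<^sub>m n n)"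

lemma mat_sum_simps [simp]:
  "mat_sum n F [] = 0\<^sub>m n n" "mat_sum n F (x # xs) = F x + mat_sum n F xs"
  by (auto simp: mat_sum_def)

lemma mat_sum_carrier [simp]:
  "(\<And>x. x \<in> set xs \<Longrightarrow> F x \<in> carrier_mat n n) \<Longrightarrow> mat_sum n F xs \<in> carrier_mat n n"
  by (induction xs) auto

lemma mat_sum_cong:
  "(\<And>x. x \<in> set xs \<Longrightarrow> F x = G x) \<Longrightarrow> mat_sum n F xs = mat_sum n G xs"
  by (induction xs) auto

lemma mat_sum_append:
  assumes "\<And>x. x \<in> set xs \<union> set ys \<Longrightarrow> F x \<in> carrier_mat n n"
  shows "mat_sum n F (xs @ ys) = mat_sum n F xs + mat_sum n F ys"
  using assms
proof (induction xs)
  case (Cons x xs)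
  have F: "F x \<in> carrier_mat n n" "mat_sum n F xs \<in> carrier_mat n n" "mat_sum n F ys \<in> carrier_mat n n"
    using Cons.prems by auto
  have "mat_sum n F (xs @ ys) = mat_sum n F xs + mat_sum n F ys" using Cons.prems by (intro Cons.IH) auto
  then show ?case using assoc_add_mat[OF F] by simp
qed (auto simp: left_add_zero_mat[OF mat_sum_carrier])

lemma mat_sum_concat:
  assumes "\<And>x y. x \<in> set xs \<Longrightarrow> y \<in> set (g x) \<Longrightarrow> F y \<in> carrier_mat n n"
  shows "mat_sum n F (concat (map g xs)) = mat_sum n (\<lambda>x. mat_sum n F (g x)) xs"
  using assms
proof (induction xs)
  case (Cons a xs)
  have "mat_sum n F (g a @ concat (map g xs)) = mat_sum n F (g a) + mat_sum n F (concat (map g xs))"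
    using Cons.prems by (intro mat_sum_append) auto
  moreover have "mat_sum n F (concat (map g xs)) = mat_sum n (\<lambda>x. mat_sum n F (g x)) xs"
    using Cons.prems by (intro Cons.IH) auto
  ultimately show ?case by simp
qed auto

lemma mat_sum_map: "mat_sum n F (map g xs) = mat_sum n (\<lambda>x. F (g x)) xs"
  by (induction xs) auto

lemma mult_mat_sum:
  assumes "A \<in> carrier_mat n n" "\<And>x. x \<in> set xs \<Longrightarrow> F x \<in> carrier_mat n n"
  shows "A * mat_sum n F xs = mat_sum n (\<lambda>x. A * F x) xs"
  using assms(2)
proof (induction xs)
  case (Cons x xs)
  have F: "F x \<in> carrier_mat n n" "mat_sum n F xs \<in> carrier_mat n n" using Cons.prems by auto
  show ?case using Cons.IH Cons.prems by (simp add: mult_add_distrib_mat[OF assms(1) F])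
qed (use assms in auto)

lemma mat_sum_mult:
  assumes "A \<in> carrier_mat n n" "\<And>x. x \<in> set xs \<Longrightarrow> F x \<in> carrier_mat n n"
  shows "mat_sum n F xs * A = mat_sum n (\<lambda>x. F x * A) xs"
  using assms(2)
proof (induction xs)
  case (Cons x xs)
  have F: "F x \<in> carrier_mat n n" "mat_sum n F xs \<in> carrier_mat n n" using Cons.prems by auto
  show ?case using Cons.IH Cons.prems by (simp add: add_mult_distrib_mat[OF F assms(1)])
qed (use assms in auto)

lemma smult_mat_sum:
  assumes "\<And>x. x \<in> set xs \<Longrightarrow> F x \<in> carrier_mat n n"
  shows "c \<cdot>\<^sub>m mat_sum n F xs = mat_sum n (\<lambda>x. c \<cdot>\<^sub>m F x) xs"
  using assms
proof (induction xs)
  case (Cons x xs)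
  have F: "F x \<in> carrier_mat n n" "mat_sum n F xs \<in> carrier_mat n n" using Cons.prems by auto
  show ?case using Cons.IH Cons.prems by (simp add: add_smult_distrib_left_mat[OF F])
qed auto

section \<open>Evaluation of words and linear combinations at matrices\<close>

lemma lc_mat_eq_sum: "lc_mat n \<rho> p = mat_sum n (\<lambda>(c, w). c \<cdot>\<^sub>m word_mat n \<rho> w) p"
  unfolding lc_mat_def mat_sum_def by (simp add: case_prod_unfold)

lemma word_mat_simps [simp]:
  "word_mat n \<rho> [] = 1\<^sub>m n" "word_mat n \<rho> (x # w) = \<rho> x * word_mat n \<rho> w"
  by (auto simp: word_mat_def)

lemma word_mat_carrier:
  "(\<And>x. x \<in> set w \<Longrightarrow> \<rho> x \<in> carrier_mat n n) \<Longrightarrow> word_mat n \<rho> w \<in> carrier_mat n n"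
  by (induction w) (auto intro!: mult_carrier_mat)

lemma word_mat_append:
  assumes "\<And>x. x \<in> set v \<union> set w \<Longrightarrow> \<rho> x \<in> carrier_mat n n"
  shows "word_mat n \<rho> (v @ w) = word_mat n \<rho> v * word_mat n \<rho> w"
  using assms
proof (induction v)
  case (Cons x v)
  have "\<rho> x \<in> carrier_mat n n" "word_mat n \<rho> v \<in> carrier_mat n n" "word_mat n \<rho> w \<in> carrier_mat n n"
    using Cons.prems by (auto intro!: word_mat_carrier)
  note assoc = assoc_mult_mat[OF this]
  have "word_mat n \<rho> (v @ w) = word_mat n \<rho> v * word_mat n \<rho> w" using Cons.prems by (intro Cons.IH) auto
  then show ?case by (simp add: assoc)
qed (auto simp: left_mult_one_mat[OF word_mat_carrier])

lemma word_mat_cong: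
  "(\<And>x. x \<in> set w \<Longrightarrow> \<rho> x = \<sigma> x) \<Longrightarrow> word_mat n \<rho> w = word_mat n \<sigma> w"
  by (induction w) auto

text \<open>Guards every evaluation: outside the generators of a presentation the matrices
  \<open>\<rho> x\<close> are arbitrary and need not even have the right size.\<close>

definition lc_in :: "'x set \<Rightarrow> 'x lincomb \<Rightarrow> bool" where
  "lc_in X p \<longleftrightarrow> (\<forall>(c, w)\<in>set p. set w \<subseteq> X)"

lemma lc_in_simps [simp]:
  "lc_in X []" "lc_in X ((c, w) # p) \<longleftrightarrow> set w \<subseteq> X \<and> lc_in X p"
  "lc_in X (p @ s) \<longleftrightarrow> lc_in X p \<and> lc_in X s"
  by (auto simp: lc_in_def)

lemma lc_mat_simps [simp]:
  "lc_mat n \<rho> [] = 0\<^sub>m n n"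
  "lc_mat n \<rho> ((c, w) # p) = c \<cdot>\<^sub>m word_mat n \<rho> w + lc_mat n \<rho> p"
  by (auto simp: lc_mat_eq_sum)

lemma lc_mat_carrier:
  assumes "lc_in X p" "\<And>x. x \<in> X \<Longrightarrow> \<rho> x \<in> carrier_mat n n"
  shows "lc_mat n \<rho> p \<in> carrier_mat n n"
  using assms(1)
proof (induction p)
  case (Cons a p)
  then show ?case using assms(2)
    by (cases a) (auto intro!: add_carrier_mat smult_carrier_mat word_mat_carrier)
qed simp

lemma lc_mat_cong:
  "lc_in X p \<Longrightarrow> (\<And>x. x \<in> X \<Longrightarrow> \<rho> x = \<sigma> x) \<Longrightarrow> lc_mat n \<rho> p = lc_mat n \<sigma> p"
proof (induction p)
  case (Cons a p)
  obtain c w where a: "a = (c, w)" by force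
  have "word_mat n \<rho> w = word_mat n \<sigma> w" using Cons.prems by (intro word_mat_cong) (auto simp: a)
  then show ?case using Cons by (simp add: a)
qed simp

lemma lc_mat_index:
  assumes "lc_in X p" "\<And>x. x \<in> X \<Longrightarrow> \<rho> x \<in> carrier_mat n n" "i < n" "j < n"
  shows "lc_mat n \<rho> p $$ (i, j) = (\<Sum>(c, w)\<leftarrow>p. c * word_mat n \<rho> w $$ (i, j))"
  using assms(1)
proof (induction p)
  case (Cons a p)
  obtain c w where a: "a = (c, w)" by force
  have "word_mat n \<rho> w \<in> carrier_mat n n" "lc_mat n \<rho> p \<in> carrier_mat n n"
    using Cons.prems assms(2) by (auto simp: a intro!: word_mat_carrier lc_mat_carrier[of X])
  then show ?case using Cons assms(3,4) by (simp add: a)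
qed (use assms in auto)

lemma lc_mat_append:
  assumes "lc_in X p" "lc_in X s" and X: "\<And>x. x \<in> X \<Longrightarrow> \<rho> x \<in> carrier_mat n n"
  shows "lc_mat n \<rho> (p @ s) = lc_mat n \<rho> p + lc_mat n \<rho> s"
  using assms(1)
proof (induction p)
  case Nil
  then show ?case using lc_mat_carrier[OF assms(2) X] by simp
next
  case (Cons a p)
  obtain c w where a: "a = (c, w)" by force
  have w: "c \<cdot>\<^sub>m word_mat n \<rho> w \<in> carrier_mat n n" and p: "lc_in X p"
    using Cons.prems X by (auto simp: a intro!: smult_carrier_mat word_mat_carrier)
  show ?case
    using Cons.IH[OF p] assoc_add_mat[OF w lc_mat_carrier[OF p X] lc_mat_carrier[OF assms(2) X]]
    by (simp add: a)
qed

lemma lc_in_mult [simp]: "lc_in X p \<Longrightarrow> lc_in X s \<Longrightarrow> lc_in X (lc_mult p s)"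
  unfolding lc_in_def lc_mult_def by fastforce

text \<open>Multiplicativity of the extension of \<open>\<rho>\<close> to the free algebra.
  Linearity in \<open>p\<close> leaves a single term \<open>c v\<close>, linearity in
  \<open>s\<close> a pair of words, and there it is \<open>word_mat_append\<close>.\<close>

lemma lc_mat_mult:
  assumes p: "lc_in X p" and s: "lc_in X s" and X: "\<And>x. x \<in> X \<Longrightarrow> \<rho> x \<in> carrier_mat n n"
  shows "lc_mat n \<rho> (lc_mult p s) = lc_mat n \<rho> p * lc_mat n \<rho> s"
  using p
proof (induction p)
  case Nil
  have "0\<^sub>m n n * lc_mat n \<rho> s = 0\<^sub>m n n"
    by (rule left_mult_zero_mat) (rule lc_mat_carrier[OF s X])
  then show ?case by (simp add: lc_mult_def)
next
  case (Cons a p)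
  obtain c v where a: "a = (c, v)" by force
  have v: "set v \<subseteq> X" and p: "lc_in X p" using Cons.prems by (auto simp: a)
  have sc: "lc_mat n \<rho> s \<in> carrier_mat n n" by (rule lc_mat_carrier[OF s X])
  have vc: "word_mat n \<rho> v \<in> carrier_mat n n" using v X by (auto intro!: word_mat_carrier)
  have 1: "lc_in X (map (\<lambda>(d, w). (c * d, v @ w)) s)"
    using s v unfolding lc_in_def by fastforce
  have 2: "lc_mult (a # p) s = map (\<lambda>(d, w). (c * d, v @ w)) s @ lc_mult p s"
    by (simp add: lc_mult_def a case_prod_unfold)
  have 3: "lc_mat n \<rho> (map (\<lambda>(d, w). (c * d, v @ w)) s) = c \<cdot>\<^sub>m word_mat n \<rho> v * lc_mat n \<rho> s"
    using s
  proof (induction s)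
    case Nil
    have "c \<cdot>\<^sub>m word_mat n \<rho> v * 0\<^sub>m n n = 0\<^sub>m n n" by (rule right_mult_zero_mat) (use vc in simp)
    then show ?case by simp
  next
    case (Cons b s)
    obtain d w where b: "b = (d, w)" by force
    have w: "set w \<subseteq> X" and s: "lc_in X s" using Cons.prems by (auto simp: b)
    have wc: "word_mat n \<rho> w \<in> carrier_mat n n" using w X by (auto intro!: word_mat_carrier)
    have "word_mat n \<rho> (v @ w) = word_mat n \<rho> v * word_mat n \<rho> w"
      using v w X by (intro word_mat_append) auto
    moreover have "c \<cdot>\<^sub>m word_mat n \<rho> v * (d \<cdot>\<^sub>m word_mat n \<rho> w) = (c * d) \<cdot>\<^sub>m (word_mat n \<rho> v * word_mat n \<rho> w)"
      using mult_smult_assoc_mat[OF vc, of "d \<cdot>\<^sub>m word_mat n \<rho> w" n c] wc mult_smult_distrib[OF vc wc, of d]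
      by (auto intro!: eq_matI)
    ultimately have "(c * d) \<cdot>\<^sub>m word_mat n \<rho> (v @ w) = c \<cdot>\<^sub>m word_mat n \<rho> v * (d \<cdot>\<^sub>m word_mat n \<rho> w)"
      by simp
    moreover have "c \<cdot>\<^sub>m word_mat n \<rho> v * (d \<cdot>\<^sub>m word_mat n \<rho> w + lc_mat n \<rho> s) =
        c \<cdot>\<^sub>m word_mat n \<rho> v * (d \<cdot>\<^sub>m word_mat n \<rho> w) + c \<cdot>\<^sub>m word_mat n \<rho> v * lc_mat n \<rho> s"
      by (rule mult_add_distrib_mat) (use vc wc lc_mat_carrier[OF s X] in auto)
    ultimately show ?case using Cons.IH s by (simp add: b)
  qed
  have "(c \<cdot>\<^sub>m word_mat n \<rho> v + lc_mat n \<rho> p) * lc_mat n \<rho> s =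
      c \<cdot>\<^sub>m word_mat n \<rho> v * lc_mat n \<rho> s + lc_mat n \<rho> p * lc_mat n \<rho> s"
    by (rule add_mult_distrib_mat) (use vc sc lc_mat_carrier[OF p X] in auto)
  moreover have "lc_mat n \<rho> (lc_mult (a # p) s) = lc_mat n \<rho> (map (\<lambda>(d, w). (c * d, v @ w)) s) + lc_mat n \<rho> (lc_mult p s)"
    unfolding 2 by (rule lc_mat_append[OF 1 lc_in_mult[OF p s] X])
  ultimately show ?case by (simp add: a 3 Cons.IH[OF p])
qed

section \<open>Kronecker products and spans\<close>

abbreviation kron :: "complex mat \<Rightarrow> complex mat \<Rightarrow> complex mat" where
  "kron \<equiv> kron_with (*)"

lemma kron_with_dim [simp]:
  "dim_row (kron_with f A B) = dim_row A * dim_row B" "dim_col (kron_with f A B) = dim_col A * dim_col B"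
  by (auto simp: kron_with_def)

lemma kron_carrier [simp]:
  "A \<in> carrier_mat n n' \<Longrightarrow> B \<in> carrier_mat m m' \<Longrightarrow> kron_with f A B \<in> carrier_mat (n * m) (n' * m')"
  by (auto intro!: carrier_matI)

lemma kron_vec_dim [simp]: "dim_vec (kron_vec x y) = dim_vec x * dim_vec y"
  by (auto simp: kron_vec_def)

lemma kron_vec_carrier [simp]:
  "x \<in> carrier_vec n \<Longrightarrow> y \<in> carrier_vec m \<Longrightarrow> kron_vec x y \<in> carrier_vec (n * m)"
  by (auto intro!: carrier_vecI)

lemma div_mod_less:
  assumes "i < n * m" shows "i div m < n" "i mod m < (m :: nat)"
proof -
  have "0 < m" using assms by (cases m) auto
  then show "i div m < n" "i mod m < m" using assms by (auto simp: less_mult_imp_div_less)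
qed

lemma kron_with_index:
  assumes "A \<in> carrier_mat n n'" "B \<in> carrier_mat m m'" "i < n * m" "j < n' * m'"
  shows "kron_with f A B $$ (i, j) = f (A $$ (i div m, j div m')) (B $$ (i mod m, j mod m'))"
  using assms by (simp add: kron_with_def)

lemma kron_vec_index:
  assumes "x \<in> carrier_vec n" "y \<in> carrier_vec m" "i < n * m"
  shows "kron_vec x y $ i = x $ (i div m) * y $ (i mod m)"
  using assms by (simp add: kron_vec_def)

text \<open>Quotient and remainder by \<open>m\<close> identify Kronecker indices with pairs; the
  sum is cut into \<open>n\<close> blocks of length \<open>m\<close>.\<close>

lemma sum_div_mod:
  fixes h :: "nat \<Rightarrow> nat \<Rightarrow> 'a :: comm_monoid_add"
  shows "(\<Sum>k<n * m. h (k div m) (k mod m)) = (\<Sum>i<n. \<Sum>j<m. h i j)"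
proof -
  have "(\<Sum>k<n * m. h (k div m) (k mod m)) = (\<Sum>i<n. \<Sum>k\<in>{i * m..<i * m + m}. h (k div m) (k mod m))"
    by (rule sum.nat_group[symmetric])
  also have "\<dots> = (\<Sum>i<n. \<Sum>j<m. h i j)"
  proof (rule sum.cong[OF refl])
    fix i
    have "(\<Sum>k\<in>{i * m..<i * m + m}. h (k div m) (k mod m)) = (\<Sum>j<m. h ((i * m + j) div m) ((i * m + j) mod m))"
      by (rule sum.reindex_bij_witness[of _ "\<lambda>j. i * m + j" "\<lambda>k. k - i * m"]) auto
    also have "\<dots> = (\<Sum>j<m. h i j)" by (intro sum.cong) auto
    finally show "(\<Sum>k\<in>{i * m..<i * m + m}. h (k div m) (k mod m)) = (\<Sum>j<m. h i j)" .
  qed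
  finally show ?thesis .
qed

lemma sum_div_mod_product:
  fixes a b :: "nat \<Rightarrow> 'a :: comm_semiring_0"
  shows "(\<Sum>k<n * m. a (k div m) * b (k mod m)) = (\<Sum>i<n. a i) * (\<Sum>j<m. b j)"
  using sum_div_mod[of "\<lambda>i j. a i * b j" m n] by (simp add: sum_product)

lemma kron_mult_kron_vec:
  assumes A: "A \<in> carrier_mat n n'" and B: "B \<in> carrier_mat m m'"
    and x: "x \<in> carrier_vec n'" and y: "y \<in> carrier_vec m'"
  shows "kron A B *\<^sub>v kron_vec x y = kron_vec (A *\<^sub>v x) (B *\<^sub>v y)"
proof (rule eq_vecI)
  fix i assume "i < dim_vec (kron_vec (A *\<^sub>v x) (B *\<^sub>v y))"
  then have i: "i < n * m" using A B by simp
  have "(kron A B *\<^sub>v kron_vec x y) $ i =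
      (\<Sum>k<n' * m'. A $$ (i div m, k div m') * x $ (k div m') * (B $$ (i mod m, k mod m') * y $ (k mod m')))"
    unfolding mult_mat_vec_index[OF kron_carrier[OF A B] kron_vec_carrier[OF x y] i]
    using i by (intro sum.cong) (auto simp: kron_with_index[OF A B] kron_vec_index[OF x y])
  also have "\<dots> = (A *\<^sub>v x) $ (i div m) * (B *\<^sub>v y) $ (i mod m)"
    using div_mod_less[OF i]
      sum_div_mod_product[of "\<lambda>k. A $$ (i div m, k) * x $ k" m' "\<lambda>k. B $$ (i mod m, k) * y $ k" n']
    by (simp add: mult_mat_vec_index[OF A x] mult_mat_vec_index[OF B y] del: index_mult_mat_vec)
  also have "\<dots> = kron_vec (A *\<^sub>v x) (B *\<^sub>v y) $ i"
    by (rule kron_vec_index[symmetric]) (use A B x y i in auto)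
  finally show "(kron A B *\<^sub>v kron_vec x y) $ i = kron_vec (A *\<^sub>v x) (B *\<^sub>v y) $ i" .
qed (use A B in auto)

lemma kron_mult_kron:
  assumes A: "A \<in> carrier_mat n n" and B: "B \<in> carrier_mat m m"
    and C: "C \<in> carrier_mat n n" and D: "D \<in> carrier_mat m m"
  shows "kron A B * kron C D = kron (A * C) (B * D)"
proof (rule eq_matI)
  fix i j assume "i < dim_row (kron (A * C) (B * D))" "j < dim_col (kron (A * C) (B * D))"
  then have i: "i < n * m" and j: "j < n * m" using assms by auto
  have "(kron A B * kron C D) $$ (i, j) =
      (\<Sum>k<n * m. A $$ (i div m, k div m) * C $$ (k div m, j div m) * (B $$ (i mod m, k mod m) * D $$ (k mod m, j mod m)))"
    unfolding mult_mat_index[OF kron_carrier[OF A B] kron_carrier[OF C D] i j]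
    using i j by (intro sum.cong) (auto simp: kron_with_index[OF A B] kron_with_index[OF C D])
  also have "\<dots> = (A * C) $$ (i div m, j div m) * (B * D) $$ (i mod m, j mod m)"
    using div_mod_less[OF i] div_mod_less[OF j]
      sum_div_mod_product[of "\<lambda>k. A $$ (i div m, k) * C $$ (k, j div m)" m "\<lambda>k. B $$ (i mod m, k) * D $$ (k, j mod m)" n]
    by (simp add: mult_mat_index[OF A C] mult_mat_index[OF B D] del: index_mult_mat)
  also have "\<dots> = kron (A * C) (B * D) $$ (i, j)"
    by (rule kron_with_index[symmetric]) (use assms i j in auto)
  finally show "(kron A B * kron C D) $$ (i, j) = kron (A * C) (B * D) $$ (i, j)" .
qed (use assms in auto)

lemma kron_one: "kron (1\<^sub>m n) (1\<^sub>m m) = 1\<^sub>m (n * m)"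
proof (rule eq_matI)
  fix i j assume "i < dim_row (1\<^sub>m (n * m) :: complex mat)" "j < dim_col (1\<^sub>m (n * m) :: complex mat)"
  then have i: "i < n * m" and j: "j < n * m" by auto
  have "i = j" if "i div m = j div m" "i mod m = j mod m" using that by (metis div_mult_mod_eq)
  then show "kron (1\<^sub>m n) (1\<^sub>m m) $$ (i, j) = 1\<^sub>m (n * m) $$ (i, j)"
    using i j div_mod_less[OF i] div_mod_less[OF j]
    by (auto simp: kron_with_index[OF one_carrier_mat one_carrier_mat])
qed auto

lemma mat_adjoint_kron: "mat_adjoint (kron A B) = kron (mat_adjoint A) (mat_adjoint B)"
proof (rule eq_matI)
  fix i j assume "i < dim_row (kron (mat_adjoint A) (mat_adjoint B))" "j < dim_col (kron (mat_adjoint A) (mat_adjoint B))"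
  then have i: "i < dim_col A * dim_col B" and j: "j < dim_row A * dim_row B" by auto
  then show "mat_adjoint (kron A B) $$ (i, j) = kron (mat_adjoint A) (mat_adjoint B) $$ (i, j)"
    using div_mod_less[OF i] div_mod_less[OF j] by (simp add: kron_with_def)
qed auto

lemma kron_smult:
  "kron (c \<cdot>\<^sub>m A) B = c \<cdot>\<^sub>m kron A B" "kron A (c \<cdot>\<^sub>m B) = c \<cdot>\<^sub>m kron A B"
proof -
  show "kron (c \<cdot>\<^sub>m A) B = c \<cdot>\<^sub>m kron A B"
  proof (rule eq_matI)
    fix i j assume "i < dim_row (c \<cdot>\<^sub>m kron A B)" "j < dim_col (c \<cdot>\<^sub>m kron A B)"
    then have i: "i < dim_row A * dim_row B" and j: "j < dim_col A * dim_col B" by auto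
    then show "kron (c \<cdot>\<^sub>m A) B $$ (i, j) = (c \<cdot>\<^sub>m kron A B) $$ (i, j)"
      using div_mod_less[OF i] div_mod_less[OF j] by (simp add: kron_with_def)
  qed auto
  show "kron A (c \<cdot>\<^sub>m B) = c \<cdot>\<^sub>m kron A B"
  proof (rule eq_matI)
    fix i j assume "i < dim_row (c \<cdot>\<^sub>m kron A B)" "j < dim_col (c \<cdot>\<^sub>m kron A B)"
    then have i: "i < dim_row A * dim_row B" and j: "j < dim_col A * dim_col B" by auto
    then show "kron A (c \<cdot>\<^sub>m B) $$ (i, j) = (c \<cdot>\<^sub>m kron A B) $$ (i, j)"
      using div_mod_less[OF i] div_mod_less[OF j] by (simp add: kron_with_def)
  qed auto
qed

lemma kron_vec_smult:
  "kron_vec (c \<cdot>\<^sub>v x) y = c \<cdot>\<^sub>v kron_vec x y" "kron_vec x (c \<cdot>\<^sub>v y) = c \<cdot>\<^sub>v kron_vec x y"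
proof -
  have "kron_vec (c \<cdot>\<^sub>v x) y $ i = (c \<cdot>\<^sub>v kron_vec x y) $ i \<and> kron_vec x (c \<cdot>\<^sub>v y) $ i = (c \<cdot>\<^sub>v kron_vec x y) $ i"
    if i: "i < dim_vec x * dim_vec y" for i
    using i div_mod_less[OF i] by (simp add: kron_vec_def)
  then show "kron_vec (c \<cdot>\<^sub>v x) y = c \<cdot>\<^sub>v kron_vec x y" "kron_vec x (c \<cdot>\<^sub>v y) = c \<cdot>\<^sub>v kron_vec x y"
    by (auto intro!: eq_vecI)
qed

lemma kron_vec_add:
  assumes "x \<in> carrier_vec n" "x' \<in> carrier_vec n" "y \<in> carrier_vec m" "y' \<in> carrier_vec m"
  shows "kron_vec (x + x') y = kron_vec x y + kron_vec x' y"
    "kron_vec x (y + y') = kron_vec x y + kron_vec x y'"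
proof -
  have "kron_vec (x + x') y $ i = (kron_vec x y + kron_vec x' y) $ i \<and>
      kron_vec x (y + y') $ i = (kron_vec x y + kron_vec x y') $ i" if i: "i < n * m" for i
    using i div_mod_less[OF i] assms by (simp add: kron_vec_def distrib_left distrib_right)
  then show "kron_vec (x + x') y = kron_vec x y + kron_vec x' y"
    "kron_vec x (y + y') = kron_vec x y + kron_vec x y'"
    using assms by (auto intro!: eq_vecI)
qed

lemma kron_vec_zero [simp]:
  "kron_vec (0\<^sub>v n) y = 0\<^sub>v (n * dim_vec y)" "kron_vec x (0\<^sub>v n) = 0\<^sub>v (dim_vec x * n)"
proof -
  show "kron_vec (0\<^sub>v n) y = 0\<^sub>v (n * dim_vec y)"
  proof (rule eq_vecI)
    fix i assume "i < dim_vec (0\<^sub>v (n * dim_vec y) :: complex vec)"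
    then have i: "i < n * dim_vec y" by simp
    then show "kron_vec (0\<^sub>v n) y $ i = 0\<^sub>v (n * dim_vec y) $ i"
      using div_mod_less[OF i] by (simp add: kron_vec_def)
  qed simp
  show "kron_vec x (0\<^sub>v n) = 0\<^sub>v (dim_vec x * n)"
  proof (rule eq_vecI)
    fix i assume "i < dim_vec (0\<^sub>v (dim_vec x * n) :: complex vec)"
    then have i: "i < dim_vec x * n" by simp
    then show "kron_vec x (0\<^sub>v n) $ i = 0\<^sub>v (dim_vec x * n) $ i"
      using div_mod_less[OF i] by (simp add: kron_vec_def)
  qed simp
qed

text \<open>An index is split by quotient and remainder in two orders, with the same three digits as
  result. This strictness lets operators adapted to either bracketing be evaluated at one and the
  same vector.\<close>

lemma kron_vec_assoc: "kron_vec (kron_vec x y) z = kron_vec x (kron_vec y z)"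
proof (rule eq_vecI)
  fix i assume "i < dim_vec (kron_vec x (kron_vec y z))"
  then have i: "i < dim_vec x * (dim_vec y * dim_vec z)" by simp
  then have i': "i < dim_vec x * dim_vec y * dim_vec z" by (simp add: mult.assoc)
  have z: "0 < dim_vec z" using i' by (cases "dim_vec z") auto
  have "i div dim_vec z div dim_vec y = i div (dim_vec y * dim_vec z)"
    by (metis div_mult2_eq mult.commute)
  moreover have eq: "i mod (dim_vec y * dim_vec z) = dim_vec z * (i div dim_vec z mod dim_vec y) + i mod dim_vec z"
    unfolding mult.commute[of "dim_vec y" "dim_vec z"] by (rule mod_mult2_eq)
  moreover have "i div dim_vec z mod dim_vec y = i mod (dim_vec y * dim_vec z) div dim_vec z"
    unfolding eq using z by (subst div_mult_self4) auto
  moreover have "i mod dim_vec z = i mod (dim_vec y * dim_vec z) mod dim_vec z"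
    unfolding eq using z by simp
  ultimately show "kron_vec (kron_vec x y) z $ i = kron_vec x (kron_vec y z) $ i"
    using i i' div_mod_less[OF i] div_mod_less[OF i'] by (simp add: kron_vec_def)
qed (simp add: mult.assoc)

text \<open>Generated inductively so that statements about spans are proved by induction on the
  construction instead of with finite linear combinations; \<open>n\<close> only fixes the length of
  the zero vector.\<close>

inductive_set vspan :: "nat \<Rightarrow> complex vec set \<Rightarrow> complex vec set" for n S where
  vspan_zero: "0\<^sub>v n \<in> vspan n S"
| vspan_base: "v \<in> S \<Longrightarrow> v \<in> vspan n S"
| vspan_add: "v \<in> vspan n S \<Longrightarrow> w \<in> vspan n S \<Longrightarrow> v + w \<in> vspan n S"
| vspan_smult: "v \<in> vspan n S \<Longrightarrow> c \<cdot>\<^sub>v v \<in> vspan n S"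

lemma vspan_carrier: "S \<subseteq> carrier_vec n \<Longrightarrow> v \<in> vspan n S \<Longrightarrow> v \<in> carrier_vec n"
  by (rotate_tac, induction rule: vspan.induct) auto

lemma vspan_subset:
  assumes "S \<subseteq> vspan n T" shows "vspan n S \<subseteq> vspan n T"
proof
  fix v assume "v \<in> vspan n S"
  then show "v \<in> vspan n T"
    by (induction rule: vspan.induct) (use assms in \<open>auto intro: vspan.intros\<close>)
qed

lemma vspan_mono: "S \<subseteq> T \<Longrightarrow> vspan n S \<subseteq> vspan n T"
  by (rule vspan_subset) (auto intro: vspan_base)

lemma vspan_unit_vecs:
  assumes v: "v \<in> carrier_vec n"
  shows "v \<in> vspan n (unit_vec n ` {..<n})"
proof -
  \<comment> \<open>\<open>t m\<close> keeps the first \<open>m\<close> coordinates of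
    \<open>v\<close>, so each step adds one multiple of a unit vector.\<close>
  define t where "t m = vec n (\<lambda>k. if k < m then v $ k else 0)" for m
  have t: "t m \<in> vspan n (unit_vec n ` {..<n})" if "m \<le> n" for m
    using that
  proof (induction m)
    case 0
    have "t 0 = 0\<^sub>v n" unfolding t_def by (rule eq_vecI) auto
    then show ?case by (simp add: vspan_zero)
  next
    case (Suc m)
    have "t (Suc m) = t m + (v $ m) \<cdot>\<^sub>v unit_vec n m"
      using Suc.prems unfolding t_def by (intro eq_vecI) (auto simp: less_Suc_eq)
    moreover have "t m \<in> vspan n (unit_vec n ` {..<n})" using Suc by simp
    moreover have "unit_vec n m \<in> vspan n (unit_vec n ` {..<n})"
      using Suc.prems by (intro vspan_base imageI) simp
    ultimately show ?case by (simp add: vspan_add vspan_smult)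
  qed
  have "t n = v" unfolding t_def by (rule eq_vecI) (use v in auto)
  then show ?thesis using t[of n] by simp
qed

lemma vspan_eq_mult:
  assumes "A \<in> carrier_mat m n" "B \<in> carrier_mat m n" "S \<subseteq> carrier_vec n"
    and "\<And>v. v \<in> S \<Longrightarrow> A *\<^sub>v v = B *\<^sub>v v" "v \<in> vspan n S"
  shows "A *\<^sub>v v = B *\<^sub>v v"
  using assms(5)
proof (induction rule: vspan.induct)
  case (vspan_add v w)
  then show ?case using vspan_carrier[OF assms(3)] assms(1,2) by (simp add: mult_add_distrib_mat_vec)
next
  case (vspan_smult v c)
  then show ?case using vspan_carrier[OF assms(3)] assms(1,2) by (simp add: mult_mat_vec)
qed (use assms in auto)

text \<open>Reduces operator identities to eigenvalue computations, once weight vectors are known to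
  span.\<close>

lemma mat_eq_on_vspan:
  assumes "A \<in> carrier_mat m n" "B \<in> carrier_mat m n" "S \<subseteq> carrier_vec n"
    and "carrier_vec n \<subseteq> vspan n S" "\<And>v. v \<in> S \<Longrightarrow> A *\<^sub>v v = B *\<^sub>v v"
  shows "A = B"
proof (rule mat_eq_on_unit_vecs[OF assms(1,2)])
  fix k
  have "unit_vec n k \<in> vspan n S" by (rule subsetD[OF assms(4)]) simp
  with assms(5) show "A *\<^sub>v unit_vec n k = B *\<^sub>v unit_vec n k"
    by (rule vspan_eq_mult[OF assms(1,2,3)])
qed

text \<open>Linearity of the Kronecker product in each argument, hence two nested inductions over
  the spans.\<close>

lemma vspan_kron_vec:
  assumes "x \<in> vspan n S" "y \<in> vspan m T" "S \<subseteq> carrier_vec n" "T \<subseteq> carrier_vec m"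
  shows "kron_vec x y \<in> vspan (n * m) {kron_vec a b | a b. a \<in> S \<and> b \<in> T}"
  using assms(1)
proof (induction rule: vspan.induct)
  case vspan_zero
  then show ?case using vspan_carrier[OF assms(4,2)] by (auto intro: vspan.vspan_zero)
next
  case (vspan_base a)
  show ?case using assms(2)
  proof (induction rule: vspan.induct)
    case vspan_zero
    have "dim_vec a = n" using vspan_base assms(3) by auto
    then show ?case by (simp add: vspan.vspan_zero)
  next
    case (vspan_base b)
    then show ?case using \<open>a \<in> S\<close> by (auto intro: vspan.vspan_base)
  next
    case (vspan_add v w)
    have "kron_vec a (v + w) = kron_vec a v + kron_vec a w"
      using kron_vec_add(2)[of a n a v m w] \<open>a \<in> S\<close> assms(3) vspan_carrier[OF assms(4)] vspan_add by blast
    then show ?case using vspan_add by (simp add: vspan.vspan_add)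
  qed (auto simp: kron_vec_smult intro: vspan.vspan_smult)
next
  case (vspan_add v w)
  have "kron_vec (v + w) y = kron_vec v y + kron_vec w y"
    using kron_vec_add(1)[of v n w y m y] vspan_carrier[OF assms(3)] vspan_carrier[OF assms(4,2)] vspan_add by blast
  then show ?case using vspan_add by (simp add: vspan.vspan_add)
qed (auto simp: kron_vec_smult intro: vspan.vspan_smult)

lemma unit_vec_kron:
  assumes "i < n * m"
  shows "unit_vec (n * m) i = kron_vec (unit_vec n (i div m)) (unit_vec m (i mod m))"
proof (rule eq_vecI)
  fix j assume "j < dim_vec (kron_vec (unit_vec n (i div m)) (unit_vec m (i mod m)))"
  then have j: "j < n * m" by simp
  have "j = i" if "j div m = i div m" "j mod m = i mod m" using that by (metis div_mult_mod_eq)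
  then show "unit_vec (n * m) i $ j = kron_vec (unit_vec n (i div m)) (unit_vec m (i mod m)) $ j"
    using assms j div_mod_less[OF assms] div_mod_less[OF j] by (auto simp: kron_vec_def)
qed auto

lemma vspan_kron_full:
  assumes "carrier_vec n \<subseteq> vspan n S" "carrier_vec m \<subseteq> vspan m T"
    "S \<subseteq> carrier_vec n" "T \<subseteq> carrier_vec m"
  shows "carrier_vec (n * m) \<subseteq> vspan (n * m) {kron_vec a b | a b. a \<in> S \<and> b \<in> T}"
proof
  fix v :: "complex vec" assume "v \<in> carrier_vec (n * m)"
  then have "v \<in> vspan (n * m) (unit_vec (n * m) ` {..<n * m})" by (rule vspan_unit_vecs)
  moreover have "vspan (n * m) (unit_vec (n * m) ` {..<n * m}) \<subseteq> vspan (n * m) {kron_vec a b | a b. a \<in> S \<and> b \<in> T}"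
  proof (rule vspan_subset, safe)
    fix i assume "i < n * m"
    then show "unit_vec (n * m) i \<in> vspan (n * m) {kron_vec a b | a b. a \<in> S \<and> b \<in> T}"
      unfolding unit_vec_kron[OF \<open>i < n * m\<close>]
      using assms by (intro vspan_kron_vec) auto
  qed
  ultimately show "v \<in> vspan (n * m) {kron_vec a b | a b. a \<in> S \<and> b \<in> T}" by blast
qed

section \<open>Interpolation and weight spaces\<close>

text \<open>The character of the free algebra that sends a generator \<open>x\<close> to
  \<open>e x\<close>. On a joint eigenvector with eigenvalues \<open>e\<close> an element acts by
  this scalar.\<close>

definition lc_eval :: "('x \<Rightarrow> complex) \<Rightarrow> 'x lincomb \<Rightarrow> complex" where
  "lc_eval e p = (\<Sum>(c, w)\<leftarrow>p. c * (\<Prod>x\<leftarrow>w. e x))"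

lemma lc_eval_simps [simp]:
  "lc_eval e [] = 0" "lc_eval e ((c, w) # p) = c * (\<Prod>x\<leftarrow>w. e x) + lc_eval e p"
  "lc_eval e (p @ s) = lc_eval e p + lc_eval e s"
  by (auto simp: lc_eval_def)

lemma lc_eval_mult [simp]: "lc_eval e (lc_mult p s) = lc_eval e p * lc_eval e s"
proof (induction p)
  case (Cons a p)
  obtain c v where a: "a = (c, v)" by force
  have "lc_eval e (map (\<lambda>(d, w). (c * d, v @ w)) s) = c * (\<Prod>x\<leftarrow>v. e x) * lc_eval e s"
    by (induction s) (auto simp: algebra_simps)
  moreover have "lc_mult (a # p) s = map (\<lambda>(d, w). (c * d, v @ w)) s @ lc_mult p s"
    by (simp add: lc_mult_def a case_prod_unfold)
  ultimately show ?case using Cons by (simp add: a algebra_simps)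
qed (simp add: lc_mult_def)

text \<open>Lagrange interpolation for characters: the element is a product over \<open>J\<close> of
  affine factors, the factor for \<open>j\<close> being built from a generator that distinguishes
  \<open>e i\<close> from \<open>e j\<close>.\<close>

lemma lc_separate:
  assumes "finite J" "\<And>j. j \<in> J \<Longrightarrow> \<exists>x\<in>X. e i x \<noteq> e j x"
  shows "\<exists>p. lc_in X p \<and> lc_eval (e i) p = 1 \<and> (\<forall>j\<in>J. lc_eval (e j) p = 0)"
  using assms
proof (induction J)
  case empty
  show ?case by (rule exI[of _ "[(1, [])]"]) simp
next
  case (insert k J)
  obtain p where p: "lc_in X p" "lc_eval (e i) p = 1" "\<forall>j\<in>J. lc_eval (e j) p = 0"
    using insert by auto
  obtain x where x: "x \<in> X" "e i x \<noteq> e k x" using insert by auto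
  \<comment> \<open>The factor \<open>(x - e k x) / (e i x - e k x)\<close>, with value 1 at
    \<open>i\<close> and 0 at \<open>k\<close>.\<close>
  define s where "s = [(1 / (e i x - e k x), [x]), (- e k x / (e i x - e k x), [])]"
  have "e i x / (e i x - e k x) - e k x / (e i x - e k x) = 1"
    using x by (simp flip: diff_divide_distrib)
  then have "lc_in X s \<and> lc_eval (e i) s = 1 \<and> lc_eval (e k) s = 0"
    using x by (simp add: s_def)
  then show ?case using p by (intro exI[of _ "lc_mult s p"]) auto
qed

lemma lc_interpolate:
  assumes "finite I" "\<And>i j. i \<in> I \<Longrightarrow> j \<in> I \<Longrightarrow> i \<noteq> j \<Longrightarrow> \<exists>x\<in>X. e i x \<noteq> e j x"
  shows "\<exists>p. lc_in X p \<and> (\<forall>i\<in>I. lc_eval (e i) p = g i)"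
  using assms
proof (induction I)
  case empty
  show ?case by (rule exI[of _ "[]"]) simp
next
  case (insert k I)
  obtain p where p: "lc_in X p" "\<forall>i\<in>I. lc_eval (e i) p = g i" using insert by auto
  obtain s where s: "lc_in X s" "lc_eval (e k) s = 1" "\<forall>j\<in>I. lc_eval (e j) s = 0"
    using lc_separate[of I X e k] insert.hyps insert.prems by auto
  \<comment> \<open>Newton's form of interpolation: the error of \<open>p\<close> at the new node
    \<open>k\<close> is corrected by a multiple of \<open>s\<close>, which vanishes at all old
    nodes.\<close>
  show ?case
    by (rule exI[of _ "p @ lc_mult [(g k - lc_eval (e k) p, [])] s"]) (use p s in auto)
qed

lemma word_mat_eigen:
  assumes "set w \<subseteq> X" "v \<in> carrier_vec n"
    and "\<And>x. x \<in> X \<Longrightarrow> \<rho> x \<in> carrier_mat n n" "\<And>x. x \<in> X \<Longrightarrow> \<rho> x *\<^sub>v v = e x \<cdot>\<^sub>v v"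
  shows "word_mat n \<rho> w *\<^sub>v v = (\<Prod>x\<leftarrow>w. e x) \<cdot>\<^sub>v v"
  using assms(1)
proof (induction w)
  case (Cons x w)
  have x: "x \<in> X" and w: "word_mat n \<rho> w \<in> carrier_mat n n"
    using Cons.prems assms(3) by (auto intro!: word_mat_carrier)
  have "word_mat n \<rho> (x # w) *\<^sub>v v = \<rho> x *\<^sub>v ((\<Prod>x\<leftarrow>w. e x) \<cdot>\<^sub>v v)"
    using Cons assoc_mult_mat_vec[OF assms(3)[OF x] w assms(2)] by simp
  also have "\<dots> = (\<Prod>x\<leftarrow>x # w. e x) \<cdot>\<^sub>v v"
    using mult_mat_vec[OF assms(3)[OF x] assms(2)] assms(4)[OF x] by (simp add: smult_smult_assoc mult.commute)
  finally show ?case .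
qed (use assms in auto)

lemma lc_mat_eigen:
  assumes p: "lc_in X p" and v: "v \<in> carrier_vec n"
    and X: "\<And>x. x \<in> X \<Longrightarrow> \<rho> x \<in> carrier_mat n n" "\<And>x. x \<in> X \<Longrightarrow> \<rho> x *\<^sub>v v = e x \<cdot>\<^sub>v v"
  shows "lc_mat n \<rho> p *\<^sub>v v = lc_eval e p \<cdot>\<^sub>v v"
  using p
proof (induction p)
  case Nil
  show ?case using v by (intro eq_vecI) auto
next
  case (Cons a p)
  obtain c w where a: "a = (c, w)" by force
  have w: "set w \<subseteq> X" and p: "lc_in X p" using Cons.prems by (auto simp: a)
  have wc: "word_mat n \<rho> w \<in> carrier_mat n n" using w X by (auto intro!: word_mat_carrier)
  have pc: "lc_mat n \<rho> p \<in> carrier_mat n n" by (rule lc_mat_carrier[OF p X(1)])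
  have "lc_mat n \<rho> (a # p) *\<^sub>v v = c \<cdot>\<^sub>v (word_mat n \<rho> w *\<^sub>v v) + lc_mat n \<rho> p *\<^sub>v v"
    using add_mult_distrib_mat_vec[OF smult_carrier_mat[OF wc] pc v] smult_mult_mat_vec[OF wc v]
    by (simp add: a)
  also have "\<dots> = lc_eval e (a # p) \<cdot>\<^sub>v v"
    using Cons.IH[OF p] word_mat_eigen[OF w v X]
    by (simp add: a smult_smult_assoc add_smult_distrib_vec)
  finally show ?case .
qed

text \<open>The involution of the free algebra that fixes every generator; it evaluates to the
  adjoint matrix as long as the generators act by self-adjoint matrices.\<close>

definition lc_adj :: "'x lincomb \<Rightarrow> 'x lincomb" where
  "lc_adj p = map (\<lambda>(c, w). (cnj c, rev w)) p"

lemma lc_in_adj [simp]: "lc_in X (lc_adj p) = lc_in X p"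
  by (induction p) (auto simp: lc_adj_def)

lemma lc_eval_adj:
  assumes "lc_in X p" "\<And>x. x \<in> X \<Longrightarrow> cnj (e x) = e x"
  shows "lc_eval e (lc_adj p) = cnj (lc_eval e p)"
  using assms(1)
proof (induction p)
  case (Cons a p)
  obtain c w where a: "a = (c, w)" by force
  have "set w \<subseteq> X \<Longrightarrow> cnj (\<Prod>x\<leftarrow>w. e x) = (\<Prod>x\<leftarrow>rev w. e x)"
    by (induction w) (use assms(2) in \<open>auto simp: mult.commute\<close>)
  then show ?case using Cons by (simp add: a lc_adj_def)
qed (simp add: lc_adj_def)

lemma lc_mat_adj:
  assumes p: "lc_in X p"
    and X: "\<And>x. x \<in> X \<Longrightarrow> \<rho> x \<in> carrier_mat n n" "\<And>x. x \<in> X \<Longrightarrow> mat_adjoint (\<rho> x) = \<rho> x"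
  shows "lc_mat n \<rho> (lc_adj p) = mat_adjoint (lc_mat n \<rho> p)"
  using p
proof (induction p)
  case (Cons a p)
  obtain c w where a: "a = (c, w)" by force
  have w: "set w \<subseteq> X" and p: "lc_in X p" using Cons.prems by (auto simp: a)
  have wc: "word_mat n \<rho> w \<in> carrier_mat n n" using w X by (auto intro!: word_mat_carrier)
  have pc: "lc_mat n \<rho> p \<in> carrier_mat n n" by (rule lc_mat_carrier[OF p X(1)])
  have "word_mat n \<rho> (rev w) = mat_adjoint (word_mat n \<rho> w)" using w
  proof (induction w)
    case (Cons x w)
    have x: "\<rho> x \<in> carrier_mat n n" and w: "word_mat n \<rho> w \<in> carrier_mat n n"
      using Cons.prems X(1) by (auto intro!: word_mat_carrier)
    have "word_mat n \<rho> (rev (x # w)) = word_mat n \<rho> (rev w) * word_mat n \<rho> [x]"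
      using word_mat_append[of "rev w" "[x]" \<rho> n] Cons.prems X(1) by auto
    also have "\<dots> = mat_adjoint (word_mat n \<rho> w) * mat_adjoint (\<rho> x)"
      using Cons X(2) right_mult_one_mat[OF x] by simp
    also have "\<dots> = mat_adjoint (\<rho> x * word_mat n \<rho> w)" by (rule mat_adjoint_mult[OF x w, symmetric])
    finally show ?case by simp
  qed simp
  then show ?case
    using Cons.IH[OF p] mat_adjoint_add[OF smult_carrier_mat[OF wc] pc]
    by (simp add: a lc_adj_def mat_adjoint_smult)
qed (simp add: lc_adj_def)

text \<open>The operator is a polynomial in self-adjoint matrices, so its adjoint is the polynomial
  \<open>lc_adj p\<close> in the same matrices. As the eigenvalues are real, the value of that
  polynomial is the conjugate one; this gives the eigenvalues of the adjoint without a discussion of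
  orthogonality of eigenspaces.\<close>

lemma diagonal_operator_exists:
  assumes "finite I" "\<And>i j. i \<in> I \<Longrightarrow> j \<in> I \<Longrightarrow> i \<noteq> j \<Longrightarrow> \<exists>x\<in>X. e i x \<noteq> e j x"
    and X: "\<And>x. x \<in> X \<Longrightarrow> \<rho> x \<in> carrier_mat n n" "\<And>x. x \<in> X \<Longrightarrow> mat_adjoint (\<rho> x) = \<rho> x"
    and real: "\<And>i x. cnj (e i x) = e i x"
  shows "\<exists>M\<in>carrier_mat n n. \<forall>i\<in>I. \<forall>v\<in>carrier_vec n. (\<forall>x\<in>X. \<rho> x *\<^sub>v v = e i x \<cdot>\<^sub>v v) \<longrightarrow>
    M *\<^sub>v v = g i \<cdot>\<^sub>v v \<and> mat_adjoint M *\<^sub>v v = cnj (g i) \<cdot>\<^sub>v v"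
proof -
  have "\<exists>p. lc_in X p \<and> (\<forall>i\<in>I. lc_eval (e i) p = g i)"
    by (rule lc_interpolate[OF assms(1)]) (rule assms(2))
  then obtain p where p: "lc_in X p" "\<And>i. i \<in> I \<Longrightarrow> lc_eval (e i) p = g i" by blast
  show ?thesis
  proof (intro bexI[of _ "lc_mat n \<rho> p"] ballI impI)
    fix i v assume i: "i \<in> I" and v: "v \<in> carrier_vec n" and e: "\<forall>x\<in>X. \<rho> x *\<^sub>v v = e i x \<cdot>\<^sub>v v"
    have "lc_mat n \<rho> p *\<^sub>v v = lc_eval (e i) p \<cdot>\<^sub>v v"
      by (rule lc_mat_eigen[OF p(1) v X(1)]) (use e in auto)
    moreover have "lc_mat n \<rho> (lc_adj p) *\<^sub>v v = lc_eval (e i) (lc_adj p) \<cdot>\<^sub>v v"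
      by (rule lc_mat_eigen[of X, OF _ v X(1)]) (use e p in auto)
    ultimately show "lc_mat n \<rho> p *\<^sub>v v = g i \<cdot>\<^sub>v v \<and> mat_adjoint (lc_mat n \<rho> p) *\<^sub>v v = cnj (g i) \<cdot>\<^sub>v v"
      using p(2)[OF i] lc_eval_adj[OF p(1) real] lc_mat_adj[OF p(1) X] by simp
  qed (rule lc_mat_carrier[OF p(1) X(1)])
qed

text \<open>Together with \<open>torus_eigenvalue\<close> this makes the cases \<open>q = 1\<close>
  and \<open>q \<noteq> 1\<close> uniform: in both, a weight vector is a joint eigenvector with real
  eigenvalues. The inverses of the K_i are not among these generators.\<close>

definition torus_gen :: "real \<Rightarrow> 'r \<Rightarrow> 'r gen" where
  "torus_gen q i = (if q = 1 then Hg i else Kg i)"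

definition torus_eigenvalue :: "real \<Rightarrow> ('r \<Rightarrow> 'e::euclidean_space) \<Rightarrow> 'e \<Rightarrow> 'r \<Rightarrow> real" where
  "torus_eigenvalue q \<alpha> \<chi> i =
     (if q = 1 then 2 * inner (\<alpha> i) \<chi> / inner (\<alpha> i) (\<alpha> i) else q powr inner (\<alpha> i) \<chi>)"

lemma weight_space_iff:
  "v \<in> weight_space q \<alpha> n \<rho> \<chi> \<longleftrightarrow> v \<in> carrier_vec n \<and>
     (\<forall>i. \<rho> (torus_gen q i) *\<^sub>v v = of_real (torus_eigenvalue q \<alpha> \<chi> i) \<cdot>\<^sub>v v)"
  unfolding weight_space_def torus_gen_def torus_eigenvalue_def by (cases "q = 1") simp_all

section \<open>Weight spaces and diagonal operators\<close>

locale root_data =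
  fixes R :: "'e::euclidean_space set" and \<alpha> :: "'r::finite \<Rightarrow> 'e" and q :: real
  assumes rs: "root_system R" and sr: "simple_roots R \<alpha>" and q0: "q > 0"
begin

abbreviation P where "P \<equiv> weight_lattice R"
abbreviation W where "W \<equiv> weight_space q \<alpha>"

lemma root_pos: "inner (\<alpha> i) (\<alpha> i) > 0"
proof -
  have "\<alpha> i \<in> R" using sr by (auto simp: simple_roots_def)
  then show ?thesis using rs by (auto simp: root_system_def)
qed

lemma span_simple: "span (range \<alpha>) = UNIV"
proof -
  have "R \<subseteq> span (range \<alpha>)"
  proof
    fix b assume "b \<in> R"
    then obtain c :: "'r \<Rightarrow> nat" where
      "b = (\<Sum>i\<in>UNIV. real (c i) *\<^sub>R \<alpha> i) \<or> b = - (\<Sum>i\<in>UNIV. real (c i) *\<^sub>R \<alpha> i)"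
      using sr unfolding simple_roots_def by blast
    moreover have "(\<Sum>i\<in>UNIV. real (c i) *\<^sub>R \<alpha> i) \<in> span (range \<alpha>)"
      by (intro span_sum span_scale span_base) auto
    ultimately show "b \<in> span (range \<alpha>)" using span_neg by auto
  qed
  then have "span R \<subseteq> span (range \<alpha>)" by (simp add: span_minimal)
  then show ?thesis using rs by (auto simp: root_system_def)
qed

text \<open>The eigenvalues determine the inner products with the simple roots, for
  \<open>q \<noteq> 1\<close> because \<open>powr\<close> is injective in the exponent, and the
  simple roots span the space.\<close>

lemma torus_eigenvalue_separates:
  assumes "\<chi> \<noteq> \<chi>'"
  shows "\<exists>i. torus_eigenvalue q \<alpha> \<chi> i \<noteq> torus_eigenvalue q \<alpha> \<chi>' i"
proof (rule ccontr)
  assume "\<not> ?thesis"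
  then have "torus_eigenvalue q \<alpha> \<chi> i = torus_eigenvalue q \<alpha> \<chi>' i" for i by blast
  then have "inner (\<alpha> i) \<chi> = inner (\<alpha> i) \<chi>'" for i
    using root_pos[of i] q0 by (cases "q = 1") (auto simp: torus_eigenvalue_def powr_inj)
  then have "inner (\<chi> - \<chi>') x = 0" if "x \<in> range \<alpha>" for x
    using that by (auto simp: inner_diff_left inner_commute[of _ "\<alpha> _"])
  moreover have "Real_Vector_Spaces.subspace {x. inner (\<chi> - \<chi>') x = 0}"
    by (simp add: real_vector.subspace_def inner_add_right)
  ultimately have "span (range \<alpha>) \<subseteq> {x. inner (\<chi> - \<chi>') x = 0}" by (intro span_minimal) auto
  then have "inner (\<chi> - \<chi>') (\<chi> - \<chi>') = 0" unfolding span_simple by blast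
  then show False using assms by simp
qed

text \<open>Keeps from a *-representation only what the construction of diagonal operators uses.
  Tensor products and the unit object can be shown to be graded directly, without verifying that
  they are unitary representations.\<close>

definition graded :: "nat \<Rightarrow> ('r gen \<Rightarrow> complex mat) \<Rightarrow> bool" where
  "graded n \<rho> \<longleftrightarrow> admissible R \<alpha> q n \<rho> \<and>
     (\<forall>i. \<rho> (torus_gen q i) \<in> carrier_mat n n \<and> mat_adjoint (\<rho> (torus_gen q i)) = \<rho> (torus_gen q i))"

lemma weight_space_carrier: "W n \<rho> \<chi> \<subseteq> carrier_vec n"
  by (auto simp: weight_space_iff)

lemma W_carrier: "v \<in> W n \<rho> \<chi> \<Longrightarrow> v \<in> carrier_vec n" and W_dim: "v \<in> W n \<rho> \<chi> \<Longrightarrow> dim_vec v = n"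
  by (auto simp: weight_space_iff)

lemma weight_space_zero:
  assumes "\<And>i. \<rho> (torus_gen q i) \<in> carrier_mat n n"
  shows "0\<^sub>v n \<in> W n \<rho> \<chi>"
  unfolding weight_space_iff
proof (intro conjI allI)
  fix i show "\<rho> (torus_gen q i) *\<^sub>v 0\<^sub>v n = of_real (torus_eigenvalue q \<alpha> \<chi> i) \<cdot>\<^sub>v 0\<^sub>v n"
    unfolding mult_mat_zero_vec[OF assms] by (rule eq_vecI) auto
qed simp

lemma weight_space_add:
  assumes "\<And>i. \<rho> (torus_gen q i) \<in> carrier_mat n n" "v \<in> W n \<rho> \<chi>" "w \<in> W n \<rho> \<chi>"
  shows "v + w \<in> W n \<rho> \<chi>"
  unfolding weight_space_iff
proof (intro conjI allI)
  fix i
  have vw: "v \<in> carrier_vec n" "w \<in> carrier_vec n" using assms by (auto simp: weight_space_iff)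
  then show "v + w \<in> carrier_vec n" by simp
  show "\<rho> (torus_gen q i) *\<^sub>v (v + w) = of_real (torus_eigenvalue q \<alpha> \<chi> i) \<cdot>\<^sub>v (v + w)"
    unfolding mult_add_distrib_mat_vec[OF assms(1) vw] smult_add_distrib_vec[OF vw]
    using assms by (simp add: weight_space_iff)
qed

lemma weight_space_smult:
  assumes "\<And>i. \<rho> (torus_gen q i) \<in> carrier_mat n n" "v \<in> W n \<rho> \<chi>"
  shows "c \<cdot>\<^sub>v v \<in> W n \<rho> \<chi>"
  unfolding weight_space_iff
proof (intro conjI allI)
  fix i
  have v: "v \<in> carrier_vec n" using assms by (auto simp: weight_space_iff)
  then show "c \<cdot>\<^sub>v v \<in> carrier_vec n" by simp
  show "\<rho> (torus_gen q i) *\<^sub>v (c \<cdot>\<^sub>v v) = of_real (torus_eigenvalue q \<alpha> \<chi> i) \<cdot>\<^sub>v (c \<cdot>\<^sub>v v)"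
    unfolding mult_mat_vec[OF assms(1) v]
    using assms by (simp add: weight_space_iff smult_smult_assoc mult.commute)
qed

lemma sum_in_vspan:
  assumes "finite M" "\<And>\<chi>. \<chi> \<in> M \<Longrightarrow> x \<chi> \<in> S" "S \<subseteq> carrier_vec n"
    "v \<in> carrier_vec n" "\<forall>k<n. v $ k = (\<Sum>\<chi>\<in>M. x \<chi> $ k)"
  shows "v \<in> vspan n S"
  using assms(1,2,4,5)
proof (induction M arbitrary: v)
  case empty
  then have "v = 0\<^sub>v n" by (intro eq_vecI) auto
  then show ?case by (simp add: vspan_zero)
next
  case (insert \<chi> M)
  define u where "u = vec n (\<lambda>k. \<Sum>\<chi>\<in>M. x \<chi> $ k)"
  have u: "u \<in> vspan n S" using insert by (intro insert.IH) (auto simp: u_def)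
  have \<chi>: "x \<chi> \<in> S" using insert by auto
  then have "v = x \<chi> + u" using insert assms(3) by (intro eq_vecI) (auto simp: u_def)
  then show ?case using u \<chi> by (simp add: vspan_add vspan_base)
qed

text \<open>Only the decompositions of the finitely many unit vectors matter, and each involves
  finitely many weights. Finiteness is essential, since these weights become the nodes of an
  interpolation.\<close>

lemma admissible_finite_span:
  assumes "admissible R \<alpha> q n \<rho>"
  shows "\<exists>M. finite M \<and> M \<subseteq> P \<and> carrier_vec n \<subseteq> vspan n (\<Union>\<chi>\<in>M. W n \<rho> \<chi>)"
proof -
  have "\<exists>M. finite M \<and> M \<subseteq> P \<and> unit_vec n k \<in> vspan n (\<Union>\<chi>\<in>M. W n \<rho> \<chi>)" for k
  proof -
    obtain M x where M: "finite M" "M \<subseteq> P" "\<forall>\<chi>\<in>M. x \<chi> \<in> W n \<rho> \<chi>"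
      "\<forall>l<n. unit_vec n k $ l = (\<Sum>\<chi>\<in>M. x \<chi> $ l)"
      using assms[unfolded admissible_def, rule_format, OF unit_vec_carrier[of n k]]
      by (elim exE conjE)
    have "unit_vec n k \<in> vspan n (\<Union>\<chi>\<in>M. W n \<rho> \<chi>)"
      by (rule sum_in_vspan[OF M(1) _ _ _ M(4)]) (use M W_carrier in auto)
    then show ?thesis using M by blast
  qed
  then have "\<forall>k. \<exists>M. finite M \<and> M \<subseteq> P \<and> unit_vec n k \<in> vspan n (\<Union>\<chi>\<in>M. W n \<rho> \<chi>)" by blast
  from choice[OF this] obtain M where M: "\<And>k. finite (M k)" "\<And>k. M k \<subseteq> P"
    "\<And>k. unit_vec n k \<in> vspan n (\<Union>\<chi>\<in>M k. W n \<rho> \<chi>)" by blast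
  show ?thesis
  proof (intro exI[of _ "\<Union>k<n. M k"] conjI)
    have "unit_vec n ` {..<n} \<subseteq> vspan n (\<Union>\<chi>\<in>(\<Union>k<n. M k). W n \<rho> \<chi>)"
    proof safe
      fix k assume "k < n"
      then show "unit_vec n k \<in> vspan n (\<Union>\<chi>\<in>(\<Union>k<n. M k). W n \<rho> \<chi>)"
        by (intro subsetD[OF vspan_mono M(3)]) auto
    qed
    then show "carrier_vec n \<subseteq> vspan n (\<Union>\<chi>\<in>(\<Union>k<n. M k). W n \<rho> \<chi>)"
      using vspan_unit_vecs vspan_subset by blast
  qed (use M in auto)
qed

lemma admissible_span:
  assumes "admissible R \<alpha> q n \<rho>"
  shows "carrier_vec n \<subseteq> vspan n (\<Union>\<chi>\<in>P. W n \<rho> \<chi>)"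
proof -
  obtain M where M: "M \<subseteq> P" "carrier_vec n \<subseteq> vspan n (\<Union>\<chi>\<in>M. W n \<rho> \<chi>)"
    using admissible_finite_span[OF assms] by blast
  have "vspan n (\<Union>\<chi>\<in>M. W n \<rho> \<chi>) \<subseteq> vspan n (\<Union>\<chi>\<in>P. W n \<rho> \<chi>)"
    using M(1) by (intro vspan_mono) auto
  then show ?thesis using M(2) by blast
qed

lemma admissibleI:
  assumes c: "\<And>i. \<rho> (torus_gen q i) \<in> carrier_mat n n"
    and s: "carrier_vec n \<subseteq> vspan n (\<Union>\<chi>\<in>P. W n \<rho> \<chi>)"
  shows "admissible R \<alpha> q n \<rho>"
  unfolding admissible_def
proof
  fix v :: "complex vec" assume "v \<in> carrier_vec n"
  then have "v \<in> vspan n (\<Union>\<chi>\<in>P. W n \<rho> \<chi>)" using s by blast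
  then show "\<exists>M x. finite M \<and> M \<subseteq> P \<and> (\<forall>\<chi>\<in>M. x \<chi> \<in> W n \<rho> \<chi>) \<and> (\<forall>k<n. v $ k = (\<Sum>\<chi>\<in>M. x \<chi> $ k))"
  proof (induction rule: vspan.induct)
    case vspan_zero
    show ?case by (rule exI[of _ "{}"]) auto
  next
    case (vspan_base v)
    then obtain \<chi> where "\<chi> \<in> P" "v \<in> W n \<rho> \<chi>" by blast
    then show ?case by (intro exI[of _ "{\<chi>}"] exI[of _ "\<lambda>_. v"]) auto
  next
    case (vspan_smult v a)
    then obtain M x where M: "finite M" "M \<subseteq> P" "\<forall>\<chi>\<in>M. x \<chi> \<in> W n \<rho> \<chi>" "\<forall>k<n. v $ k = (\<Sum>\<chi>\<in>M. x \<chi> $ k)"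
      by blast
    have v: "dim_vec v = n" using vspan_carrier[OF _ vspan_smult(1)] W_carrier by fastforce
    have "(a \<cdot>\<^sub>v v) $ k = (\<Sum>\<chi>\<in>M. (a \<cdot>\<^sub>v x \<chi>) $ k)" if "k < n" for k
    proof -
      have "(\<Sum>\<chi>\<in>M. (a \<cdot>\<^sub>v x \<chi>) $ k) = (\<Sum>\<chi>\<in>M. a * x \<chi> $ k)"
      proof (intro sum.cong refl)
        fix \<chi> assume "\<chi> \<in> M"
        then have "dim_vec (x \<chi>) = n" using M(3) W_dim by blast
        then show "(a \<cdot>\<^sub>v x \<chi>) $ k = a * x \<chi> $ k" using that by simp
      qed
      then show ?thesis using M(4) v that by (simp add: sum_distrib_left)
    qed
    then show ?case using M weight_space_smult[of \<rho>, OF c]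
      by (intro exI[of _ M] exI[of _ "\<lambda>\<chi>. a \<cdot>\<^sub>v x \<chi>"]) auto
  next
    case (vspan_add v w)
    obtain M x where M: "finite M" "M \<subseteq> P" "\<forall>\<chi>\<in>M. x \<chi> \<in> W n \<rho> \<chi>" "\<forall>k<n. v $ k = (\<Sum>\<chi>\<in>M. x \<chi> $ k)"
      using vspan_add by blast
    obtain M' x' where M': "finite M'" "M' \<subseteq> P" "\<forall>\<chi>\<in>M'. x' \<chi> \<in> W n \<rho> \<chi>" "\<forall>k<n. w $ k = (\<Sum>\<chi>\<in>M'. x' \<chi> $ k)"
      using vspan_add by blast
    have vw: "dim_vec v = n" "dim_vec w = n"
      using vspan_carrier[OF _ vspan_add(1)] vspan_carrier[OF _ vspan_add(2)] W_carrier by fastforce+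
    \<comment> \<open>Zero lies in every weight space, so both decompositions can be padded to the
      common index set \<open>M \<union> M'\<close> and added termwise.\<close>
    define y where "y \<chi> = (if \<chi> \<in> M then x \<chi> else 0\<^sub>v n)" for \<chi>
    define y' where "y' \<chi> = (if \<chi> \<in> M' then x' \<chi> else 0\<^sub>v n)" for \<chi>
    have y: "y \<chi> \<in> W n \<rho> \<chi>" "y' \<chi> \<in> W n \<rho> \<chi>" for \<chi>
      using M M' weight_space_zero[of \<rho>, OF c] by (auto simp: y_def y'_def)
    have "(v + w) $ k = (\<Sum>\<chi>\<in>M \<union> M'. (y \<chi> + y' \<chi>) $ k)" if "k < n" for k
    proof -
      have "(\<Sum>\<chi>\<in>M \<union> M'. (y \<chi> + y' \<chi>) $ k) = (\<Sum>\<chi>\<in>M \<union> M'. y \<chi> $ k + y' \<chi> $ k)"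
        using W_dim[OF y(2)] that by (intro sum.cong) auto
      also have "\<dots> = (\<Sum>\<chi>\<in>M \<union> M'. y \<chi> $ k) + (\<Sum>\<chi>\<in>M \<union> M'. y' \<chi> $ k)" by (rule sum.distrib)
      also have "(\<Sum>\<chi>\<in>M \<union> M'. y \<chi> $ k) = (\<Sum>\<chi>\<in>M. x \<chi> $ k)"
        using M(1) M'(1) that by (intro sum.mono_neutral_cong_right) (auto simp: y_def)
      also have "(\<Sum>\<chi>\<in>M \<union> M'. y' \<chi> $ k) = (\<Sum>\<chi>\<in>M'. x' \<chi> $ k)"
        using M(1) M'(1) that by (intro sum.mono_neutral_cong_right) (auto simp: y'_def)
      finally show ?thesis using M(4) M'(4) vw that by simp
    qed
    then show ?case using M M' weight_space_add[of \<rho>, OF c y]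
      by (intro exI[of _ "M \<union> M'"] exI[of _ "\<lambda>\<chi>. y \<chi> + y' \<chi>"]) auto
  qed
qed

lemma graded_diagonal:
  assumes g: "graded n \<rho>" and M: "finite M"
  shows "\<exists>T\<in>carrier_mat n n. \<forall>\<chi>\<in>M. \<forall>v\<in>W n \<rho> \<chi>. T *\<^sub>v v = h \<chi> \<cdot>\<^sub>v v \<and> mat_adjoint T *\<^sub>v v = cnj (h \<chi>) \<cdot>\<^sub>v v"
proof -
  have "\<exists>T\<in>carrier_mat n n. \<forall>\<chi>\<in>M. \<forall>v\<in>carrier_vec n.
      (\<forall>i\<in>UNIV. \<rho> (torus_gen q i) *\<^sub>v v = complex_of_real (torus_eigenvalue q \<alpha> \<chi> i) \<cdot>\<^sub>v v) \<longrightarrow>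
      T *\<^sub>v v = h \<chi> \<cdot>\<^sub>v v \<and> mat_adjoint T *\<^sub>v v = cnj (h \<chi>) \<cdot>\<^sub>v v"
  proof (rule diagonal_operator_exists[OF M])
    fix i show "\<rho> (torus_gen q i) \<in> carrier_mat n n" "mat_adjoint (\<rho> (torus_gen q i)) = \<rho> (torus_gen q i)"
      using g by (auto simp: graded_def)
  next
    fix \<chi> \<chi>' :: 'e assume "\<chi> \<noteq> \<chi>'"
    then show "\<exists>i\<in>UNIV. complex_of_real (torus_eigenvalue q \<alpha> \<chi> i) \<noteq> complex_of_real (torus_eigenvalue q \<alpha> \<chi>' i)"
      using torus_eigenvalue_separates by simp
  qed simp
  then obtain T where T: "T \<in> carrier_mat n n" and T': "\<And>\<chi> v. \<chi> \<in> M \<Longrightarrow> v \<in> carrier_vec n \<Longrightarrow>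
      (\<And>i. \<rho> (torus_gen q i) *\<^sub>v v = complex_of_real (torus_eigenvalue q \<alpha> \<chi> i) \<cdot>\<^sub>v v) \<Longrightarrow>
      T *\<^sub>v v = h \<chi> \<cdot>\<^sub>v v \<and> mat_adjoint T *\<^sub>v v = cnj (h \<chi>) \<cdot>\<^sub>v v" by blast
  show ?thesis
    by (intro bexI[OF _ T] ballI T') (simp_all add: weight_space_iff)
qed

text \<open>Interpolate the value 1 at \<open>\<kappa>\<close> and 0 on \<open>M\<close>. The
  resulting operator vanishes on a spanning set, hence everywhere, but it fixes
  \<open>v\<close>.\<close>

lemma weight_space_trivial:
  assumes g: "graded n \<rho>" and M: "finite M" "carrier_vec n \<subseteq> vspan n (\<Union>\<chi>\<in>M. W n \<rho> \<chi>)"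
    and v: "\<kappa> \<notin> M" "v \<in> W n \<rho> \<kappa>"
  shows "v = 0\<^sub>v n"
proof -
  obtain T where T: "T \<in> carrier_mat n n"
    and T': "\<And>\<chi> v. \<chi> \<in> insert \<kappa> M \<Longrightarrow> v \<in> W n \<rho> \<chi> \<Longrightarrow> T *\<^sub>v v = (if \<chi> = \<kappa> then 1 else 0) \<cdot>\<^sub>v v"
    using graded_diagonal[OF g, of "insert \<kappa> M" "\<lambda>\<chi>. if \<chi> = \<kappa> then 1 else 0"] M(1) by blast
  have "T = 0\<^sub>m n n"
  proof (rule mat_eq_on_vspan[OF T zero_carrier_mat _ M(2)])
    fix w assume "w \<in> (\<Union>\<chi>\<in>M. W n \<rho> \<chi>)"
    then obtain \<chi> where \<chi>: "\<chi> \<in> M" "w \<in> W n \<rho> \<chi>" by blast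
    have "w \<in> carrier_vec n" using \<chi> weight_space_carrier by blast
    then show "T *\<^sub>v w = 0\<^sub>m n n *\<^sub>v w" using T'[OF _ \<chi>(2)] \<chi>(1) v(1) by auto
  qed (use weight_space_carrier in blast)
  moreover have "T *\<^sub>v v = v" using T'[OF _ v(2)] by simp
  moreover have "v \<in> carrier_vec n" using v weight_space_carrier by blast
  ultimately show ?thesis by auto
qed

lemma graded_finite_span:
  assumes "graded n \<rho>"
  obtains M where "finite M" "carrier_vec n \<subseteq> vspan n (\<Union>\<chi>\<in>M. W n \<rho> \<chi>)"
proof -
  have "admissible R \<alpha> q n \<rho>" using assms by (simp add: graded_def)
  from admissible_finite_span[OF this] show thesis using that by (elim exE conjE)
qed

text \<open>Interpolation reaches only a finite set of weights; all further weight spaces are zero,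
  where any eigenvalue is correct. So an arbitrary function of the weight can be prescribed.\<close>

lemma graded_diagonal_all:
  assumes g: "graded n \<rho>"
  shows "\<exists>T\<in>carrier_mat n n. \<forall>\<chi>. \<forall>v\<in>W n \<rho> \<chi>. T *\<^sub>v v = h \<chi> \<cdot>\<^sub>v v \<and> mat_adjoint T *\<^sub>v v = cnj (h \<chi>) \<cdot>\<^sub>v v"
proof -
  obtain M where M: "finite M" "carrier_vec n \<subseteq> vspan n (\<Union>\<chi>\<in>M. W n \<rho> \<chi>)"
    by (rule graded_finite_span[OF g])
  obtain T where T: "T \<in> carrier_mat n n"
    "\<forall>\<chi>\<in>M. \<forall>v\<in>W n \<rho> \<chi>. T *\<^sub>v v = h \<chi> \<cdot>\<^sub>v v \<and> mat_adjoint T *\<^sub>v v = cnj (h \<chi>) \<cdot>\<^sub>v v"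
    using graded_diagonal[OF g M(1), of h] by (rule bexE)
  show ?thesis
  proof (intro bexI[OF _ T(1)] allI ballI)
    fix \<chi> v assume v: "v \<in> W n \<rho> \<chi>"
    show "T *\<^sub>v v = h \<chi> \<cdot>\<^sub>v v \<and> mat_adjoint T *\<^sub>v v = cnj (h \<chi>) \<cdot>\<^sub>v v"
    proof (cases "\<chi> \<in> M")
      case True
      from T(2)[rule_format, OF this v] show ?thesis .
    next
      case False
      from weight_space_trivial[OF g M this v]
      show ?thesis using mult_mat_zero_vec[OF T(1)] mult_mat_zero_vec[OF mat_adjoint_carrier[OF T(1)]] by simp
    qed
  qed
qed

text \<open>A function of two weights need not be a product of functions of one weight, so
  interpolation is carried out on \<open>M \<times> N\<close>, with the torus generators of both
  tensor factors as commuting variables; the sum type \<open>'r + 'r\<close> indexes them. This is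
  the source of the twist.\<close>

lemma graded_diagonal_pair:
  assumes g: "graded n \<rho>" "graded m \<sigma>"
  shows "\<exists>T\<in>carrier_mat (n * m) (n * m). \<forall>\<kappa> \<mu>. \<forall>x\<in>W n \<rho> \<kappa>. \<forall>y\<in>W m \<sigma> \<mu>.
    T *\<^sub>v kron_vec x y = h \<kappa> \<mu> \<cdot>\<^sub>v kron_vec x y \<and> mat_adjoint T *\<^sub>v kron_vec x y = cnj (h \<kappa> \<mu>) \<cdot>\<^sub>v kron_vec x y"
proof -
  obtain M where M: "finite M" "carrier_vec n \<subseteq> vspan n (\<Union>\<chi>\<in>M. W n \<rho> \<chi>)"
    by (rule graded_finite_span[OF g(1)])
  obtain N where N: "finite N" "carrier_vec m \<subseteq> vspan m (\<Union>\<chi>\<in>N. W m \<sigma> \<chi>)"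
    by (rule graded_finite_span[OF g(2)])
  define \<pi> :: "'r + 'r \<Rightarrow> complex mat" where
    "\<pi> = case_sum (\<lambda>i. kron (\<rho> (torus_gen q i)) (1\<^sub>m m)) (\<lambda>i. kron (1\<^sub>m n) (\<sigma> (torus_gen q i)))"
  define e :: "'e \<times> 'e \<Rightarrow> 'r + 'r \<Rightarrow> complex" where
    "e = (\<lambda>(\<kappa>, \<mu>). case_sum (\<lambda>i. of_real (torus_eigenvalue q \<alpha> \<kappa> i)) (\<lambda>i. of_real (torus_eigenvalue q \<alpha> \<mu> i)))"
  have "\<exists>T\<in>carrier_mat (n * m) (n * m). \<forall>i\<in>M \<times> N. \<forall>v\<in>carrier_vec (n * m). (\<forall>x\<in>UNIV. \<pi> x *\<^sub>v v = e i x \<cdot>\<^sub>v v) \<longrightarrow>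
    T *\<^sub>v v = h (fst i) (snd i) \<cdot>\<^sub>v v \<and> mat_adjoint T *\<^sub>v v = cnj (h (fst i) (snd i)) \<cdot>\<^sub>v v"
  proof (rule diagonal_operator_exists)
    show "finite (M \<times> N)" using M N by blast
    fix i j :: "'e \<times> 'e" assume "i \<noteq> j"
    then consider "fst i \<noteq> fst j" | "snd i \<noteq> snd j" using prod_eqI by blast
    then show "\<exists>x\<in>UNIV. e i x \<noteq> e j x"
    proof cases
      case 1
      then obtain k where "torus_eigenvalue q \<alpha> (fst i) k \<noteq> torus_eigenvalue q \<alpha> (fst j) k"
        using torus_eigenvalue_separates by blast
      then show ?thesis by (intro bexI[of _ "Inl k"]) (auto simp: e_def case_prod_unfold)
    next
      case 2
      then obtain k where "torus_eigenvalue q \<alpha> (snd i) k \<noteq> torus_eigenvalue q \<alpha> (snd j) k"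
        using torus_eigenvalue_separates by blast
      then show ?thesis by (intro bexI[of _ "Inr k"]) (auto simp: e_def case_prod_unfold)
    qed
  next
    fix x
    have "\<rho> (torus_gen q i) \<in> carrier_mat n n" "\<sigma> (torus_gen q i) \<in> carrier_mat m m"
      "mat_adjoint (\<rho> (torus_gen q i)) = \<rho> (torus_gen q i)" "mat_adjoint (\<sigma> (torus_gen q i)) = \<sigma> (torus_gen q i)"
      for i using g unfolding graded_def by blast+
    then show "\<pi> x \<in> carrier_mat (n * m) (n * m)" "mat_adjoint (\<pi> x) = \<pi> x"
      by (cases x; simp add: \<pi>_def mat_adjoint_kron)+
    fix i :: "'e \<times> 'e" show "cnj (e i x) = e i x" by (cases i; cases x) (simp_all add: e_def)
  qed
  then obtain T where T: "T \<in> carrier_mat (n * m) (n * m)"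
    and T'': "\<forall>i\<in>M \<times> N. \<forall>v\<in>carrier_vec (n * m). (\<forall>x\<in>UNIV. \<pi> x *\<^sub>v v = e i x \<cdot>\<^sub>v v) \<longrightarrow>
      T *\<^sub>v v = h (fst i) (snd i) \<cdot>\<^sub>v v \<and> mat_adjoint T *\<^sub>v v = cnj (h (fst i) (snd i)) \<cdot>\<^sub>v v"
    by (rule bexE)
  have T': "\<And>i v. i \<in> M \<times> N \<Longrightarrow> v \<in> carrier_vec (n * m) \<Longrightarrow> (\<And>x. \<pi> x *\<^sub>v v = e i x \<cdot>\<^sub>v v) \<Longrightarrow>
      T *\<^sub>v v = h (fst i) (snd i) \<cdot>\<^sub>v v \<and> mat_adjoint T *\<^sub>v v = cnj (h (fst i) (snd i)) \<cdot>\<^sub>v v"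
    by (rule T''[rule_format]) auto
  show ?thesis
  proof (intro bexI[OF _ T] allI ballI)
    fix \<kappa> \<mu> x y assume x: "x \<in> W n \<rho> \<kappa>" and y: "y \<in> W m \<sigma> \<mu>"
    have xc: "x \<in> carrier_vec n" and yc: "y \<in> carrier_vec m" using x y weight_space_carrier by blast+
    show "T *\<^sub>v kron_vec x y = h \<kappa> \<mu> \<cdot>\<^sub>v kron_vec x y \<and> mat_adjoint T *\<^sub>v kron_vec x y = cnj (h \<kappa> \<mu>) \<cdot>\<^sub>v kron_vec x y"
    proof (cases "\<kappa> \<in> M \<and> \<mu> \<in> N")
      case True
      have "\<pi> z *\<^sub>v kron_vec x y = e (\<kappa>, \<mu>) z \<cdot>\<^sub>v kron_vec x y" for z
      proof (cases z)
        case (Inl i)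
        have "\<rho> (torus_gen q i) \<in> carrier_mat n n" using g(1) by (simp add: graded_def)
        from kron_mult_kron_vec[OF this one_carrier_mat xc yc]
        have "\<pi> z *\<^sub>v kron_vec x y = kron_vec (\<rho> (torus_gen q i) *\<^sub>v x) y" using yc by (simp add: Inl \<pi>_def)
        also have "\<rho> (torus_gen q i) *\<^sub>v x = of_real (torus_eigenvalue q \<alpha> \<kappa> i) \<cdot>\<^sub>v x"
          using x by (simp add: weight_space_iff)
        finally show ?thesis by (simp add: Inl e_def kron_vec_smult)
      next
        case (Inr i)
        have "\<sigma> (torus_gen q i) \<in> carrier_mat m m" using g(2) by (simp add: graded_def)
        from kron_mult_kron_vec[OF one_carrier_mat this xc yc]
        have "\<pi> z *\<^sub>v kron_vec x y = kron_vec x (\<sigma> (torus_gen q i) *\<^sub>v y)" using xc by (simp add: Inr \<pi>_def)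
        also have "\<sigma> (torus_gen q i) *\<^sub>v y = of_real (torus_eigenvalue q \<alpha> \<mu> i) \<cdot>\<^sub>v y"
          using y by (simp add: weight_space_iff)
        finally show ?thesis by (simp add: Inr e_def kron_vec_smult)
      qed
      from T'[OF _ kron_vec_carrier[OF xc yc] this] show ?thesis using True by simp
    next
      case False
      then consider "\<kappa> \<notin> M" | "\<mu> \<notin> N" by blast
      then have "kron_vec x y = 0\<^sub>v (n * m)"
      proof cases
        case 1
        then show ?thesis using weight_space_trivial[OF g(1) M _ x] yc by simp
      next
        case 2
        then show ?thesis using weight_space_trivial[OF g(2) N _ y] xc by simp
      qed
      then show ?thesis using mult_mat_zero_vec[OF T] mult_mat_zero_vec[OF mat_adjoint_carrier[OF T]] by simp
    qed
  qed
qed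

end

section \<open>Bilinear maps and coproducts\<close>

lemma mat_sum_add:
  assumes "\<And>x. x \<in> set xs \<Longrightarrow> F x \<in> carrier_mat n n" "\<And>x. x \<in> set xs \<Longrightarrow> G x \<in> carrier_mat n n"
  shows "mat_sum n (\<lambda>x. F x + G x) xs = mat_sum n F xs + mat_sum n G xs"
  using assms
proof (induction xs)
  case (Cons x xs)
  have c: "F x \<in> carrier_mat n n" "G x \<in> carrier_mat n n" "mat_sum n F xs \<in> carrier_mat n n" "mat_sum n G xs \<in> carrier_mat n n"
    using Cons.prems by auto
  have "mat_sum n (\<lambda>x. F x + G x) xs = mat_sum n F xs + mat_sum n G xs" using Cons.prems by (intro Cons.IH) auto
  then show ?case using c by (auto intro!: eq_matI)
qed simp

lemma mat_sum_zero: "mat_sum n (\<lambda>x. 0\<^sub>m n n) xs = 0\<^sub>m n n"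
  by (induction xs) auto

lemma mat_sum_swap:
  assumes "\<And>x y. x \<in> set xs \<Longrightarrow> y \<in> set ys \<Longrightarrow> F x y \<in> carrier_mat n n"
  shows "mat_sum n (\<lambda>x. mat_sum n (F x) ys) xs = mat_sum n (\<lambda>y. mat_sum n (\<lambda>x. F x y) xs) ys"
  using assms
proof (induction xs)
  case (Cons x xs)
  have "mat_sum n (\<lambda>y. F x y + mat_sum n (\<lambda>x. F x y) xs) ys =
      mat_sum n (F x) ys + mat_sum n (\<lambda>y. mat_sum n (\<lambda>x. F x y) xs) ys"
    using Cons.prems by (intro mat_sum_add) auto
  then show ?case using Cons by simp
qed (simp add: mat_sum_zero)

text \<open>Linear extension of a function of two words to the tensor square of the free algebra.
  With different \<open>F\<close> it gives tensor products of representations and the convolutions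
  in the antipode axioms.\<close>

definition lc2_mat :: "nat \<Rightarrow> ('x list \<Rightarrow> 'x list \<Rightarrow> complex mat) \<Rightarrow> 'x lincomb2 \<Rightarrow> complex mat" where
  "lc2_mat n F p = mat_sum n (\<lambda>(c, v, w). c \<cdot>\<^sub>m F v w) p"

definition lc2_in :: "'x set \<Rightarrow> 'x lincomb2 \<Rightarrow> bool" where
  "lc2_in X p \<longleftrightarrow> (\<forall>(c, v, w)\<in>set p. set v \<subseteq> X \<and> set w \<subseteq> X)"

definition lc2_mult :: "'x lincomb2 \<Rightarrow> 'x lincomb2 \<Rightarrow> 'x lincomb2" where
  "lc2_mult p s = [(c * d, u @ u', v @ v'). (c, u, v) \<leftarrow> p, (d, u', v') \<leftarrow> s]"

lemma coprod_word_Cons: "coprod_word \<Delta> (x # w) = lc2_mult (\<Delta> x) (coprod_word \<Delta> w)"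
  by (simp add: lc2_mult_def)

lemma lc2_in_mult: "lc2_in X p \<Longrightarrow> lc2_in X s \<Longrightarrow> lc2_in X (lc2_mult p s)"
  unfolding lc2_in_def lc2_mult_def by fastforce

lemma lc2_mat_carrier:
  assumes "lc2_in X p" "\<And>v w. set v \<subseteq> X \<Longrightarrow> set w \<subseteq> X \<Longrightarrow> F v w \<in> carrier_mat n n"
  shows "lc2_mat n F p \<in> carrier_mat n n"
  unfolding lc2_mat_def
proof (rule mat_sum_carrier)
  fix x assume "x \<in> set p"
  then show "(case x of (c, v, w) \<Rightarrow> c \<cdot>\<^sub>m F v w) \<in> carrier_mat n n"
    using assms by (cases x) (auto simp: lc2_in_def)
qed

lemma lc2_mat_index:
  assumes "lc2_in X p" "\<And>v w. set v \<subseteq> X \<Longrightarrow> set w \<subseteq> X \<Longrightarrow> F v w \<in> carrier_mat n n" "i < n" "j < n"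
  shows "lc2_mat n F p $$ (i, j) = (\<Sum>(c, v, w)\<leftarrow>p. c * F v w $$ (i, j))"
  using assms(1)
proof (induction p)
  case (Cons a p)
  obtain c v w where a: "a = (c, v, w)" by (cases a)
  have p: "lc2_in X p" and "F v w \<in> carrier_mat n n" using Cons.prems assms(2) by (auto simp: a lc2_in_def)
  moreover have "lc2_mat n F p \<in> carrier_mat n n" by (rule lc2_mat_carrier[OF p assms(2)])
  ultimately show ?case using Cons.IH[OF p] assms(3,4) by (simp add: a lc2_mat_def)
qed (use assms in \<open>simp add: lc2_mat_def\<close>)

lemma lc2_mat_cong:
  assumes "lc2_in X p" "\<And>v w. set v \<subseteq> X \<Longrightarrow> set w \<subseteq> X \<Longrightarrow> F v w = G v w"
  shows "lc2_mat n F p = lc2_mat n G p"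
  unfolding lc2_mat_def
proof (rule mat_sum_cong)
  fix x assume "x \<in> set p"
  then show "(case x of (c, v, w) \<Rightarrow> c \<cdot>\<^sub>m F v w) = (case x of (c, v, w) \<Rightarrow> c \<cdot>\<^sub>m G v w)"
    using assms by (cases x) (auto simp: lc2_in_def)
qed

lemma lc2_mat_mult_eq:
  assumes p: "lc2_in X p" and s: "lc2_in X s"
    and F: "\<And>v w. set v \<subseteq> X \<Longrightarrow> set w \<subseteq> X \<Longrightarrow> F v w \<in> carrier_mat n n"
  shows "lc2_mat n F (lc2_mult p s) =
    mat_sum n (\<lambda>(c, u, v). mat_sum n (\<lambda>(d, u', v'). (c * d) \<cdot>\<^sub>m F (u @ u') (v @ v')) s) p"
proof -
  have "lc2_mat n F (lc2_mult p s) = mat_sum n (\<lambda>x. mat_sum n (\<lambda>(c, v, w). c \<cdot>\<^sub>m F v w)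
      ((\<lambda>(c, u, v). map (\<lambda>(d, u', v'). (c * d, u @ u', v @ v')) s) x)) p"
    unfolding lc2_mat_def lc2_mult_def
  proof (subst mat_sum_concat[symmetric])
    fix x y assume x: "x \<in> set p" and y: "y \<in> set ((\<lambda>(c, u, v). map (\<lambda>(d, u', v'). (c * d, u @ u', v @ v')) s) x)"
    obtain c u v where x': "x = (c, u, v)" by (cases x)
    from y obtain d u' v' where y': "(d, u', v') \<in> set s" "y = (c * d, u @ u', v @ v')"
      by (auto simp: x')
    have "F (u @ u') (v @ v') \<in> carrier_mat n n"
      using x y'(1) p s by (intro F) (auto simp: x' lc2_in_def)
    then show "(case y of (c, v, w) \<Rightarrow> c \<cdot>\<^sub>m F v w) \<in> carrier_mat n n" by (simp add: y')
  qed (simp add: case_prod_unfold)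
  also have "\<dots> = mat_sum n (\<lambda>(c, u, v). mat_sum n (\<lambda>(d, u', v'). (c * d) \<cdot>\<^sub>m F (u @ u') (v @ v')) s) p"
    by (intro mat_sum_cong) (auto simp: mat_sum_map case_prod_unfold)
  finally show ?thesis .
qed

text \<open>Made for \<open>F u v = \<rho>(u) S(v)\<close> with \<open>S\<close> reversing products:
  then \<open>F (u @ u') (v @ v')\<close> is \<open>\<rho>(u) F(u', v') S(v)\<close>, so the second
  factor of the product is evaluated in the middle.\<close>

lemma lc2_mat_mult_outer:
  assumes p: "lc2_in X p" and s: "lc2_in X s"
    and F: "\<And>v w. set v \<subseteq> X \<Longrightarrow> set w \<subseteq> X \<Longrightarrow> F v w \<in> carrier_mat n n"
    and L: "\<And>v w. set v \<subseteq> X \<Longrightarrow> set w \<subseteq> X \<Longrightarrow> L v w \<in> carrier_mat n n"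
    and M: "\<And>v w. set v \<subseteq> X \<Longrightarrow> set w \<subseteq> X \<Longrightarrow> M v w \<in> carrier_mat n n"
    and eq: "\<And>u v u' v'. set u \<subseteq> X \<Longrightarrow> set v \<subseteq> X \<Longrightarrow> set u' \<subseteq> X \<Longrightarrow> set v' \<subseteq> X \<Longrightarrow>
      F (u @ u') (v @ v') = L u v * F u' v' * M u v"
  shows "lc2_mat n F (lc2_mult p s) = lc2_mat n (\<lambda>u v. L u v * lc2_mat n F s * M u v) p"
proof -
  have "lc2_mat n F (lc2_mult p s) =
      mat_sum n (\<lambda>(c, u, v). mat_sum n (\<lambda>(d, u', v'). (c * d) \<cdot>\<^sub>m F (u @ u') (v @ v')) s) p"
    by (rule lc2_mat_mult_eq[OF p s F])
  also have "\<dots> = mat_sum n (\<lambda>(c, u, v). c \<cdot>\<^sub>m (L u v * lc2_mat n F s * M u v)) p"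
  proof (rule mat_sum_cong)
  fix x assume x: "x \<in> set p"
  obtain c u v where x': "x = (c, u, v)" by (cases x)
  have uv: "set u \<subseteq> X" "set v \<subseteq> X" using x p by (auto simp: x' lc2_in_def)
  note Lc = L[OF uv] and Mc = M[OF uv]
  have Fs: "F u' v' \<in> carrier_mat n n" if "(d, u', v') \<in> set s" for d u' v'
    using that s by (intro F) (auto simp: lc2_in_def)
  have "mat_sum n (\<lambda>(d, u', v'). (c * d) \<cdot>\<^sub>m F (u @ u') (v @ v')) s =
      mat_sum n (\<lambda>y. c \<cdot>\<^sub>m (L u v * (case y of (d, u', v') \<Rightarrow> d \<cdot>\<^sub>m F u' v') * M u v)) s"
  proof (rule mat_sum_cong)
    fix y assume y: "y \<in> set s"
    obtain d u' v' where y': "y = (d, u', v')" by (cases y)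
    have u'v': "set u' \<subseteq> X" "set v' \<subseteq> X" using y s by (auto simp: y' lc2_in_def)
    note Fc = F[OF u'v']
    have "L u v * (d \<cdot>\<^sub>m F u' v') * M u v = d \<cdot>\<^sub>m (L u v * F u' v' * M u v)"
      using mult_smult_distrib[OF Lc Fc] mult_smult_assoc_mat[OF mult_carrier_mat[OF Lc Fc] Mc] by simp
    then show "(case y of (d, u', v') \<Rightarrow> (c * d) \<cdot>\<^sub>m F (u @ u') (v @ v')) =
        c \<cdot>\<^sub>m (L u v * (case y of (d, u', v') \<Rightarrow> d \<cdot>\<^sub>m F u' v') * M u v)"
      using eq[OF uv u'v'] by (auto simp: y' intro!: eq_matI)
  qed
  also have "\<dots> = c \<cdot>\<^sub>m mat_sum n (\<lambda>y. L u v * (case y of (d, u', v') \<Rightarrow> d \<cdot>\<^sub>m F u' v') * M u v) s"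
    by (rule smult_mat_sum[symmetric]) (use Fs Lc Mc in \<open>auto intro!: mult_carrier_mat[of _ n n]\<close>)
  also have "mat_sum n (\<lambda>y. L u v * (case y of (d, u', v') \<Rightarrow> d \<cdot>\<^sub>m F u' v') * M u v) s =
      mat_sum n (\<lambda>y. L u v * (case y of (d, u', v') \<Rightarrow> d \<cdot>\<^sub>m F u' v')) s * M u v"
    by (rule mat_sum_mult[OF Mc, symmetric]) (use Fs Lc in \<open>auto intro!: mult_carrier_mat[of _ n n]\<close>)
  also have "mat_sum n (\<lambda>y. L u v * (case y of (d, u', v') \<Rightarrow> d \<cdot>\<^sub>m F u' v')) s = L u v * lc2_mat n F s"
    unfolding lc2_mat_def by (rule mult_mat_sum[OF Lc, symmetric]) (use Fs in auto)
  finally show "(case x of (c, u, v) \<Rightarrow> mat_sum n (\<lambda>(d, u', v'). (c * d) \<cdot>\<^sub>m F (u @ u') (v @ v')) s) =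
      (case x of (c, u, v) \<Rightarrow> c \<cdot>\<^sub>m (L u v * lc2_mat n F s * M u v))" by (simp add: x')
  qed
  finally show ?thesis by (simp add: lc2_mat_def)
qed

text \<open>The mirror image, for \<open>F u v = S(u) \<rho>(v)\<close>, where the first factor ends
  up in the middle. Reversing all words exchanges the two factors of the product and reduces it to
  \<open>lc2_mat_mult_outer\<close>.\<close>

lemma lc2_mat_mult_inner:
  assumes p: "lc2_in X p" and s: "lc2_in X s"
    and F: "\<And>v w. set v \<subseteq> X \<Longrightarrow> set w \<subseteq> X \<Longrightarrow> F v w \<in> carrier_mat n n"
    and L: "\<And>v w. set v \<subseteq> X \<Longrightarrow> set w \<subseteq> X \<Longrightarrow> L v w \<in> carrier_mat n n"
    and M: "\<And>v w. set v \<subseteq> X \<Longrightarrow> set w \<subseteq> X \<Longrightarrow> M v w \<in> carrier_mat n n"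
    and eq: "\<And>u v u' v'. set u \<subseteq> X \<Longrightarrow> set v \<subseteq> X \<Longrightarrow> set u' \<subseteq> X \<Longrightarrow> set v' \<subseteq> X \<Longrightarrow>
      F (u @ u') (v @ v') = L u' v' * F u v * M u' v'"
  shows "lc2_mat n F (lc2_mult p s) = lc2_mat n (\<lambda>u v. L u v * lc2_mat n F p * M u v) s"
proof -
  define F' where "F' u v = F (rev u) (rev v)" for u v
  define r :: "'a lincomb2 \<Rightarrow> 'a lincomb2" where "r = map (\<lambda>(c, u, v). (c, rev u, rev v))"
  have r: "lc2_mat n (\<lambda>u v. H (rev u) (rev v)) (r t) = lc2_mat n H t" for H t
    unfolding lc2_mat_def r_def mat_sum_map by (rule mat_sum_cong) auto
  have rX: "lc2_in X (r t)" if "lc2_in X t" for t using that unfolding lc2_in_def r_def by fastforce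
  have "lc2_mat n F (lc2_mult p s) = mat_sum n (\<lambda>x. mat_sum n (\<lambda>y. case x of (c, u, v) \<Rightarrow> case y of (d, u', v') \<Rightarrow> (c * d) \<cdot>\<^sub>m F (u @ u') (v @ v')) s) p"
    by (subst lc2_mat_mult_eq[OF p s F]) (auto intro!: mat_sum_cong)
  also have "\<dots> = mat_sum n (\<lambda>y. mat_sum n (\<lambda>x. case x of (c, u, v) \<Rightarrow> case y of (d, u', v') \<Rightarrow> (c * d) \<cdot>\<^sub>m F (u @ u') (v @ v')) p) s"
  proof (rule mat_sum_swap)
    fix x y assume xy: "x \<in> set p" "y \<in> set s"
    obtain c u v where x: "x = (c, u, v)" by (cases x)
    obtain d u' v' where y: "y = (d, u', v')" by (cases y)
    have "F (u @ u') (v @ v') \<in> carrier_mat n n" using xy p s by (intro F) (auto simp: x y lc2_in_def)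
    then show "(case x of (c, u, v) \<Rightarrow> case y of (d, u', v') \<Rightarrow> (c * d) \<cdot>\<^sub>m F (u @ u') (v @ v')) \<in> carrier_mat n n"
      by (simp add: x y)
  qed
  also have "\<dots> = mat_sum n (\<lambda>y. mat_sum n (\<lambda>x. case y of (d, u', v') \<Rightarrow> case x of (c, u, v) \<Rightarrow> (d * c) \<cdot>\<^sub>m F (u @ u') (v @ v')) p) s"
    by (intro mat_sum_cong) (auto simp: mult.commute)
  also have "\<dots> = mat_sum n (\<lambda>(d, u', v'). mat_sum n (\<lambda>(c, u, v). (d * c) \<cdot>\<^sub>m F' (u' @ u) (v' @ v)) (r p)) (r s)"
    unfolding r_def mat_sum_map by (intro mat_sum_cong) (auto simp: F'_def intro!: mat_sum_cong)
  also have "\<dots> = lc2_mat n F' (lc2_mult (r s) (r p))"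
    by (rule lc2_mat_mult_eq[OF rX[OF s] rX[OF p], symmetric]) (auto simp: F'_def intro!: F)
  also have "\<dots> = lc2_mat n (\<lambda>u v. L (rev u) (rev v) * lc2_mat n F' (r p) * M (rev u) (rev v)) (r s)"
    by (rule lc2_mat_mult_outer[OF rX[OF s] rX[OF p]]) (auto simp: F'_def intro!: F L M eq)
  also have "\<dots> = lc2_mat n (\<lambda>u v. L u v * lc2_mat n F p * M u v) s"
    unfolding r[of "\<lambda>u v. L u v * lc2_mat n F' (r p) * M u v"] F'_def r[of F] ..
  finally show ?thesis .
qed

lemma lc2_mat_smult:
  assumes p: "lc2_in X p" and F: "\<And>v w. set v \<subseteq> X \<Longrightarrow> set w \<subseteq> X \<Longrightarrow> F v w \<in> carrier_mat n n"
  shows "lc2_mat n (\<lambda>u v. c \<cdot>\<^sub>m F u v) p = c \<cdot>\<^sub>m lc2_mat n F p"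
  unfolding lc2_mat_def
proof (subst smult_mat_sum)
  fix x assume "x \<in> set p"
  then show "(case x of (c, v, w) \<Rightarrow> c \<cdot>\<^sub>m F v w) \<in> carrier_mat n n"
    using assms by (cases x) (auto simp: lc2_in_def)
qed (auto intro!: mat_sum_cong eq_matI simp: mult.left_commute)

section \<open>Structure maps of a presented Hopf *-algebra on words\<close>

definition hopf_closed :: "'x hopf_pres \<Rightarrow> bool" where
  "hopf_closed A \<longleftrightarrow> (\<forall>x\<in>Gens A. lc2_in (Gens A) (Coprod A x) \<and>
     lc_in (Gens A) (Antipode A x) \<and> lc_in (Gens A) (Invol A x))"

lemma coprod_word_in:
  assumes "hopf_closed A" "set w \<subseteq> Gens A"
  shows "lc2_in (Gens A) (coprod_word (Coprod A) w)"
  using assms(2)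
proof (induction w)
  case (Cons x w)
  then show ?case unfolding coprod_word_Cons using assms(1) by (intro lc2_in_mult) (auto simp: hopf_closed_def)
qed (simp add: lc2_in_def)

lemma antimult_word_in:
  assumes "\<And>x. x \<in> X \<Longrightarrow> lc_in X (s x)" "set w \<subseteq> X"
  shows "lc_in X (antimult_word s w)"
  using assms(2) by (induction w) (use assms(1) in auto)

lemma antimult_word_append:
  assumes "\<And>x. x \<in> X \<Longrightarrow> lc_in X (s x)" "set v \<subseteq> X" "set w \<subseteq> X"
    and "\<And>x. x \<in> X \<Longrightarrow> \<rho> x \<in> carrier_mat n n"
  shows "lc_mat n \<rho> (antimult_word s (v @ w)) = lc_mat n \<rho> (antimult_word s w) * lc_mat n \<rho> (antimult_word s v)"
  using assms(2)
proof (induction v)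
  case Nil
  have "lc_mat n \<rho> (antimult_word s w) \<in> carrier_mat n n"
    by (rule lc_mat_carrier[OF antimult_word_in[OF assms(1,3)] assms(4)])
  moreover have "1 \<cdot>\<^sub>m 1\<^sub>m n + 0\<^sub>m n n = (1\<^sub>m n :: complex mat)" by (auto intro!: eq_matI)
  ultimately show ?case by simp
next
  case (Cons x v)
  have x: "lc_in X (s x)" and v: "set v \<subseteq> X" using Cons.prems assms(1) by auto
  have vi: "lc_in X (antimult_word s v)" by (rule antimult_word_in[OF assms(1) v])
  have wi: "lc_in X (antimult_word s w)" by (rule antimult_word_in[OF assms(1,3)])
  have vwi: "lc_in X (antimult_word s (v @ w))" by (rule antimult_word_in[OF assms(1)]) (use v assms(3) in auto)
  note c = lc_mat_carrier[OF wi assms(4)] lc_mat_carrier[OF vi assms(4)] lc_mat_carrier[OF x assms(4)]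
  show ?case
    using Cons.IH[OF v] lc_mat_mult[OF vwi x assms(4)] lc_mat_mult[OF vi x assms(4)] assoc_mult_mat[OF c]
    by simp
qed

lemma lc_star_Cons: "lc_star s ((c, v) # p) = map (\<lambda>(d, w). (cnj c * d, w)) (antimult_word s v) @ lc_star s p"
  by (simp add: lc_star_def)

lemma lc_star_in:
  assumes "\<And>x. x \<in> X \<Longrightarrow> lc_in X (s x)" "lc_in X p"
  shows "lc_in X (lc_star s p)"
  using assms(2)
proof (induction p)
  case (Cons a p)
  obtain c v where a: "a = (c, v)" by force
  have "lc_in X (antimult_word s v)" using Cons.prems by (intro antimult_word_in assms(1)) (auto simp: a)
  then have "lc_in X (map (\<lambda>(d, w). (cnj c * d, w)) (antimult_word s v))" unfolding lc_in_def by fastforce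
  then show ?case using Cons by (simp add: a lc_star_Cons)
qed (simp add: lc_star_def)

lemma lc_mat_scale:
  assumes "lc_in X p" "\<And>x. x \<in> X \<Longrightarrow> \<rho> x \<in> carrier_mat n n"
  shows "lc_mat n \<rho> (map (\<lambda>(d, w). (c * d, w)) p) = c \<cdot>\<^sub>m lc_mat n \<rho> p"
  using assms(1)
proof (induction p)
  case (Cons a p)
  obtain d w where a: "a = (d, w)" by force
  have w: "word_mat n \<rho> w \<in> carrier_mat n n" and p: "lc_in X p"
    using Cons.prems assms(2) by (auto simp: a intro!: word_mat_carrier)
  have "lc_mat n \<rho> p \<in> carrier_mat n n" by (rule lc_mat_carrier[OF p assms(2)])
  then have "c \<cdot>\<^sub>m (d \<cdot>\<^sub>m word_mat n \<rho> w + lc_mat n \<rho> p) = (c * d) \<cdot>\<^sub>m word_mat n \<rho> w + c \<cdot>\<^sub>m lc_mat n \<rho> p"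
    using w by (intro eq_matI) (auto simp: distrib_left mult.assoc)
  then show ?case using Cons.IH[OF p] by (simp add: a)
qed simp

lemma star_rep_carrier: "star_rep A n \<rho> \<Longrightarrow> x \<in> Gens A \<Longrightarrow> \<rho> x \<in> carrier_mat n n"
  by (simp add: star_rep_def)

text \<open>Both sides are antilinear and reverse products, so agreement on generators, which is
  part of \<open>star_rep\<close>, is enough.\<close>

lemma lc_mat_star:
  assumes A: "hopf_closed A" and \<rho>: "star_rep A n \<rho>" and p: "lc_in (Gens A) p"
  shows "lc_mat n \<rho> (lc_star (Invol A) p) = mat_adjoint (lc_mat n \<rho> p)"
proof -
  note X = star_rep_carrier[OF \<rho>]
  have I: "lc_in (Gens A) (Invol A x)" if "x \<in> Gens A" for x using A that by (simp add: hopf_closed_def)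
  have word: "lc_mat n \<rho> (antimult_word (Invol A) w) = mat_adjoint (word_mat n \<rho> w)" if "set w \<subseteq> Gens A" for w
    using that
  proof (induction w)
    case (Cons x w)
    then have x: "x \<in> Gens A" and w: "set w \<subseteq> Gens A" by auto
    have wc: "word_mat n \<rho> w \<in> carrier_mat n n" using w X by (intro word_mat_carrier) auto
    have "lc_mat n \<rho> (Invol A x) = mat_adjoint (\<rho> x)" using \<rho> x by (simp add: star_rep_def)
    then show ?case
      using Cons.IH[OF w] lc_mat_mult[OF antimult_word_in[OF I w] I[OF x] X] mat_adjoint_mult[OF X[OF x] wc]
      by simp
  next
    case Nil
    have "1\<^sub>m n + 0\<^sub>m n n = (1\<^sub>m n :: complex mat)" "1 \<cdot>\<^sub>m 1\<^sub>m n = (1\<^sub>m n :: complex mat)" by (auto intro!: eq_matI)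
    then show ?case by simp
  qed
  show ?thesis using p
  proof (induction p)
    case Nil
    then show ?case by (simp add: lc_star_def)
  next
    case (Cons a p)
    obtain c v where a: "a = (c, v)" by force
    have v: "set v \<subseteq> Gens A" and p: "lc_in (Gens A) p" using Cons.prems by (auto simp: a)
    have vi: "lc_in (Gens A) (antimult_word (Invol A) v)" by (rule antimult_word_in[OF I v])
    then have vi': "lc_in (Gens A) (map (\<lambda>(d, w). (cnj c * d, w)) (antimult_word (Invol A) v))"
      unfolding lc_in_def by fastforce
    have vc: "word_mat n \<rho> v \<in> carrier_mat n n" using v X by (intro word_mat_carrier) auto
    show ?case
      using Cons.IH[OF p] lc_mat_append[OF vi' lc_star_in[OF I p] X] lc_mat_scale[OF vi X] word[OF v]
        mat_adjoint_add[OF smult_carrier_mat[OF vc] lc_mat_carrier[OF p X]]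
      by (simp add: a lc_star_Cons mat_adjoint_smult)
  qed
qed

section \<open>Matrices of coefficients\<close>

lemma sum_sum_list_swap:
  "(\<Sum>k\<in>S. \<Sum>x\<leftarrow>xs. f k x) = (\<Sum>x\<leftarrow>xs. \<Sum>k\<in>S. (f k x :: complex))"
  by (induction xs) (simp_all add: sum.distrib)

definition eval_mat :: "'x corep \<Rightarrow> 'x list \<Rightarrow> complex mat" where
  "eval_mat u w = map_mat (\<lambda>a. a w) u"

lemma corep_action_eq: "corep_action u x = eval_mat u [x]"
  by (simp add: corep_action_def eval_mat_def)

lemma eval_mat_dim [simp]: "dim_row (eval_mat u w) = dim_row u" "dim_col (eval_mat u w) = dim_col u"
  by (auto simp: eval_mat_def)

lemma eval_mat_index [simp]: "i < dim_row u \<Longrightarrow> j < dim_col u \<Longrightarrow> eval_mat u w $$ (i, j) = (u $$ (i, j)) w"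
  by (simp add: eval_mat_def)

text \<open>Such a matrix consists of the coefficients of a representation of the free algebra on \<open>X\<close>.\<close>

definition mult_corep :: "'x set \<Rightarrow> 'x corep \<Rightarrow> bool" where
  "mult_corep X u \<longleftrightarrow> dim_col u = dim_row u \<and>
     (\<forall>w. \<not> set w \<subseteq> X \<longrightarrow> eval_mat u w = 0\<^sub>m (dim_row u) (dim_row u)) \<and>
     eval_mat u [] = 1\<^sub>m (dim_row u) \<and>
     (\<forall>v w. set v \<subseteq> X \<longrightarrow> set w \<subseteq> X \<longrightarrow> eval_mat u (v @ w) = eval_mat u v * eval_mat u w)"

lemma mult_corep_action_carrier:
  "mult_corep X u \<Longrightarrow> corep_action u x \<in> carrier_mat (dim_row u) (dim_row u)"
  by (auto simp: mult_corep_def corep_action_eq intro!: carrier_matI)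

lemma mult_corep_word_mat:
  assumes "mult_corep X u" "set w \<subseteq> X"
  shows "eval_mat u w = word_mat (dim_row u) (corep_action u) w"
  using assms(2)
proof (induction w)
  case (Cons x w)
  have "eval_mat u (v @ w) = eval_mat u v * eval_mat u w" if "set v \<subseteq> X" "set w \<subseteq> X" for v w
    using assms(1) that by (simp add: mult_corep_def)
  from this[of "[x]" w] have "eval_mat u (x # w) = eval_mat u [x] * eval_mat u w" using Cons.prems by simp
  then show ?case using Cons by (simp add: corep_action_eq)
qed (use assms in \<open>simp add: mult_corep_def\<close>)

lemma mult_corep_entry:
  assumes "mult_corep X u" "set w \<subseteq> X" "i < dim_row u" "j < dim_row u"
  shows "(u $$ (i, j)) w = word_mat (dim_row u) (corep_action u) w $$ (i, j)"
proof -
  have "dim_col u = dim_row u" using assms(1) by (simp add: mult_corep_def)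
  then show ?thesis using mult_corep_word_mat[OF assms(1,2)] eval_mat_index[of i u j w] assms(3,4) by simp
qed

definition coeff_corep :: "'x set \<Rightarrow> nat \<Rightarrow> ('x \<Rightarrow> complex mat) \<Rightarrow> 'x corep" where
  "coeff_corep X n \<rho> = mat n n (\<lambda>(i, j). on_words X (\<lambda>w. word_mat n \<rho> w $$ (i, j)))"

lemma coeff_corep_dim [simp]: "dim_row (coeff_corep X n \<rho>) = n" "dim_col (coeff_corep X n \<rho>) = n"
  by (auto simp: coeff_corep_def)

lemma eval_coeff_corep:
  assumes "\<And>x. x \<in> X \<Longrightarrow> \<rho> x \<in> carrier_mat n n"
  shows "eval_mat (coeff_corep X n \<rho>) w = (if set w \<subseteq> X then word_mat n \<rho> w else 0\<^sub>m n n)"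
proof -
  have "word_mat n \<rho> w \<in> carrier_mat n n" if "set w \<subseteq> X"
    using that assms by (intro word_mat_carrier) auto
  then show ?thesis
    by (cases "set w \<subseteq> X"; intro eq_matI) (simp_all add: coeff_corep_def eval_mat_def on_words_def lists_eq_set)
qed

lemma coeff_corep_action:
  assumes "\<And>x. x \<in> X \<Longrightarrow> \<rho> x \<in> carrier_mat n n" "x \<in> X"
  shows "corep_action (coeff_corep X n \<rho>) x = \<rho> x"
  using eval_coeff_corep[of X \<rho> n "[x]"] assms by (simp add: corep_action_eq right_mult_one_mat[OF assms(1)])

lemma mult_coeff_corep:
  assumes "\<And>x. x \<in> X \<Longrightarrow> \<rho> x \<in> carrier_mat n n"
  shows "mult_corep X (coeff_corep X n \<rho>)"
  unfolding mult_corep_def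
proof (intro conjI allI impI)
  fix v w assume vw: "set v \<subseteq> X" "set w \<subseteq> X"
  have "word_mat n \<rho> (v @ w) = word_mat n \<rho> v * word_mat n \<rho> w"
    using vw assms by (intro word_mat_append) auto
  then show "eval_mat (coeff_corep X n \<rho>) (v @ w) = eval_mat (coeff_corep X n \<rho>) v * eval_mat (coeff_corep X n \<rho>) w"
    using vw eval_coeff_corep[of X \<rho> n] assms by simp
qed (use eval_coeff_corep[of X \<rho> n] assms in auto)

text \<open>Multiplicativity determines \<open>u\<close> on words over \<open>X\<close> by its
  values at single letters, and on all other words it is zero. With
  \<open>coeff_corep_action\<close> this makes the two constructions inverse to each other.\<close>

lemma coeff_corep_corep_action:
  assumes "mult_corep X u"
  shows "coeff_corep X (dim_row u) (corep_action u) = u"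
proof (rule eq_matI)
  have sq: "dim_col u = dim_row u" using assms by (simp add: mult_corep_def)
  then show "dim_col (coeff_corep X (dim_row u) (corep_action u)) = dim_col u" by simp
  fix i j assume "i < dim_row u" "j < dim_col u"
  then have ij: "i < dim_row u" "j < dim_row u" using sq by auto
  show "coeff_corep X (dim_row u) (corep_action u) $$ (i, j) = u $$ (i, j)"
  proof
    fix w
    show "(coeff_corep X (dim_row u) (corep_action u) $$ (i, j)) w = (u $$ (i, j)) w"
    proof (cases "set w \<subseteq> X")
      case True
      then show ?thesis using mult_corep_entry[OF assms True ij] ij
        by (simp add: coeff_corep_def on_words_def lists_eq_set)
    next
      case False
      then have "eval_mat u w = 0\<^sub>m (dim_row u) (dim_row u)" using assms by (simp add: mult_corep_def)
      then have "(u $$ (i, j)) w = 0" using eval_mat_index[of i u j w] ij sq by simp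
      then show ?thesis using False ij by (simp add: coeff_corep_def on_words_def lists_eq_set)
    qed
  qed
qed simp

section \<open>Regular functions and unitarity in the reconstructed quantum group\<close>

lemma reconstruct_simps [simp]:
  "FMult (reconstruct A ob) a b = on_words (Gens A)
        (\<lambda>w. \<Sum>(c, u, v)\<leftarrow>coprod_word (Coprod A) w. c * a u * b v)"
  "FOne (reconstruct A ob) = on_words (Gens A) (\<lambda>w. \<Prod>x\<leftarrow>w. Counit A x)"
  "FStar (reconstruct A ob) a = on_words (Gens A)
        (\<lambda>w. cnj (\<Sum>(c, u)\<leftarrow>lc_star (Invol A) (antimult_word (Antipode A) w). c * a u))"
  "FComult (reconstruct A ob) a v w = a (v @ w)"
  by (auto simp: reconstruct_def)

lemma on_words_simps: "set w \<subseteq> X \<Longrightarrow> on_words X a w = a w" "\<not> set w \<subseteq> X \<Longrightarrow> on_words X a w = 0"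
  by (auto simp: on_words_def)

lemma Fun_reconstruct:
  "a \<in> Fun (reconstruct A ob) \<longleftrightarrow> (\<exists>M c. finite M \<and>
     M \<subseteq> {on_words (Gens A) (\<lambda>w. word_mat n \<rho> w $$ (i, j)) | n \<rho> i j. ob n \<rho> \<and> i < n \<and> j < n} \<and>
     a = (\<lambda>w. \<Sum>b\<in>M. c b * b w))"
  unfolding reconstruct_def by auto

lemma coeff_in_Fun:
  assumes "ob n \<rho>" "i < n" "j < n"
  shows "on_words (Gens A) (\<lambda>w. word_mat n \<rho> w $$ (i, j)) \<in> Fun (reconstruct A ob)"
  unfolding Fun_reconstruct using assms
  by (intro exI[of _ "{on_words (Gens A) (\<lambda>w. word_mat n \<rho> w $$ (i, j))}"] exI[of _ "\<lambda>_. 1"]) auto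

lemma Fun_zero:
  assumes "a \<in> Fun (reconstruct A ob)" "\<not> set w \<subseteq> Gens A"
  shows "a w = 0"
proof -
  obtain M c where M: "M \<subseteq> {on_words (Gens A) (\<lambda>w. word_mat n \<rho> w $$ (i, j)) | n \<rho> i j. ob n \<rho> \<and> i < n \<and> j < n}"
    and a: "a = (\<lambda>w. \<Sum>b\<in>M. c b * b w)" using assms(1) unfolding Fun_reconstruct by (elim exE conjE)
  have "b w = 0" if b: "b \<in> M" for b
  proof -
    from subsetD[OF M b] obtain n \<rho> i j where "b = on_words (Gens A) (\<lambda>w. word_mat n \<rho> w $$ (i, j))" by auto
    then show ?thesis using assms(2) by (simp add: on_words_simps)
  qed
  then show ?thesis unfolding a by (simp add: sum.neutral)
qed

text \<open>A regular function is a combination of finitely many coefficients, each belonging to one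
  object. As a functional on the free algebra it therefore kills whatever vanishes in these finitely
  many objects.\<close>

lemma Fun_vanish:
  assumes "a \<in> Fun (reconstruct A ob)" and c: "\<And>n \<rho> x. ob n \<rho> \<Longrightarrow> x \<in> Gens A \<Longrightarrow> \<rho> x \<in> carrier_mat n n"
  shows "\<exists>B. finite B \<and> (\<forall>(n, \<rho>)\<in>B. ob n \<rho>) \<and> (\<forall>p. lc_in (Gens A) p \<longrightarrow>
    (\<forall>(n, \<rho>)\<in>B. lc_mat n \<rho> p = 0\<^sub>m n n) \<longrightarrow> (\<Sum>(c, w)\<leftarrow>p. c * a w) = 0)"
proof -
  obtain M d where M: "M \<subseteq> {on_words (Gens A) (\<lambda>w. word_mat n \<rho> w $$ (i, j)) | n \<rho> i j. ob n \<rho> \<and> i < n \<and> j < n}"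
    and fin: "finite M" and a: "a = (\<lambda>w. \<Sum>b\<in>M. d b * b w)" using assms(1) unfolding Fun_reconstruct by (elim exE conjE)
  have "\<forall>b\<in>M. \<exists>t. case t of (n, \<rho>, i, j) \<Rightarrow> ob n \<rho> \<and> i < n \<and> j < n \<and> b = on_words (Gens A) (\<lambda>w. word_mat n \<rho> w $$ (i, j))"
  proof
    fix b assume "b \<in> M"
    with M obtain n \<rho> i j where "ob n \<rho>" "i < n" "j < n" "b = on_words (Gens A) (\<lambda>w. word_mat n \<rho> w $$ (i, j))" by auto
    then show "\<exists>t. case t of (n, \<rho>, i, j) \<Rightarrow> ob n \<rho> \<and> i < n \<and> j < n \<and> b = on_words (Gens A) (\<lambda>w. word_mat n \<rho> w $$ (i, j))"
      by (intro exI[of _ "(n, \<rho>, i, j)"]) simp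
  qed
  from bchoice[OF this] obtain t where t: "\<forall>b\<in>M. case t b of (n, \<rho>, i, j) \<Rightarrow>
      ob n \<rho> \<and> i < n \<and> j < n \<and> b = on_words (Gens A) (\<lambda>w. word_mat n \<rho> w $$ (i, j))" by (elim exE)
  define B where "B = (\<lambda>b. (fst (t b), fst (snd (t b)))) ` M"
  show ?thesis
  proof (intro exI[of _ B] conjI allI impI)
    show "finite B" using fin by (simp add: B_def)
    show "\<forall>(n, \<rho>)\<in>B. ob n \<rho>"
      unfolding B_def using t by (simp add: case_prod_unfold)
    fix p assume p: "lc_in (Gens A) p" and 0: "\<forall>(n, \<rho>)\<in>B. lc_mat n \<rho> p = 0\<^sub>m n n"
    have z: "(\<Sum>(c, w)\<leftarrow>p. c * b w) = 0" if b: "b \<in> M" for b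
    proof -
      obtain n \<rho> i j where tb: "t b = (n, \<rho>, i, j)" by (cases "t b")
      have ob: "ob n \<rho>" "i < n" "j < n" "b = on_words (Gens A) (\<lambda>w. word_mat n \<rho> w $$ (i, j))"
        using bspec[OF t b] by (simp_all add: tb)
      have "(n, \<rho>) \<in> B" unfolding B_def using b tb by (intro image_eqI[of _ _ b]) auto
      then have "lc_mat n \<rho> p = 0\<^sub>m n n" using 0 by blast
      moreover have "(\<Sum>(c, w)\<leftarrow>p. c * b w) = lc_mat n \<rho> p $$ (i, j)"
      proof (subst lc_mat_index[OF p c[OF ob(1)] ob(2,3)], assumption, intro arg_cong[of _ _ sum_list] map_cong refl)
        fix x assume "x \<in> set p"
        then show "(case x of (c, w) \<Rightarrow> c * b w) = (case x of (c, w) \<Rightarrow> c * word_mat n \<rho> w $$ (i, j))"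
          using p by (auto simp: lc_in_def ob(4) on_words_simps)
      qed
      ultimately show ?thesis using ob by simp
    qed
    have "(\<Sum>(c, w)\<leftarrow>p. c * a w) = (\<Sum>x\<leftarrow>p. \<Sum>b\<in>M. d b * (fst x * b (snd x)))"
      unfolding a by (simp add: case_prod_unfold sum_distrib_left mult.left_commute)
    also have "\<dots> = (\<Sum>b\<in>M. d b * (\<Sum>x\<leftarrow>p. fst x * b (snd x)))"
      unfolding sum_sum_list_swap[symmetric] by (simp add: sum_list_const_mult)
    also have "\<dots> = 0" using z by (simp add: case_prod_unfold sum.neutral)
    finally show "(\<Sum>(c, w)\<leftarrow>p. c * a w) = 0" .
  qed
qed

lemma lc_mat_diff_zero:
  assumes "lc_in X p" "lc_in X s" "\<And>x. x \<in> X \<Longrightarrow> \<rho> x \<in> carrier_mat n n"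
  shows "lc_mat n \<rho> (p @ map (\<lambda>(d, w). (- 1 * d, w)) s) = 0\<^sub>m n n \<longleftrightarrow> lc_mat n \<rho> p = lc_mat n \<rho> s"
proof -
  have s': "lc_in X (map (\<lambda>(d, w). (- 1 * d, w)) s)" using assms(2) unfolding lc_in_def by fastforce
  have pc: "lc_mat n \<rho> p \<in> carrier_mat n n" by (rule lc_mat_carrier[OF assms(1,3)])
  have sc: "lc_mat n \<rho> s \<in> carrier_mat n n" by (rule lc_mat_carrier[OF assms(2,3)])
  have 1: "lc_mat n \<rho> (p @ map (\<lambda>(d, w). (- 1 * d, w)) s) = lc_mat n \<rho> p + lc_mat n \<rho> (map (\<lambda>(d, w). (- 1 * d, w)) s)"
    by (rule lc_mat_append[OF assms(1) s' assms(3)])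
  have 2: "lc_mat n \<rho> (map (\<lambda>(d, w). (- 1 * d, w)) s) = - 1 \<cdot>\<^sub>m lc_mat n \<rho> s"
    by (rule lc_mat_scale[OF assms(2,3)])
  show ?thesis unfolding 1 2
  proof
    assume 0: "lc_mat n \<rho> p + - 1 \<cdot>\<^sub>m lc_mat n \<rho> s = 0\<^sub>m n n"
    show "lc_mat n \<rho> p = lc_mat n \<rho> s"
    proof (rule eq_matI)
      fix i j assume ij: "i < dim_row (lc_mat n \<rho> s)" "j < dim_col (lc_mat n \<rho> s)"
      have "(lc_mat n \<rho> p + - 1 \<cdot>\<^sub>m lc_mat n \<rho> s) $$ (i, j) = 0" using ij sc unfolding 0 by simp
      then show "lc_mat n \<rho> p $$ (i, j) = lc_mat n \<rho> s $$ (i, j)" using ij pc sc by simp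
    qed (use pc sc in auto)
  qed (use pc sc in \<open>auto intro!: eq_matI\<close>)
qed

text \<open>Unites the finite sets of objects behind all the entries of \<open>u\<close>. That one
  finite \<open>B\<close> serves all identities at once is what later yields a finite set of weights
  for \<open>u\<close>.\<close>

lemma corep_identity:
  assumes u: "mult_corep (Gens A) u" "\<And>i j. i < dim_row u \<Longrightarrow> j < dim_row u \<Longrightarrow> u $$ (i, j) \<in> Fun (reconstruct A ob)"
    and c: "\<And>n \<rho> x. ob n \<rho> \<Longrightarrow> x \<in> Gens A \<Longrightarrow> \<rho> x \<in> carrier_mat n n"
  shows "\<exists>B. finite B \<and> (\<forall>(n, \<rho>)\<in>B. ob n \<rho>) \<and> (\<forall>p s. lc_in (Gens A) p \<longrightarrow> lc_in (Gens A) s \<longrightarrow>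
    (\<forall>(n, \<rho>)\<in>B. lc_mat n \<rho> p = lc_mat n \<rho> s) \<longrightarrow>
    lc_mat (dim_row u) (corep_action u) p = lc_mat (dim_row u) (corep_action u) s)"
proof -
  let ?n = "dim_row u"
  have "\<forall>k\<in>{..<?n} \<times> {..<?n}. \<exists>B. finite B \<and> (\<forall>(n, \<rho>)\<in>B. ob n \<rho>) \<and> (\<forall>p. lc_in (Gens A) p \<longrightarrow>
    (\<forall>(n, \<rho>)\<in>B. lc_mat n \<rho> p = 0\<^sub>m n n) \<longrightarrow> (\<Sum>(c, w)\<leftarrow>p. c * (u $$ k) w) = 0)"
    by (intro ballI Fun_vanish c) (auto intro: u(2))
  from bchoice[OF this] obtain B where B: "\<forall>k\<in>{..<?n} \<times> {..<?n}. finite (B k) \<and> (\<forall>(n, \<rho>)\<in>B k. ob n \<rho>) \<and> (\<forall>p. lc_in (Gens A) p \<longrightarrow>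
    (\<forall>(n, \<rho>)\<in>B k. lc_mat n \<rho> p = 0\<^sub>m n n) \<longrightarrow> (\<Sum>(c, w)\<leftarrow>p. c * (u $$ k) w) = 0)" by (elim exE)
  define B' where "B' = (\<Union>k\<in>{..<?n} \<times> {..<?n}. B k)"
  show ?thesis
  proof (intro exI[of _ B'] conjI allI impI)
    show "finite B'" unfolding B'_def using B by (intro finite_UN_I) auto
    show "\<forall>(n, \<rho>)\<in>B'. ob n \<rho>" unfolding B'_def using B by fast
    fix p s assume p: "lc_in (Gens A) p" and s: "lc_in (Gens A) s"
      and eq: "\<forall>(n, \<rho>)\<in>B'. lc_mat n \<rho> p = lc_mat n \<rho> s"
    define d where "d = p @ map (\<lambda>(d, w). (- 1 * d, w)) s"
    have d: "lc_in (Gens A) d" using p s unfolding d_def lc_in_def by fastforce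
    have d0: "lc_mat n \<rho> d = 0\<^sub>m n n" if "(n, \<rho>) \<in> B'" for n \<rho>
    proof -
      have ob: "ob n \<rho>" using \<open>\<forall>(n, \<rho>)\<in>B'. ob n \<rho>\<close> that by blast
      have "lc_mat n \<rho> p = lc_mat n \<rho> s" using eq that by blast
      then show ?thesis unfolding d_def by (subst lc_mat_diff_zero[OF p s]) (auto intro: c[OF ob])
    qed
    have X: "corep_action u x \<in> carrier_mat ?n ?n" for x by (rule mult_corep_action_carrier[OF u(1)])
    have "lc_mat ?n (corep_action u) d = 0\<^sub>m ?n ?n"
    proof (rule eq_matI)
      fix i j assume "i < dim_row (0\<^sub>m ?n ?n :: complex mat)" "j < dim_col (0\<^sub>m ?n ?n :: complex mat)"
      then have ij: "i < ?n" "j < ?n" by auto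
      have "lc_mat ?n (corep_action u) d $$ (i, j) = (\<Sum>(c, w)\<leftarrow>d. c * word_mat ?n (corep_action u) w $$ (i, j))"
        by (rule lc_mat_index[OF d X ij])
      also have "\<dots> = (\<Sum>(c, w)\<leftarrow>d. c * (u $$ (i, j)) w)"
      proof (intro arg_cong[of _ _ sum_list] map_cong refl)
        fix x assume "x \<in> set d"
        then show "(case x of (c, w) \<Rightarrow> c * word_mat ?n (corep_action u) w $$ (i, j)) = (case x of (c, w) \<Rightarrow> c * (u $$ (i, j)) w)"
          using d by (auto simp: lc_in_def mult_corep_entry[OF u(1) _ ij])
      qed
      also have "\<dots> = 0"
      proof -
        have k: "(i, j) \<in> {..<?n} \<times> {..<?n}" using ij by simp
        have "\<forall>(n, \<rho>)\<in>B (i, j). lc_mat n \<rho> d = 0\<^sub>m n n"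
        proof (rule ballI)
          fix x assume "x \<in> B (i, j)"
          then have "x \<in> B'" unfolding B'_def using k by (rule UN_I[rotated])
          then show "case x of (n, \<rho>) \<Rightarrow> lc_mat n \<rho> d = 0\<^sub>m n n" using d0 by (cases x) simp
        qed
        with bspec[OF B k] d show ?thesis by blast
      qed
      finally show "lc_mat ?n (corep_action u) d $$ (i, j) = 0\<^sub>m ?n ?n $$ (i, j)" using ij by simp
    qed (use lc_mat_carrier[OF d, of "corep_action u" ?n] X in auto)
    then show "lc_mat ?n (corep_action u) p = lc_mat ?n (corep_action u) s"
      unfolding d_def by (subst (asm) lc_mat_diff_zero[OF p s X])
  qed
qed

text \<open>The value at \<open>b\<close> of the conjugate transpose of \<open>u\<close>, formed
  with the star of the function algebra. For a *-representation it is just the antipode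
  (\<open>coinverse_star_rep\<close>); while the *-condition is still to be derived, the two must be
  kept apart.\<close>

definition coinverse :: "'x hopf_pres \<Rightarrow> nat \<Rightarrow> ('x \<Rightarrow> complex mat) \<Rightarrow> 'x list \<Rightarrow> complex mat" where
  "coinverse A n \<rho> b = mat_adjoint (lc_mat n \<rho> (lc_star (Invol A) (antimult_word (Antipode A) b)))"

lemma star_antipode_in:
  assumes "hopf_closed A" "set b \<subseteq> Gens A"
  shows "lc_in (Gens A) (lc_star (Invol A) (antimult_word (Antipode A) b))"
  using assms by (intro lc_star_in antimult_word_in) (auto simp: hopf_closed_def)

lemma coinverse_carrier:
  assumes "hopf_closed A" "set b \<subseteq> Gens A" "\<And>x. x \<in> Gens A \<Longrightarrow> \<rho> x \<in> carrier_mat n n"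
  shows "coinverse A n \<rho> b \<in> carrier_mat n n"
  unfolding coinverse_def
  by (rule mat_adjoint_carrier[OF lc_mat_carrier[OF star_antipode_in[OF assms(1,2)] assms(3)]])

lemma FStar_entry:
  assumes A: "hopf_closed A" and u: "mult_corep (Gens A) u" and b: "set b \<subseteq> Gens A"
    and ij: "i < dim_row u" "j < dim_row u"
  shows "FStar (reconstruct A ob) (u $$ (i, j)) b = coinverse A (dim_row u) (corep_action u) b $$ (j, i)"
proof -
  note X = mult_corep_action_carrier[OF u] and p = star_antipode_in[OF A b]
  let ?p = "lc_star (Invol A) (antimult_word (Antipode A) b)"
  have "(\<Sum>(c, w)\<leftarrow>?p. c * (u $$ (i, j)) w) = lc_mat (dim_row u) (corep_action u) ?p $$ (i, j)"
    unfolding lc_mat_index[OF p X ij]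
  proof (intro arg_cong[of _ _ sum_list] map_cong refl)
    fix x assume "x \<in> set ?p"
    then show "(case x of (c, w) \<Rightarrow> c * (u $$ (i, j)) w) = (case x of (c, w) \<Rightarrow> c * word_mat (dim_row u) (corep_action u) w $$ (i, j))"
      using p by (auto simp: lc_in_def mult_corep_entry[OF u _ ij])
  qed
  then show ?thesis
    using lc_mat_carrier[OF p, of "corep_action u" "dim_row u"] X ij b by (simp add: on_words_simps coinverse_def)
qed

text \<open>Turns the entries of the products of \<open>u\<close> with its conjugate transpose,
  formed in the function algebra, into entries of complex matrices: convolutions of the action and
  the coinverse along the coproduct of \<open>w\<close>.\<close>

lemma unitarity_entry:
  assumes A: "hopf_closed A" and u: "mult_corep (Gens A) u" and w: "set w \<subseteq> Gens A"
    and ij: "i < dim_row u" "j < dim_row u"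
  shows "(\<Sum>k<dim_row u. FMult (reconstruct A ob) (u $$ (i, k)) (FStar (reconstruct A ob) (u $$ (j, k))) w) =
      lc2_mat (dim_row u) (\<lambda>a b. word_mat (dim_row u) (corep_action u) a * coinverse A (dim_row u) (corep_action u) b)
        (coprod_word (Coprod A) w) $$ (i, j)" (is "?l1 = lc2_mat _ ?F1 _ $$ _")
    and "(\<Sum>k<dim_row u. FMult (reconstruct A ob) (FStar (reconstruct A ob) (u $$ (k, i))) (u $$ (k, j)) w) =
      lc2_mat (dim_row u) (\<lambda>a b. coinverse A (dim_row u) (corep_action u) a * word_mat (dim_row u) (corep_action u) b)
        (coprod_word (Coprod A) w) $$ (i, j)" (is "?l2 = lc2_mat _ ?F2 _ $$ _")
proof -
  let ?n = "dim_row u" and ?G = "reconstruct A ob"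
  note X = mult_corep_action_carrier[OF u] and p = coprod_word_in[OF A w]
  have wc: "word_mat ?n (corep_action u) a \<in> carrier_mat ?n ?n" for a by (rule word_mat_carrier) (rule X)
  have cc: "coinverse A ?n (corep_action u) a \<in> carrier_mat ?n ?n" if "set a \<subseteq> Gens A" for a
    by (rule coinverse_carrier[OF A that]) (rule X)
  have F1: "?F1 a b \<in> carrier_mat ?n ?n" if "set a \<subseteq> Gens A" "set b \<subseteq> Gens A" for a b
    by (rule mult_carrier_mat[OF wc cc[OF that(2)]])
  have F2: "?F2 a b \<in> carrier_mat ?n ?n" if "set a \<subseteq> Gens A" "set b \<subseteq> Gens A" for a b
    by (rule mult_carrier_mat[OF cc[OF that(1)] wc])
  have "?l1 = (\<Sum>x\<leftarrow>coprod_word (Coprod A) w. \<Sum>k<?n. case x of (c, a, b) \<Rightarrow> c * (u $$ (i, k)) a * FStar ?G (u $$ (j, k)) b)"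
    unfolding sum_sum_list_swap[symmetric] reconstruct_simps(1) on_words_simps(1)[OF w] ..
  also have "\<dots> = (\<Sum>(c, a, b)\<leftarrow>coprod_word (Coprod A) w. c * ?F1 a b $$ (i, j))"
  proof (intro arg_cong[of _ _ sum_list] map_cong refl)
    fix x assume x: "x \<in> set (coprod_word (Coprod A) w)"
    obtain c a b where x': "x = (c, a, b)" by (cases x)
    have ab: "set a \<subseteq> Gens A" "set b \<subseteq> Gens A" using p x by (auto simp: lc2_in_def x')
    have "(\<Sum>k<?n. c * (u $$ (i, k)) a * FStar ?G (u $$ (j, k)) b) =
        (\<Sum>k<?n. c * (word_mat ?n (corep_action u) a $$ (i, k) * coinverse A ?n (corep_action u) b $$ (k, j)))"
      by (intro sum.cong refl)
        (simp add: mult_corep_entry[OF u ab(1) ij(1)] FStar_entry[OF A u ab(2) ij(2)] mult.assoc del: reconstruct_simps)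
    also have "\<dots> = c * ?F1 a b $$ (i, j)"
      unfolding mult_mat_index[OF wc cc[OF ab(2)] ij] by (simp add: sum_distrib_left)
    finally show "(\<Sum>k<?n. case x of (c, a, b) \<Rightarrow> c * (u $$ (i, k)) a * FStar ?G (u $$ (j, k)) b) =
        (case x of (c, a, b) \<Rightarrow> c * ?F1 a b $$ (i, j))" by (simp add: x')
  qed
  also have "\<dots> = lc2_mat ?n ?F1 (coprod_word (Coprod A) w) $$ (i, j)"
    by (rule lc2_mat_index[OF p F1 ij, symmetric])
  finally show "?l1 = lc2_mat ?n ?F1 (coprod_word (Coprod A) w) $$ (i, j)" .
  have "?l2 = (\<Sum>x\<leftarrow>coprod_word (Coprod A) w. \<Sum>k<?n. case x of (c, a, b) \<Rightarrow> c * FStar ?G (u $$ (k, i)) a * (u $$ (k, j)) b)"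
    unfolding sum_sum_list_swap[symmetric] reconstruct_simps(1) on_words_simps(1)[OF w] ..
  also have "\<dots> = (\<Sum>(c, a, b)\<leftarrow>coprod_word (Coprod A) w. c * ?F2 a b $$ (i, j))"
  proof (intro arg_cong[of _ _ sum_list] map_cong refl)
    fix x assume x: "x \<in> set (coprod_word (Coprod A) w)"
    obtain c a b where x': "x = (c, a, b)" by (cases x)
    have ab: "set a \<subseteq> Gens A" "set b \<subseteq> Gens A" using p x by (auto simp: lc2_in_def x')
    have "(\<Sum>k<?n. c * FStar ?G (u $$ (k, i)) a * (u $$ (k, j)) b) =
        (\<Sum>k<?n. c * (coinverse A ?n (corep_action u) a $$ (i, k) * word_mat ?n (corep_action u) b $$ (k, j)))"
      by (intro sum.cong refl)
        (simp add: mult_corep_entry[OF u ab(2) _ ij(2)] FStar_entry[OF A u ab(1) _ ij(1)] mult.assoc del: reconstruct_simps)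
    also have "\<dots> = c * ?F2 a b $$ (i, j)"
      unfolding mult_mat_index[OF cc[OF ab(1)] wc ij] by (simp add: sum_distrib_left)
    finally show "(\<Sum>k<?n. case x of (c, a, b) \<Rightarrow> c * FStar ?G (u $$ (k, i)) a * (u $$ (k, j)) b) =
        (case x of (c, a, b) \<Rightarrow> c * ?F2 a b $$ (i, j))" by (simp add: x')
  qed
  also have "\<dots> = lc2_mat ?n ?F2 (coprod_word (Coprod A) w) $$ (i, j)"
    by (rule lc2_mat_index[OF p F2 ij, symmetric])
  finally show "?l2 = lc2_mat ?n ?F2 (coprod_word (Coprod A) w) $$ (i, j)" .
qed

text \<open>The coproduct condition makes \<open>?E\<close> idempotent, and unitarity at the empty
  word makes \<open>?E\<close> times its adjoint the identity. An idempotent with a right inverse is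
  the identity.\<close>

lemma unitary_rep_mult_corep:
  assumes A: "hopf_closed A" and u: "unitary_rep (reconstruct A ob) u"
  shows "mult_corep (Gens A) u"
proof -
  let ?n = "dim_row u" and ?E = "eval_mat u []"
  have sq: "dim_col u = ?n" using u by (simp add: unitary_rep_def)
  have Fun: "u $$ (i, j) \<in> Fun (reconstruct A ob)" if "i < ?n" "j < ?n" for i j
    using u that by (simp add: unitary_rep_def del: reconstruct_simps)
  have c: "eval_mat u w \<in> carrier_mat ?n ?n" for w using sq by (intro carrier_matI) auto
  have mult: "eval_mat u (v @ w) = eval_mat u v * eval_mat u w" for v w
  proof (rule eq_matI)
    fix i j assume "i < dim_row (eval_mat u v * eval_mat u w)" "j < dim_col (eval_mat u v * eval_mat u w)"
    then have ij: "i < ?n" "j < ?n" using sq by auto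
    have "FComult (reconstruct A ob) (u $$ (i, j)) = (\<lambda>v w. \<Sum>k<dim_row u. (u $$ (i, k)) v * (u $$ (k, j)) w)"
      using u ij by (simp add: unitary_rep_def del: reconstruct_simps)
    from fun_cong[OF fun_cong[OF this], of v w]
    have "(u $$ (i, j)) (v @ w) = (\<Sum>k<dim_row u. (u $$ (i, k)) v * (u $$ (k, j)) w)" by simp
    then show "eval_mat u (v @ w) $$ (i, j) = (eval_mat u v * eval_mat u w) $$ (i, j)"
      using ij sq by (simp add: mult_mat_index[OF c c] del: index_mult_mat)
  qed (use sq in auto)
  have "?E * mat_adjoint ?E = 1\<^sub>m ?n"
  proof (rule eq_matI)
    fix i j assume "i < dim_row (1\<^sub>m ?n :: complex mat)" "j < dim_col (1\<^sub>m ?n :: complex mat)"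
    then have ij: "i < ?n" "j < ?n" by auto
    have "(\<lambda>w. \<Sum>k<?n. FMult (reconstruct A ob) (u $$ (i, k)) (FStar (reconstruct A ob) (u $$ (j, k))) w) =
        (if i = j then FOne (reconstruct A ob) else (\<lambda>_. 0))"
      using u ij by (simp add: unitary_rep_def del: reconstruct_simps)
    from fun_cong[OF this, of "[]"]
    have "(\<Sum>k<?n. (u $$ (i, k)) [] * cnj ((u $$ (j, k)) [])) = (if i = j then 1 else 0)"
      by (simp add: on_words_simps lc_star_def split: if_splits)
    then show "(?E * mat_adjoint ?E) $$ (i, j) = 1\<^sub>m ?n $$ (i, j)"
      using ij sq by (simp add: mult_mat_index[OF c mat_adjoint_carrier[OF c]] del: index_mult_mat)
  qed (use sq in auto)
  moreover have "?E * ?E = ?E" using mult[of "[]" "[]"] by simp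
  ultimately have "?E = 1\<^sub>m ?n"
    using assoc_mult_mat[OF c c mat_adjoint_carrier[OF c], of "[]" "[]" "[]"] right_mult_one_mat[OF c, of "[]"] by simp
  moreover have "eval_mat u w = 0\<^sub>m ?n ?n" if "\<not> set w \<subseteq> Gens A" for w
    using Fun_zero[OF Fun that] sq by (intro eq_matI) auto
  ultimately show ?thesis using sq mult by (simp add: mult_corep_def)
qed

text \<open>Splits the notion into a representation of the free algebra, regular entries, and the
  two antipode convolutions on words, so that everything below can be done with complex
  matrices.\<close>

lemma unitary_rep_iff:
  assumes A: "hopf_closed A"
  shows "unitary_rep (reconstruct A ob) u \<longleftrightarrow> mult_corep (Gens A) u \<and>
    (\<forall>i<dim_row u. \<forall>j<dim_row u. u $$ (i, j) \<in> Fun (reconstruct A ob)) \<and>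
    (\<forall>w. set w \<subseteq> Gens A \<longrightarrow>
      lc2_mat (dim_row u) (\<lambda>a b. word_mat (dim_row u) (corep_action u) a * coinverse A (dim_row u) (corep_action u) b)
        (coprod_word (Coprod A) w) = (\<Prod>x\<leftarrow>w. Counit A x) \<cdot>\<^sub>m 1\<^sub>m (dim_row u) \<and>
      lc2_mat (dim_row u) (\<lambda>a b. coinverse A (dim_row u) (corep_action u) a * word_mat (dim_row u) (corep_action u) b)
        (coprod_word (Coprod A) w) = (\<Prod>x\<leftarrow>w. Counit A x) \<cdot>\<^sub>m 1\<^sub>m (dim_row u))"
    (is "?L \<longleftrightarrow> ?M \<and> ?F \<and> (\<forall>w. _ w \<longrightarrow> lc2_mat _ ?F1 _ = _ \<and> lc2_mat _ ?F2 _ = _)")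
proof -
  let ?n = "dim_row u" and ?G = "reconstruct A ob"
  have c: "lc2_mat ?n ?F1 (coprod_word (Coprod A) w) \<in> carrier_mat ?n ?n \<and>
      lc2_mat ?n ?F2 (coprod_word (Coprod A) w) \<in> carrier_mat ?n ?n" if "?M" "set w \<subseteq> Gens A" for w
  proof -
    note X = mult_corep_action_carrier[OF that(1)]
    have wc: "word_mat ?n (corep_action u) a \<in> carrier_mat ?n ?n" for a by (rule word_mat_carrier) (rule X)
    have cc: "coinverse A ?n (corep_action u) a \<in> carrier_mat ?n ?n" if "set a \<subseteq> Gens A" for a
      by (rule coinverse_carrier[OF A that]) (rule X)
    show ?thesis
      by (intro conjI lc2_mat_carrier[OF coprod_word_in[OF A that(2)]] mult_carrier_mat[OF wc cc] mult_carrier_mat[OF cc wc])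
  qed
  show ?thesis
  proof
    assume L: ?L
    have M: ?M by (rule unitary_rep_mult_corep[OF A L])
    have F: ?F using L by (simp add: unitary_rep_def del: reconstruct_simps)
    have "lc2_mat ?n ?F1 (coprod_word (Coprod A) w) = (\<Prod>x\<leftarrow>w. Counit A x) \<cdot>\<^sub>m 1\<^sub>m ?n \<and>
        lc2_mat ?n ?F2 (coprod_word (Coprod A) w) = (\<Prod>x\<leftarrow>w. Counit A x) \<cdot>\<^sub>m 1\<^sub>m ?n" if w: "set w \<subseteq> Gens A" for w
    proof -
      have "lc2_mat ?n ?F1 (coprod_word (Coprod A) w) $$ (i, j) = ((\<Prod>x\<leftarrow>w. Counit A x) \<cdot>\<^sub>m 1\<^sub>m ?n) $$ (i, j) \<and>
        lc2_mat ?n ?F2 (coprod_word (Coprod A) w) $$ (i, j) = ((\<Prod>x\<leftarrow>w. Counit A x) \<cdot>\<^sub>m 1\<^sub>m ?n) $$ (i, j)"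
        if ij: "i < ?n" "j < ?n" for i j
      proof -
        have "(\<lambda>w. \<Sum>k<?n. FMult ?G (u $$ (i, k)) (FStar ?G (u $$ (j, k))) w) = (if i = j then FOne ?G else (\<lambda>_. 0))"
          "(\<lambda>w. \<Sum>k<?n. FMult ?G (FStar ?G (u $$ (k, i))) (u $$ (k, j)) w) = (if i = j then FOne ?G else (\<lambda>_. 0))"
          using L ij by (simp_all add: unitary_rep_def del: reconstruct_simps)
        from fun_cong[OF this(1), of w] fun_cong[OF this(2), of w] show ?thesis
          unfolding unitarity_entry[OF A M w ij] using ij w by (simp add: on_words_simps)
      qed
      then show ?thesis using c[OF M w] by (intro conjI eq_matI) auto
    qed
    then show "?M \<and> ?F \<and> (\<forall>w. set w \<subseteq> Gens A \<longrightarrow> lc2_mat ?n ?F1 (coprod_word (Coprod A) w) = (\<Prod>x\<leftarrow>w. Counit A x) \<cdot>\<^sub>m 1\<^sub>m ?n \<and>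
        lc2_mat ?n ?F2 (coprod_word (Coprod A) w) = (\<Prod>x\<leftarrow>w. Counit A x) \<cdot>\<^sub>m 1\<^sub>m ?n)" using M F by blast
  next
    assume R: "?M \<and> ?F \<and> (\<forall>w. set w \<subseteq> Gens A \<longrightarrow> lc2_mat ?n ?F1 (coprod_word (Coprod A) w) = (\<Prod>x\<leftarrow>w. Counit A x) \<cdot>\<^sub>m 1\<^sub>m ?n \<and>
        lc2_mat ?n ?F2 (coprod_word (Coprod A) w) = (\<Prod>x\<leftarrow>w. Counit A x) \<cdot>\<^sub>m 1\<^sub>m ?n)"
    then have M: ?M and F: ?F by blast+
    have U: "lc2_mat ?n ?F1 (coprod_word (Coprod A) w) = (\<Prod>x\<leftarrow>w. Counit A x) \<cdot>\<^sub>m 1\<^sub>m ?n"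
        "lc2_mat ?n ?F2 (coprod_word (Coprod A) w) = (\<Prod>x\<leftarrow>w. Counit A x) \<cdot>\<^sub>m 1\<^sub>m ?n" if "set w \<subseteq> Gens A" for w
      using R that by blast+
    have sq: "dim_col u = ?n" using M by (simp add: mult_corep_def)
    show ?L
      unfolding unitary_rep_def
    proof (intro conjI allI impI)
      fix i j assume ij: "i < ?n" "j < ?n"
      show "u $$ (i, j) \<in> Fun ?G" using F ij by blast
      show "FComult ?G (u $$ (i, j)) = (\<lambda>v w. \<Sum>k<dim_row u. (u $$ (i, k)) v * (u $$ (k, j)) w)"
      proof (intro ext)
        fix v w
        show "FComult ?G (u $$ (i, j)) v w = (\<Sum>k<dim_row u. (u $$ (i, k)) v * (u $$ (k, j)) w)"
        proof (cases "set v \<subseteq> Gens A \<and> set w \<subseteq> Gens A")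
          case True
          then have "eval_mat u (v @ w) = eval_mat u v * eval_mat u w" using M by (simp add: mult_corep_def)
          moreover have "eval_mat u v \<in> carrier_mat ?n ?n" for v using sq by (intro carrier_matI) auto
          ultimately have "eval_mat u (v @ w) $$ (i, j) = (\<Sum>k<?n. eval_mat u v $$ (i, k) * eval_mat u w $$ (k, j))"
            using mult_mat_index[of "eval_mat u v" ?n ?n "eval_mat u w" ?n i j] ij by metis
          then show ?thesis using ij sq by simp
        next
          case False
          \<comment> \<open>If the concatenation leaves the generators, so does one of the two
            words, and both sides of the coproduct identity are zero.\<close>
          have z: "(u $$ (a, b)) x = 0" if "a < ?n" "b < ?n" "\<not> set x \<subseteq> Gens A" for a b x
          proof -
            have "eval_mat u x = 0\<^sub>m ?n ?n" using M that(3) by (simp add: mult_corep_def)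
            then show ?thesis using eval_mat_index[of a u b x] that sq by simp
          qed
          have "(u $$ (i, j)) (v @ w) = 0" using False ij by (intro z) auto
          moreover have "(u $$ (i, k)) v * (u $$ (k, j)) w = 0" if "k < ?n" for k
            using z[OF ij(1) that] z[OF that ij(2)] False by auto
          ultimately show ?thesis by (simp add: sum.neutral)
        qed
      qed
      show "(\<lambda>w. \<Sum>k<?n. FMult ?G (u $$ (i, k)) (FStar ?G (u $$ (j, k))) w) = (if i = j then FOne ?G else (\<lambda>_. 0))"
      proof
        fix w show "(\<Sum>k<?n. FMult ?G (u $$ (i, k)) (FStar ?G (u $$ (j, k))) w) = (if i = j then FOne ?G else (\<lambda>_. 0)) w"
        proof (cases "set w \<subseteq> Gens A")
          case True
          show ?thesis unfolding unitarity_entry[OF A M True ij] U[OF True] using ij True by (simp add: on_words_simps)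
        qed (simp add: on_words_simps)
      qed
      show "(\<lambda>w. \<Sum>k<?n. FMult ?G (FStar ?G (u $$ (k, i))) (u $$ (k, j)) w) = (if i = j then FOne ?G else (\<lambda>_. 0))"
      proof
        fix w show "(\<Sum>k<?n. FMult ?G (FStar ?G (u $$ (k, i))) (u $$ (k, j)) w) = (if i = j then FOne ?G else (\<lambda>_. 0)) w"
        proof (cases "set w \<subseteq> Gens A")
          case True
          show ?thesis unfolding unitarity_entry[OF A M True ij] U[OF True] using ij True by (simp add: on_words_simps)
        qed (simp add: on_words_simps)
      qed
    qed (rule sq)
  qed
qed

section \<open>The quantized enveloping algebras\<close>

lemma smult_one_mat [simp]: "(1 :: complex) \<cdot>\<^sub>m A = A"
  by (intro eq_matI) auto

text \<open>The ring laws for matrices mention dimensions that do not occur in the terms to be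
  rewritten; fixing all of them to be \<open>n\<close> turns these laws into usable rewrite
  rules.\<close>

locale square_matrices =
  fixes n :: nat
begin

lemmas sq_carrier [simp] = mult_carrier_mat[of _ n n _ n] smult_carrier_mat[of _ n n] add_carrier_mat[of _ n n]
  mat_adjoint_carrier[of _ n n]

lemmas sq_simps = assoc_mult_mat[of _ n n _ n _ n] mult_smult_distrib[of _ n n _ n] mult_smult_assoc_mat[of _ n n _ n]
  left_mult_one_mat[of _ n n] right_mult_one_mat[of _ n n] mat_adjoint_mult[of _ n n _ n]
  right_add_zero_mat[of _ n n] left_add_zero_mat[of _ n n]

lemma cancel_left:
  assumes "(A :: complex mat) * B = 1\<^sub>m n" "A \<in> carrier_mat n n" "B \<in> carrier_mat n n" "X \<in> carrier_mat n n"
  shows "A * (B * X) = X"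
  using assoc_mult_mat[OF assms(2-4)] assms by simp

lemma add_neg_eq_zero:
  fixes A B :: "complex mat"
  assumes "A \<in> carrier_mat n n" "B \<in> carrier_mat n n" "A + - 1 \<cdot>\<^sub>m B = 0\<^sub>m n n"
  shows "A = B"
proof (rule eq_matI)
  fix i j assume ij: "i < dim_row B" "j < dim_col B"
  have "(A + - 1 \<cdot>\<^sub>m B) $$ (i, j) = 0" using ij assms(2) unfolding assms(3) by simp
  then show "A $$ (i, j) = B $$ (i, j)" using ij assms(1,2) by simp
qed (use assms in auto)

lemma add_neg_zero:
  "(A :: complex mat) \<in> carrier_mat n n \<Longrightarrow> A + - 1 \<cdot>\<^sub>m A = 0\<^sub>m n n"
  "(A :: complex mat) \<in> carrier_mat n n \<Longrightarrow> - 1 \<cdot>\<^sub>m A + A = 0\<^sub>m n n"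
  by (auto intro!: eq_matI)

end

lemma lc_mat_single:
  assumes "word_mat n \<rho> w \<in> carrier_mat n n"
  shows "lc_mat n \<rho> [(c, w)] = c \<cdot>\<^sub>m word_mat n \<rho> w"
  using assms by (auto intro!: eq_matI)

lemma lc2_mult_unit: "lc2_mult p [(1, [], [])] = p"
  unfolding lc2_mult_def by (induction p) auto

lemma lc_mult_unit: "lc_mult [(1, [])] p = p"
  unfolding lc_mult_def by (induction p) auto

lemma coinverse_star_rep:
  assumes A: "hopf_closed A" and \<rho>: "star_rep A n \<rho>" and b: "set b \<subseteq> Gens A"
  shows "coinverse A n \<rho> b = lc_mat n \<rho> (antimult_word (Antipode A) b)"
proof -
  have "lc_in (Gens A) (antimult_word (Antipode A) b)"
    by (rule antimult_word_in[OF _ b]) (use A in \<open>simp add: hopf_closed_def\<close>)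
  from lc_mat_star[OF A \<rho> this] show ?thesis by (simp add: coinverse_def)
qed

text \<open>The antipode axioms pass from generators to words by induction. In \<open>?F\<close> the
  convolution of the tail \<open>w\<close> sits in the middle and collapses to a scalar, in
  \<open>?G\<close> that of the head \<open>x\<close> does; hence the outer product rule for one and
  the inner rule for the other.\<close>

lemma star_rep_unitary_rep:
  assumes A: "hopf_closed A" and \<rho>: "star_rep A n \<rho>" and ob: "ob n \<rho>"
    and gen1: "\<And>x. x \<in> Gens A \<Longrightarrow> lc2_mat n (\<lambda>a b. word_mat n \<rho> a * lc_mat n \<rho> (antimult_word (Antipode A) b)) (Coprod A x)
      = Counit A x \<cdot>\<^sub>m 1\<^sub>m n"
    and gen2: "\<And>x. x \<in> Gens A \<Longrightarrow> lc2_mat n (\<lambda>a b. lc_mat n \<rho> (antimult_word (Antipode A) a) * word_mat n \<rho> b) (Coprod A x)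
      = Counit A x \<cdot>\<^sub>m 1\<^sub>m n"
  shows "unitary_rep (reconstruct A ob) (coeff_corep (Gens A) n \<rho>)"
proof -
  interpret square_matrices n .
  let ?X = "Gens A" and ?S = "\<lambda>b. lc_mat n \<rho> (antimult_word (Antipode A) b)"
  let ?u = "coeff_corep ?X n \<rho>"
  let ?F = "\<lambda>a b. word_mat n \<rho> a * ?S b" and ?G = "\<lambda>a b. ?S a * word_mat n \<rho> b"
  note X = star_rep_carrier[OF \<rho>]
  have Sin: "lc_in ?X (Antipode A x)" if "x \<in> ?X" for x using A that by (simp add: hopf_closed_def)
  have W: "word_mat n \<rho> a \<in> carrier_mat n n" if "set a \<subseteq> ?X" for a using that X by (intro word_mat_carrier) auto
  have S: "?S a \<in> carrier_mat n n" if "set a \<subseteq> ?X" for a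
    by (rule lc_mat_carrier[OF antimult_word_in[OF Sin that] X])
  have W2: "word_mat n \<rho> (a @ b) = word_mat n \<rho> a * word_mat n \<rho> b" if "set a \<subseteq> ?X" "set b \<subseteq> ?X" for a b
    using that X by (intro word_mat_append) auto
  have S2: "?S (a @ b) = ?S b * ?S a" if "set a \<subseteq> ?X" "set b \<subseteq> ?X" for a b
    by (rule antimult_word_append[OF Sin that X])
  have \<Delta>: "lc2_in ?X (Coprod A x)" if "x \<in> ?X" for x using A that by (simp add: hopf_closed_def)
  have base: "?S [] = 1\<^sub>m n" by (simp add: sq_simps)
  have words: "lc2_mat n ?F (coprod_word (Coprod A) w) = (\<Prod>x\<leftarrow>w. Counit A x) \<cdot>\<^sub>m 1\<^sub>m n \<and>
      lc2_mat n ?G (coprod_word (Coprod A) w) = (\<Prod>x\<leftarrow>w. Counit A x) \<cdot>\<^sub>m 1\<^sub>m n" if "set w \<subseteq> ?X" for w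
    using that
  proof (induction w)
    case Nil
    show ?case unfolding coprod_word.simps lc2_mat_def mat_sum_simps case_prod_conv base word_mat_simps by (simp add: sq_simps)
  next
    case (Cons x w)
    then have x: "x \<in> ?X" and w: "set w \<subseteq> ?X" by auto
    note p = \<Delta>[OF x] and s = coprod_word_in[OF A w]
    let ?e = "\<Prod>x\<leftarrow>w. Counit A x"
    have "lc2_mat n ?F (coprod_word (Coprod A) (x # w)) =
        lc2_mat n (\<lambda>u v. word_mat n \<rho> u * lc2_mat n ?F (coprod_word (Coprod A) w) * ?S v) (Coprod A x)"
      unfolding coprod_word_Cons
      by (rule lc2_mat_mult_outer[OF p s]) (simp_all add: W S W2 S2 sq_simps)
    also have "\<dots> = lc2_mat n (\<lambda>u v. ?e \<cdot>\<^sub>m ?F u v) (Coprod A x)"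
      using Cons.IH[OF w] by (intro lc2_mat_cong[OF p]) (simp add: sq_simps W S)
    also have "\<dots> = ?e \<cdot>\<^sub>m lc2_mat n ?F (Coprod A x)" by (rule lc2_mat_smult[OF p]) (simp add: W S)
    also have "\<dots> = (\<Prod>x\<leftarrow>x # w. Counit A x) \<cdot>\<^sub>m 1\<^sub>m n" unfolding gen1[OF x] by (auto intro!: eq_matI)
    finally have 1: "lc2_mat n ?F (coprod_word (Coprod A) (x # w)) = (\<Prod>x\<leftarrow>x # w. Counit A x) \<cdot>\<^sub>m 1\<^sub>m n" .
    have "lc2_mat n ?G (coprod_word (Coprod A) (x # w)) =
        lc2_mat n (\<lambda>u v. ?S u * lc2_mat n ?G (Coprod A x) * word_mat n \<rho> v) (coprod_word (Coprod A) w)"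
      unfolding coprod_word_Cons
      by (rule lc2_mat_mult_inner[OF p s]) (simp_all add: W S W2 S2 sq_simps)
    also have "\<dots> = lc2_mat n (\<lambda>u v. Counit A x \<cdot>\<^sub>m ?G u v) (coprod_word (Coprod A) w)"
      by (intro lc2_mat_cong[OF s]) (simp add: gen2[OF x] sq_simps W S)
    also have "\<dots> = Counit A x \<cdot>\<^sub>m lc2_mat n ?G (coprod_word (Coprod A) w)" by (rule lc2_mat_smult[OF s]) (simp add: W S)
    also have "\<dots> = (\<Prod>x\<leftarrow>x # w. Counit A x) \<cdot>\<^sub>m 1\<^sub>m n" using Cons.IH[OF w] by (auto intro!: eq_matI)
    finally show ?case using 1 by blast
  qed
  have act: "corep_action ?u x = \<rho> x" if "x \<in> ?X" for x by (rule coeff_corep_action[OF X that])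
  have wact: "word_mat n (corep_action ?u) a = word_mat n \<rho> a" if "set a \<subseteq> ?X" for a
    using that act by (intro word_mat_cong) auto
  have cact: "coinverse A n (corep_action ?u) b = ?S b" if "set b \<subseteq> ?X" for b
  proof -
    have "coinverse A n (corep_action ?u) b = coinverse A n \<rho> b"
      unfolding coinverse_def using lc_mat_cong[OF star_antipode_in[OF A that], of "corep_action ?u" \<rho> n] act by simp
    then show ?thesis using coinverse_star_rep[OF A \<rho> that] by simp
  qed
  show ?thesis
    unfolding unitary_rep_iff[OF A] coeff_corep_dim
  proof (intro conjI allI impI)
    show "mult_corep ?X ?u" by (rule mult_coeff_corep[OF X])
    fix i j assume "i < n" "j < n"
    then show "?u $$ (i, j) \<in> Fun (reconstruct A ob)"
      using coeff_in_Fun[of ob n \<rho> i j A, OF ob] by (simp add: coeff_corep_def)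
  next
    fix w assume w: "set w \<subseteq> ?X"
    show "lc2_mat n (\<lambda>a b. word_mat n (corep_action ?u) a * coinverse A n (corep_action ?u) b) (coprod_word (Coprod A) w) =
        (\<Prod>x\<leftarrow>w. Counit A x) \<cdot>\<^sub>m 1\<^sub>m n"
      using words[OF w] lc2_mat_cong[OF coprod_word_in[OF A w],
          of "\<lambda>a b. word_mat n (corep_action ?u) a * coinverse A n (corep_action ?u) b" ?F n] by (simp add: wact cact)
    show "lc2_mat n (\<lambda>a b. coinverse A n (corep_action ?u) a * word_mat n (corep_action ?u) b) (coprod_word (Coprod A) w) =
        (\<Prod>x\<leftarrow>w. Counit A x) \<cdot>\<^sub>m 1\<^sub>m n"
      using words[OF w] lc2_mat_cong[OF coprod_word_in[OF A w],
          of "\<lambda>a b. coinverse A n (corep_action ?u) a * word_mat n (corep_action ?u) b" ?G n] by (simp add: wact cact)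
  qed
qed

text \<open>The algebras with and without the central generators are treated simultaneously.\<close>

definition Ux :: "bool \<Rightarrow> real \<Rightarrow> ('r \<Rightarrow> 'e::euclidean_space) \<Rightarrow> 'r gen hopf_pres" where
  "Ux b q \<alpha> = (if b then Uqt q \<alpha> else Uq q \<alpha>)"

text \<open>The empty word stands for C_i = 1, so one formula for coproduct and antipode serves both
  algebras, just as \<open>Kw\<close> does for the two cases of \<open>q\<close>.\<close>

definition Cw :: "bool \<Rightarrow> 'r \<Rightarrow> 'r gen list" where "Cw b i = (if b then [Cg i] else [])"
definition Cinvw :: "bool \<Rightarrow> 'r \<Rightarrow> 'r gen list" where "Cinvw b i = (if b then [Cinv i] else [])"

lemma Gens_Ux: "Gens (Ux b q \<alpha>) = Uq_gens q \<union> (if b then central_gens else {})"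
  by (simp add: Ux_def Uq_def Uqt_def)

lemma Ux_simps [simp]:
  "Coprod (Ux b q \<alpha>) (Eg i) = [(1, [Eg i], Cw b i), (1, Kw q i, [Eg i])]"
  "Coprod (Ux b q \<alpha>) (Fg i) = [(1, [Fg i], Cinvw b i @ Kinvw q i), (1, [], [Fg i])]"
  "Coprod (Ux b q \<alpha>) (Hg i) = [(1, [Hg i], []), (1, [], [Hg i])]"
  "Coprod (Ux b q \<alpha>) (Kg i) = [(1, [Kg i], [Kg i])]"
  "Coprod (Ux b q \<alpha>) (Kinv i) = [(1, [Kinv i], [Kinv i])]"
  "Coprod (Ux b q \<alpha>) (Cg i) = [(1, [Cg i], [Cg i])]"
  "Coprod (Ux b q \<alpha>) (Cinv i) = [(1, [Cinv i], [Cinv i])]"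
  "Antipode (Ux b q \<alpha>) (Eg i) = [(-1, Kinvw q i @ [Eg i] @ Cinvw b i)]"
  "Antipode (Ux b q \<alpha>) (Fg i) = [(-1, [Fg i] @ Kw q i @ Cw b i)]"
  "Antipode (Ux b q \<alpha>) (Kg i) = [(1, [Kinv i])]"
  "Antipode (Ux b q \<alpha>) (Kinv i) = [(1, [Kg i])]"
  "Antipode (Ux b q \<alpha>) (Hg i) = [(-1, [Hg i])]"
  "Antipode (Ux b q \<alpha>) (Cg i) = [(1, [Cinv i])]"
  "Antipode (Ux b q \<alpha>) (Cinv i) = [(1, [Cg i])]"
  "Counit (Ux b q \<alpha>) = Uq_counit" "Invol (Ux b q \<alpha>) = Uq_invol q"
  by (auto simp: Ux_def Uq_def Uqt_def Cw_def Cinvw_def)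

lemma gens_cases:
  assumes "x \<in> Gens (Ux b q \<alpha>)"
  obtains (E) i where "x = Eg i" | (F) i where "x = Fg i" | (K) i where "x = Kg i" "q \<noteq> 1"
    | (Kinv) i where "x = Kinv i" "q \<noteq> 1" | (H) i where "x = Hg i" "q = 1"
    | (C) i where "x = Cg i" b | (Cinv) i where "x = Cinv i" b
  using assms by (cases "q = 1"; cases b) (auto simp: Gens_Ux Uq_gens_def central_gens_def)

lemma gens_words:
  "Eg i \<in> Gens (Ux b q \<alpha>)" "Fg i \<in> Gens (Ux b q \<alpha>)"
  "set (Kw q i) \<subseteq> Gens (Ux b q \<alpha>)" "set (Kinvw q i) \<subseteq> Gens (Ux b q \<alpha>)"
  "set (Cw b i) \<subseteq> Gens (Ux b q \<alpha>)" "set (Cinvw b i) \<subseteq> Gens (Ux b q \<alpha>)"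
  "torus_gen q i \<in> Gens (Ux b q \<alpha>)"
  by (auto simp: Gens_Ux Uq_gens_def Kw_def Kinvw_def Cw_def Cinvw_def central_gens_def torus_gen_def)

lemma hopf_closed_Ux: "hopf_closed (Ux b q \<alpha>)"
  unfolding hopf_closed_def
proof
  fix x assume x: "x \<in> Gens (Ux b q \<alpha>)"
  then show "lc2_in (Gens (Ux b q \<alpha>)) (Coprod (Ux b q \<alpha>) x) \<and> lc_in (Gens (Ux b q \<alpha>)) (Antipode (Ux b q \<alpha>) x) \<and>
      lc_in (Gens (Ux b q \<alpha>)) (Invol (Ux b q \<alpha>) x)"
    by (cases rule: gens_cases)
      (use gens_words in \<open>auto simp: lc2_in_def Gens_Ux Uq_gens_def central_gens_def Kw_def Kinvw_def Cw_def Cinvw_def\<close>)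
qed

lemma rels_closed_Ux:
  assumes "(p, s) \<in> Rels (Ux b q \<alpha>)"
  shows "lc_in (Gens (Ux b q \<alpha>)) p \<and> lc_in (Gens (Ux b q \<alpha>)) s"
proof -
  define X where "X = Gens (Ux b q \<alpha>)"
  define cl where "cl t \<longleftrightarrow> lc_in X (fst t) \<and> lc_in X (snd t)" for t
  have EF: "Eg i \<in> X" "Fg i \<in> X" for i by (auto simp: X_def Gens_Ux Uq_gens_def)
  have serre: "\<forall>t\<in>serre_rels q' \<alpha>. cl t" for q'
  proof
    fix t assume "t \<in> serre_rels q' \<alpha>"
    then obtain Y i j where Y: "Y = Eg \<or> Y = Fg" and t: "t = (serre q' \<alpha> Y i j, [])"
      unfolding serre_rels_def by blast
    have "Y k \<in> X" for k using Y EF by auto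
    then show "cl t" unfolding cl_def t serre_def Let_def lc_in_def by auto
  qed
  have uq: "\<forall>t\<in>Rels (Uq q \<alpha>). cl t"
  proof (cases "q = 1")
    case True
    have H: "Hg i \<in> X" for i using True by (auto simp: X_def Gens_Ux Uq_gens_def)
    have "\<forall>t\<in>U1_rels \<alpha>. cl t"
      unfolding U1_rels_def ball_Un by (intro conjI serre) (auto simp: cl_def EF H)
    then show ?thesis using True by (simp add: Uq_def)
  next
    case False
    have K: "Kg i \<in> X" "Kinv i \<in> X" for i using False by (auto simp: X_def Gens_Ux Uq_gens_def)
    have "\<forall>t\<in>Uq_rels q \<alpha>. cl t"
      unfolding Uq_rels_def ball_Un by (intro conjI serre) (auto simp: cl_def EF K Let_def)
    then show ?thesis using False by (simp add: Uq_def)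
  qed
  have "\<forall>t\<in>central_rels q. cl t" if b
  proof -
    have c: "Cg i \<in> X" "Cinv i \<in> X" "x \<in> central_gens \<Longrightarrow> x \<in> X" "x \<in> Uq_gens q \<Longrightarrow> x \<in> X" for i x
      using that by (auto simp: X_def Gens_Ux central_gens_def)
    show ?thesis unfolding central_rels_def ball_Un by (auto simp: cl_def c)
  qed
  then have "\<forall>t\<in>Rels (Ux b q \<alpha>). cl t" using uq by (simp add: Ux_def Uqt_def ball_Un)
  from bspec[OF this assms] show ?thesis by (simp add: cl_def X_def)
qed

lemma rels_Ux:
  "q \<noteq> 1 \<Longrightarrow> ([(1, [Kg i, Kinv i])], [(1, [])]) \<in> Rels (Ux b q \<alpha>)"
  "q \<noteq> 1 \<Longrightarrow> ([(1, [Kinv i, Kg i])], [(1, [])]) \<in> Rels (Ux b q \<alpha>)"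
  "q \<noteq> 1 \<Longrightarrow> ([(1, [Kg i, Eg j, Kinv i])], [(of_real (q_root q \<alpha> i powi cartan \<alpha> i j), [Eg j])]) \<in> Rels (Ux b q \<alpha>)"
  "q \<noteq> 1 \<Longrightarrow> ([(1, [Kg i, Fg j, Kinv i])], [(of_real (q_root q \<alpha> i powi (- cartan \<alpha> i j)), [Fg j])]) \<in> Rels (Ux b q \<alpha>)"
  "q = 1 \<Longrightarrow> ([(1, [Hg i, Eg j]), (-1, [Eg j, Hg i])], [(of_int (cartan \<alpha> i j), [Eg j])]) \<in> Rels (Ux b q \<alpha>)"
  "q = 1 \<Longrightarrow> ([(1, [Hg i, Fg j]), (-1, [Fg j, Hg i])], [(of_int (- cartan \<alpha> i j), [Fg j])]) \<in> Rels (Ux b q \<alpha>)"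
  "b \<Longrightarrow> ([(1, [Cg i, Cinv i])], [(1, [])]) \<in> Rels (Ux b q \<alpha>)"
  "b \<Longrightarrow> ([(1, [Cinv i, Cg i])], [(1, [])]) \<in> Rels (Ux b q \<alpha>)"
  "b \<Longrightarrow> x \<in> Gens (Ux b q \<alpha>) \<Longrightarrow> ([(1, [Cg i, x])], [(1, [x, Cg i])]) \<in> Rels (Ux b q \<alpha>)"
  "b \<Longrightarrow> x \<in> Gens (Ux b q \<alpha>) \<Longrightarrow> ([(1, [Cinv i, x])], [(1, [x, Cinv i])]) \<in> Rels (Ux b q \<alpha>)"
proof -
  have 1: "q \<noteq> 1 \<Longrightarrow> t \<in> Uq_rels q \<alpha> \<Longrightarrow> t \<in> Rels (Ux b q \<alpha>)" for t by (simp add: Ux_def Uqt_def Uq_def)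
  have 2: "q = 1 \<Longrightarrow> t \<in> U1_rels \<alpha> \<Longrightarrow> t \<in> Rels (Ux b q \<alpha>)" for t by (simp add: Ux_def Uqt_def Uq_def)
  have 3: "b \<Longrightarrow> t \<in> central_rels q \<Longrightarrow> t \<in> Rels (Ux b q \<alpha>)" for t by (simp add: Ux_def Uqt_def)
  show "([(1, [Kg i, Kinv i])], [(1, [])]) \<in> Rels (Ux b q \<alpha>)"
    "([(1, [Kinv i, Kg i])], [(1, [])]) \<in> Rels (Ux b q \<alpha>)"
    "([(1, [Kg i, Eg j, Kinv i])], [(of_real (q_root q \<alpha> i powi cartan \<alpha> i j), [Eg j])]) \<in> Rels (Ux b q \<alpha>)"
    "([(1, [Kg i, Fg j, Kinv i])], [(of_real (q_root q \<alpha> i powi (- cartan \<alpha> i j)), [Fg j])]) \<in> Rels (Ux b q \<alpha>)"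
    if "q \<noteq> 1" by (rule 1[OF that], unfold Uq_rels_def, blast)+
  show "([(1, [Hg i, Eg j]), (-1, [Eg j, Hg i])], [(of_int (cartan \<alpha> i j), [Eg j])]) \<in> Rels (Ux b q \<alpha>)"
    "([(1, [Hg i, Fg j]), (-1, [Fg j, Hg i])], [(of_int (- cartan \<alpha> i j), [Fg j])]) \<in> Rels (Ux b q \<alpha>)"
    if "q = 1" by (rule 2[OF that], unfold U1_rels_def, blast)+
  show "([(1, [Cg i, Cinv i])], [(1, [])]) \<in> Rels (Ux b q \<alpha>)"
    "([(1, [Cinv i, Cg i])], [(1, [])]) \<in> Rels (Ux b q \<alpha>)" if b
    by (rule 3[OF that], unfold central_rels_def, blast)+
  show "([(1, [Cg i, x])], [(1, [x, Cg i])]) \<in> Rels (Ux b q \<alpha>)"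
    "([(1, [Cinv i, x])], [(1, [x, Cinv i])]) \<in> Rels (Ux b q \<alpha>)" if b "x \<in> Gens (Ux b q \<alpha>)"
  proof -
    have x: "x \<in> Uq_gens q \<union> central_gens" using that by (simp add: Gens_Ux)
    have c: "Cg i \<in> central_gens" "Cinv i \<in> central_gens" by (simp_all add: central_gens_def)
    show "([(1, [Cg i, x])], [(1, [x, Cg i])]) \<in> Rels (Ux b q \<alpha>)"
      by (rule 3[OF that(1)], unfold central_rels_def, rule UnI2, use x c in blast)
    show "([(1, [Cinv i, x])], [(1, [x, Cinv i])]) \<in> Rels (Ux b q \<alpha>)"
      by (rule 3[OF that(1)], unfold central_rels_def, rule UnI2, use x c in blast)
  qed
qed

text \<open>\<open>star_rep\<close> without the condition on adjoints: for a unitary representation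
  the relations are established first and then used to derive that condition.\<close>

definition Ux_rels_hold :: "bool \<Rightarrow> real \<Rightarrow> ('r \<Rightarrow> 'e::euclidean_space) \<Rightarrow> nat \<Rightarrow> ('r gen \<Rightarrow> complex mat) \<Rightarrow> bool" where
  "Ux_rels_hold b q \<alpha> n \<rho> \<longleftrightarrow> (\<forall>x\<in>Gens (Ux b q \<alpha>). \<rho> x \<in> carrier_mat n n) \<and>
     (\<forall>(p, s)\<in>Rels (Ux b q \<alpha>). lc_mat n \<rho> p = lc_mat n \<rho> s)"

section \<open>Consequences of the defining relations\<close>

context
  fixes b q and \<alpha> :: "'r \<Rightarrow> 'e::euclidean_space" and n \<rho>
  assumes rh: "Ux_rels_hold b q \<alpha> n \<rho>"
begin

interpretation square_matrices n .

lemma Ux_carrier: "x \<in> Gens (Ux b q \<alpha>) \<Longrightarrow> \<rho> x \<in> carrier_mat n n"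
  using rh by (simp add: Ux_rels_hold_def)

lemma Ux_word_carrier: "set w \<subseteq> Gens (Ux b q \<alpha>) \<Longrightarrow> word_mat n \<rho> w \<in> carrier_mat n n"
  by (rule word_mat_carrier) (auto intro: Ux_carrier)

lemma Ux_rel: "(p, s) \<in> Rels (Ux b q \<alpha>) \<Longrightarrow> lc_mat n \<rho> p = lc_mat n \<rho> s"
  using rh by (auto simp: Ux_rels_hold_def)

lemma Ux_rel_word:
  assumes "([(1, v)], [(c, w)]) \<in> Rels (Ux b q \<alpha>)"
  shows "word_mat n \<rho> v = c \<cdot>\<^sub>m word_mat n \<rho> w"
proof -
  have v: "word_mat n \<rho> v \<in> carrier_mat n n" and w: "word_mat n \<rho> w \<in> carrier_mat n n"
    using rels_closed_Ux[OF assms] by (auto intro!: Ux_word_carrier)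
  show ?thesis using Ux_rel[OF assms] unfolding lc_mat_single[OF v] lc_mat_single[OF w] by simp
qed

lemma Ux_K:
  "word_mat n \<rho> (Kw q i) * word_mat n \<rho> (Kinvw q i) = 1\<^sub>m n"
  "word_mat n \<rho> (Kinvw q i) * word_mat n \<rho> (Kw q i) = 1\<^sub>m n"
proof -
  have "word_mat n \<rho> (Kw q i) * word_mat n \<rho> (Kinvw q i) = 1\<^sub>m n \<and>
    word_mat n \<rho> (Kinvw q i) * word_mat n \<rho> (Kw q i) = 1\<^sub>m n"
  proof (cases "q = 1")
    case False
    have c: "\<rho> (Kg i) \<in> carrier_mat n n" "\<rho> (Kinv i) \<in> carrier_mat n n"
      using False by (auto intro!: Ux_carrier simp: Gens_Ux Uq_gens_def)
    show ?thesis using Ux_rel_word[OF rels_Ux(1)[OF False, of i]] Ux_rel_word[OF rels_Ux(2)[OF False, of i]] False c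
      by (simp add: Kw_def Kinvw_def sq_simps)
  qed (simp add: Kw_def Kinvw_def)
  then show "word_mat n \<rho> (Kw q i) * word_mat n \<rho> (Kinvw q i) = 1\<^sub>m n"
    "word_mat n \<rho> (Kinvw q i) * word_mat n \<rho> (Kw q i) = 1\<^sub>m n" by blast+
qed

lemma Ux_C:
  "word_mat n \<rho> (Cw b i) * word_mat n \<rho> (Cinvw b i) = 1\<^sub>m n"
  "word_mat n \<rho> (Cinvw b i) * word_mat n \<rho> (Cw b i) = 1\<^sub>m n"
proof -
  have "word_mat n \<rho> (Cw b i) * word_mat n \<rho> (Cinvw b i) = 1\<^sub>m n \<and>
    word_mat n \<rho> (Cinvw b i) * word_mat n \<rho> (Cw b i) = 1\<^sub>m n"
  proof (cases b)
    case True
    have c: "\<rho> (Cg i) \<in> carrier_mat n n" "\<rho> (Cinv i) \<in> carrier_mat n n"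
      using True by (auto intro!: Ux_carrier simp: Gens_Ux central_gens_def)
    show ?thesis using Ux_rel_word[OF rels_Ux(7)[OF True, of i]] Ux_rel_word[OF rels_Ux(8)[OF True, of i]] True c
      by (simp add: Cw_def Cinvw_def sq_simps)
  qed (simp add: Cw_def Cinvw_def)
  then show "word_mat n \<rho> (Cw b i) * word_mat n \<rho> (Cinvw b i) = 1\<^sub>m n"
    "word_mat n \<rho> (Cinvw b i) * word_mat n \<rho> (Cw b i) = 1\<^sub>m n" by blast+
qed

lemma Ux_C_commute:
  assumes "x \<in> Gens (Ux b q \<alpha>)"
  shows "word_mat n \<rho> (Cw b i) * \<rho> x = \<rho> x * word_mat n \<rho> (Cw b i)"
    "word_mat n \<rho> (Cinvw b i) * \<rho> x = \<rho> x * word_mat n \<rho> (Cinvw b i)"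
proof -
  note x = Ux_carrier[OF assms]
  have "word_mat n \<rho> (Cw b i) * \<rho> x = \<rho> x * word_mat n \<rho> (Cw b i) \<and>
    word_mat n \<rho> (Cinvw b i) * \<rho> x = \<rho> x * word_mat n \<rho> (Cinvw b i)"
  proof (cases b)
    case True
    have c: "\<rho> (Cg i) \<in> carrier_mat n n" "\<rho> (Cinv i) \<in> carrier_mat n n"
      using True by (auto intro!: Ux_carrier simp: Gens_Ux central_gens_def)
    show ?thesis using Ux_rel_word[OF rels_Ux(9)[OF True assms, of i]] Ux_rel_word[OF rels_Ux(10)[OF True assms, of i]] True c x
      by (simp add: Cw_def Cinvw_def sq_simps)
  qed (use x in \<open>simp add: Cw_def Cinvw_def sq_simps\<close>)
  then show "word_mat n \<rho> (Cw b i) * \<rho> x = \<rho> x * word_mat n \<rho> (Cw b i)"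
    "word_mat n \<rho> (Cinvw b i) * \<rho> x = \<rho> x * word_mat n \<rho> (Cinvw b i)" by blast+
qed

lemma Ux_antipode_words:
  "lc_mat n \<rho> (antimult_word (Antipode (Ux b q \<alpha>)) (Cw b i)) = word_mat n \<rho> (Cinvw b i)"
  "lc_mat n \<rho> (antimult_word (Antipode (Ux b q \<alpha>)) (Kw q i)) = word_mat n \<rho> (Kinvw q i)"
  "lc_mat n \<rho> (antimult_word (Antipode (Ux b q \<alpha>)) (Cinvw b i @ Kinvw q i)) = word_mat n \<rho> (Kw q i) * word_mat n \<rho> (Cw b i)"
  "lc_mat n \<rho> (antimult_word (Antipode (Ux b q \<alpha>)) [Eg i]) = -1 \<cdot>\<^sub>m (word_mat n \<rho> (Kinvw q i) * (\<rho> (Eg i) * word_mat n \<rho> (Cinvw b i)))"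
  "lc_mat n \<rho> (antimult_word (Antipode (Ux b q \<alpha>)) [Fg i]) = -1 \<cdot>\<^sub>m (\<rho> (Fg i) * (word_mat n \<rho> (Kw q i) * word_mat n \<rho> (Cw b i)))"
  "lc_mat n \<rho> (antimult_word (Antipode (Ux b q \<alpha>)) []) = 1\<^sub>m n"
proof -
  note ws = Ux_word_carrier[OF gens_words(3)] Ux_word_carrier[OF gens_words(4)] Ux_word_carrier[OF gens_words(5)] Ux_word_carrier[OF gens_words(6)]
  have E: "\<rho> (Eg i) \<in> carrier_mat n n" "\<rho> (Fg i) \<in> carrier_mat n n" by (intro Ux_carrier gens_words)+
  have K: "\<rho> (Kg i) \<in> carrier_mat n n" "\<rho> (Kinv i) \<in> carrier_mat n n" if "q \<noteq> 1"
    using that by (auto intro!: Ux_carrier simp: Gens_Ux Uq_gens_def)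
  have C: "\<rho> (Cg i) \<in> carrier_mat n n" "\<rho> (Cinv i) \<in> carrier_mat n n" if b
    using that by (auto intro!: Ux_carrier simp: Gens_Ux central_gens_def)
  show "lc_mat n \<rho> (antimult_word (Antipode (Ux b q \<alpha>)) (Cw b i)) = word_mat n \<rho> (Cinvw b i)"
    using C by (cases b) (auto simp: Cw_def Cinvw_def lc_mult_unit sq_simps)
  show "lc_mat n \<rho> (antimult_word (Antipode (Ux b q \<alpha>)) (Kw q i)) = word_mat n \<rho> (Kinvw q i)"
    using K by (cases "q = 1") (auto simp: Kw_def Kinvw_def lc_mult_unit sq_simps)
  show "lc_mat n \<rho> (antimult_word (Antipode (Ux b q \<alpha>)) (Cinvw b i @ Kinvw q i)) = word_mat n \<rho> (Kw q i) * word_mat n \<rho> (Cw b i)"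
    using K C by (cases "q = 1"; cases b) (auto simp: Kw_def Kinvw_def Cw_def Cinvw_def lc_mult_def sq_simps)
  show "lc_mat n \<rho> (antimult_word (Antipode (Ux b q \<alpha>)) [Eg i]) = -1 \<cdot>\<^sub>m (word_mat n \<rho> (Kinvw q i) * (\<rho> (Eg i) * word_mat n \<rho> (Cinvw b i)))"
    using K C E by (cases "q = 1"; cases b) (auto simp: Kw_def Kinvw_def Cw_def Cinvw_def lc_mult_def sq_simps)
  show "lc_mat n \<rho> (antimult_word (Antipode (Ux b q \<alpha>)) [Fg i]) = -1 \<cdot>\<^sub>m (\<rho> (Fg i) * (word_mat n \<rho> (Kw q i) * word_mat n \<rho> (Cw b i)))"
    using K C E by (cases "q = 1"; cases b) (auto simp: Kw_def Kinvw_def Cw_def Cinvw_def lc_mult_def sq_simps)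
  show "lc_mat n \<rho> (antimult_word (Antipode (Ux b q \<alpha>)) []) = 1\<^sub>m n" by (simp add: sq_simps)
qed

text \<open>For E_i, F_i and H_i the two terms of the coproduct give opposite matrices once K_i and
  C_i are contracted with their inverses; for the group-like generators the identity is this
  contraction itself.\<close>

lemma Ux_hopf_identities:
  assumes x: "x \<in> Gens (Ux b q \<alpha>)"
  shows "lc2_mat n (\<lambda>a d. word_mat n \<rho> a * lc_mat n \<rho> (antimult_word (Antipode (Ux b q \<alpha>)) d)) (Coprod (Ux b q \<alpha>) x)
      = Counit (Ux b q \<alpha>) x \<cdot>\<^sub>m 1\<^sub>m n \<and>
    lc2_mat n (\<lambda>a d. lc_mat n \<rho> (antimult_word (Antipode (Ux b q \<alpha>)) a) * word_mat n \<rho> d) (Coprod (Ux b q \<alpha>) x)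
      = Counit (Ux b q \<alpha>) x \<cdot>\<^sub>m 1\<^sub>m n"
proof -
  note K = Ux_word_carrier[OF gens_words(3)] and Ki = Ux_word_carrier[OF gens_words(4)]
    and C = Ux_word_carrier[OF gens_words(5)] and Ci = Ux_word_carrier[OF gens_words(6)]
  have z: "0 \<cdot>\<^sub>m 1\<^sub>m n = (0\<^sub>m n n :: complex mat)" by (auto intro!: eq_matI)
  from x show ?thesis
  proof (cases rule: gens_cases)
    case (E i)
    have E: "\<rho> (Eg i) \<in> carrier_mat n n" by (intro Ux_carrier gens_words)
    have w: "word_mat n \<rho> [Eg i] = \<rho> (Eg i)" using E by (simp add: sq_simps)
    note KKi = cancel_left[OF Ux_K(1) K Ki]
    note CiE = Ux_C_commute[OF gens_words(1)]
    show ?thesis unfolding \<open>x = Eg i\<close> Ux_simps lc2_mat_def mat_sum_simps case_prod_conv Ux_antipode_words w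
      using E K Ki C Ci by (simp add: z sq_simps KKi CiE Ux_C add_neg_zero)
  next
    case (F i)
    have F: "\<rho> (Fg i) \<in> carrier_mat n n" by (intro Ux_carrier gens_words)
    have w: "word_mat n \<rho> [Fg i] = \<rho> (Fg i)" using F by (simp add: sq_simps)
    have wC: "word_mat n \<rho> (Cinvw b i @ Kinvw q i) = word_mat n \<rho> (Cinvw b i) * word_mat n \<rho> (Kinvw q i)"
      using gens_words(4,6)[where i = i and b = b and q = q and \<alpha> = \<alpha>] by (intro word_mat_append) (auto intro: Ux_carrier)
    note KKi = cancel_left[OF Ux_K(1) K Ki] and CCi = cancel_left[OF Ux_C(1) C Ci]
    show ?thesis unfolding \<open>x = Fg i\<close> Ux_simps lc2_mat_def mat_sum_simps case_prod_conv Ux_antipode_words w wC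
      using F K Ki C Ci by (simp add: z sq_simps KKi CCi Ux_K add_neg_zero)
  next
    case (H i)
    have "\<rho> (Hg i) \<in> carrier_mat n n" using x H by (intro Ux_carrier) simp
    then show ?thesis unfolding \<open>x = Hg i\<close> Ux_simps lc2_mat_def mat_sum_simps case_prod_conv
      by (simp add: lc_mult_unit z sq_simps add_neg_zero)
  next
    case (K i)
    have c: "\<rho> (Kg i) \<in> carrier_mat n n" "\<rho> (Kinv i) \<in> carrier_mat n n"
      using K by (auto intro!: Ux_carrier simp: Gens_Ux Uq_gens_def)
    show ?thesis unfolding \<open>x = Kg i\<close> Ux_simps lc2_mat_def mat_sum_simps case_prod_conv
      using Ux_K[of i] c K by (simp add: lc_mult_unit sq_simps Kw_def Kinvw_def)
  next
    case (Kinv i)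
    have c: "\<rho> (Kg i) \<in> carrier_mat n n" "\<rho> (Kinv i) \<in> carrier_mat n n"
      using Kinv by (auto intro!: Ux_carrier simp: Gens_Ux Uq_gens_def)
    show ?thesis unfolding \<open>x = gen.Kinv i\<close> Ux_simps lc2_mat_def mat_sum_simps case_prod_conv
      using Ux_K[of i] c Kinv by (simp add: lc_mult_unit sq_simps Kw_def Kinvw_def)
  next
    case (C i)
    have c: "\<rho> (Cg i) \<in> carrier_mat n n" "\<rho> (Cinv i) \<in> carrier_mat n n"
      using C by (auto intro!: Ux_carrier simp: Gens_Ux central_gens_def)
    show ?thesis unfolding \<open>x = Cg i\<close> Ux_simps lc2_mat_def mat_sum_simps case_prod_conv
      using Ux_C[of i] c C by (simp add: lc_mult_unit sq_simps Cw_def Cinvw_def)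
  next
    case (Cinv i)
    have c: "\<rho> (Cg i) \<in> carrier_mat n n" "\<rho> (Cinv i) \<in> carrier_mat n n"
      using Cinv by (auto intro!: Ux_carrier simp: Gens_Ux central_gens_def)
    show ?thesis unfolding \<open>x = gen.Cinv i\<close> Ux_simps lc2_mat_def mat_sum_simps case_prod_conv
      using Ux_C[of i] c Cinv by (simp add: lc_mult_unit sq_simps Cw_def Cinvw_def)
  qed
qed

end

lemma star_rep_rels_hold: "star_rep (Ux b q \<alpha>) n \<rho> \<Longrightarrow> Ux_rels_hold b q \<alpha> n \<rho>"
  by (simp add: star_rep_def Ux_rels_hold_def)

lemma star_rep_Ux_unitary_rep:
  assumes "star_rep (Ux b q \<alpha>) n \<rho>" "ob n \<rho>"
  shows "unitary_rep (reconstruct (Ux b q \<alpha>) ob) (coeff_corep (Gens (Ux b q \<alpha>)) n \<rho>)"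
  by (rule star_rep_unitary_rep[where ob = ob, OF hopf_closed_Ux assms])
    (use Ux_hopf_identities[OF star_rep_rels_hold[OF assms(1)]] in blast)+

section \<open>From unitarity back to a *-representation\<close>

context
  fixes b q and \<alpha> :: "'r \<Rightarrow> 'e::euclidean_space" and ob and u
  assumes ur: "unitary_rep (reconstruct (Ux b q \<alpha>) ob) u"
    and ob: "\<And>n \<rho>. ob n \<rho> \<Longrightarrow> star_rep (Ux b q \<alpha>) n \<rho>"
begin

interpretation square_matrices "dim_row u" .

lemma unitary_rep_Ux_facts:
  shows "mult_corep (Gens (Ux b q \<alpha>)) u"
    and "i < dim_row u \<Longrightarrow> j < dim_row u \<Longrightarrow> u $$ (i, j) \<in> Fun (reconstruct (Ux b q \<alpha>) ob)"
    and "x \<in> Gens (Ux b q \<alpha>) \<Longrightarrow>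
      lc2_mat (dim_row u) (\<lambda>a d. word_mat (dim_row u) (corep_action u) a * coinverse (Ux b q \<alpha>) (dim_row u) (corep_action u) d)
        (Coprod (Ux b q \<alpha>) x) = Counit (Ux b q \<alpha>) x \<cdot>\<^sub>m 1\<^sub>m (dim_row u)"
proof -
  note all = iffD1[OF unitary_rep_iff[OF hopf_closed_Ux] ur]
  show "mult_corep (Gens (Ux b q \<alpha>)) u" by (rule all[THEN conjunct1])
  show "u $$ (i, j) \<in> Fun (reconstruct (Ux b q \<alpha>) ob)" if "i < dim_row u" "j < dim_row u"
    by (rule all[THEN conjunct2, THEN conjunct1, rule_format, OF that])
  assume "x \<in> Gens (Ux b q \<alpha>)"
  then have x: "set [x] \<subseteq> Gens (Ux b q \<alpha>)" by simp
  have c: "coprod_word (Coprod (Ux b q \<alpha>)) [x] = Coprod (Ux b q \<alpha>) x"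
    unfolding coprod_word_Cons by (simp add: lc2_mult_unit)
  show "lc2_mat (dim_row u) (\<lambda>a d. word_mat (dim_row u) (corep_action u) a * coinverse (Ux b q \<alpha>) (dim_row u) (corep_action u) d)
        (Coprod (Ux b q \<alpha>) x) = Counit (Ux b q \<alpha>) x \<cdot>\<^sub>m 1\<^sub>m (dim_row u)"
    using all[THEN conjunct2, THEN conjunct2, rule_format, OF x] unfolding c by simp
qed

lemma unitary_rep_Ux_identity:
  "\<exists>B. finite B \<and> (\<forall>(n, \<rho>)\<in>B. ob n \<rho>) \<and> (\<forall>p s. lc_in (Gens (Ux b q \<alpha>)) p \<longrightarrow> lc_in (Gens (Ux b q \<alpha>)) s \<longrightarrow>
    (\<forall>(n, \<rho>)\<in>B. lc_mat n \<rho> p = lc_mat n \<rho> s) \<longrightarrow>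
    lc_mat (dim_row u) (corep_action u) p = lc_mat (dim_row u) (corep_action u) s)"
  by (rule corep_identity[OF unitary_rep_Ux_facts(1,2)]) (auto intro: star_rep_carrier[OF ob])

text \<open>The relations hold in every object of the category and involve only generators, so
  \<open>corep_identity\<close> carries them over to \<open>u\<close>.\<close>

lemma unitary_rep_Ux_rels_hold: "Ux_rels_hold b q \<alpha> (dim_row u) (corep_action u)"
  unfolding Ux_rels_hold_def
proof (intro conjI ballI)
  show "corep_action u x \<in> carrier_mat (dim_row u) (dim_row u)" for x
    by (rule mult_corep_action_carrier[OF unitary_rep_Ux_facts(1)])
  obtain B where B: "\<forall>(n, \<rho>)\<in>B. ob n \<rho>" "\<forall>p s. lc_in (Gens (Ux b q \<alpha>)) p \<longrightarrow> lc_in (Gens (Ux b q \<alpha>)) s \<longrightarrow>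
    (\<forall>(n, \<rho>)\<in>B. lc_mat n \<rho> p = lc_mat n \<rho> s) \<longrightarrow>
    lc_mat (dim_row u) (corep_action u) p = lc_mat (dim_row u) (corep_action u) s"
    using unitary_rep_Ux_identity by (elim exE conjE)
  fix t assume t: "t \<in> Rels (Ux b q \<alpha>)"
  obtain p s where ps: "t = (p, s)" by (cases t)
  have "lc_mat n \<rho> p = lc_mat n \<rho> s" if "(n, \<rho>) \<in> B" for n \<rho>
  proof -
    have "ob n \<rho>" using bspec[OF B(1) that] by simp
    then have "star_rep (Ux b q \<alpha>) n \<rho>" by (rule ob)
    from bspec[OF this[unfolded star_rep_def, THEN conjunct2, THEN conjunct1] t] show ?thesis by (simp add: ps)
  qed
  then show "case t of (p, s) \<Rightarrow> lc_mat (dim_row u) (corep_action u) p = lc_mat (dim_row u) (corep_action u) s"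
    using B(2)[rule_format, of p s] rels_closed_Ux[OF t[unfolded ps]] unfolding ps by (simp add: case_prod_unfold)
qed

text \<open>
  Unitarity of \<open>u\<close>, evaluated at a single generator, already determines the adjoint of its action.
\<close>

lemma unitary_rep_Ux_invol:
  assumes "x \<in> Gens (Ux b q \<alpha>)"
  shows "lc_mat (dim_row u) (corep_action u) (Invol (Ux b q \<alpha>) x) = mat_adjoint (corep_action u x)"
proof -
  let ?n = "dim_row u" and ?\<rho> = "corep_action u" and ?A = "Ux b q \<alpha>"
  note rh = unitary_rep_Ux_rels_hold
  note X = Ux_carrier[OF rh]
  note eq = unitary_rep_Ux_facts(3)
  have z: "0 \<cdot>\<^sub>m 1\<^sub>m ?n = (0\<^sub>m ?n ?n :: complex mat)" by (auto intro!: eq_matI)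
  \<comment> \<open>Unitarity at \<open>Kg i\<close> says that the adjoint of K_i^-1 is a right
    inverse of K_i, hence equals K_i^-1. The adjoint of \<open>K_i^-1\<close> being known, taking
    adjoints in \<open>K_i K_i^-1 = 1\<close> settles K_i.\<close>
  have Kstar: "mat_adjoint (?\<rho> (Kinv i)) = ?\<rho> (Kinv i) \<and> mat_adjoint (?\<rho> (Kg i)) = ?\<rho> (Kg i)" if q: "q \<noteq> 1" for i
  proof -
    have K: "Kg i \<in> Gens ?A" "Kinv i \<in> Gens ?A" using q by (auto simp: Gens_Ux Uq_gens_def)
    note c = X[OF K(1)] X[OF K(2)]
    have co: "coinverse ?A ?n ?\<rho> [Kg i] = mat_adjoint (?\<rho> (Kinv i))"
      unfolding coinverse_def by (simp add: lc_mult_def lc_star_def sq_simps c)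
    have KK: "?\<rho> (Kg i) * ?\<rho> (Kinv i) = 1\<^sub>m ?n" "?\<rho> (Kinv i) * ?\<rho> (Kg i) = 1\<^sub>m ?n"
      using Ux_K[OF rh, of i] q c by (simp_all add: Kw_def Kinvw_def sq_simps)
    have 1: "?\<rho> (Kg i) * mat_adjoint (?\<rho> (Kinv i)) = 1\<^sub>m ?n"
      using eq[OF K(1)] unfolding Ux_simps lc2_mat_def mat_sum_simps case_prod_conv co using c by (simp add: sq_simps)
    have 2: "mat_adjoint (?\<rho> (Kinv i)) = ?\<rho> (Kinv i)"
      using cancel_left[OF KK(2) c(2,1), of "mat_adjoint (?\<rho> (Kinv i))"] c 1 by (simp add: sq_simps)
    have "mat_adjoint (?\<rho> (Kg i) * ?\<rho> (Kinv i)) = 1\<^sub>m ?n" unfolding KK by simp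
    then have "?\<rho> (Kinv i) * mat_adjoint (?\<rho> (Kg i)) = 1\<^sub>m ?n" using c 2 by (simp add: sq_simps)
    then have "mat_adjoint (?\<rho> (Kg i)) = ?\<rho> (Kg i)"
      using cancel_left[OF KK(1) c(1,2), of "mat_adjoint (?\<rho> (Kg i))"] c by (simp add: sq_simps)
    then show ?thesis using 2 by blast
  qed
  \<comment> \<open>Unitarity at \<open>Cg i\<close> says directly that C_i acts by a unitary
    matrix, whose inverse is the action of C_i^-1.\<close>
  have Cstar: "mat_adjoint (?\<rho> (Cg i)) = ?\<rho> (Cinv i) \<and> mat_adjoint (?\<rho> (Cinv i)) = ?\<rho> (Cg i)" if b: b for i
  proof -
    have C: "Cg i \<in> Gens ?A" "Cinv i \<in> Gens ?A" using b by (auto simp: Gens_Ux central_gens_def)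
    note c = X[OF C(1)] X[OF C(2)]
    have co: "coinverse ?A ?n ?\<rho> [Cg i] = mat_adjoint (?\<rho> (Cg i))"
      unfolding coinverse_def by (simp add: lc_mult_def lc_star_def sq_simps c)
    have CC: "?\<rho> (Cinv i) * ?\<rho> (Cg i) = 1\<^sub>m ?n"
      using Ux_C[OF rh, of i] b c by (simp_all add: Cw_def Cinvw_def sq_simps)
    have 1: "?\<rho> (Cg i) * mat_adjoint (?\<rho> (Cg i)) = 1\<^sub>m ?n"
      using eq[OF C(1)] unfolding Ux_simps lc2_mat_def mat_sum_simps case_prod_conv co using c by (simp add: sq_simps)
    have 2: "mat_adjoint (?\<rho> (Cg i)) = ?\<rho> (Cinv i)"
      using cancel_left[OF CC c(2,1), of "mat_adjoint (?\<rho> (Cg i))"] c 1 by (simp add: sq_simps)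
    then show ?thesis by (metis mat_adjoint_adjoint)
  qed
  \<comment> \<open>Unitarity at \<open>Eg i\<close> reads \<open>E C^* - K F^* C^* = 0\<close>; the
    matrix \<open>C^*\<close> is invertible and cancels.\<close>
  have EF: "?\<rho> (Eg i) = word_mat ?n ?\<rho> (Kw q i) * mat_adjoint (?\<rho> (Fg i))" for i
  proof -
    note K = Ux_word_carrier[OF rh gens_words(3)] and Ki = Ux_word_carrier[OF rh gens_words(4)]
      and C = Ux_word_carrier[OF rh gens_words(5)] and Ci = Ux_word_carrier[OF rh gens_words(6)]
    have E: "?\<rho> (Eg i) \<in> carrier_mat ?n ?n" and F: "?\<rho> (Fg i) \<in> carrier_mat ?n ?n" by (intro X gens_words)+
    have coC: "coinverse ?A ?n ?\<rho> (Cw b i) = mat_adjoint (word_mat ?n ?\<rho> (Cw b i))"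
    proof (cases b)
      case True
      have "?\<rho> (Cg i) \<in> carrier_mat ?n ?n" using True by (auto intro!: X simp: Gens_Ux central_gens_def)
      then show ?thesis unfolding coinverse_def using True by (simp add: Cw_def lc_mult_def lc_star_def sq_simps)
    qed (simp add: coinverse_def Cw_def lc_mult_def lc_star_def sq_simps)
    \<comment> \<open>The involution turns the antipode \<open>- K^-1 E C^-1\<close> of E_i into
      \<open>- C F K K^-1\<close>, of which \<open>- C F\<close> is left in the
      representation.\<close>
    have "lc_star (Uq_invol q) (antimult_word (Antipode ?A) [Eg i]) = [(-1, Cw b i @ [Fg i] @ Kw q i @ Kinvw q i)]"
      by (cases b; cases "q = 1") (simp_all add: lc_mult_def lc_star_def Cw_def Cinvw_def Kw_def Kinvw_def)
    then have coE: "coinverse ?A ?n ?\<rho> [Eg i] = mat_adjoint (lc_mat ?n ?\<rho> [(-1, Cw b i @ [Fg i] @ Kw q i @ Kinvw q i)])"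
      unfolding coinverse_def by simp
    have wc: "word_mat ?n ?\<rho> (Cw b i @ [Fg i] @ Kw q i @ Kinvw q i) = word_mat ?n ?\<rho> (Cw b i) * ?\<rho> (Fg i)"
    proof -
      have "word_mat ?n ?\<rho> (Kw q i @ Kinvw q i) = 1\<^sub>m ?n"
        using gens_words(3,4)[where i = i and b = b and q = q and \<alpha> = \<alpha>]
        by (subst word_mat_append) (auto intro: X simp: Ux_K[OF rh])
      moreover have "word_mat ?n ?\<rho> (Cw b i @ [Fg i] @ Kw q i @ Kinvw q i) =
          word_mat ?n ?\<rho> (Cw b i) * (?\<rho> (Fg i) * word_mat ?n ?\<rho> (Kw q i @ Kinvw q i))"
        using gens_words(2,3,4,5)[where i = i and b = b and q = q and \<alpha> = \<alpha>]
        by (subst word_mat_append) (auto intro: X)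
      ultimately show ?thesis using F by (simp add: sq_simps)
    qed
    have coE': "coinverse ?A ?n ?\<rho> [Eg i] = - 1 \<cdot>\<^sub>m (mat_adjoint (?\<rho> (Fg i)) * mat_adjoint (word_mat ?n ?\<rho> (Cw b i)))"
      unfolding coE using C F by (subst lc_mat_single) (auto simp: wc[simplified] mat_adjoint_smult sq_simps)
    have w: "word_mat ?n ?\<rho> [Eg i] = ?\<rho> (Eg i)" using E by (simp add: sq_simps)
    let ?C = "mat_adjoint (word_mat ?n ?\<rho> (Cw b i))" and ?K = "word_mat ?n ?\<rho> (Kw q i)" and ?F = "mat_adjoint (?\<rho> (Fg i))"
      and ?Ci = "mat_adjoint (word_mat ?n ?\<rho> (Cinvw b i))"
    have "?\<rho> (Eg i) * ?C + - 1 \<cdot>\<^sub>m (?K * (?F * ?C)) = 0\<^sub>m ?n ?n"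
      using eq[OF gens_words(1)[where i = i]] unfolding Ux_simps lc2_mat_def mat_sum_simps case_prod_conv coC coE' w
      using E F K C by (simp add: z sq_simps)
    then have 1: "?\<rho> (Eg i) * ?C = ?K * (?F * ?C)"
      by (rule add_neg_eq_zero[rotated 2]) (use E F K C in simp_all)
    have CC: "?C * ?Ci = 1\<^sub>m ?n"
      using C Ci Ux_C(2)[OF rh, of i] by (simp add: sq_simps flip: mat_adjoint_mult[of _ ?n ?n _ ?n])
    have "?\<rho> (Eg i) = ?\<rho> (Eg i) * ?C * ?Ci" using CC E C Ci by (simp add: sq_simps)
    also have "\<dots> = ?K * ?F" unfolding 1 using CC K F C Ci by (simp add: sq_simps)
    finally show ?thesis .
  qed
  from assms show ?thesis
  proof (cases rule: gens_cases)
    case (E i)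
    note K = Ux_word_carrier[OF rh gens_words(3)[of q i b \<alpha>]]
    have F: "?\<rho> (Fg i) \<in> carrier_mat ?n ?n" by (intro X gens_words)
    have "mat_adjoint (word_mat ?n ?\<rho> (Kw q i)) = word_mat ?n ?\<rho> (Kw q i)"
    proof (cases "q = 1")
      case False
      then have "?\<rho> (Kg i) \<in> carrier_mat ?n ?n" by (auto intro!: X simp: Gens_Ux Uq_gens_def)
      then show ?thesis using Kstar[OF False, of i] False by (simp add: Kw_def sq_simps)
    qed (simp add: Kw_def)
    then show ?thesis using EF[of i] F K by (simp add: E sq_simps)
  next
    case (F i)
    note K = Ux_word_carrier[OF rh gens_words(3)[of q i b \<alpha>]] and Ki = Ux_word_carrier[OF rh gens_words(4)[of q i b \<alpha>]]
    have E: "?\<rho> (Eg i) \<in> carrier_mat ?n ?n" and F': "?\<rho> (Fg i) \<in> carrier_mat ?n ?n" by (intro X gens_words)+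
    have "word_mat ?n ?\<rho> (Kinvw q i @ [Eg i]) = word_mat ?n ?\<rho> (Kinvw q i) * ?\<rho> (Eg i)"
      using gens_words(1,4)[where i = i and b = b and q = q and \<alpha> = \<alpha>] E
      by (subst word_mat_append) (auto intro: X simp: sq_simps)
    also have "\<dots> = mat_adjoint (?\<rho> (Fg i))"
      unfolding EF[of i] using cancel_left[OF Ux_K(2)[OF rh] Ki K] F' by simp
    finally show ?thesis using F' by (simp add: F sq_simps)
  next
    case (K i)
    have "?\<rho> (Kg i) \<in> carrier_mat ?n ?n" using X[OF assms] K by simp
    then show ?thesis using Kstar[OF K(2), of i] by (simp add: K sq_simps)
  next
    case (Kinv i)
    have "?\<rho> (gen.Kinv i) \<in> carrier_mat ?n ?n" using X[OF assms] Kinv by simp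
    then show ?thesis using Kstar[OF Kinv(2), of i] by (simp add: Kinv sq_simps)
  next
    case (H i)
    have c: "?\<rho> (Hg i) \<in> carrier_mat ?n ?n" using X[OF assms] H by simp
    have co: "coinverse ?A ?n ?\<rho> [Hg i] = - 1 \<cdot>\<^sub>m mat_adjoint (?\<rho> (Hg i))" "coinverse ?A ?n ?\<rho> [] = 1\<^sub>m ?n"
      unfolding coinverse_def using c by (simp_all add: lc_mult_def lc_star_def sq_simps mat_adjoint_smult)
    have "?\<rho> (Hg i) + - 1 \<cdot>\<^sub>m mat_adjoint (?\<rho> (Hg i)) = 0\<^sub>m ?n ?n"
      using eq[OF assms] unfolding H(1) Ux_simps lc2_mat_def mat_sum_simps case_prod_conv co
      using c by (simp add: z sq_simps)
    then have "?\<rho> (Hg i) = mat_adjoint (?\<rho> (Hg i))"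
      by (rule add_neg_eq_zero[rotated 2]) (use c in simp_all)
    then show ?thesis using c by (simp add: H sq_simps)
  next
    case (C i)
    have "?\<rho> (Cinv i) \<in> carrier_mat ?n ?n" using C by (auto intro!: X simp: Gens_Ux central_gens_def)
    then show ?thesis using Cstar[OF C(2), of i] by (simp add: C sq_simps)
  next
    case (Cinv i)
    have "?\<rho> (Cg i) \<in> carrier_mat ?n ?n" using Cinv by (auto intro!: X simp: Gens_Ux central_gens_def)
    then show ?thesis using Cstar[OF Cinv(2), of i] by (simp add: Cinv sq_simps)
  qed
qed

lemma unitary_rep_Ux_star_rep: "star_rep (Ux b q \<alpha>) (dim_row u) (corep_action u)"
  using unitary_rep_Ux_rels_hold unitary_rep_Ux_invol unfolding star_rep_def Ux_rels_hold_def by blast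

end

section \<open>Weights and admissibility\<close>

context root_data
begin

lemma star_rep_torus:
  assumes "star_rep (Ux b q \<alpha>) n \<rho>"
  shows "\<rho> (torus_gen q i) \<in> carrier_mat n n" "mat_adjoint (\<rho> (torus_gen q i)) = \<rho> (torus_gen q i)"
proof -
  interpret square_matrices n .
  show c: "\<rho> (torus_gen q i) \<in> carrier_mat n n" by (rule star_rep_carrier[OF assms gens_words(7)])
  have "lc_mat n \<rho> (Uq_invol q (torus_gen q i)) = mat_adjoint (\<rho> (torus_gen q i))"
    using assms gens_words(7)[of q i b \<alpha>] by (simp add: star_rep_def)
  then show "mat_adjoint (\<rho> (torus_gen q i)) = \<rho> (torus_gen q i)"
    using c by (cases "q = 1") (simp_all add: torus_gen_def sq_simps)
qed

lemma graded_star_rep: "star_rep (Ux b q \<alpha>) n \<rho> \<Longrightarrow> admissible R \<alpha> q n \<rho> \<Longrightarrow> graded n \<rho>"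
  unfolding graded_def using star_rep_torus by simp

lemma simple_root: "\<alpha> i \<in> R"
  using sr by (auto simp: simple_roots_def)

lemma cartan_eq: "of_int (cartan \<alpha> i j) = 2 * inner (\<alpha> i) (\<alpha> j) / inner (\<alpha> i) (\<alpha> i)"
proof -
  have "2 * inner (\<alpha> i) (\<alpha> j) / inner (\<alpha> i) (\<alpha> i) \<in> \<int>"
    using rs simple_root unfolding root_system_def by simp
  then obtain k where "2 * inner (\<alpha> i) (\<alpha> j) / inner (\<alpha> i) (\<alpha> i) = of_int k" by (rule Ints_cases)
  then show ?thesis unfolding cartan_def by simp
qed

lemma q_root_powi: "q_root q \<alpha> i powi k = q powr (of_int k * inner (\<alpha> i) (\<alpha> i) / 2)"
proof -
  have "q_root q \<alpha> i powi k = q_root q \<alpha> i powr of_int k"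
    using q0 by (intro powr_real_of_int'[symmetric]) (auto simp: q_root_def)
  then show ?thesis by (simp add: q_root_def powr_powr mult.commute)
qed

text \<open>For \<open>q \<noteq> 1\<close> this is
  \<open>q_j^(a_ji) = q^(\<alpha>_j, \<alpha>_i)\<close>, by the definitions of \<open>q_j\<close>
  and of the Cartan integer; for \<open>q = 1\<close> the Cartan integer is itself the difference of
  the eigenvalues.\<close>

lemma torus_eigenvalue_shift:
  "q = 1 \<Longrightarrow> torus_eigenvalue q \<alpha> (\<chi> + \<alpha> i) j = torus_eigenvalue q \<alpha> \<chi> j + of_int (cartan \<alpha> j i)"
  "q = 1 \<Longrightarrow> torus_eigenvalue q \<alpha> (\<chi> - \<alpha> i) j = torus_eigenvalue q \<alpha> \<chi> j - of_int (cartan \<alpha> j i)"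
  "q \<noteq> 1 \<Longrightarrow> torus_eigenvalue q \<alpha> (\<chi> + \<alpha> i) j = q_root q \<alpha> j powi cartan \<alpha> j i * torus_eigenvalue q \<alpha> \<chi> j"
  "q \<noteq> 1 \<Longrightarrow> torus_eigenvalue q \<alpha> (\<chi> - \<alpha> i) j = q_root q \<alpha> j powi (- cartan \<alpha> j i) * torus_eigenvalue q \<alpha> \<chi> j"
proof -
  have nz: "inner (\<alpha> j) (\<alpha> j) \<noteq> 0" using root_pos[of j] by simp
  show "q = 1 \<Longrightarrow> torus_eigenvalue q \<alpha> (\<chi> + \<alpha> i) j = torus_eigenvalue q \<alpha> \<chi> j + of_int (cartan \<alpha> j i)"
    "q = 1 \<Longrightarrow> torus_eigenvalue q \<alpha> (\<chi> - \<alpha> i) j = torus_eigenvalue q \<alpha> \<chi> j - of_int (cartan \<alpha> j i)"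
    by (simp_all add: torus_eigenvalue_def cartan_eq inner_add_right inner_diff_right add_divide_distrib diff_divide_distrib distrib_left right_diff_distrib)
  have c: "of_int (cartan \<alpha> j i) * inner (\<alpha> j) (\<alpha> j) / 2 = inner (\<alpha> j) (\<alpha> i)"
    using nz by (simp add: cartan_eq)
  show "q \<noteq> 1 \<Longrightarrow> torus_eigenvalue q \<alpha> (\<chi> + \<alpha> i) j = q_root q \<alpha> j powi cartan \<alpha> j i * torus_eigenvalue q \<alpha> \<chi> j"
    unfolding q_root_powi c by (simp add: torus_eigenvalue_def inner_add_right powr_add)
  have c': "of_int (- cartan \<alpha> j i) * inner (\<alpha> j) (\<alpha> j) / 2 = - inner (\<alpha> j) (\<alpha> i)"
    using c by simp
  show "q \<noteq> 1 \<Longrightarrow> torus_eigenvalue q \<alpha> (\<chi> - \<alpha> i) j = q_root q \<alpha> j powi (- cartan \<alpha> j i) * torus_eigenvalue q \<alpha> \<chi> j"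
    unfolding q_root_powi c' by (simp add: torus_eigenvalue_def inner_diff_right powr_diff powr_minus divide_inverse)
qed

lemma shift_conjugation:
  fixes X K Ki :: "complex mat"
  assumes c: "X \<in> carrier_mat n n" "K \<in> carrier_mat n n" "Ki \<in> carrier_mat n n"
    and K: "Ki * K = 1\<^sub>m n" and eq: "K * (X * Ki) = c \<cdot>\<^sub>m X"
    and v: "v \<in> carrier_vec n" "K *\<^sub>v v = k \<cdot>\<^sub>v v"
  shows "K *\<^sub>v (X *\<^sub>v v) = (c * k) \<cdot>\<^sub>v (X *\<^sub>v v)"
proof -
  interpret square_matrices n .
  have "K * X = K * (X * Ki) * K" using c K by (simp add: sq_simps)
  then have "K * X = c \<cdot>\<^sub>m (X * K)" using c unfolding eq by (simp add: sq_simps)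
  moreover have "K *\<^sub>v (X *\<^sub>v v) = (K * X) *\<^sub>v v" by (rule assoc_mult_mat_vec[OF c(2,1) v(1), symmetric])
  ultimately have "K *\<^sub>v (X *\<^sub>v v) = c \<cdot>\<^sub>v ((X * K) *\<^sub>v v)"
    using smult_mult_mat_vec[OF mult_carrier_mat[OF c(1,2)] v(1)] by simp
  then show ?thesis
    using assoc_mult_mat_vec[OF c(1,2) v(1)] mult_mat_vec[OF c(1) v(1)] v(2) by (simp add: smult_smult_assoc)
qed

lemma shift_commutator:
  fixes X H :: "complex mat"
  assumes c: "X \<in> carrier_mat n n" "H \<in> carrier_mat n n"
    and eq: "H * X + - 1 \<cdot>\<^sub>m (X * H) = c \<cdot>\<^sub>m X"
    and v: "v \<in> carrier_vec n" "H *\<^sub>v v = k \<cdot>\<^sub>v v"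
  shows "H *\<^sub>v (X *\<^sub>v v) = (k + c) \<cdot>\<^sub>v (X *\<^sub>v v)"
proof -
  have HX: "H * X \<in> carrier_mat n n" "X * H \<in> carrier_mat n n" using c by (simp_all add: mult_carrier_mat[of _ n n])
  have Xv: "X *\<^sub>v v \<in> carrier_vec n" using c v by simp
  have XH: "(X * H) *\<^sub>v v = k \<cdot>\<^sub>v (X *\<^sub>v v)"
    using assoc_mult_mat_vec[OF c v(1)] mult_mat_vec[OF c(1) v(1)] v(2) by simp
  have H': "(H * X) *\<^sub>v v = H *\<^sub>v (X *\<^sub>v v)" by (rule assoc_mult_mat_vec[OF c(2,1) v(1)])
  have "(H * X + - 1 \<cdot>\<^sub>m (X * H)) *\<^sub>v v = (c \<cdot>\<^sub>m X) *\<^sub>v v" using eq by simp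
  then have e: "H *\<^sub>v (X *\<^sub>v v) + - 1 \<cdot>\<^sub>v (k \<cdot>\<^sub>v (X *\<^sub>v v)) = c \<cdot>\<^sub>v (X *\<^sub>v v)"
    using add_mult_distrib_mat_vec[OF HX(1) smult_carrier_mat[OF HX(2)] v(1)]
      smult_mult_mat_vec[OF HX(2) v(1)] smult_mult_mat_vec[OF c(1) v(1)] XH H' by simp
  show ?thesis
  proof (rule eq_vecI)
    fix i assume "i < dim_vec ((k + c) \<cdot>\<^sub>v (X *\<^sub>v v))"
    then have i: "i < n" using c by simp
    have HXv: "H *\<^sub>v (X *\<^sub>v v) \<in> carrier_vec n" using c Xv by simp
    have d: "dim_vec (H *\<^sub>v (X *\<^sub>v v)) = n" "dim_vec (X *\<^sub>v v) = n" using HXv Xv by (auto dest: carrier_vecD)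
    have "(H *\<^sub>v (X *\<^sub>v v) + - 1 \<cdot>\<^sub>v (k \<cdot>\<^sub>v (X *\<^sub>v v))) $ i = (c \<cdot>\<^sub>v (X *\<^sub>v v)) $ i" unfolding e ..
    then have "(H *\<^sub>v (X *\<^sub>v v)) $ i - k * (X *\<^sub>v v) $ i = c * (X *\<^sub>v v) $ i"
      using i d by (simp del: index_mult_mat_vec)
    then show "(H *\<^sub>v (X *\<^sub>v v)) $ i = ((k + c) \<cdot>\<^sub>v (X *\<^sub>v v)) $ i"
      using i d by (simp add: algebra_simps del: index_mult_mat_vec)
  qed (use c in auto)
qed

text \<open>The relations between torus generators and E_i, F_i change each eigenvalue by exactly
  the amount computed in \<open>torus_eigenvalue_shift\<close>. The twist is thereby evaluated at
  weights shifted by simple roots.\<close>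

lemma weight_shift:
  assumes rh: "Ux_rels_hold b q \<alpha> n \<rho>" and v: "v \<in> W n \<rho> \<chi>"
  shows "\<rho> (Eg i) *\<^sub>v v \<in> W n \<rho> (\<chi> + \<alpha> i)" "\<rho> (Fg i) *\<^sub>v v \<in> W n \<rho> (\<chi> - \<alpha> i)"
proof -
  interpret square_matrices n .
  have E: "\<rho> (Eg i) \<in> carrier_mat n n" and F: "\<rho> (Fg i) \<in> carrier_mat n n" by (intro Ux_carrier[OF rh] gens_words)+
  note vc = W_carrier[OF v]
  have ev: "\<rho> (torus_gen q j) *\<^sub>v v = of_real (torus_eigenvalue q \<alpha> \<chi> j) \<cdot>\<^sub>v v" for j
    using v by (simp add: weight_space_iff)
  have "\<rho> (torus_gen q j) *\<^sub>v (\<rho> (Eg i) *\<^sub>v v) = of_real (torus_eigenvalue q \<alpha> (\<chi> + \<alpha> i) j) \<cdot>\<^sub>v (\<rho> (Eg i) *\<^sub>v v) \<and>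
    \<rho> (torus_gen q j) *\<^sub>v (\<rho> (Fg i) *\<^sub>v v) = of_real (torus_eigenvalue q \<alpha> (\<chi> - \<alpha> i) j) \<cdot>\<^sub>v (\<rho> (Fg i) *\<^sub>v v)" for j
  proof (cases "q = 1")
    case True
    have H: "\<rho> (Hg j) \<in> carrier_mat n n" using Ux_carrier[OF rh gens_words(7)[of q j b \<alpha>]] True by (simp add: torus_gen_def)
    have 1: "\<rho> (Hg j) * \<rho> (Eg i) + - 1 \<cdot>\<^sub>m (\<rho> (Eg i) * \<rho> (Hg j)) = of_int (cartan \<alpha> j i) \<cdot>\<^sub>m \<rho> (Eg i)"
      using Ux_rel[OF rh rels_Ux(5)[OF True, of j i \<alpha> b]] E H by (simp add: sq_simps)
    have 2: "\<rho> (Hg j) * \<rho> (Fg i) + - 1 \<cdot>\<^sub>m (\<rho> (Fg i) * \<rho> (Hg j)) = of_int (- cartan \<alpha> j i) \<cdot>\<^sub>m \<rho> (Fg i)"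
      using Ux_rel[OF rh rels_Ux(6)[OF True, of j i \<alpha> b]] F H by (simp add: sq_simps)
    show ?thesis
      using shift_commutator[OF E H 1 vc, of "of_real (torus_eigenvalue q \<alpha> \<chi> j)"]
        shift_commutator[OF F H 2 vc, of "of_real (torus_eigenvalue q \<alpha> \<chi> j)"] ev[of j]
      unfolding torus_eigenvalue_shift(1,2)[OF True] using True by (simp add: torus_gen_def)
  next
    case False
    have K: "\<rho> (Kg j) \<in> carrier_mat n n" "\<rho> (Kinv j) \<in> carrier_mat n n"
      using False by (auto intro!: Ux_carrier[OF rh] simp: Gens_Ux Uq_gens_def)
    have KK: "\<rho> (Kinv j) * \<rho> (Kg j) = 1\<^sub>m n"
      using Ux_K(2)[OF rh, of j] K False by (simp add: Kw_def Kinvw_def sq_simps)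
    have 1: "\<rho> (Kg j) * (\<rho> (Eg i) * \<rho> (Kinv j)) = of_real (q_root q \<alpha> j powi cartan \<alpha> j i) \<cdot>\<^sub>m \<rho> (Eg i)"
      using Ux_rel_word[OF rh rels_Ux(3)[OF False, of j i \<alpha> b]] E K by (simp add: sq_simps)
    have 2: "\<rho> (Kg j) * (\<rho> (Fg i) * \<rho> (Kinv j)) = of_real (q_root q \<alpha> j powi (- cartan \<alpha> j i)) \<cdot>\<^sub>m \<rho> (Fg i)"
      using Ux_rel_word[OF rh rels_Ux(4)[OF False, of j i \<alpha> b]] F K by (simp add: sq_simps)
    show ?thesis
      using shift_conjugation[OF E K KK 1 vc, of "of_real (torus_eigenvalue q \<alpha> \<chi> j)"]
        shift_conjugation[OF F K KK 2 vc, of "of_real (torus_eigenvalue q \<alpha> \<chi> j)"] ev[of j]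
      unfolding torus_eigenvalue_shift(3,4)[OF False] using False by (simp add: torus_gen_def)
  qed
  then show "\<rho> (Eg i) *\<^sub>v v \<in> W n \<rho> (\<chi> + \<alpha> i)" "\<rho> (Fg i) *\<^sub>v v \<in> W n \<rho> (\<chi> - \<alpha> i)"
    using E F vc by (simp_all add: weight_space_iff)
qed

definition xadmissible :: "bool \<Rightarrow> ('r \<Rightarrow> 'e \<Rightarrow> complex) \<Rightarrow> nat \<Rightarrow> ('r gen \<Rightarrow> complex mat) \<Rightarrow> bool" where
  "xadmissible b \<tau> n \<rho> \<longleftrightarrow> admissible R \<alpha> q n \<rho> \<and>
     (b \<longrightarrow> (\<forall>\<chi>\<in>P. \<forall>v\<in>W n \<rho> \<chi>. \<forall>i. \<rho> (Cg i) *\<^sub>v v = \<tau> i \<chi> \<cdot>\<^sub>v v))"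

definition Gx :: "bool \<Rightarrow> ('r \<Rightarrow> 'e \<Rightarrow> complex) \<Rightarrow> 'r gen cqg" where
  "Gx b \<tau> = reconstruct (Ux b q \<alpha>) (\<lambda>n \<rho>. star_rep (Ux b q \<alpha>) n \<rho> \<and> xadmissible b \<tau> n \<rho>)"

lemma Gx_simps: "Gx False \<tau> = Gq R \<alpha> q" "Gx True \<tau> = Gq_tau R \<alpha> q \<tau>"
  by (simp_all add: Gx_def Gq_def Gq_tau_def Ux_def xadmissible_def tau_admissible_def)

section \<open>Admissibility of unitary representations\<close>

lemma lc_eval_concat: "lc_eval e (concat ps) = (\<Sum>p\<leftarrow>ps. lc_eval e p)"
  by (induction ps) auto

text \<open>The character by which polynomials in the torus generators act on weight vectors. The
  value 0 at the remaining generators is a filler; the polynomials in question contain none of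
  them.\<close>

definition torus_weight :: "'e \<Rightarrow> 'r gen \<Rightarrow> complex" where
  "torus_weight \<chi> x = (case x of Kg i \<Rightarrow> of_real (torus_eigenvalue q \<alpha> \<chi> i) | Hg i \<Rightarrow> of_real (torus_eigenvalue q \<alpha> \<chi> i) | _ \<Rightarrow> 0)"

lemma torus_weight_gen [simp]: "torus_weight \<chi> (torus_gen q i) = of_real (torus_eigenvalue q \<alpha> \<chi> i)"
  by (simp add: torus_weight_def torus_gen_def)

lemma lc_mat_weight:
  assumes c: "\<And>i. \<rho> (torus_gen q i) \<in> carrier_mat n n" and p: "lc_in (range (torus_gen q)) p" and v: "v \<in> W n \<rho> \<chi>"
  shows "lc_mat n \<rho> p *\<^sub>v v = lc_eval (torus_weight \<chi>) p \<cdot>\<^sub>v v"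
  by (rule lc_mat_eigen[OF p W_carrier[OF v]]) (use c v in \<open>auto simp: weight_space_iff\<close>)

text \<open>
  The weights of the finitely many representations whose coefficients span the entries of \<open>u\<close>
  suffice for \<open>u\<close>: the interpolated projections onto their weight spaces add up to 1 in each of
  these representations, hence for \<open>u\<close>.
\<close>

lemma unitary_rep_xadmissible:
  assumes u: "unitary_rep (Gx b \<tau>) u"
  shows "xadmissible b \<tau> (dim_row u) (corep_action u)"
proof -
  let ?N = "dim_row u" and ?\<sigma> = "corep_action u" and ?X = "Gens (Ux b q \<alpha>)"
  let ?ob = "\<lambda>n \<rho>. star_rep (Ux b q \<alpha>) n \<rho> \<and> xadmissible b \<tau> n \<rho>"
  have u': "unitary_rep (reconstruct (Ux b q \<alpha>) ?ob) u" using u by (simp add: Gx_def)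
  have ob: "?ob n \<rho> \<Longrightarrow> star_rep (Ux b q \<alpha>) n \<rho>" for n \<rho> by simp
  have star: "star_rep (Ux b q \<alpha>) ?N ?\<sigma>" by (rule unitary_rep_Ux_star_rep[OF u' ob])
  note \<sigma>c = star_rep_torus(1)[OF star] and X = star_rep_carrier[OF star]
  have "\<exists>B. finite B \<and> (\<forall>(n, \<rho>)\<in>B. ?ob n \<rho>) \<and> (\<forall>p s. lc_in ?X p \<longrightarrow> lc_in ?X s \<longrightarrow>
      (\<forall>(n, \<rho>)\<in>B. lc_mat n \<rho> p = lc_mat n \<rho> s) \<longrightarrow> lc_mat ?N ?\<sigma> p = lc_mat ?N ?\<sigma> s)"
    by (rule unitary_rep_Ux_identity[OF u']) simp
  then obtain B where B: "finite B" "\<forall>(n, \<rho>)\<in>B. ?ob n \<rho>"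
    "\<forall>p s. lc_in ?X p \<longrightarrow> lc_in ?X s \<longrightarrow> (\<forall>(n, \<rho>)\<in>B. lc_mat n \<rho> p = lc_mat n \<rho> s) \<longrightarrow> lc_mat ?N ?\<sigma> p = lc_mat ?N ?\<sigma> s"
    by (elim exE conjE)
  have Bob: "star_rep (Ux b q \<alpha>) (fst t) (snd t) \<and> xadmissible b \<tau> (fst t) (snd t)" if "t \<in> B" for t
    using bspec[OF B(2) that] by (simp add: case_prod_unfold)
  have "\<forall>t\<in>B. \<exists>M. finite M \<and> M \<subseteq> P \<and> carrier_vec (fst t) \<subseteq> vspan (fst t) (\<Union>\<chi>\<in>M. W (fst t) (snd t) \<chi>)"
    using Bob by (intro ballI admissible_finite_span) (simp add: xadmissible_def)
  from bchoice[OF this] obtain Mt where Mt: "\<forall>t\<in>B. finite (Mt t) \<and> Mt t \<subseteq> P \<and>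
      carrier_vec (fst t) \<subseteq> vspan (fst t) (\<Union>\<chi>\<in>Mt t. W (fst t) (snd t) \<chi>)" by (elim exE)
  define M where "M = (\<Union>t\<in>B. Mt t)"
  have fM: "finite M" unfolding M_def using B(1) Mt by (intro finite_UN_I) auto
  have MP: "M \<subseteq> P" unfolding M_def using Mt by (intro UN_least) blast
  have Mspan: "carrier_vec n \<subseteq> vspan n (\<Union>\<chi>\<in>M. W n \<rho> \<chi>)" if "(n, \<rho>) \<in> B" for n \<rho>
  proof -
    have "carrier_vec n \<subseteq> vspan n (\<Union>\<chi>\<in>Mt (n, \<rho>). W n \<rho> \<chi>)" using bspec[OF Mt that] by simp
    also have "\<dots> \<subseteq> vspan n (\<Union>\<chi>\<in>M. W n \<rho> \<chi>)"
      by (rule vspan_mono, rule UN_mono) (use that in \<open>auto simp: M_def\<close>)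
    finally show ?thesis .
  qed
  have lX: "lc_in (range (torus_gen q)) p \<Longrightarrow> lc_in ?X p" for p
    unfolding lc_in_def using gens_words(7)[of q _ b \<alpha>] by fastforce
  \<comment> \<open>Weight vectors with weights in \<open>M\<close> span each object of
    \<open>B\<close>. Agreement on them gives equality in all of \<open>B\<close>, hence in
    \<open>u\<close>.\<close>
  have transfer: "lc_mat ?N ?\<sigma> p = lc_mat ?N ?\<sigma> s" if ps: "lc_in ?X p" "lc_in ?X s"
    and eq: "\<And>n \<rho> \<chi> v. star_rep (Ux b q \<alpha>) n \<rho> \<Longrightarrow> xadmissible b \<tau> n \<rho> \<Longrightarrow> \<chi> \<in> M \<Longrightarrow> v \<in> W n \<rho> \<chi> \<Longrightarrow>
        lc_mat n \<rho> p *\<^sub>v v = lc_mat n \<rho> s *\<^sub>v v" for p s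
  proof (rule B(3)[rule_format, OF ps])
    fix t assume t: "t \<in> B"
    obtain n \<rho> where t': "t = (n, \<rho>)" by (cases t)
    have st: "star_rep (Ux b q \<alpha>) n \<rho>" "xadmissible b \<tau> n \<rho>" using Bob[OF t] by (simp_all add: t')
    have "lc_mat n \<rho> p = lc_mat n \<rho> s"
    proof (rule mat_eq_on_vspan[OF _ _ _ Mspan[OF t[unfolded t']]])
      show "lc_mat n \<rho> p \<in> carrier_mat n n" by (rule lc_mat_carrier[OF ps(1) star_rep_carrier[OF st(1)]])
      show "lc_mat n \<rho> s \<in> carrier_mat n n" by (rule lc_mat_carrier[OF ps(2) star_rep_carrier[OF st(1)]])
      show "(\<Union>\<chi>\<in>M. W n \<rho> \<chi>) \<subseteq> carrier_vec n" by (intro UN_least weight_space_carrier)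
      fix v assume "v \<in> (\<Union>\<chi>\<in>M. W n \<rho> \<chi>)"
      then obtain \<chi> where "\<chi> \<in> M" "v \<in> W n \<rho> \<chi>" by (rule UN_E)
      then show "lc_mat n \<rho> p *\<^sub>v v = lc_mat n \<rho> s *\<^sub>v v" by (rule eq[OF st])
    qed
    then show "case t of (n, \<rho>) \<Rightarrow> lc_mat n \<rho> p = lc_mat n \<rho> s" by (simp add: t')
  qed
  \<comment> \<open>\<open>D \<chi>\<close> will be the polynomial in the torus generators that is
    the indicator of \<open>\<chi>\<close> on \<open>M\<close>, that is, the projection onto the
    weight space of \<open>\<chi>\<close> in every object of \<open>B\<close>.\<close>
  have "\<forall>\<chi>\<in>M. \<exists>p. lc_in (range (torus_gen q)) p \<and> (\<forall>\<chi>'\<in>M. lc_eval (torus_weight \<chi>') p = (if \<chi>' = \<chi> then 1 else 0))"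
  proof
    fix \<chi> assume "\<chi> \<in> M"
    show "\<exists>p. lc_in (range (torus_gen q)) p \<and> (\<forall>\<chi>'\<in>M. lc_eval (torus_weight \<chi>') p = (if \<chi>' = \<chi> then 1 else 0))"
    proof (rule lc_interpolate[OF fM])
      fix i j :: 'e assume "i \<noteq> j"
      then obtain k where "torus_eigenvalue q \<alpha> i k \<noteq> torus_eigenvalue q \<alpha> j k" using torus_eigenvalue_separates by blast
      then show "\<exists>x\<in>range (torus_gen q). torus_weight i x \<noteq> torus_weight j x"
        by (intro bexI[of _ "torus_gen q k"]) auto
    qed
  qed
  from bchoice[OF this] obtain D where "\<forall>\<chi>\<in>M. lc_in (range (torus_gen q)) (D \<chi>) \<and>
      (\<forall>\<chi>'\<in>M. lc_eval (torus_weight \<chi>') (D \<chi>) = (if \<chi>' = \<chi> then 1 else 0))" by (elim exE)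
  then have D: "\<And>\<chi>. \<chi> \<in> M \<Longrightarrow> lc_in (range (torus_gen q)) (D \<chi>)"
    "\<And>\<chi> \<chi>'. \<chi> \<in> M \<Longrightarrow> \<chi>' \<in> M \<Longrightarrow> lc_eval (torus_weight \<chi>') (D \<chi>) = (if \<chi>' = \<chi> then 1 else 0)" by simp_all
  have Dw: "lc_mat n \<rho> (D \<chi>) *\<^sub>v v = (if \<chi>' = \<chi> then 1 else 0) \<cdot>\<^sub>v v"
    if "star_rep (Ux b q \<alpha>) n \<rho>" "\<chi> \<in> M" "\<chi>' \<in> M" "v \<in> W n \<rho> \<chi>'" for n \<rho> \<chi> \<chi>' v
    using lc_mat_weight[OF star_rep_torus(1)[OF that(1)] D(1)[OF that(2)] that(4)] D(2)[OF that(2,3)] by simp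
  have Dc: "lc_mat ?N ?\<sigma> (D \<chi>) \<in> carrier_mat ?N ?N" if "\<chi> \<in> M" for \<chi>
    by (rule lc_mat_carrier[OF lX[OF D(1)[OF that]] X])
  have scalar: "lc_mat n \<rho> (lc_mult [(c, w)] p) *\<^sub>v v = word_mat n \<rho> w *\<^sub>v (c \<cdot>\<^sub>v (lc_mat n \<rho> p *\<^sub>v v))"
    if st: "star_rep (Ux b q \<alpha>) n \<rho>" and w: "set w \<subseteq> ?X" and p: "lc_in ?X p" and v: "v \<in> carrier_vec n" for n \<rho> c w p v
  proof -
    note X = star_rep_carrier[OF st]
    have pc: "lc_mat n \<rho> p \<in> carrier_mat n n" by (rule lc_mat_carrier[OF p X])
    have wc: "word_mat n \<rho> w \<in> carrier_mat n n" using w X by (intro word_mat_carrier) auto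
    have "lc_in ?X [(c, w)]" using w by simp
    then have "lc_mat n \<rho> (lc_mult [(c, w)] p) = lc_mat n \<rho> [(c, w)] * lc_mat n \<rho> p" by (rule lc_mat_mult[OF _ p X])
    then have "lc_mat n \<rho> (lc_mult [(c, w)] p) = (c \<cdot>\<^sub>m word_mat n \<rho> w) * lc_mat n \<rho> p"
      unfolding lc_mat_single[OF wc] .
    then show ?thesis
      using assoc_mult_mat_vec[OF smult_carrier_mat[OF wc] pc v] smult_mult_mat_vec[OF wc, of "lc_mat n \<rho> p *\<^sub>v v" c]
        mult_mat_vec[OF wc, of "lc_mat n \<rho> p *\<^sub>v v" c] pc v by simp
  qed
  \<comment> \<open>A torus generator times \<open>D \<chi>\<close> equals its eigenvalue at
    \<open>\<chi>\<close> times \<open>D \<chi>\<close> on every weight vector with weight in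
    \<open>M\<close>; transferred to \<open>u\<close>, this makes the image of
    \<open>D \<chi>\<close> consist of weight vectors.\<close>
  have DW: "lc_mat ?N ?\<sigma> (D \<chi>) *\<^sub>v v \<in> W ?N ?\<sigma> \<chi>" if \<chi>: "\<chi> \<in> M" and v: "v \<in> carrier_vec ?N" for \<chi> v
    unfolding weight_space_iff
  proof (intro conjI allI)
    show "lc_mat ?N ?\<sigma> (D \<chi>) *\<^sub>v v \<in> carrier_vec ?N" using Dc[OF \<chi>] v by simp
    fix i
    let ?k = "complex_of_real (torus_eigenvalue q \<alpha> \<chi> i)"
    have D': "lc_in ?X (D \<chi>)" by (rule lX[OF D(1)[OF \<chi>]])
    have g: "set [torus_gen q i] \<subseteq> ?X" using gens_words(7)[of q i b \<alpha>] by simp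
    have "lc_mat ?N ?\<sigma> (lc_mult [(1, [torus_gen q i])] (D \<chi>)) = lc_mat ?N ?\<sigma> (lc_mult [(?k, [])] (D \<chi>))"
    proof (rule transfer)
      show "lc_in ?X (lc_mult [(1, [torus_gen q i])] (D \<chi>))" "lc_in ?X (lc_mult [(?k, [])] (D \<chi>))"
        using D' g by (auto intro!: lc_in_mult)
      fix n \<rho> \<chi>' v assume st: "star_rep (Ux b q \<alpha>) n \<rho>" and \<chi>': "\<chi>' \<in> M" and v: "v \<in> W n \<rho> \<chi>'"
      note vc = W_carrier[OF v]
      have t: "\<rho> (torus_gen q i) *\<^sub>v v = of_real (torus_eigenvalue q \<alpha> \<chi>' i) \<cdot>\<^sub>v v" using v by (simp add: weight_space_iff)
      note tc = star_rep_torus(1)[OF st, of i]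
      show "lc_mat n \<rho> (lc_mult [(1, [torus_gen q i])] (D \<chi>)) *\<^sub>v v = lc_mat n \<rho> (lc_mult [(?k, [])] (D \<chi>)) *\<^sub>v v"
        unfolding scalar[OF st g D' vc] scalar[OF st _ D' vc, of "[]", simplified] Dw[OF st \<chi> \<chi>' v]
        using t vc tc right_mult_one_mat[OF tc] mult_mat_vec[OF tc vc] by (cases "\<chi>' = \<chi>") (auto simp: smult_smult_assoc)
    qed
    from arg_cong[OF this, of "\<lambda>T. T *\<^sub>v v"] show "?\<sigma> (torus_gen q i) *\<^sub>v (lc_mat ?N ?\<sigma> (D \<chi>) *\<^sub>v v) = ?k \<cdot>\<^sub>v (lc_mat ?N ?\<sigma> (D \<chi>) *\<^sub>v v)"
      unfolding scalar[OF star g D' v] scalar[OF star _ D' v, of "[]", simplified]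
      using \<sigma>c[of i] Dc[OF \<chi>] v right_mult_one_mat[OF \<sigma>c[of i]] by simp
  qed
  obtain xs where xs: "set xs = M" "distinct xs" using finite_distinct_list[OF fM] by blast
  have one: "lc_mat ?N ?\<sigma> (concat (map D xs)) = lc_mat ?N ?\<sigma> [(1, [])]"
  proof (rule transfer)
    have in1: "lc_in (range (torus_gen q)) (concat (map D xs))" using D(1) xs(1) unfolding lc_in_def by fastforce
    then show "lc_in ?X (concat (map D xs))" by (rule lX)
    fix n \<rho> \<chi> v assume st: "star_rep (Ux b q \<alpha>) n \<rho>" and \<chi>: "\<chi> \<in> M" and v: "v \<in> W n \<rho> \<chi>"
    have "lc_eval (torus_weight \<chi>) (concat (map D xs)) = (\<Sum>\<chi>'\<leftarrow>xs. if \<chi> = \<chi>' then 1 else 0)"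
      unfolding lc_eval_concat map_map comp_def using D(2) xs(1) \<chi> by (intro arg_cong[of _ _ sum_list] map_cong) auto
    also have "\<dots> = 1" using xs \<chi> fM by (simp add: sum_list_distinct_conv_sum_set)
    finally show "lc_mat n \<rho> (concat (map D xs)) *\<^sub>v v = lc_mat n \<rho> [(1, [])] *\<^sub>v v"
      using lc_mat_weight[OF star_rep_torus(1)[OF st] in1 v] W_carrier[OF v] by (simp add: lc_mat_single)
  qed simp
  have span: "carrier_vec ?N \<subseteq> vspan ?N (\<Union>\<chi>\<in>M. W ?N ?\<sigma> \<chi>)"
  proof
    fix v :: "complex vec" assume v: "v \<in> carrier_vec ?N"
    have "lc_mat ?N ?\<sigma> (concat (map D ys)) *\<^sub>v v \<in> vspan ?N (\<Union>\<chi>\<in>M. W ?N ?\<sigma> \<chi>)" if "set ys \<subseteq> M" for ys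
      using that
    proof (induction ys)
      case Nil
      show ?case using v by (simp add: vspan_zero)
    next
      case (Cons \<chi> ys)
      then have \<chi>: "\<chi> \<in> M" and ys: "set ys \<subseteq> M" by auto
      have i: "lc_in ?X (D \<chi>)" "lc_in ?X (concat (map D ys))"
        using lX[OF D(1)] \<chi> ys unfolding lc_in_def by fastforce+
      have "lc_mat ?N ?\<sigma> (concat (map D (\<chi> # ys))) *\<^sub>v v = lc_mat ?N ?\<sigma> (D \<chi>) *\<^sub>v v + lc_mat ?N ?\<sigma> (concat (map D ys)) *\<^sub>v v"
        using lc_mat_append[OF i X] add_mult_distrib_mat_vec[OF Dc[OF \<chi>] lc_mat_carrier[OF i(2) X] v] by simp
      moreover have "lc_mat ?N ?\<sigma> (D \<chi>) *\<^sub>v v \<in> vspan ?N (\<Union>\<chi>\<in>M. W ?N ?\<sigma> \<chi>)"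
        using DW[OF \<chi> v] \<chi> by (intro vspan_base UN_I)
      ultimately show ?case using Cons.IH[OF ys] by (simp add: vspan_add)
    qed
    from this[of xs] show "v \<in> vspan ?N (\<Union>\<chi>\<in>M. W ?N ?\<sigma> \<chi>)"
      unfolding one using xs(1) v by (simp add: lc_mat_single)
  qed
  have adm: "admissible R \<alpha> q ?N ?\<sigma>"
  proof (rule admissibleI[of ?\<sigma>, OF \<sigma>c])
    have "vspan ?N (\<Union>\<chi>\<in>M. W ?N ?\<sigma> \<chi>) \<subseteq> vspan ?N (\<Union>\<chi>\<in>P. W ?N ?\<sigma> \<chi>)"
      by (rule vspan_mono, rule UN_mono[OF MP]) simp
    with span show "carrier_vec ?N \<subseteq> vspan ?N (\<Union>\<chi>\<in>P. W ?N ?\<sigma> \<chi>)" by (rule order_trans)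
  qed
  \<comment> \<open>For a weight in \<open>M\<close>, the identity between C_i times
    \<open>D \<kappa>\<close> and \<open>\<tau> i \<kappa>\<close> times \<open>D \<kappa>\<close>
    is transferred to \<open>u\<close>, and \<open>D \<kappa>\<close> fixes \<open>v\<close>. For
    any other weight \<open>v\<close> is zero, as the weight spaces over \<open>M\<close> already
    span.\<close>
  have "?\<sigma> (Cg i) *\<^sub>v v = \<tau> i \<kappa> \<cdot>\<^sub>v v" if b: b and v: "v \<in> W ?N ?\<sigma> \<kappa>" for \<kappa> v i
  proof (cases "\<kappa> \<in> M")
    case True
    have g: "set [Cg i] \<subseteq> ?X" using b by (simp add: Gens_Ux central_gens_def)
    have D': "lc_in ?X (D \<kappa>)" by (rule lX[OF D(1)[OF True]])
    have "lc_mat ?N ?\<sigma> (lc_mult [(1, [Cg i])] (D \<kappa>)) = lc_mat ?N ?\<sigma> (lc_mult [(\<tau> i \<kappa>, [])] (D \<kappa>))"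
    proof (rule transfer)
      show "lc_in ?X (lc_mult [(1, [Cg i])] (D \<kappa>))" "lc_in ?X (lc_mult [(\<tau> i \<kappa>, [])] (D \<kappa>))"
        using D' g by (auto intro!: lc_in_mult)
      fix n \<rho> \<chi>' v assume st: "star_rep (Ux b q \<alpha>) n \<rho>" and xa: "xadmissible b \<tau> n \<rho>" and \<chi>': "\<chi>' \<in> M" and v: "v \<in> W n \<rho> \<chi>'"
      note vc = W_carrier[OF v]
      have t: "\<rho> (Cg i) *\<^sub>v v = \<tau> i \<chi>' \<cdot>\<^sub>v v" using xa b v subsetD[OF MP \<chi>'] by (simp add: xadmissible_def)
      have tc: "\<rho> (Cg i) \<in> carrier_mat n n" using g by (intro star_rep_carrier[OF st]) simp
      show "lc_mat n \<rho> (lc_mult [(1, [Cg i])] (D \<kappa>)) *\<^sub>v v = lc_mat n \<rho> (lc_mult [(\<tau> i \<kappa>, [])] (D \<kappa>)) *\<^sub>v v"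
        unfolding scalar[OF st g D' vc] scalar[OF st _ D' vc, of "[]", simplified] Dw[OF st True \<chi>' v]
        using t vc tc right_mult_one_mat[OF tc] mult_mat_vec[OF tc vc] by (cases "\<chi>' = \<kappa>") (auto simp: smult_smult_assoc)
    qed
    moreover have "lc_mat ?N ?\<sigma> (D \<kappa>) *\<^sub>v v = v" using Dw[OF star True True v] by simp
    moreover have "?\<sigma> (Cg i) \<in> carrier_mat ?N ?N" using g by (intro X) simp
    ultimately show ?thesis
      using scalar[OF star g D' W_carrier[OF v], of 1] scalar[OF star _ D' W_carrier[OF v], of "[]" "\<tau> i \<kappa>"] W_carrier[OF v]
      by (simp add: right_mult_one_mat)
  next
    case False
    have g: "Cg i \<in> ?X" using b by (simp add: Gens_Ux central_gens_def)
    have "v = 0\<^sub>v ?N" by (rule weight_space_trivial[OF graded_star_rep[OF star adm] fM span False v])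
    then show ?thesis using mult_mat_zero_vec[OF X[OF g]] by simp
  qed
  then show ?thesis using adm by (simp add: xadmissible_def)
qed

end

section \<open>The center and the cocycle\<close>

lemma vspan_map:
  assumes "A \<in> carrier_mat m n" "S \<subseteq> carrier_vec n" "\<And>v. v \<in> S \<Longrightarrow> A *\<^sub>v v \<in> vspan m T" "v \<in> vspan n S"
  shows "A *\<^sub>v v \<in> vspan m T"
  using assms(4)
proof (induction rule: vspan.induct)
  case vspan_zero
  then show ?case using assms(1) by (simp add: vspan.vspan_zero)
next
  case (vspan_add v w)
  have "v \<in> carrier_vec n" "w \<in> carrier_vec n" using vspan_add vspan_carrier[OF assms(2)] by auto
  then show ?case using mult_add_distrib_mat_vec[OF assms(1)] vspan_add by (simp add: vspan.vspan_add)
next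
  case (vspan_smult v c)
  have "v \<in> carrier_vec n" using vspan_smult vspan_carrier[OF assms(2)] by auto
  then show ?case using mult_mat_vec[OF assms(1)] vspan_smult by (simp add: vspan.vspan_smult)
qed (rule assms(3))

context root_data
begin

lemma P_add: "\<kappa> \<in> P \<Longrightarrow> \<mu> \<in> P \<Longrightarrow> \<kappa> + \<mu> \<in> P"
  unfolding weight_lattice_def by (auto simp: inner_add_right distrib_left add_divide_distrib)

lemma P_minus: "\<kappa> \<in> P \<Longrightarrow> - \<kappa> \<in> P"
  unfolding weight_lattice_def by (auto simp: minus_divide_left[symmetric])

lemma P_zero: "0 \<in> P"
  unfolding weight_lattice_def by simp

lemma P_diff: "\<kappa> \<in> P \<Longrightarrow> \<mu> \<in> P \<Longrightarrow> \<kappa> - \<mu> \<in> P"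
  using P_add[OF _ P_minus, of \<kappa> \<mu>] by simp

lemma P_simple_root: "\<alpha> i \<in> P"
  using rs simple_root by (simp add: weight_lattice_def root_system_def)

text \<open>Presents the root lattice as the subgroup generated by the simple roots, so that later
  arguments avoid integer coefficients.\<close>

lemma root_lattice_induct [consumes 1, case_names root zero add neg]:
  assumes "b \<in> root_lattice \<alpha>" and "\<And>i. S (\<alpha> i)" and z: "S 0" and add: "\<And>b c. S b \<Longrightarrow> S c \<Longrightarrow> S (b + c)"
    and neg: "\<And>b. S b \<Longrightarrow> S (- b)"
  shows "S b"
proof -
  obtain c :: "'r \<Rightarrow> int" where b: "b = (\<Sum>i\<in>UNIV. of_int (c i) *\<^sub>R \<alpha> i)"
    using assms(1) unfolding root_lattice_def by blast
  have nat: "S (real k *\<^sub>R \<alpha> i)" for k i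
    by (induction k) (use assms(2) z add in \<open>auto simp: scaleR_add_left\<close>)
  have int: "S (of_int k *\<^sub>R \<alpha> i)" for k i
  proof (cases k)
    case (nonneg m)
    then show ?thesis using nat[of m i] by simp
  next
    case (neg m)
    then show ?thesis using assms(5)[OF nat[of "Suc m" i]] by (simp add: scaleR_minus_left[symmetric] del: scaleR_minus_left)
  qed
  have "S (\<Sum>i\<in>I. of_int (c i) *\<^sub>R \<alpha> i)" if "finite I" for I
    using that by (induction I) (auto intro: z add int)
  then show ?thesis unfolding b by simp
qed

lemma root_lattice_P: "b \<in> root_lattice \<alpha> \<Longrightarrow> b \<in> P"
  by (induction rule: root_lattice_induct) (auto intro: P_simple_root P_zero P_add P_minus)

text \<open>
  A weight outside of the root lattice has a non-integral coordinate in the basis of simple roots,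
  and exponentiating this coordinate gives an element of the center.
\<close>

lemma center_separates:
  assumes \<kappa>: "\<kappa> \<in> P" and \<mu>: "\<mu> \<in> P" and ne: "\<kappa> - \<mu> \<notin> root_lattice \<alpha>"
  obtains t where "t \<in> center R \<alpha>" "t \<kappa> \<noteq> t \<mu>"
proof -
  define c where "c x i = real_vector.representation (range \<alpha>) x (\<alpha> i)" for x i
  have ind: "independent (range \<alpha>)" and inj: "inj \<alpha>" using sr by (auto simp: simple_roots_def)
  have c_add: "c (x + y) i = c x i + c y i" for x y i
    unfolding c_def using real_vector.representation_add[OF ind, of y x] by (simp add: span_simple)
  have c_root: "c (\<alpha> j) i = (if i = j then 1 else 0)" for i j
    using real_vector.representation_basis[OF ind, of "\<alpha> j"] inj by (auto simp: c_def dest: injD)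
  have c_zero: "c 0 i = 0" for i using c_add[of 0 0 i] by simp
  have c_neg: "c (- x) i = - c x i" for x i using c_add[of x "- x" i] c_zero by simp
  have expand: "x = (\<Sum>i\<in>UNIV. c x i *\<^sub>R \<alpha> i)" for x
  proof -
    have "(\<Sum>b\<in>range \<alpha>. real_vector.representation (range \<alpha>) x b *\<^sub>R b) = x"
      by (rule real_vector.sum_representation_eq[OF ind]) (auto simp: span_simple)
    then show ?thesis unfolding c_def by (subst (asm) sum.reindex[OF inj]) simp
  qed
  have c_int: "b \<in> root_lattice \<alpha> \<Longrightarrow> c b i \<in> \<int>" for b i
    by (induction rule: root_lattice_induct) (auto simp: c_add c_zero c_neg c_root)
  obtain i where i: "c (\<kappa> - \<mu>) i \<notin> \<int>"
  proof (rule ccontr)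
    assume "\<not> thesis"
    then have "\<forall>i. c (\<kappa> - \<mu>) i \<in> \<int>" using that by blast
    then have "c (\<kappa> - \<mu>) i = of_int \<lfloor>c (\<kappa> - \<mu>) i\<rfloor>" for i by (metis Ints_cases floor_of_int)
    then have "\<kappa> - \<mu> = (\<Sum>i\<in>UNIV. of_int \<lfloor>c (\<kappa> - \<mu>) i\<rfloor> *\<^sub>R \<alpha> i)" using expand[of "\<kappa> - \<mu>"] by simp
    then have "\<kappa> - \<mu> \<in> root_lattice \<alpha>" unfolding root_lattice_def by (intro CollectI exI[of _ "\<lambda>i. \<lfloor>c (\<kappa> - \<mu>) i\<rfloor>"]) simp
    then show False using ne by simp
  qed
  define t where "t = restrict (\<lambda>x. cis (2 * pi * c x i)) P"
  have cis_int: "cis (2 * pi * x) = 1 \<longleftrightarrow> x \<in> \<int>" for x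
  proof
    assume "cis (2 * pi * x) = 1"
    then have "cos (2 * pi * x) = 1" by (simp add: complex_eq_iff)
    then obtain n :: int where "2 * pi * x = of_int n * 2 * pi" unfolding cos_one_2pi_int by blast
    then have "x = of_int n" by simp
    then show "x \<in> \<int>" by simp
  next
    assume "x \<in> \<int>"
    then show "cis (2 * pi * x) = 1" by (rule cis_multiple_2pi)
  qed
  have "t \<in> center R \<alpha>"
    unfolding center_def torus_def
    using cis_int[THEN iffD2, OF c_int] root_lattice_P
    by (auto simp: t_def P_add cis_mult c_add distrib_left)
  moreover have "t \<kappa> \<noteq> t \<mu>"
  proof
    assume "t \<kappa> = t \<mu>"
    then have "cis (2 * pi * c \<kappa> i) = cis (2 * pi * c \<mu> i)" using \<kappa> \<mu> by (simp add: t_def)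
    then have "cis (2 * pi * c \<kappa> i) / cis (2 * pi * c \<mu> i) = 1" by simp
    then have "cis (2 * pi * (c \<kappa> i - c \<mu> i)) = 1" by (simp add: cis_divide right_diff_distrib)
    moreover have "c \<kappa> i - c \<mu> i = c (\<kappa> - \<mu>) i" using c_add[of \<kappa> "- \<mu>" i] c_neg by simp
    ultimately show False using cis_int i by simp
  qed
  ultimately show thesis by (rule that)
qed

section \<open>Testing operators on weight vectors\<close>

definition graded_corep :: "'r gen corep \<Rightarrow> bool" where
  "graded_corep u \<longleftrightarrow> dim_col u = dim_row u \<and> graded (dim_row u) (corep_action u)"

abbreviation Wu :: "'r gen corep \<Rightarrow> 'e \<Rightarrow> complex vec set" where
  "Wu u \<equiv> W (dim_row u) (corep_action u)"

definition weight_vecs :: "'r gen corep \<Rightarrow> complex vec set" where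
  "weight_vecs u = (\<Union>\<chi>\<in>P. Wu u \<chi>)"

lemma weight_vecs_carrier: "weight_vecs u \<subseteq> carrier_vec (dim_row u)"
  unfolding weight_vecs_def by (intro UN_least weight_space_carrier)

lemma weight_vecs_span: "graded_corep u \<Longrightarrow> carrier_vec (dim_row u) \<subseteq> vspan (dim_row u) (weight_vecs u)"
  unfolding weight_vecs_def graded_corep_def graded_def by (intro admissible_span) simp

lemma weight_mat_eqI:
  assumes "graded_corep u" "A \<in> carrier_mat m (dim_row u)" "B \<in> carrier_mat m (dim_row u)"
    and eq: "\<And>\<kappa> x. \<kappa> \<in> P \<Longrightarrow> x \<in> Wu u \<kappa> \<Longrightarrow> A *\<^sub>v x = B *\<^sub>v x"
  shows "A = B"
proof (rule mat_eq_on_vspan[OF assms(2,3) weight_vecs_carrier weight_vecs_span[OF assms(1)]])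
  fix v assume "v \<in> weight_vecs u"
  then obtain \<kappa> where "\<kappa> \<in> P" "v \<in> Wu u \<kappa>" unfolding weight_vecs_def by (rule UN_E)
  then show "A *\<^sub>v v = B *\<^sub>v v" by (rule eq)
qed

lemma weight_mat_eqI2:
  assumes "graded_corep u" "graded_corep v"
    and A: "A \<in> carrier_mat m (dim_row u * dim_row v)" and B: "B \<in> carrier_mat m (dim_row u * dim_row v)"
    and eq: "\<And>\<kappa> \<mu> x y. \<kappa> \<in> P \<Longrightarrow> \<mu> \<in> P \<Longrightarrow> x \<in> Wu u \<kappa> \<Longrightarrow> y \<in> Wu v \<mu> \<Longrightarrow>
      A *\<^sub>v kron_vec x y = B *\<^sub>v kron_vec x y"
  shows "A = B"
proof (rule mat_eq_on_vspan[OF A B _ vspan_kron_full[OF weight_vecs_span[OF assms(1)] weight_vecs_span[OF assms(2)]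
      weight_vecs_carrier weight_vecs_carrier]])
  show "{kron_vec x y |x y. x \<in> weight_vecs u \<and> y \<in> weight_vecs v} \<subseteq> carrier_vec (dim_row u * dim_row v)"
    using weight_vecs_carrier by (auto intro!: kron_vec_carrier dest: subsetD)
  fix z assume "z \<in> {kron_vec x y |x y. x \<in> weight_vecs u \<and> y \<in> weight_vecs v}"
  then obtain x y where z: "z = kron_vec x y" and x: "x \<in> weight_vecs u" and y: "y \<in> weight_vecs v" by blast
  obtain \<kappa> where \<kappa>: "\<kappa> \<in> P" "x \<in> Wu u \<kappa>" using x unfolding weight_vecs_def by (rule UN_E)
  obtain \<mu> where \<mu>: "\<mu> \<in> P" "y \<in> Wu v \<mu>" using y unfolding weight_vecs_def by (rule UN_E)
  show "A *\<^sub>v z = B *\<^sub>v z" unfolding z by (rule eq[OF \<kappa>(1) \<mu>(1) \<kappa>(2) \<mu>(2)])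
qed

lemma weight_mat_eqI3:
  assumes g: "graded_corep u" "graded_corep v" "graded_corep w"
    and A: "A \<in> carrier_mat m (dim_row u * dim_row v * dim_row w)" and B: "B \<in> carrier_mat m (dim_row u * dim_row v * dim_row w)"
    and eq: "\<And>\<kappa> \<mu> \<nu> x y z. \<kappa> \<in> P \<Longrightarrow> \<mu> \<in> P \<Longrightarrow> \<nu> \<in> P \<Longrightarrow> x \<in> Wu u \<kappa> \<Longrightarrow> y \<in> Wu v \<mu> \<Longrightarrow> z \<in> Wu w \<nu> \<Longrightarrow>
      A *\<^sub>v kron_vec (kron_vec x y) z = B *\<^sub>v kron_vec (kron_vec x y) z"
  shows "A = B"
proof -
  let ?S = "{kron_vec x y |x y. x \<in> weight_vecs u \<and> y \<in> weight_vecs v}"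
  have S: "?S \<subseteq> carrier_vec (dim_row u * dim_row v)"
    using weight_vecs_carrier by (auto intro!: kron_vec_carrier dest: subsetD)
  show ?thesis
  proof (rule mat_eq_on_vspan[OF A B _ vspan_kron_full[OF vspan_kron_full[OF weight_vecs_span[OF g(1)] weight_vecs_span[OF g(2)]
      weight_vecs_carrier weight_vecs_carrier] weight_vecs_span[OF g(3)] S weight_vecs_carrier]])
    show "{kron_vec x y |x y. x \<in> ?S \<and> y \<in> weight_vecs w} \<subseteq> carrier_vec (dim_row u * dim_row v * dim_row w)"
    proof
      fix a assume "a \<in> {kron_vec x y |x y. x \<in> ?S \<and> y \<in> weight_vecs w}"
      then obtain x y where "a = kron_vec x y" "x \<in> ?S" "y \<in> weight_vecs w" by blast
      then show "a \<in> carrier_vec (dim_row u * dim_row v * dim_row w)"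
        using subsetD[OF S] subsetD[OF weight_vecs_carrier] by simp
    qed
    fix a assume "a \<in> {kron_vec x y |x y. x \<in> ?S \<and> y \<in> weight_vecs w}"
    then obtain x y z where a: "a = kron_vec (kron_vec x y) z" and x: "x \<in> weight_vecs u" and y: "y \<in> weight_vecs v"
      and z: "z \<in> weight_vecs w" by blast
    obtain \<kappa> where \<kappa>: "\<kappa> \<in> P" "x \<in> Wu u \<kappa>" using x unfolding weight_vecs_def by (rule UN_E)
    obtain \<mu> where \<mu>: "\<mu> \<in> P" "y \<in> Wu v \<mu>" using y unfolding weight_vecs_def by (rule UN_E)
    obtain \<nu> where \<nu>: "\<nu> \<in> P" "z \<in> Wu w \<nu>" using z unfolding weight_vecs_def by (rule UN_E)
    show "A *\<^sub>v a = B *\<^sub>v a" unfolding a by (rule eq[OF \<kappa>(1) \<mu>(1) \<nu>(1) \<kappa>(2) \<mu>(2) \<nu>(2)])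
  qed
qed

text \<open>Justifies the definite description: \<open>graded_diagonal_all\<close> provides an
  operator with the prescribed eigenvalues, and there is only one because weight vectors
  span.\<close>

lemma torus_action_weight:
  assumes g: "graded_corep u"
  shows "torus_action R \<alpha> q u t \<in> carrier_mat (dim_row u) (dim_row u) \<and>
    (\<forall>\<kappa>\<in>P. \<forall>v\<in>Wu u \<kappa>. torus_action R \<alpha> q u t *\<^sub>v v = t \<kappa> \<cdot>\<^sub>v v)"
proof -
  have "graded (dim_row u) (corep_action u)" using g by (simp add: graded_corep_def)
  from graded_diagonal_all[OF this, of t] obtain T where T: "T \<in> carrier_mat (dim_row u) (dim_row u)"
    and "\<forall>\<chi>. \<forall>v\<in>Wu u \<chi>. T *\<^sub>v v = t \<chi> \<cdot>\<^sub>v v \<and> mat_adjoint T *\<^sub>v v = cnj (t \<chi>) \<cdot>\<^sub>v v" by (rule bexE)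
  then have T': "T *\<^sub>v v = t \<chi> \<cdot>\<^sub>v v" if "v \<in> Wu u \<chi>" for v \<chi> using that by simp
  show ?thesis unfolding torus_action_def
  proof (rule theI[of _ T])
    show "T \<in> carrier_mat (dim_row u) (dim_row u) \<and> (\<forall>\<kappa>\<in>P. \<forall>v\<in>Wu u \<kappa>. T *\<^sub>v v = t \<kappa> \<cdot>\<^sub>v v)"
      using T T' by simp
    fix M assume M: "M \<in> carrier_mat (dim_row u) (dim_row u) \<and> (\<forall>\<kappa>\<in>P. \<forall>v\<in>Wu u \<kappa>. M *\<^sub>v v = t \<kappa> \<cdot>\<^sub>v v)"
    show "M = T" by (rule weight_mat_eqI[OF g _ T]) (use M T' in simp_all)
  qed
qed

lemma weight_space_isotypic:
  assumes "graded_corep u" "\<kappa> \<in> P" "x \<in> Wu u \<kappa>"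
  shows "x \<in> isotypic R \<alpha> q u \<kappa>"
  using torus_action_weight[OF assms(1)] assms(2,3) W_carrier[OF assms(3)] by (simp add: isotypic_def)

text \<open>A vector is a sum over finitely many weights. A weight \<open>\<chi>\<close> outside the
  coset of \<open>\<kappa>\<close> is removed with a central \<open>t\<close> separating
  \<open>\<chi>\<close> from \<open>\<kappa>\<close>: the operator \<open>t - t(\<chi>)\<close>
  kills weight \<open>\<chi>\<close> and multiplies the isotypic vector by a nonzero scalar.\<close>

lemma isotypic_span:
  assumes g: "graded_corep u" and \<kappa>: "\<kappa> \<in> P" and x: "x \<in> isotypic R \<alpha> q u \<kappa>"
  shows "x \<in> vspan (dim_row u) (\<Union>\<chi>\<in>{\<chi>\<in>P. \<chi> - \<kappa> \<in> root_lattice \<alpha>}. Wu u \<chi>)"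
proof -
  let ?n = "dim_row u"
  have xc: "x \<in> carrier_vec ?n" using x by (simp add: isotypic_def)
  have "admissible R \<alpha> q ?n (corep_action u)" using g by (simp add: graded_corep_def graded_def)
  from admissible_finite_span[OF this] obtain M where M: "finite M" "M \<subseteq> P" "carrier_vec ?n \<subseteq> vspan ?n (\<Union>\<chi>\<in>M. Wu u \<chi>)"
    by (elim exE conjE)
  define A where "A = {\<chi>\<in>P. \<chi> - \<kappa> \<in> root_lattice \<alpha>}"
  have step: "x \<in> vspan ?n (\<Union>\<chi>\<in>A \<union> N. Wu u \<chi>) \<Longrightarrow> x \<in> vspan ?n (\<Union>\<chi>\<in>A. Wu u \<chi>)" if "finite N" "N \<subseteq> P - A" for N
    using that
  proof (induction N)
    case (insert \<chi> N)
    have \<chi>: "\<chi> \<in> P" "\<chi> - \<kappa> \<notin> root_lattice \<alpha>" using insert.prems by (auto simp: A_def)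
    obtain t where t: "t \<in> center R \<alpha>" "t \<chi> \<noteq> t \<kappa>" by (rule center_separates[OF \<chi>(1) \<kappa> \<chi>(2)])
    define T where "T = torus_action R \<alpha> q u t"
    have Tc: "T \<in> carrier_mat ?n ?n" and T: "\<And>\<mu> v. \<mu> \<in> P \<Longrightarrow> v \<in> Wu u \<mu> \<Longrightarrow> T *\<^sub>v v = t \<mu> \<cdot>\<^sub>v v"
      using torus_action_weight[OF g, of t] unfolding T_def by blast+
    have Tx: "T *\<^sub>v x = t \<kappa> \<cdot>\<^sub>v x" using x t(1) by (simp add: isotypic_def T_def)
    \<comment> \<open>Acts on an eigenvector of \<open>T\<close> with eigenvalue \<open>s\<close> by
      \<open>s - t \<chi>\<close>: zero on the weight space of \<open>\<chi>\<close>, a scalar on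
      every other weight space, and the nonzero scalar \<open>t \<kappa> - t \<chi>\<close> on
      \<open>x\<close>.\<close>
    define Z where "Z = T + (- t \<chi>) \<cdot>\<^sub>m 1\<^sub>m ?n"
    have Zc: "Z \<in> carrier_mat ?n ?n" using Tc by (simp add: Z_def)
    have Z: "Z *\<^sub>v v = (s - t \<chi>) \<cdot>\<^sub>v v" if "v \<in> carrier_vec ?n" "T *\<^sub>v v = s \<cdot>\<^sub>v v" for v s
      unfolding Z_def using that add_mult_distrib_mat_vec[OF Tc smult_carrier_mat[OF one_carrier_mat] that(1), of "- t \<chi>"]
        smult_mult_mat_vec[OF one_carrier_mat that(1), of "- t \<chi>"]
      by (auto intro!: eq_vecI simp: algebra_simps)
    have AP: "A \<union> insert \<chi> N \<subseteq> P" using insert.prems by (auto simp: A_def)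
    have "Z *\<^sub>v x \<in> vspan ?n (\<Union>\<chi>\<in>A \<union> N. Wu u \<chi>)"
    proof (rule vspan_map[OF Zc _ _ insert.prems(1)])
      show "(\<Union>\<chi>\<in>A \<union> insert \<chi> N. Wu u \<chi>) \<subseteq> carrier_vec ?n" by (intro UN_least weight_space_carrier)
      fix v assume "v \<in> (\<Union>\<chi>\<in>A \<union> insert \<chi> N. Wu u \<chi>)"
      then obtain \<mu> where \<mu>: "\<mu> \<in> A \<union> insert \<chi> N" "v \<in> Wu u \<mu>" by (rule UN_E)
      have Zv: "Z *\<^sub>v v = (t \<mu> - t \<chi>) \<cdot>\<^sub>v v" by (rule Z[OF W_carrier[OF \<mu>(2)] T[OF subsetD[OF AP \<mu>(1)] \<mu>(2)]])
      show "Z *\<^sub>v v \<in> vspan ?n (\<Union>\<chi>\<in>A \<union> N. Wu u \<chi>)"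
      proof (cases "\<mu> = \<chi>")
        case True
        have "Z *\<^sub>v v = 0\<^sub>v ?n" using Zv W_carrier[OF \<mu>(2)] True by auto
        then show ?thesis by (simp add: vspan_zero)
      next
        case False
        then have "\<mu> \<in> A \<union> N" using \<mu>(1) by auto
        then have "v \<in> (\<Union>\<chi>\<in>A \<union> N. Wu u \<chi>)" using \<mu>(2) by (rule UN_I)
        then show ?thesis unfolding Zv by (intro vspan_smult vspan_base)
      qed
    qed
    then have "inverse (t \<kappa> - t \<chi>) \<cdot>\<^sub>v (Z *\<^sub>v x) \<in> vspan ?n (\<Union>\<chi>\<in>A \<union> N. Wu u \<chi>)" by (rule vspan_smult)
    then have "x \<in> vspan ?n (\<Union>\<chi>\<in>A \<union> N. Wu u \<chi>)" unfolding Z[OF xc Tx] using t(2) by (simp add: smult_smult_assoc)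
    then show ?case by (rule insert.IH) (use insert.prems in auto)
  qed simp
  have "x \<in> vspan ?n (\<Union>\<chi>\<in>A \<union> (M - A). Wu u \<chi>)"
  proof (rule subsetD[OF vspan_mono])
    show "(\<Union>\<chi>\<in>M. Wu u \<chi>) \<subseteq> (\<Union>\<chi>\<in>A \<union> (M - A). Wu u \<chi>)" by (rule UN_mono) auto
    show "x \<in> vspan ?n (\<Union>\<chi>\<in>M. Wu u \<chi>)" using M(3) xc by (rule subsetD)
  qed
  then show ?thesis unfolding A_def[symmetric] by (rule step[rotated 2]) (use M in auto)
qed

end

section \<open>The cocycle and the operators that twist tensor products\<close>

locale twist_data = root_data R \<alpha> q for R :: "'e::euclidean_space set" and \<alpha> :: "'r::finite \<Rightarrow> 'e" and q +
  fixes \<tau> :: "'r \<Rightarrow> 'e \<Rightarrow> complex" and f :: "'e \<Rightarrow> 'e \<Rightarrow> complex"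
  assumes \<tau>_center: "\<And>i. \<tau> i \<in> center R \<alpha>" and tf: "twist_function R \<alpha> \<tau> f"
begin

lemma f_root_lattice: "\<kappa> \<in> P \<Longrightarrow> \<mu> \<in> P \<Longrightarrow> b \<in> root_lattice \<alpha> \<Longrightarrow> f \<kappa> (\<mu> + b) = f \<kappa> \<mu>"
  using tf by (simp add: twist_function_def)

lemma f_root: "\<kappa> \<in> P \<Longrightarrow> \<mu> \<in> P \<Longrightarrow> f (\<kappa> + \<alpha> i) \<mu> = \<tau> i \<mu> * f \<kappa> \<mu>"
  using tf by (simp add: twist_function_def)

lemma f_cmod: "\<kappa> \<in> P \<Longrightarrow> \<mu> \<in> P \<Longrightarrow> cmod (f \<kappa> \<mu>) = 1"
  using tf by (simp add: twist_function_def)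

lemma cnj_unit: "cmod z = 1 \<Longrightarrow> cnj z = inverse z"
proof -
  assume "cmod z = 1"
  then have "z * cnj z = 1" by (simp flip: complex_norm_square)
  then show "cnj z = inverse z" by (rule inverse_unique[symmetric])
qed

lemma f_nonzero: "\<kappa> \<in> P \<Longrightarrow> \<mu> \<in> P \<Longrightarrow> f \<kappa> \<mu> \<noteq> 0"
  using f_cmod[of \<kappa> \<mu>] by auto

lemma f_cnj: "\<kappa> \<in> P \<Longrightarrow> \<mu> \<in> P \<Longrightarrow> cnj (f \<kappa> \<mu>) = inverse (f \<kappa> \<mu>)"
  by (rule cnj_unit[OF f_cmod])

lemma root_lattice_simple: "\<alpha> i \<in> root_lattice \<alpha>"
  unfolding root_lattice_def
  by (intro CollectI exI[of _ "\<lambda>j. if j = i then 1 else 0"]) (simp add: if_distrib[of of_int] if_distrib[of "\<lambda>c. c *\<^sub>R _"] cong: if_cong)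

lemma \<tau>_cmod: "\<mu> \<in> P \<Longrightarrow> cmod (\<tau> i \<mu>) = 1"
  using \<tau>_center[of i] by (simp add: center_def torus_def)

lemma \<tau>_nonzero: "\<mu> \<in> P \<Longrightarrow> \<tau> i \<mu> \<noteq> 0"
  using \<tau>_cmod[of \<mu> i] by auto

lemma \<tau>_add: "\<mu> \<in> P \<Longrightarrow> \<nu> \<in> P \<Longrightarrow> \<tau> i (\<mu> + \<nu>) = \<tau> i \<mu> * \<tau> i \<nu>"
  using \<tau>_center[of i] by (simp add: center_def torus_def)

lemma \<tau>_root: "\<mu> \<in> P \<Longrightarrow> \<tau> i (\<mu> + \<alpha> j) = \<tau> i \<mu>" "\<mu> \<in> P \<Longrightarrow> \<tau> i (\<mu> - \<alpha> j) = \<tau> i \<mu>"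
proof -
  have 1: "\<tau> i (\<mu> + \<alpha> j) = \<tau> i \<mu>" if "\<mu> \<in> P" for \<mu>
    using \<tau>_add[OF that P_simple_root] \<tau>_center[of i] root_lattice_simple by (simp add: center_def)
  show "\<mu> \<in> P \<Longrightarrow> \<tau> i (\<mu> + \<alpha> j) = \<tau> i \<mu>" by (rule 1)
  show "\<mu> \<in> P \<Longrightarrow> \<tau> i (\<mu> - \<alpha> j) = \<tau> i \<mu>" using 1[of "\<mu> - \<alpha> j"] P_diff P_simple_root by simp
qed

text \<open>Invariance under \<open>- b\<close> is invariance under \<open>b\<close> at the
  translated point. That point has to be a weight again, so membership of \<open>b\<close> in
  \<open>P\<close> is carried through the induction.\<close>

lemma invariant_root_lattice:
  assumes "\<And>\<kappa> i. \<kappa> \<in> P \<Longrightarrow> g (\<kappa> + \<alpha> i) = g \<kappa>" "b \<in> root_lattice \<alpha>" "\<kappa> \<in> P"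
  shows "g (\<kappa> + b) = g \<kappa>"
proof -
  have "b \<in> P \<and> (\<forall>\<kappa>\<in>P. g (\<kappa> + b) = g \<kappa>)" using assms(2)
  proof (induction rule: root_lattice_induct)
    case (add b c)
    then show ?case using P_add by (metis add.assoc)
  next
    case (neg b)
    have "g (\<kappa> + - b) = g \<kappa>" if "\<kappa> \<in> P" for \<kappa>
    proof -
      have "\<kappa> + - b \<in> P" using that neg P_add P_minus by blast
      then have "g (\<kappa> + - b + b) = g (\<kappa> + - b)" using neg by blast
      then show ?thesis by simp
    qed
    then show ?case using neg P_minus by blast
  qed (auto simp: P_simple_root P_zero assms(1))
  then show ?thesis using assms(3) by blast
qed

text \<open>A shift by a simple root in the first variable produces
  \<open>\<tau> i (\<mu> + \<nu>)\<close> divided by \<open>\<tau> i \<mu> * \<tau> i \<nu>\<close>,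
  which is 1 for a character. In the second variable the factor \<open>\<tau> i \<nu>\<close>
  appears once in the numerator and once in the denominator. In the third only second arguments of
  \<open>f\<close> move, which does not change \<open>f\<close>.\<close>

lemma twist_cocycle_invariant:
  assumes P: "\<kappa> \<in> P" "\<mu> \<in> P" "\<nu> \<in> P" "\<kappa>' \<in> P" "\<mu>' \<in> P" "\<nu>' \<in> P"
    and Q: "\<kappa>' - \<kappa> \<in> root_lattice \<alpha>" "\<mu>' - \<mu> \<in> root_lattice \<alpha>" "\<nu>' - \<nu> \<in> root_lattice \<alpha>"
  shows "twist_cocycle f \<kappa>' \<mu>' \<nu>' = twist_cocycle f \<kappa> \<mu> \<nu>"
proof -
  let ?c = "coboundary f"
  note [simp] = P_add f_nonzero \<tau>_nonzero
  have 1: "?c (\<kappa> + \<alpha> i) \<mu> \<nu> = ?c \<kappa> \<mu> \<nu>" if "\<kappa> \<in> P" "\<mu> \<in> P" "\<nu> \<in> P" for \<kappa> \<mu> \<nu> i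
  proof -
    have "f (\<kappa> + \<alpha> i + \<mu>) \<nu> = \<tau> i \<nu> * f (\<kappa> + \<mu>) \<nu>" using f_root[of "\<kappa> + \<mu>" \<nu> i] that by (simp add: add_ac)
    then show ?thesis using that by (simp add: coboundary_def f_root \<tau>_add field_simps)
  qed
  have 2: "?c \<kappa> (\<mu> + \<alpha> i) \<nu> = ?c \<kappa> \<mu> \<nu>" if "\<kappa> \<in> P" "\<mu> \<in> P" "\<nu> \<in> P" for \<kappa> \<mu> \<nu> i
  proof -
    have "f (\<kappa> + (\<mu> + \<alpha> i)) \<nu> = \<tau> i \<nu> * f (\<kappa> + \<mu>) \<nu>" using f_root[of "\<kappa> + \<mu>" \<nu> i] that by (simp add: add_ac)
    moreover have "f \<kappa> (\<mu> + \<alpha> i + \<nu>) = f \<kappa> (\<mu> + \<nu>)"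
      using f_root_lattice[of \<kappa> "\<mu> + \<nu>" "\<alpha> i"] that root_lattice_simple by (simp add: add_ac)
    moreover have "f \<kappa> (\<mu> + \<alpha> i) = f \<kappa> \<mu>" using f_root_lattice that root_lattice_simple by simp
    ultimately show ?thesis using that by (simp add: coboundary_def f_root field_simps)
  qed
  have 3: "?c \<kappa> \<mu> (\<nu> + \<alpha> i) = ?c \<kappa> \<mu> \<nu>" if "\<kappa> \<in> P" "\<mu> \<in> P" "\<nu> \<in> P" for \<kappa> \<mu> \<nu> i
  proof -
    have "f \<kappa> (\<mu> + (\<nu> + \<alpha> i)) = f \<kappa> (\<mu> + \<nu>)"
      using f_root_lattice[of \<kappa> "\<mu> + \<nu>" "\<alpha> i"] that root_lattice_simple by (simp add: add_ac)
    then show ?thesis using that root_lattice_simple by (simp add: coboundary_def f_root_lattice)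
  qed
  have "?c \<kappa>' \<mu>' \<nu>' = ?c \<kappa> \<mu>' \<nu>'"
    using invariant_root_lattice[of "\<lambda>x. ?c x \<mu>' \<nu>'", OF 1[OF _ P(5,6)] Q(1) P(1)] by simp
  also have "\<dots> = ?c \<kappa> \<mu> \<nu>'"
    using invariant_root_lattice[of "\<lambda>x. ?c \<kappa> x \<nu>'", OF 2[OF P(1) _ P(6)] Q(2) P(2)] by simp
  also have "\<dots> = ?c \<kappa> \<mu> \<nu>"
    using invariant_root_lattice[of "\<lambda>x. ?c \<kappa> \<mu> x", OF 3[OF P(1,2)] Q(3) P(3)] by simp
  finally show ?thesis by (simp add: twist_cocycle_def)
qed

text \<open>The associator is defined by its action on isotypic vectors but is accessible only on
  weight vectors. Isotypic vectors are sums over one coset of the root lattice, on which the cocycle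
  is constant, so the values there follow. Uniqueness holds because weight vectors are isotypic and
  their products span.\<close>

lemma twisted_assoc_eqI:
  assumes g: "graded_corep u" "graded_corep v" "graded_corep w"
    and A: "A \<in> carrier_mat (dim_row u * dim_row v * dim_row w) (dim_row u * dim_row v * dim_row w)"
    and eq: "\<And>\<kappa> \<mu> \<nu> x y z. \<kappa> \<in> P \<Longrightarrow> \<mu> \<in> P \<Longrightarrow> \<nu> \<in> P \<Longrightarrow> x \<in> Wu u \<kappa> \<Longrightarrow> y \<in> Wu v \<mu> \<Longrightarrow> z \<in> Wu w \<nu> \<Longrightarrow>
      A *\<^sub>v kron_vec (kron_vec x y) z = twist_cocycle f \<kappa> \<mu> \<nu> \<cdot>\<^sub>v kron_vec (kron_vec x y) z"
  shows "twisted_assoc R \<alpha> q (twist_cocycle f) u v w = A"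
proof -
  let ?\<Phi> = "twist_cocycle f"
  let ?l = "dim_row u" and ?m = "dim_row v" and ?n = "dim_row w"
  let ?B = "\<lambda>u \<kappa>. \<Union>\<chi>\<in>{\<chi>\<in>P. \<chi> - \<kappa> \<in> root_lattice \<alpha>}. Wu u \<chi>"
  have Bc: "?B u \<kappa> \<subseteq> carrier_vec (dim_row u)" for u \<kappa> by (intro UN_least weight_space_carrier)
  have iso: "A *\<^sub>v kron_vec (kron_vec x y) z = ?\<Phi> \<kappa> \<mu> \<nu> \<cdot>\<^sub>v kron_vec (kron_vec x y) z"
    if P: "\<kappa> \<in> P" "\<mu> \<in> P" "\<nu> \<in> P"
      and xyz: "x \<in> isotypic R \<alpha> q u \<kappa>" "y \<in> isotypic R \<alpha> q v \<mu>" "z \<in> isotypic R \<alpha> q w \<nu>" for \<kappa> \<mu> \<nu> x y z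
  proof -
    let ?S = "{kron_vec a b |a b. a \<in> ?B u \<kappa> \<and> b \<in> ?B v \<mu>}"
    have Sc: "?S \<subseteq> carrier_vec (?l * ?m)" using Bc by (auto intro!: kron_vec_carrier dest: subsetD)
    have xy: "kron_vec x y \<in> vspan (?l * ?m) ?S"
      by (rule vspan_kron_vec[OF isotypic_span[OF g(1) P(1) xyz(1)] isotypic_span[OF g(2) P(2) xyz(2)] Bc Bc])
    let ?S3 = "{kron_vec a b |a b. a \<in> ?S \<and> b \<in> ?B w \<nu>}"
    have xyz3: "kron_vec (kron_vec x y) z \<in> vspan (?l * ?m * ?n) ?S3"
      by (rule vspan_kron_vec[OF xy isotypic_span[OF g(3) P(3) xyz(3)] Sc Bc])
    have S3c: "?S3 \<subseteq> carrier_vec (?l * ?m * ?n)"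
    proof
      fix a assume "a \<in> ?S3"
      then obtain b c where "a = kron_vec b c" "b \<in> ?S" "c \<in> ?B w \<nu>" by blast
      then show "a \<in> carrier_vec (?l * ?m * ?n)" using subsetD[OF Sc] subsetD[OF Bc] by simp
    qed
    have "A *\<^sub>v kron_vec (kron_vec x y) z = (?\<Phi> \<kappa> \<mu> \<nu> \<cdot>\<^sub>m 1\<^sub>m (?l * ?m * ?n)) *\<^sub>v kron_vec (kron_vec x y) z"
    proof (rule vspan_eq_mult[OF A smult_carrier_mat[OF one_carrier_mat] S3c _ xyz3])
      fix a assume "a \<in> ?S3"
      then obtain x' y' z' where a: "a = kron_vec (kron_vec x' y') z'" and x': "x' \<in> ?B u \<kappa>" and y': "y' \<in> ?B v \<mu>" and z': "z' \<in> ?B w \<nu>"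
        by blast
      obtain \<kappa>' where \<kappa>': "\<kappa>' \<in> P" "\<kappa>' - \<kappa> \<in> root_lattice \<alpha>" "x' \<in> Wu u \<kappa>'" using x' by (elim UN_E CollectE conjE)
      obtain \<mu>' where \<mu>': "\<mu>' \<in> P" "\<mu>' - \<mu> \<in> root_lattice \<alpha>" "y' \<in> Wu v \<mu>'" using y' by (elim UN_E CollectE conjE)
      obtain \<nu>' where \<nu>': "\<nu>' \<in> P" "\<nu>' - \<nu> \<in> root_lattice \<alpha>" "z' \<in> Wu w \<nu>'" using z' by (elim UN_E CollectE conjE)
      have "A *\<^sub>v a = ?\<Phi> \<kappa>' \<mu>' \<nu>' \<cdot>\<^sub>v a" unfolding a by (rule eq[OF \<kappa>'(1) \<mu>'(1) \<nu>'(1) \<kappa>'(3) \<mu>'(3) \<nu>'(3)])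
      also have "?\<Phi> \<kappa>' \<mu>' \<nu>' = ?\<Phi> \<kappa> \<mu> \<nu>"
        by (rule twist_cocycle_invariant[OF P \<kappa>'(1) \<mu>'(1) \<nu>'(1) \<kappa>'(2) \<mu>'(2) \<nu>'(2)])
      also have "?\<Phi> \<kappa> \<mu> \<nu> \<cdot>\<^sub>v a = (?\<Phi> \<kappa> \<mu> \<nu> \<cdot>\<^sub>m 1\<^sub>m (?l * ?m * ?n)) *\<^sub>v a"
        using subsetD[OF S3c \<open>a \<in> ?S3\<close>] by (simp add: smult_mult_mat_vec[OF one_carrier_mat])
      finally show "A *\<^sub>v a = (?\<Phi> \<kappa> \<mu> \<nu> \<cdot>\<^sub>m 1\<^sub>m (?l * ?m * ?n)) *\<^sub>v a" .
    qed
    moreover have "kron_vec (kron_vec x y) z \<in> carrier_vec (?l * ?m * ?n)"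
      using xyz by (auto simp: isotypic_def intro!: kron_vec_carrier)
    ultimately show ?thesis by (simp add: smult_mult_mat_vec[OF one_carrier_mat])
  qed
  show ?thesis unfolding twisted_assoc_def Let_def
  proof (rule the_equality)
    show "A \<in> carrier_mat (?l * ?m * ?n) (?l * ?m * ?n) \<and> (\<forall>\<kappa>\<in>P. \<forall>\<mu>\<in>P. \<forall>\<nu>\<in>P. \<forall>x\<in>isotypic R \<alpha> q u \<kappa>. \<forall>y\<in>isotypic R \<alpha> q v \<mu>. \<forall>z\<in>isotypic R \<alpha> q w \<nu>.
        A *\<^sub>v kron_vec (kron_vec x y) z = ?\<Phi> \<kappa> \<mu> \<nu> \<cdot>\<^sub>v kron_vec (kron_vec x y) z)"
      using A iso by simp
    fix M assume M: "M \<in> carrier_mat (?l * ?m * ?n) (?l * ?m * ?n) \<and> (\<forall>\<kappa>\<in>P. \<forall>\<mu>\<in>P. \<forall>\<nu>\<in>P. \<forall>x\<in>isotypic R \<alpha> q u \<kappa>. \<forall>y\<in>isotypic R \<alpha> q v \<mu>. \<forall>z\<in>isotypic R \<alpha> q w \<nu>.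
        M *\<^sub>v kron_vec (kron_vec x y) z = ?\<Phi> \<kappa> \<mu> \<nu> \<cdot>\<^sub>v kron_vec (kron_vec x y) z)"
    show "M = A"
    proof (rule weight_mat_eqI3[OF g _ A])
      show "M \<in> carrier_mat (?l * ?m * ?n) (?l * ?m * ?n)" using M by (rule conjunct1)
      fix \<kappa> \<mu> \<nu> x y z assume h: "\<kappa> \<in> P" "\<mu> \<in> P" "\<nu> \<in> P" "x \<in> Wu u \<kappa>" "y \<in> Wu v \<mu>" "z \<in> Wu w \<nu>"
      show "M *\<^sub>v kron_vec (kron_vec x y) z = A *\<^sub>v kron_vec (kron_vec x y) z"
        unfolding eq[OF h]
        by (rule M[THEN conjunct2, rule_format, OF h(1-3) weight_space_isotypic[OF g(1) h(1,4)]
              weight_space_isotypic[OF g(2) h(2,5)] weight_space_isotypic[OF g(3) h(3,6)]])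
    qed
  qed
qed

text \<open>The action of the adjoint is part of the specification, because unitarity is read off
  from it. A suitable matrix is supplied by \<open>graded_diagonal_pair\<close>.\<close>

definition twist :: "'r gen corep \<Rightarrow> 'r gen corep \<Rightarrow> complex mat" where
  "twist u v = (SOME M. M \<in> carrier_mat (dim_row u * dim_row v) (dim_row u * dim_row v) \<and>
     (\<forall>\<kappa>\<in>P. \<forall>\<mu>\<in>P. \<forall>x\<in>Wu u \<kappa>. \<forall>y\<in>Wu v \<mu>.
       M *\<^sub>v kron_vec x y = f \<kappa> \<mu> \<cdot>\<^sub>v kron_vec x y \<and> mat_adjoint M *\<^sub>v kron_vec x y = cnj (f \<kappa> \<mu>) \<cdot>\<^sub>v kron_vec x y))"

lemma twist_props:
  assumes "graded_corep u" "graded_corep v"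
  shows "twist u v \<in> carrier_mat (dim_row u * dim_row v) (dim_row u * dim_row v)"
    and "\<kappa> \<in> P \<Longrightarrow> \<mu> \<in> P \<Longrightarrow> x \<in> Wu u \<kappa> \<Longrightarrow> y \<in> Wu v \<mu> \<Longrightarrow> twist u v *\<^sub>v kron_vec x y = f \<kappa> \<mu> \<cdot>\<^sub>v kron_vec x y"
    and "\<kappa> \<in> P \<Longrightarrow> \<mu> \<in> P \<Longrightarrow> x \<in> Wu u \<kappa> \<Longrightarrow> y \<in> Wu v \<mu> \<Longrightarrow>
      mat_adjoint (twist u v) *\<^sub>v kron_vec x y = cnj (f \<kappa> \<mu>) \<cdot>\<^sub>v kron_vec x y"
proof -
  have "graded (dim_row u) (corep_action u)" "graded (dim_row v) (corep_action v)"
    using assms by (simp_all add: graded_corep_def)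
  from graded_diagonal_pair[OF this, of f] obtain T where T: "T \<in> carrier_mat (dim_row u * dim_row v) (dim_row u * dim_row v)"
    "\<forall>\<kappa> \<mu>. \<forall>x\<in>Wu u \<kappa>. \<forall>y\<in>Wu v \<mu>. T *\<^sub>v kron_vec x y = f \<kappa> \<mu> \<cdot>\<^sub>v kron_vec x y \<and>
      mat_adjoint T *\<^sub>v kron_vec x y = cnj (f \<kappa> \<mu>) \<cdot>\<^sub>v kron_vec x y" by (rule bexE)
  have *: "twist u v \<in> carrier_mat (dim_row u * dim_row v) (dim_row u * dim_row v) \<and>
     (\<forall>\<kappa>\<in>P. \<forall>\<mu>\<in>P. \<forall>x\<in>Wu u \<kappa>. \<forall>y\<in>Wu v \<mu>. twist u v *\<^sub>v kron_vec x y = f \<kappa> \<mu> \<cdot>\<^sub>v kron_vec x y \<and>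
       mat_adjoint (twist u v) *\<^sub>v kron_vec x y = cnj (f \<kappa> \<mu>) \<cdot>\<^sub>v kron_vec x y)"
    unfolding twist_def by (rule someI[of _ T]) (use T in simp)
  show "twist u v \<in> carrier_mat (dim_row u * dim_row v) (dim_row u * dim_row v)" by (rule *[THEN conjunct1])
  show "\<kappa> \<in> P \<Longrightarrow> \<mu> \<in> P \<Longrightarrow> x \<in> Wu u \<kappa> \<Longrightarrow> y \<in> Wu v \<mu> \<Longrightarrow> twist u v *\<^sub>v kron_vec x y = f \<kappa> \<mu> \<cdot>\<^sub>v kron_vec x y"
    "\<kappa> \<in> P \<Longrightarrow> \<mu> \<in> P \<Longrightarrow> x \<in> Wu u \<kappa> \<Longrightarrow> y \<in> Wu v \<mu> \<Longrightarrow>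
      mat_adjoint (twist u v) *\<^sub>v kron_vec x y = cnj (f \<kappa> \<mu>) \<cdot>\<^sub>v kron_vec x y"
    using * by simp_all
qed

lemma twist_unitary:
  assumes g: "graded_corep u" "graded_corep v"
  shows "mat_adjoint (twist u v) * twist u v = 1\<^sub>m (dim_row u * dim_row v)"
    "twist u v * mat_adjoint (twist u v) = 1\<^sub>m (dim_row u * dim_row v)"
proof -
  note c = twist_props(1)[OF g] and a = twist_props(2)[OF g] and a' = twist_props(3)[OF g]
  note c' = mat_adjoint_carrier[OF c]
  have v: "kron_vec x y \<in> carrier_vec (dim_row u * dim_row v)" if "x \<in> Wu u \<kappa>" "y \<in> Wu v \<mu>" for x y \<kappa> \<mu>
    using that by (intro kron_vec_carrier) (auto dest: W_carrier)
  show "mat_adjoint (twist u v) * twist u v = 1\<^sub>m (dim_row u * dim_row v)"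
  proof (rule weight_mat_eqI2[OF g mult_carrier_mat[OF c' c] one_carrier_mat])
    fix \<kappa> \<mu> x y assume h: "\<kappa> \<in> P" "\<mu> \<in> P" "x \<in> Wu u \<kappa>" "y \<in> Wu v \<mu>"
    note vc = v[OF h(3,4)]
    show "(mat_adjoint (twist u v) * twist u v) *\<^sub>v kron_vec x y = 1\<^sub>m (dim_row u * dim_row v) *\<^sub>v kron_vec x y"
      using assoc_mult_mat_vec[OF c' c vc] a[OF h] a'[OF h] mult_mat_vec[OF c' vc] f_cnj[OF h(1,2)] f_nonzero[OF h(1,2)] vc
      by (simp add: smult_smult_assoc)
  qed
  show "twist u v * mat_adjoint (twist u v) = 1\<^sub>m (dim_row u * dim_row v)"
  proof (rule weight_mat_eqI2[OF g mult_carrier_mat[OF c c'] one_carrier_mat])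
    fix \<kappa> \<mu> x y assume h: "\<kappa> \<in> P" "\<mu> \<in> P" "x \<in> Wu u \<kappa>" "y \<in> Wu v \<mu>"
    note vc = v[OF h(3,4)]
    show "(twist u v * mat_adjoint (twist u v)) *\<^sub>v kron_vec x y = 1\<^sub>m (dim_row u * dim_row v) *\<^sub>v kron_vec x y"
      using assoc_mult_mat_vec[OF c c' vc] a[OF h] a'[OF h] mult_mat_vec[OF c vc] f_cnj[OF h(1,2)] f_nonzero[OF h(1,2)] vc
      by (simp add: smult_smult_assoc)
  qed
qed

end

section \<open>Tensor products\<close>

lemma mult_corep_square: "mult_corep X u \<Longrightarrow> u \<in> carrier_mat (dim_row u) (dim_row u)"
  unfolding mult_corep_def by (elim conjE) (rule carrier_matI, simp_all)

text \<open>Multiplying entries in the function algebra means evaluating along the coproduct, so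
  \<open>w\<close> acts on the tensor product by the Kronecker products of both actions, summed over
  the coproduct of \<open>w\<close>.\<close>

lemma kron_with_FMult_eval:
  assumes A: "hopf_closed A" and u: "mult_corep (Gens A) u" and v: "mult_corep (Gens A) v"
  shows "eval_mat (kron_with (FMult (reconstruct A ob)) u v) w = (if set w \<subseteq> Gens A
    then lc2_mat (dim_row u * dim_row v)
      (\<lambda>a c. kron (word_mat (dim_row u) (corep_action u) a) (word_mat (dim_row v) (corep_action v) c)) (coprod_word (Coprod A) w)
    else 0\<^sub>m (dim_row u * dim_row v) (dim_row u * dim_row v))"
proof -
  let ?n = "dim_row u" and ?m = "dim_row v"
  let ?K = "kron_with (FMult (reconstruct A ob)) u v"
  let ?F = "\<lambda>a c. kron (word_mat ?n (corep_action u) a) (word_mat ?m (corep_action v) c)"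
  note uc = mult_corep_square[OF u] and vc = mult_corep_square[OF v]
  have wu: "word_mat ?n (corep_action u) a \<in> carrier_mat ?n ?n" for a
    by (rule word_mat_carrier) (rule mult_corep_action_carrier[OF u])
  have wv: "word_mat ?m (corep_action v) a \<in> carrier_mat ?m ?m" for a
    by (rule word_mat_carrier) (rule mult_corep_action_carrier[OF v])
  have dim: "dim_row ?K = ?n * ?m" "dim_col ?K = ?n * ?m"
    unfolding kron_with_dim carrier_matD(2)[OF uc] carrier_matD(2)[OF vc] by (rule refl)+
  show ?thesis
  proof (cases "set w \<subseteq> Gens A")
    case True
    note p = coprod_word_in[OF A True]
    have Fc: "?F a c \<in> carrier_mat (?n * ?m) (?n * ?m)" for a c by (rule kron_carrier[OF wu wv])
    have "eval_mat ?K w = lc2_mat (?n * ?m) ?F (coprod_word (Coprod A) w)"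
    proof (rule eq_matI)
      have c: "lc2_mat (?n * ?m) ?F (coprod_word (Coprod A) w) \<in> carrier_mat (?n * ?m) (?n * ?m)"
        by (rule lc2_mat_carrier[OF p Fc])
      show "dim_row (eval_mat ?K w) = dim_row (lc2_mat (?n * ?m) ?F (coprod_word (Coprod A) w))"
        "dim_col (eval_mat ?K w) = dim_col (lc2_mat (?n * ?m) ?F (coprod_word (Coprod A) w))"
        unfolding carrier_matD[OF c] eval_mat_dim dim by (rule refl)+
      fix i j assume "i < dim_row (lc2_mat (?n * ?m) ?F (coprod_word (Coprod A) w))"
        "j < dim_col (lc2_mat (?n * ?m) ?F (coprod_word (Coprod A) w))"
      then have ij: "i < ?n * ?m" "j < ?n * ?m" unfolding carrier_matD[OF c] .
      note d = div_mod_less[OF ij(1)] div_mod_less[OF ij(2)]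
      have "eval_mat ?K w $$ (i, j) = (\<Sum>(c, a, d)\<leftarrow>coprod_word (Coprod A) w.
          c * (u $$ (i div ?m, j div ?m)) a * (v $$ (i mod ?m, j mod ?m)) d)"
        unfolding eval_mat_index[of i ?K j w, unfolded dim, OF ij] kron_with_index[OF uc vc ij] reconstruct_simps(1) on_words_simps(1)[OF True] ..
      also have "\<dots> = (\<Sum>(c, a, d)\<leftarrow>coprod_word (Coprod A) w. c * ?F a d $$ (i, j))"
      proof (intro arg_cong[of _ _ sum_list] map_cong refl)
        fix x assume x: "x \<in> set (coprod_word (Coprod A) w)"
        obtain c a b where x': "x = (c, a, b)" by (cases x)
        have ab: "set a \<subseteq> Gens A" "set b \<subseteq> Gens A" using p x by (auto simp: lc2_in_def x')
        show "(case x of (c, a, d) \<Rightarrow> c * (u $$ (i div ?m, j div ?m)) a * (v $$ (i mod ?m, j mod ?m)) d) =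
            (case x of (c, a, d) \<Rightarrow> c * ?F a d $$ (i, j))"
          unfolding x' case_prod_conv kron_with_index[OF wu wv ij]
            mult_corep_entry[OF u ab(1) d(1,3)] mult_corep_entry[OF v ab(2) d(2,4)] by (simp add: mult.assoc)
      qed
      also have "\<dots> = lc2_mat (?n * ?m) ?F (coprod_word (Coprod A) w) $$ (i, j)"
        by (rule lc2_mat_index[OF p Fc ij, symmetric])
      finally show "eval_mat ?K w $$ (i, j) = lc2_mat (?n * ?m) ?F (coprod_word (Coprod A) w) $$ (i, j)" .
    qed
    then show ?thesis using True by simp
  next
    case False
    have "eval_mat ?K w = 0\<^sub>m (?n * ?m) (?n * ?m)"
    proof (rule eq_matI)
      fix i j assume "i < dim_row (0\<^sub>m (?n * ?m) (?n * ?m) :: complex mat)" "j < dim_col (0\<^sub>m (?n * ?m) (?n * ?m) :: complex mat)"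
      then have ij: "i < ?n * ?m" "j < ?n * ?m" by simp_all
      show "eval_mat ?K w $$ (i, j) = 0\<^sub>m (?n * ?m) (?n * ?m) $$ (i, j)"
        unfolding eval_mat_index[of i ?K j w, unfolded dim, OF ij] kron_with_index[OF uc vc ij] reconstruct_simps(1) on_words_simps(2)[OF False]
        using ij by simp
    qed (simp_all only: eval_mat_dim dim index_zero_mat)
    then show ?thesis using False by simp
  qed
qed

text \<open>The coproduct of a word is built as the product of the coproducts of its letters, so the
  mixed product rule for Kronecker products suffices.\<close>

lemma mult_corep_tensor:
  assumes A: "hopf_closed A" and u: "mult_corep (Gens A) u" and v: "mult_corep (Gens A) v"
  shows "mult_corep (Gens A) (kron_with (FMult (reconstruct A ob)) u v)"
proof -
  let ?n = "dim_row u" and ?m = "dim_row v" and ?X = "Gens A"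
  let ?K = "kron_with (FMult (reconstruct A ob)) u v"
  let ?F = "\<lambda>a c. kron (word_mat ?n (corep_action u) a) (word_mat ?m (corep_action v) c)"
  interpret square_matrices "?n * ?m" .
  note uc = mult_corep_square[OF u] and vc = mult_corep_square[OF v]
  have wu: "word_mat ?n (corep_action u) a \<in> carrier_mat ?n ?n" for a
    by (rule word_mat_carrier) (rule mult_corep_action_carrier[OF u])
  have wv: "word_mat ?m (corep_action v) a \<in> carrier_mat ?m ?m" for a
    by (rule word_mat_carrier) (rule mult_corep_action_carrier[OF v])
  have Fc: "?F a c \<in> carrier_mat (?n * ?m) (?n * ?m)" for a c by (rule kron_carrier[OF wu wv])
  \<comment> \<open>The trivial right factor brings this into the two-sided shape that
    \<open>lc2_mat_mult_outer\<close> expects.\<close>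
  have Fm: "?F (a @ a') (c @ c') = ?F a c * ?F a' c' * 1\<^sub>m (?n * ?m)" for a a' c c'
  proof -
    have "word_mat ?n (corep_action u) (a @ a') = word_mat ?n (corep_action u) a * word_mat ?n (corep_action u) a'"
      by (rule word_mat_append) (rule mult_corep_action_carrier[OF u])
    moreover have "word_mat ?m (corep_action v) (c @ c') = word_mat ?m (corep_action v) c * word_mat ?m (corep_action v) c'"
      by (rule word_mat_append) (rule mult_corep_action_carrier[OF v])
    ultimately show ?thesis
      using kron_mult_kron[OF wu wv wu wv] right_mult_one_mat[OF mult_carrier_mat[OF Fc Fc]] by simp
  qed
  define T where "T w = lc2_mat (?n * ?m) ?F (coprod_word (Coprod A) w)" for w
  have Tc: "T w \<in> carrier_mat (?n * ?m) (?n * ?m)" if "set w \<subseteq> ?X" for w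
    unfolding T_def by (rule lc2_mat_carrier[OF coprod_word_in[OF A that] Fc])
  have T_Cons: "T (x # w) = lc2_mat (?n * ?m) ?F (Coprod A x) * T w" if x: "x \<in> ?X" and w: "set w \<subseteq> ?X" for x w
  proof -
    have p: "lc2_in ?X (Coprod A x)" using A x by (simp add: hopf_closed_def)
    have "T (x # w) = lc2_mat (?n * ?m) (\<lambda>a c. ?F a c * lc2_mat (?n * ?m) ?F (coprod_word (Coprod A) w) * 1\<^sub>m (?n * ?m)) (Coprod A x)"
      unfolding T_def coprod_word_Cons
      by (rule lc2_mat_mult_outer[OF p coprod_word_in[OF A w]]) (rule Fc, rule Fc, rule one_carrier_mat, rule Fm)
    also have "\<dots> = lc2_mat (?n * ?m) (\<lambda>a c. ?F a c * T w) (Coprod A x)"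
      unfolding T_def[symmetric] using Fc Tc[OF w] by (intro lc2_mat_cong[OF p]) (simp add: sq_simps)
    also have "\<dots> = mat_sum (?n * ?m) (\<lambda>y. (case y of (c, a, d) \<Rightarrow> c \<cdot>\<^sub>m ?F a d) * T w) (Coprod A x)"
      unfolding lc2_mat_def using Fc Tc[OF w] by (intro mat_sum_cong) (auto simp: sq_simps)
    also have "\<dots> = lc2_mat (?n * ?m) ?F (Coprod A x) * T w"
      unfolding lc2_mat_def by (rule mat_sum_mult[OF Tc[OF w], symmetric]) (use Fc in \<open>auto simp: case_prod_unfold\<close>)
    finally show ?thesis .
  qed
  have T_nil: "T [] = 1\<^sub>m (?n * ?m)"
    by (simp add: T_def lc2_mat_def kron_one sq_simps)
  have T_append: "T (a @ c) = T a * T c" if "set a \<subseteq> ?X" "set c \<subseteq> ?X" for a c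
    using that(1)
  proof (induction a)
    case Nil
    then show ?case using T_nil Tc[OF that(2)] by (simp add: sq_simps)
  next
    case (Cons x a)
    then have x: "x \<in> ?X" and a: "set a \<subseteq> ?X" by auto
    have p: "lc2_in ?X (Coprod A x)" using A x by (simp add: hopf_closed_def)
    have c: "lc2_mat (?n * ?m) ?F (Coprod A x) \<in> carrier_mat (?n * ?m) (?n * ?m)" by (rule lc2_mat_carrier[OF p Fc])
    have "set (a @ c) \<subseteq> ?X" using a that(2) by simp
    then show ?case using T_Cons[OF x a] T_Cons[OF x, of "a @ c"] Cons.IH[OF a] c Tc[OF a] Tc[OF that(2)]
      by (simp add: sq_simps)
  qed
  have eval: "eval_mat ?K w = (if set w \<subseteq> ?X then T w else 0\<^sub>m (?n * ?m) (?n * ?m))" for w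
    using kron_with_FMult_eval[OF A u v] by (simp add: T_def)
  have dim: "dim_row ?K = ?n * ?m" "dim_col ?K = ?n * ?m"
    unfolding kron_with_dim carrier_matD(2)[OF uc] carrier_matD(2)[OF vc] by (rule refl)+
  show ?thesis unfolding mult_corep_def dim
  proof (intro conjI allI impI)
    show "eval_mat ?K [] = 1\<^sub>m (?n * ?m)" unfolding eval using T_nil by simp
    fix a c assume "set a \<subseteq> ?X" "set c \<subseteq> ?X"
    then show "eval_mat ?K (a @ c) = eval_mat ?K a * eval_mat ?K c" unfolding eval using T_append[of a c] by simp
  qed (simp_all add: eval)
qed

lemma tensor_action:
  assumes A: "hopf_closed A" and u: "mult_corep (Gens A) u" and v: "mult_corep (Gens A) v" and x: "x \<in> Gens A"
  shows "corep_action (kron_with (FMult (reconstruct A ob)) u v) x = lc2_mat (dim_row u * dim_row v)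
      (\<lambda>a c. kron (word_mat (dim_row u) (corep_action u) a) (word_mat (dim_row v) (corep_action v) c)) (Coprod A x)"
  using kron_with_FMult_eval[OF A u v, of ob "[x]"] x
  unfolding corep_action_eq coprod_word_Cons by (simp add: lc2_mult_unit)

section \<open>Intertwiners\<close>

lemma intertwiners_iff:
  assumes "dim_col u = dim_row u" "dim_col v = dim_row v"
  shows "T \<in> intertwiners u v \<longleftrightarrow> T \<in> carrier_mat (dim_row v) (dim_row u) \<and> (\<forall>w. T * eval_mat u w = eval_mat v w * T)"
proof (cases "T \<in> carrier_mat (dim_row v) (dim_row u)")
  case True
  have c: "eval_mat u w \<in> carrier_mat (dim_row u) (dim_row u)" "eval_mat v w \<in> carrier_mat (dim_row v) (dim_row v)" for w
    using assms by (auto intro!: carrier_matI)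
  have "T * eval_mat u w = eval_mat v w * T \<longleftrightarrow> (\<forall>i<dim_row v. \<forall>j<dim_row u.
      (\<Sum>k<dim_row u. T $$ (i, k) * (u $$ (k, j)) w) = (\<Sum>k<dim_row v. (v $$ (i, k)) w * T $$ (k, j)))" for w
  proof -
    have 1: "(T * eval_mat u w) $$ (i, j) = (\<Sum>k<dim_row u. T $$ (i, k) * (u $$ (k, j)) w)" if "i < dim_row v" "j < dim_row u" for i j
      using mult_mat_index[OF True c(1) that] assms that by simp
    have 2: "(eval_mat v w * T) $$ (i, j) = (\<Sum>k<dim_row v. (v $$ (i, k)) w * T $$ (k, j))" if "i < dim_row v" "j < dim_row u" for i j
      using mult_mat_index[OF c(2) True that] assms that by simp
    show ?thesis
    proof
      assume e: "T * eval_mat u w = eval_mat v w * T"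
      show "\<forall>i<dim_row v. \<forall>j<dim_row u.
          (\<Sum>k<dim_row u. T $$ (i, k) * (u $$ (k, j)) w) = (\<Sum>k<dim_row v. (v $$ (i, k)) w * T $$ (k, j))"
      proof (intro allI impI)
        fix i j assume ij: "i < dim_row v" "j < dim_row u"
        show "(\<Sum>k<dim_row u. T $$ (i, k) * (u $$ (k, j)) w) = (\<Sum>k<dim_row v. (v $$ (i, k)) w * T $$ (k, j))"
          unfolding 1[OF ij, symmetric] 2[OF ij, symmetric] e ..
      qed
    next
      assume e: "\<forall>i<dim_row v. \<forall>j<dim_row u.
          (\<Sum>k<dim_row u. T $$ (i, k) * (u $$ (k, j)) w) = (\<Sum>k<dim_row v. (v $$ (i, k)) w * T $$ (k, j))"
      show "T * eval_mat u w = eval_mat v w * T"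
      proof (rule eq_matI)
        fix i j assume "i < dim_row (eval_mat v w * T)" "j < dim_col (eval_mat v w * T)"
        then have ij: "i < dim_row v" "j < dim_row u" using True by auto
        show "(T * eval_mat u w) $$ (i, j) = (eval_mat v w * T) $$ (i, j)" unfolding 1[OF ij] 2[OF ij] using e ij by simp
      qed (use True assms in auto)
    qed
  qed
  then show ?thesis using True unfolding intertwiners_def by (simp; blast)
qed (simp add: intertwiners_def)

text \<open>Commutation passes from letters to words by multiplicativity; on words outside
  \<open>X\<close> both matrices of functionals are zero.\<close>

lemma intertwiners_gensI:
  assumes u: "mult_corep X u" and v: "mult_corep X v" and T: "T \<in> carrier_mat (dim_row v) (dim_row u)"
    and eq: "\<And>x. x \<in> X \<Longrightarrow> T * corep_action u x = corep_action v x * T"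
  shows "T \<in> intertwiners u v"
proof -
  note Xu = mult_corep_action_carrier[OF u] and Xv = mult_corep_action_carrier[OF v]
  have wu: "word_mat (dim_row u) (corep_action u) a \<in> carrier_mat (dim_row u) (dim_row u)" for a
    by (rule word_mat_carrier) (rule Xu)
  have wv: "word_mat (dim_row v) (corep_action v) a \<in> carrier_mat (dim_row v) (dim_row v)" for a
    by (rule word_mat_carrier) (rule Xv)
  have word: "T * word_mat (dim_row u) (corep_action u) w = word_mat (dim_row v) (corep_action v) w * T" if "set w \<subseteq> X" for w
    using that
  proof (induction w)
    case Nil
    then show ?case using T by simp
  next
    case (Cons x w)
    then have x: "x \<in> X" and w: "set w \<subseteq> X" by auto
    have "T * word_mat (dim_row u) (corep_action u) (x # w) = (T * corep_action u x) * word_mat (dim_row u) (corep_action u) w"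
      by (simp add: assoc_mult_mat[OF T Xu wu])
    also have "\<dots> = corep_action v x * (T * word_mat (dim_row u) (corep_action u) w)"
      unfolding eq[OF x] by (rule assoc_mult_mat[OF Xv T wu])
    also have "\<dots> = word_mat (dim_row v) (corep_action v) (x # w) * T"
      unfolding Cons.IH[OF w] by (simp add: assoc_mult_mat[OF Xv wv T])
    finally show ?case .
  qed
  have "T * eval_mat u w = eval_mat v w * T" for w
  proof (cases "set w \<subseteq> X")
    case True
    then show ?thesis using word[OF True] by (simp add: mult_corep_word_mat[OF u] mult_corep_word_mat[OF v])
  next
    case False
    then show ?thesis using u v T by (simp add: mult_corep_def)
  qed
  then show ?thesis using T u v by (subst intertwiners_iff) (simp_all add: mult_corep_def)
qed

lemma intertwiners_action:
  assumes "dim_col u = dim_row u" "dim_col v = dim_row v" "T \<in> intertwiners u v"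
  shows "T \<in> carrier_mat (dim_row v) (dim_row u)" "T * corep_action u x = corep_action v x * T"
  using assms(3) unfolding intertwiners_iff[OF assms(1,2)] corep_action_eq by blast+

context root_data
begin

lemma intertwiner_weight:
  assumes u: "graded_corep u" and v: "graded_corep v" and T: "T \<in> intertwiners u v" and x: "x \<in> Wu u \<kappa>"
  shows "T *\<^sub>v x \<in> Wu v \<kappa>"
  unfolding weight_space_iff
proof (intro conjI allI)
  have sq: "dim_col u = dim_row u" "dim_col v = dim_row v" using u v by (simp_all add: graded_corep_def)
  note Tc = intertwiners_action(1)[OF sq T] and xc = W_carrier[OF x]
  show "T *\<^sub>v x \<in> carrier_vec (dim_row v)" using Tc xc by simp
  fix i
  have c: "corep_action u (torus_gen q i) \<in> carrier_mat (dim_row u) (dim_row u)"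
    "corep_action v (torus_gen q i) \<in> carrier_mat (dim_row v) (dim_row v)"
    using u v by (simp_all add: graded_corep_def graded_def)
  have "corep_action v (torus_gen q i) *\<^sub>v (T *\<^sub>v x) = T *\<^sub>v (corep_action u (torus_gen q i) *\<^sub>v x)"
    using assoc_mult_mat_vec[OF c(2) Tc xc] assoc_mult_mat_vec[OF Tc c(1) xc] intertwiners_action(2)[OF sq T] by simp
  then show "corep_action v (torus_gen q i) *\<^sub>v (T *\<^sub>v x) = complex_of_real (torus_eigenvalue q \<alpha> \<kappa> i) \<cdot>\<^sub>v (T *\<^sub>v x)"
    using x mult_mat_vec[OF Tc xc] by (simp add: weight_space_iff)
qed

text \<open>Weight spaces and gradedness see only the torus generators. Hence they survive
  restriction and extension by central generators.\<close>

lemma graded_cong: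
  assumes "\<And>i. \<rho> (torus_gen q i) = \<sigma> (torus_gen q i)"
  shows "graded n \<rho> \<longleftrightarrow> graded n \<sigma>" "W n \<rho> \<chi> = W n \<sigma> \<chi>"
proof -
  have W: "W n \<rho> \<chi> = W n \<sigma> \<chi>" for \<chi> by (rule Set.set_eqI) (simp add: weight_space_iff assms)
  then show "W n \<rho> \<chi> = W n \<sigma> \<chi>" by simp
  show "graded n \<rho> \<longleftrightarrow> graded n \<sigma>" by (simp add: graded_def admissible_def W assms)
qed

text \<open>H_i is primitive, so its eigenvalues add; K_i is group-like, so its eigenvalues
  multiply. In both cases this means that weights add.\<close>

lemma torus_tensor:
  assumes u: "mult_corep (Gens (Ux b q \<alpha>)) u" and v: "mult_corep (Gens (Ux b q \<alpha>)) v"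
    and gu: "graded_corep u" and gv: "graded_corep v" and x: "x \<in> Wu u \<kappa>" and y: "y \<in> Wu v \<mu>"
  shows "kron_vec x y \<in> Wu (kron_with (FMult (Gx b \<tau>)) u v) (\<kappa> + \<mu>)"
    and "mat_adjoint (corep_action (kron_with (FMult (Gx b \<tau>)) u v) (torus_gen q i)) =
      corep_action (kron_with (FMult (Gx b \<tau>)) u v) (torus_gen q i)"
proof -
  let ?n = "dim_row u" and ?m = "dim_row v" and ?K = "kron_with (FMult (Gx b \<tau>)) u v"
  interpret square_matrices "?n * ?m" .
  have tu: "corep_action u (torus_gen q i) \<in> carrier_mat ?n ?n" "mat_adjoint (corep_action u (torus_gen q i)) = corep_action u (torus_gen q i)"
    and tv: "corep_action v (torus_gen q i) \<in> carrier_mat ?m ?m" "mat_adjoint (corep_action v (torus_gen q i)) = corep_action v (torus_gen q i)" for i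
    using gu gv by (simp_all add: graded_corep_def graded_def)
  note xc = W_carrier[OF x] and yc = W_carrier[OF y]
  have act: "corep_action ?K (torus_gen q i) = (if q = 1
      then kron (corep_action u (torus_gen q i)) (1\<^sub>m ?m) + kron (1\<^sub>m ?n) (corep_action v (torus_gen q i))
      else kron (corep_action u (torus_gen q i)) (corep_action v (torus_gen q i)))" for i
    unfolding Gx_def tensor_action[OF hopf_closed_Ux u v gens_words(7)] lc2_mat_def
    using tu(1)[of i] tv(1)[of i] by (cases "q = 1") (simp_all add: torus_gen_def sq_simps right_mult_one_mat kron_carrier[of _ ?n ?n _ ?m ?m])
  show "mat_adjoint (corep_action ?K (torus_gen q i)) = corep_action ?K (torus_gen q i)"
  proof (cases "q = 1")
    case True
    have "mat_adjoint (kron (corep_action u (torus_gen q i)) (1\<^sub>m ?m) + kron (1\<^sub>m ?n) (corep_action v (torus_gen q i))) =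
        mat_adjoint (kron (corep_action u (torus_gen q i)) (1\<^sub>m ?m)) + mat_adjoint (kron (1\<^sub>m ?n) (corep_action v (torus_gen q i)))"
      by (rule mat_adjoint_add[of _ "?n * ?m" "?n * ?m"]) (use tu tv in \<open>auto intro!: kron_carrier\<close>)
    then show ?thesis unfolding act using True tu tv by (simp add: mat_adjoint_kron)
  qed (simp add: act mat_adjoint_kron tu tv)
  have "corep_action ?K (torus_gen q i) *\<^sub>v kron_vec x y = of_real (torus_eigenvalue q \<alpha> (\<kappa> + \<mu>) i) \<cdot>\<^sub>v kron_vec x y" for i
  proof -
    have ex: "corep_action u (torus_gen q i) *\<^sub>v x = of_real (torus_eigenvalue q \<alpha> \<kappa> i) \<cdot>\<^sub>v x"
      and ey: "corep_action v (torus_gen q i) *\<^sub>v y = of_real (torus_eigenvalue q \<alpha> \<mu> i) \<cdot>\<^sub>v y"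
      using x y by (simp_all add: weight_space_iff)
    show ?thesis
    proof (cases "q = 1")
      case True
      have "corep_action ?K (torus_gen q i) *\<^sub>v kron_vec x y =
          kron (corep_action u (torus_gen q i)) (1\<^sub>m ?m) *\<^sub>v kron_vec x y + kron (1\<^sub>m ?n) (corep_action v (torus_gen q i)) *\<^sub>v kron_vec x y"
        unfolding act using True tu(1)[of i] tv(1)[of i] xc yc
        by (simp add: add_mult_distrib_mat_vec[of _ "?n * ?m" "?n * ?m"] kron_carrier[of _ ?n ?n _ ?m ?m])
      also have "\<dots> = of_real (torus_eigenvalue q \<alpha> \<kappa> i) \<cdot>\<^sub>v kron_vec x y + of_real (torus_eigenvalue q \<alpha> \<mu> i) \<cdot>\<^sub>v kron_vec x y"
        using kron_mult_kron_vec[OF tu(1) one_carrier_mat xc yc] kron_mult_kron_vec[OF one_carrier_mat tv(1) xc yc] xc yc ex ey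
        by (simp add: kron_vec_smult)
      also have "\<dots> = of_real (torus_eigenvalue q \<alpha> (\<kappa> + \<mu>) i) \<cdot>\<^sub>v kron_vec x y"
        using True by (simp add: torus_eigenvalue_def inner_add_right distrib_left add_divide_distrib flip: add_smult_distrib_vec)
      finally show ?thesis .
    next
      case False
      then show ?thesis unfolding act using kron_mult_kron_vec[OF tu(1) tv(1) xc yc] ex ey
        by (simp add: kron_vec_smult smult_smult_assoc torus_eigenvalue_def inner_add_right powr_add mult.commute)
    qed
  qed
  then show "kron_vec x y \<in> Wu ?K (\<kappa> + \<mu>)" using kron_vec_carrier[OF xc yc] by (simp add: weight_space_iff)
qed

lemma graded_tensor:
  assumes u: "mult_corep (Gens (Ux b q \<alpha>)) u" and v: "mult_corep (Gens (Ux b q \<alpha>)) v"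
    and gu: "graded_corep u" and gv: "graded_corep v"
  shows "graded_corep (kron_with (FMult (Gx b \<tau>)) u v)"
proof -
  let ?K = "kron_with (FMult (Gx b \<tau>)) u v"
  have sq: "dim_col u = dim_row u" "dim_col v = dim_row v" using gu gv by (simp_all add: graded_corep_def)
  have mc: "mult_corep (Gens (Ux b q \<alpha>)) ?K" unfolding Gx_def by (rule mult_corep_tensor[OF hopf_closed_Ux u v])
  note tc = mult_corep_action_carrier[OF mc]
  \<comment> \<open>\<open>torus_tensor\<close> asks for weight vectors of both factors; zero
    vectors supply them.\<close>
  have z: "0\<^sub>v (dim_row u) \<in> Wu u 0" "0\<^sub>v (dim_row v) \<in> Wu v 0"
    using gu gv by (auto intro!: weight_space_zero simp: graded_corep_def graded_def)
  have "carrier_vec (dim_row u * dim_row v) \<subseteq> vspan (dim_row u * dim_row v) {kron_vec a b |a b. a \<in> weight_vecs u \<and> b \<in> weight_vecs v}"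
    by (rule vspan_kron_full[OF weight_vecs_span[OF gu] weight_vecs_span[OF gv] weight_vecs_carrier weight_vecs_carrier])
  moreover have "vspan (dim_row u * dim_row v) {kron_vec a b |a b. a \<in> weight_vecs u \<and> b \<in> weight_vecs v} \<subseteq>
      vspan (dim_row u * dim_row v) (\<Union>\<chi>\<in>P. Wu ?K \<chi>)"
  proof (rule vspan_mono, rule subsetI)
    fix z assume "z \<in> {kron_vec a b |a b. a \<in> weight_vecs u \<and> b \<in> weight_vecs v}"
    then obtain x y where zxy: "z = kron_vec x y" and x: "x \<in> weight_vecs u" and y: "y \<in> weight_vecs v" by blast
    obtain \<kappa> where \<kappa>: "\<kappa> \<in> P" "x \<in> Wu u \<kappa>" using x unfolding weight_vecs_def by (rule UN_E)
    obtain \<mu> where \<mu>: "\<mu> \<in> P" "y \<in> Wu v \<mu>" using y unfolding weight_vecs_def by (rule UN_E)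
    show "z \<in> (\<Union>\<chi>\<in>P. Wu ?K \<chi>)"
      unfolding zxy UN_iff
    proof (rule bexI[of _ "\<kappa> + \<mu>"])
      show "kron_vec x y \<in> Wu ?K (\<kappa> + \<mu>)" by (rule torus_tensor(1)[OF u v gu gv \<kappa>(2) \<mu>(2)])
      show "\<kappa> + \<mu> \<in> P" by (rule P_add[OF \<kappa>(1) \<mu>(1)])
    qed
  qed
  ultimately have "carrier_vec (dim_row ?K) \<subseteq> vspan (dim_row ?K) (\<Union>\<chi>\<in>P. Wu ?K \<chi>)" by simp
  then have "admissible R \<alpha> q (dim_row ?K) (corep_action ?K)" by (rule admissibleI[of "corep_action ?K", OF tc])
  then show ?thesis
    unfolding graded_corep_def graded_def using tc torus_tensor(2)[OF u v gu gv z] sq by simp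
qed

section \<open>Unitary representations as *-representations on generators\<close>

definition corep_rep :: "bool \<Rightarrow> ('r \<Rightarrow> 'e \<Rightarrow> complex) \<Rightarrow> 'r gen corep \<Rightarrow> bool" where
  "corep_rep b \<tau> u \<longleftrightarrow> mult_corep (Gens (Ux b q \<alpha>)) u \<and> star_rep (Ux b q \<alpha>) (dim_row u) (corep_action u) \<and>
     xadmissible b \<tau> (dim_row u) (corep_action u)"

text \<open>From left to right, the relations, adjoints and weights of \<open>u\<close> have all
  been extracted above. Conversely \<open>u\<close> is rebuilt as the coefficient matrix of its own
  action, which is unitary by the antipode axioms.\<close>

lemma corep_rep_unitary: "unitary_rep (Gx b \<tau>) u \<longleftrightarrow> corep_rep b \<tau> u"
proof
  assume u: "unitary_rep (Gx b \<tau>) u"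
  then have u': "unitary_rep (reconstruct (Ux b q \<alpha>) (\<lambda>n \<rho>. star_rep (Ux b q \<alpha>) n \<rho> \<and> xadmissible b \<tau> n \<rho>)) u" by (simp add: Gx_def)
  have "mult_corep (Gens (Ux b q \<alpha>)) u" by (rule unitary_rep_mult_corep[OF hopf_closed_Ux u'])
  moreover have "star_rep (Ux b q \<alpha>) (dim_row u) (corep_action u)" by (rule unitary_rep_Ux_star_rep[OF u']) simp
  ultimately show "corep_rep b \<tau> u" using unitary_rep_xadmissible[OF u] by (simp add: corep_rep_def)
next
  assume u: "corep_rep b \<tau> u"
  then have "unitary_rep (Gx b \<tau>) (coeff_corep (Gens (Ux b q \<alpha>)) (dim_row u) (corep_action u))"
    unfolding Gx_def corep_rep_def by (intro star_rep_Ux_unitary_rep) simp_all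
  then show "unitary_rep (Gx b \<tau>) u" using u by (simp add: coeff_corep_corep_action corep_rep_def)
qed

lemma corep_rep_graded:
  assumes "corep_rep b \<tau> u" shows "graded_corep u"
proof -
  have "dim_col u = dim_row u" using assms by (simp add: corep_rep_def mult_corep_def)
  then show ?thesis unfolding graded_corep_def
    using assms graded_star_rep[of b "dim_row u" "corep_action u"] by (simp add: corep_rep_def xadmissible_def)
qed

end

section \<open>Restriction to the subalgebra without central elements\<close>

text \<open>The unit coefficients and the trailing zero matrix reproduce literally what unfolding
  the coproducts of E_i and F_i leaves.\<close>

lemma two_term_action:
  fixes A B C D :: "complex mat"
  assumes A: "A \<in> carrier_mat n n" and B: "B \<in> carrier_mat m m" and C: "C \<in> carrier_mat n n" and D: "D \<in> carrier_mat m m"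
    and x: "x \<in> carrier_vec n" and y: "y \<in> carrier_vec m"
  shows "(1 \<cdot>\<^sub>m kron A B + (1 \<cdot>\<^sub>m kron C D + 0\<^sub>m (n * m) (n * m))) *\<^sub>v kron_vec x y =
    kron_vec (A *\<^sub>v x) (B *\<^sub>v y) + kron_vec (C *\<^sub>v x) (D *\<^sub>v y)"
proof -
  note AB = kron_carrier[OF A B, of "(*)"] and CD = kron_carrier[OF C D, of "(*)"]
  have "kron C D + 0\<^sub>m (n * m) (n * m) = kron C D" by (rule right_add_zero_mat[OF CD])
  then show ?thesis
    using add_mult_distrib_mat_vec[OF AB CD kron_vec_carrier[OF x y]] kron_mult_kron_vec[OF A B x y] kron_mult_kron_vec[OF C D x y]
    by simp
qed

lemma inverse_action:
  fixes A B :: "complex mat"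
  assumes "A \<in> carrier_mat n n" "B \<in> carrier_mat n n" "A * B = 1\<^sub>m n" "x \<in> carrier_vec n" "B *\<^sub>v x = c \<cdot>\<^sub>v x" "c \<noteq> 0"
  shows "A *\<^sub>v x = inverse c \<cdot>\<^sub>v x"
proof -
  have "x = c \<cdot>\<^sub>v (A *\<^sub>v x)"
    using assoc_mult_mat_vec[OF assms(1,2,4)] mult_mat_vec[OF assms(1,4)] assms by simp
  then have "inverse c \<cdot>\<^sub>v x = inverse c \<cdot>\<^sub>v (c \<cdot>\<^sub>v (A *\<^sub>v x))" by simp
  then show ?thesis using assms(6) by (simp add: smult_smult_assoc)
qed

context twist_data
begin

text \<open>This and \<open>K_weight\<close> are the eigenvalues of the words \<open>Cw b i\<close>
  and \<open>Kw q i\<close> on a weight vector; an empty word contributes 1.\<close>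

definition C_weight :: "bool \<Rightarrow> 'r \<Rightarrow> 'e \<Rightarrow> complex" where
  "C_weight b i \<mu> = (if b then \<tau> i \<mu> else 1)"

definition K_weight :: "'r \<Rightarrow> 'e \<Rightarrow> complex" where
  "K_weight i \<kappa> = (if q = 1 then 1 else of_real (torus_eigenvalue q \<alpha> \<kappa> i))"

lemma K_weight_nonzero: "K_weight i \<kappa> \<noteq> 0"
  using q0 by (simp add: K_weight_def torus_eigenvalue_def)

lemma C_weight_nonzero: "\<mu> \<in> P \<Longrightarrow> C_weight b i \<mu> \<noteq> 0"
  using \<tau>_nonzero by (simp add: C_weight_def)

lemma corep_rep_words:
  assumes u: "corep_rep b \<tau> u" and x: "x \<in> Wu u \<kappa>" and \<kappa>: "\<kappa> \<in> P"
  shows "word_mat (dim_row u) (corep_action u) (Cw b i) *\<^sub>v x = C_weight b i \<kappa> \<cdot>\<^sub>v x"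
    "word_mat (dim_row u) (corep_action u) (Cinvw b i) *\<^sub>v x = inverse (C_weight b i \<kappa>) \<cdot>\<^sub>v x"
    "word_mat (dim_row u) (corep_action u) (Kw q i) *\<^sub>v x = K_weight i \<kappa> \<cdot>\<^sub>v x"
    "word_mat (dim_row u) (corep_action u) (Kinvw q i) *\<^sub>v x = inverse (K_weight i \<kappa>) \<cdot>\<^sub>v x"
proof -
  let ?n = "dim_row u" and ?\<rho> = "corep_action u"
  have st: "star_rep (Ux b q \<alpha>) ?n ?\<rho>" and xa: "xadmissible b \<tau> ?n ?\<rho>" using u by (simp_all add: corep_rep_def)
  note rh = star_rep_rels_hold[OF st] and xc = W_carrier[OF x]
  note wK = Ux_word_carrier[OF rh gens_words(3)] and wKi = Ux_word_carrier[OF rh gens_words(4)]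
    and wC = Ux_word_carrier[OF rh gens_words(5)] and wCi = Ux_word_carrier[OF rh gens_words(6)]
  show C: "word_mat ?n ?\<rho> (Cw b i) *\<^sub>v x = C_weight b i \<kappa> \<cdot>\<^sub>v x"
  proof (cases b)
    case True
    have "?\<rho> (Cg i) \<in> carrier_mat ?n ?n" using True by (intro star_rep_carrier[OF st]) (simp add: Gens_Ux central_gens_def)
    moreover have "?\<rho> (Cg i) *\<^sub>v x = \<tau> i \<kappa> \<cdot>\<^sub>v x" using xa True \<kappa> x by (simp add: xadmissible_def)
    ultimately show ?thesis using True by (simp add: Cw_def C_weight_def right_mult_one_mat[of _ ?n ?n])
  qed (use xc in \<open>simp add: Cw_def C_weight_def\<close>)
  show "word_mat ?n ?\<rho> (Cinvw b i) *\<^sub>v x = inverse (C_weight b i \<kappa>) \<cdot>\<^sub>v x"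
    by (rule inverse_action[OF wCi wC Ux_C(2)[OF rh] xc C C_weight_nonzero[OF \<kappa>]])
  show K: "word_mat ?n ?\<rho> (Kw q i) *\<^sub>v x = K_weight i \<kappa> \<cdot>\<^sub>v x"
  proof (cases "q = 1")
    case True
    have "K_weight i \<kappa> = 1" "Kw q i = []" unfolding K_weight_def Kw_def using True by simp_all
    then show ?thesis using xc by simp
  next
    case False
    have "?\<rho> (Kg i) \<in> carrier_mat ?n ?n" using star_rep_torus(1)[OF st, of i] False by (simp add: torus_gen_def)
    moreover have "?\<rho> (torus_gen q i) *\<^sub>v x = of_real (torus_eigenvalue q \<alpha> \<kappa> i) \<cdot>\<^sub>v x" using x by (simp add: weight_space_iff)
    ultimately show ?thesis using False by (simp add: Kw_def K_weight_def torus_gen_def right_mult_one_mat[of _ ?n ?n])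
  qed
  show "word_mat ?n ?\<rho> (Kinvw q i) *\<^sub>v x = inverse (K_weight i \<kappa>) \<cdot>\<^sub>v x"
    by (rule inverse_action[OF wKi wK Ux_K(2)[OF rh] xc K K_weight_nonzero])
qed

text \<open>On weight vectors the two algebras differ only in the factor
  \<open>C_weight b i \<mu>\<close>, and its inverse for F_i; this isolates what the twist has to
  compensate.\<close>

lemma tensor_E_F:
  assumes u: "corep_rep b \<tau> u" and v: "corep_rep b \<tau> v" and x: "x \<in> Wu u \<kappa>" and y: "y \<in> Wu v \<mu>"
    and \<kappa>: "\<kappa> \<in> P" and \<mu>: "\<mu> \<in> P"
  shows "corep_action (kron_with (FMult (Gx b \<tau>)) u v) (Eg i) *\<^sub>v kron_vec x y =
      C_weight b i \<mu> \<cdot>\<^sub>v kron_vec (corep_action u (Eg i) *\<^sub>v x) y + K_weight i \<kappa> \<cdot>\<^sub>v kron_vec x (corep_action v (Eg i) *\<^sub>v y)"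
    and "corep_action (kron_with (FMult (Gx b \<tau>)) u v) (Fg i) *\<^sub>v kron_vec x y =
      (inverse (C_weight b i \<mu>) * inverse (K_weight i \<mu>)) \<cdot>\<^sub>v kron_vec (corep_action u (Fg i) *\<^sub>v x) y
        + kron_vec x (corep_action v (Fg i) *\<^sub>v y)"
proof -
  let ?n = "dim_row u" and ?m = "dim_row v" and ?\<rho> = "corep_action u" and ?\<sigma> = "corep_action v"
  have mu: "mult_corep (Gens (Ux b q \<alpha>)) u" and mv: "mult_corep (Gens (Ux b q \<alpha>)) v"
    using u v by (simp_all add: corep_rep_def)
  have stu: "star_rep (Ux b q \<alpha>) ?n ?\<rho>" and stv: "star_rep (Ux b q \<alpha>) ?m ?\<sigma>" using u v by (simp_all add: corep_rep_def)
  note rhu = star_rep_rels_hold[OF stu] and rhv = star_rep_rels_hold[OF stv]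
  note xc = W_carrier[OF x] and yc = W_carrier[OF y]
  note ac = tensor_action[OF hopf_closed_Ux mu mv]
  have Eu: "?\<rho> (Eg i) \<in> carrier_mat ?n ?n" and Fu: "?\<rho> (Fg i) \<in> carrier_mat ?n ?n"
    by (intro star_rep_carrier[OF stu] gens_words)+
  have Ev: "?\<sigma> (Eg i) \<in> carrier_mat ?m ?m" and Fv: "?\<sigma> (Fg i) \<in> carrier_mat ?m ?m"
    by (intro star_rep_carrier[OF stv] gens_words)+
  have w: "word_mat ?n ?\<rho> [Eg i] = ?\<rho> (Eg i)" "word_mat ?n ?\<rho> [Fg i] = ?\<rho> (Fg i)"
    "word_mat ?m ?\<sigma> [Eg i] = ?\<sigma> (Eg i)" "word_mat ?m ?\<sigma> [Fg i] = ?\<sigma> (Fg i)"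
    using Eu Fu Ev Fv by (simp_all add: right_mult_one_mat[of _ ?n ?n] right_mult_one_mat[of _ ?m ?m])
  note C = Ux_word_carrier[OF rhv gens_words(5)] and Ci = Ux_word_carrier[OF rhv gens_words(6)]
    and Ki = Ux_word_carrier[OF rhv gens_words(4)] and K = Ux_word_carrier[OF rhu gens_words(3)]
  show "corep_action (kron_with (FMult (Gx b \<tau>)) u v) (Eg i) *\<^sub>v kron_vec x y =
      C_weight b i \<mu> \<cdot>\<^sub>v kron_vec (?\<rho> (Eg i) *\<^sub>v x) y + K_weight i \<kappa> \<cdot>\<^sub>v kron_vec x (?\<sigma> (Eg i) *\<^sub>v y)"
    unfolding Gx_def ac[OF gens_words(1)] Ux_simps lc2_mat_def mat_sum_simps case_prod_conv w
      two_term_action[OF Eu C K Ev xc yc] corep_rep_words(1)[OF v y \<mu>] corep_rep_words(3)[OF u x \<kappa>] kron_vec_smult ..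
  have wC: "word_mat ?m ?\<sigma> (Cinvw b i @ Kinvw q i) = word_mat ?m ?\<sigma> (Cinvw b i) * word_mat ?m ?\<sigma> (Kinvw q i)"
    using gens_words(4,6)[where i = i and b = b and q = q and \<alpha> = \<alpha>] by (intro word_mat_append) (auto intro: star_rep_carrier[OF stv])
  have "word_mat ?m ?\<sigma> (Cinvw b i @ Kinvw q i) *\<^sub>v y = (inverse (C_weight b i \<mu>) * inverse (K_weight i \<mu>)) \<cdot>\<^sub>v y"
    unfolding wC assoc_mult_mat_vec[OF Ci Ki yc] corep_rep_words(4)[OF v y \<mu>] mult_mat_vec[OF Ci yc] corep_rep_words(2)[OF v y \<mu>]
    by (simp add: smult_smult_assoc mult.commute)
  moreover have "word_mat ?m ?\<sigma> (Cinvw b i @ Kinvw q i) \<in> carrier_mat ?m ?m" unfolding wC by (rule mult_carrier_mat[OF Ci Ki])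
  moreover have "word_mat ?n ?\<rho> [] *\<^sub>v x = x" using xc by simp
  moreover have "word_mat ?n ?\<rho> [] \<in> carrier_mat ?n ?n" by simp
  ultimately show "corep_action (kron_with (FMult (Gx b \<tau>)) u v) (Fg i) *\<^sub>v kron_vec x y =
      (inverse (C_weight b i \<mu>) * inverse (K_weight i \<mu>)) \<cdot>\<^sub>v kron_vec (?\<rho> (Fg i) *\<^sub>v x) y + kron_vec x (?\<sigma> (Fg i) *\<^sub>v y)"
    unfolding Gx_def ac[OF gens_words(2)] Ux_simps lc2_mat_def mat_sum_simps case_prod_conv w
    using two_term_action[OF Fu _ _ Fv xc yc] by (simp only: kron_vec_smult)
qed

text \<open>K_i^-1 is a generator of its own that \<open>torus_gen\<close> does not reach, so its
  scalar is computed separately.\<close>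

lemma tensor_Kinv:
  assumes u: "corep_rep b \<tau> u" and v: "corep_rep b \<tau> v" and x: "x \<in> Wu u \<kappa>" and y: "y \<in> Wu v \<mu>"
    and \<kappa>: "\<kappa> \<in> P" and \<mu>: "\<mu> \<in> P" and q: "q \<noteq> 1"
  shows "corep_action (kron_with (FMult (Gx b \<tau>)) u v) (Kinv i) *\<^sub>v kron_vec x y =
      (inverse (K_weight i \<kappa>) * inverse (K_weight i \<mu>)) \<cdot>\<^sub>v kron_vec x y"
proof -
  let ?n = "dim_row u" and ?m = "dim_row v" and ?\<rho> = "corep_action u" and ?\<sigma> = "corep_action v"
  have mu: "mult_corep (Gens (Ux b q \<alpha>)) u" and mv: "mult_corep (Gens (Ux b q \<alpha>)) v"
    using u v by (simp_all add: corep_rep_def)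
  have g: "Kinv i \<in> Gens (Ux b q \<alpha>)" using q by (simp add: Gens_Ux Uq_gens_def)
  have wu: "word_mat ?n ?\<rho> [Kinv i] \<in> carrier_mat ?n ?n" by (rule word_mat_carrier) (rule mult_corep_action_carrier[OF mu])
  have wv: "word_mat ?m ?\<sigma> [Kinv i] \<in> carrier_mat ?m ?m" by (rule word_mat_carrier) (rule mult_corep_action_carrier[OF mv])
  have z: "1 \<cdot>\<^sub>m kron (word_mat ?n ?\<rho> [Kinv i]) (word_mat ?m ?\<sigma> [Kinv i]) + 0\<^sub>m (?n * ?m) (?n * ?m) =
      kron (word_mat ?n ?\<rho> [Kinv i]) (word_mat ?m ?\<sigma> [Kinv i])"
    using right_add_zero_mat[OF kron_carrier[OF wu wv]] by simp
  have e: "word_mat ?n ?\<rho> [Kinv i] *\<^sub>v x = inverse (K_weight i \<kappa>) \<cdot>\<^sub>v x" "word_mat ?m ?\<sigma> [Kinv i] *\<^sub>v y = inverse (K_weight i \<mu>) \<cdot>\<^sub>v y"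
    using corep_rep_words(4)[OF u x \<kappa>, of i] corep_rep_words(4)[OF v y \<mu>, of i] q by (simp_all only: Kinvw_def if_False)
  show ?thesis
    unfolding Gx_def tensor_action[OF hopf_closed_Ux mu mv g] Ux_simps lc2_mat_def mat_sum_simps case_prod_conv z
      kron_mult_kron_vec[OF wu wv W_carrier[OF x] W_carrier[OF y]] e kron_vec_smult smult_smult_assoc by (simp only: mult.commute)
qed

section \<open>The restriction functor and its tensor structure\<close>

abbreviation X0 :: "'r gen set" where "X0 \<equiv> Gens (Ux False q \<alpha>)"
abbreviation X1 :: "'r gen set" where "X1 \<equiv> Gens (Ux True q \<alpha>)"
abbreviation tens0 where "tens0 \<equiv> kron_with (FMult (Gx False \<tau>))"
abbreviation tens1 where "tens1 \<equiv> kron_with (FMult (Gx True \<tau>))"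

text \<open>The matrix \<open>u\<close> itself does not qualify as an object over the smaller
  algebra, where functionals must vanish on words with central generators. The coefficients are
  therefore formed anew over \<open>X0\<close>.\<close>

definition res :: "'r gen corep \<Rightarrow> 'r gen corep" where
  "res u = coeff_corep X0 (dim_row u) (corep_action u)"

lemma X0_X1: "x \<in> X0 \<Longrightarrow> x \<in> X1"
  by (simp add: Gens_Ux)

lemma res_dim [simp]: "dim_row (res u) = dim_row u" "dim_col (res u) = dim_row u"
  by (simp_all add: res_def)

lemma res_mult: "mult_corep X1 u \<Longrightarrow> mult_corep X0 (res u)"
  unfolding res_def by (rule mult_coeff_corep) (rule mult_corep_action_carrier)

lemma res_action: "mult_corep X1 u \<Longrightarrow> x \<in> X0 \<Longrightarrow> corep_action (res u) x = corep_action u x"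
  unfolding res_def by (rule coeff_corep_action) (rule mult_corep_action_carrier)

lemma res_torus: "mult_corep X1 u \<Longrightarrow> corep_action (res u) (torus_gen q i) = corep_action u (torus_gen q i)"
  by (rule res_action[OF _ gens_words(7)])

lemma res_weight: "mult_corep X1 u \<Longrightarrow> Wu (res u) \<chi> = Wu u \<chi>"
  unfolding res_dim by (rule graded_cong(2)) (rule res_torus)

lemma res_graded:
  assumes "mult_corep X1 u" "graded_corep u"
  shows "graded_corep (res u)"
  using assms(2) graded_cong(1)[of "corep_action (res u)" "corep_action u", OF res_torus[OF assms(1)]]
  by (simp add: graded_corep_def)

lemma res_rep:
  assumes u: "corep_rep True \<tau> u"
  shows "corep_rep False \<tau> (res u)"
proof -
  have st: "star_rep (Ux True q \<alpha>) (dim_row u) (corep_action u)" and xa: "xadmissible True \<tau> (dim_row u) (corep_action u)"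
    using u by (simp_all add: corep_rep_def)
  have "star_rep (Ux False q \<alpha>) (dim_row u) (corep_action u)"
    unfolding star_rep_def
  proof (intro conjI ballI)
    fix x assume "x \<in> X0"
    then have x: "x \<in> X1" by (rule X0_X1)
    then show "corep_action u x \<in> carrier_mat (dim_row u) (dim_row u)" by (rule star_rep_carrier[OF st])
    show "lc_mat (dim_row u) (corep_action u) (Invol (Ux False q \<alpha>) x) = mat_adjoint (corep_action u x)"
      using st x by (simp add: star_rep_def)
  next
    fix t assume "t \<in> Rels (Ux False q \<alpha>)"
    then have "t \<in> Rels (Ux True q \<alpha>)" by (simp add: Ux_def Uqt_def)
    with st show "case t of (p, s) \<Rightarrow> lc_mat (dim_row u) (corep_action u) p = lc_mat (dim_row u) (corep_action u) s"
      unfolding star_rep_def by (elim conjE) (rule bspec)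
  qed
  moreover have "xadmissible False \<tau> (dim_row u) (corep_action u)" using xa by (simp add: xadmissible_def)
  ultimately have "unitary_rep (Gx False \<tau>) (res u)"
    unfolding Gx_def res_def by (intro star_rep_Ux_unitary_rep conjI)
  then show ?thesis by (simp add: corep_rep_unitary)
qed

text \<open>Restriction does not commute with tensor products, because C_i enters the coproducts of
  E_i and F_i. All other generators of the smaller algebra act on a product of weight vectors by the
  same scalar on both sides.\<close>

lemma twist_intertwiner:
  assumes u: "corep_rep True \<tau> u" and v: "corep_rep True \<tau> v"
  shows "twist u v \<in> intertwiners (tens0 (res u) (res v)) (res (tens1 u v))"
proof -
  let ?N = "dim_row u * dim_row v"
  have mu: "mult_corep X1 u" and mv: "mult_corep X1 v" using u v by (simp_all add: corep_rep_def)
  note gu = corep_rep_graded[OF u] and gv = corep_rep_graded[OF v]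
  note ru = res_rep[OF u] and rv = res_rep[OF v]
  have m1: "mult_corep X1 (tens1 u v)" unfolding Gx_def by (rule mult_corep_tensor[OF hopf_closed_Ux mu mv])
  have m0: "mult_corep X0 (tens0 (res u) (res v))"
    unfolding Gx_def by (rule mult_corep_tensor[OF hopf_closed_Ux res_mult[OF mu] res_mult[OF mv]])
  note Tc = twist_props(1)[OF gu gv] and tw = twist_props(2)[OF gu gv]
  have stu: "star_rep (Ux True q \<alpha>) (dim_row u) (corep_action u)" and stv: "star_rep (Ux True q \<alpha>) (dim_row v) (corep_action v)"
    using u v by (simp_all add: corep_rep_def)
  note shu = weight_shift[OF star_rep_rels_hold[OF stu]] and shv = weight_shift[OF star_rep_rels_hold[OF stv]]
  show ?thesis
  proof (rule intertwiners_gensI[OF m0 res_mult[OF m1]])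
    show "twist u v \<in> carrier_mat (dim_row (res (tens1 u v))) (dim_row (tens0 (res u) (res v)))" using Tc by simp
    fix x assume x: "x \<in> X0"
    have c0: "corep_action (tens0 (res u) (res v)) x \<in> carrier_mat ?N ?N"
      using mult_corep_action_carrier[OF m0, of x] by simp
    have c1: "corep_action (tens1 u v) x \<in> carrier_mat ?N ?N"
      using mult_corep_action_carrier[OF m1, of x] by simp
    have "twist u v * corep_action (tens0 (res u) (res v)) x = corep_action (tens1 u v) x * twist u v"
    proof (rule weight_mat_eqI2[OF gu gv mult_carrier_mat[OF Tc c0] mult_carrier_mat[OF c1 Tc]])
      fix \<kappa> \<mu> a b assume \<kappa>: "\<kappa> \<in> P" and \<mu>: "\<mu> \<in> P" and a: "a \<in> Wu u \<kappa>" and b: "b \<in> Wu v \<mu>"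
      have ab: "kron_vec a b \<in> carrier_vec ?N" by (rule kron_vec_carrier[OF W_carrier[OF a] W_carrier[OF b]])
      have a': "a \<in> Wu (res u) \<kappa>" and b': "b \<in> Wu (res v) \<mu>" using a b res_weight[OF mu] res_weight[OF mv] by simp_all
      have *: "twist u v *\<^sub>v (corep_action (tens0 (res u) (res v)) x *\<^sub>v kron_vec a b) =
          f \<kappa> \<mu> \<cdot>\<^sub>v (corep_action (tens1 u v) x *\<^sub>v kron_vec a b)"
      proof -
        \<comment> \<open>Covers every generator for which the product of weight vectors is an
          eigenvector with one common eigenvalue in both tensor products.\<close>
        have scalar: ?thesis if "corep_action (tens0 (res u) (res v)) x *\<^sub>v kron_vec a b = c \<cdot>\<^sub>v kron_vec a b"
          "corep_action (tens1 u v) x *\<^sub>v kron_vec a b = c \<cdot>\<^sub>v kron_vec a b" for c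
          unfolding that mult_mat_vec[OF Tc ab] tw[OF \<kappa> \<mu> a b] by (simp add: smult_smult_assoc mult.commute)
        have torus: ?thesis if "x = torus_gen q i" for i
        proof (rule scalar)
          show "corep_action (tens0 (res u) (res v)) x *\<^sub>v kron_vec a b = complex_of_real (torus_eigenvalue q \<alpha> (\<kappa> + \<mu>) i) \<cdot>\<^sub>v kron_vec a b"
            using torus_tensor(1)[OF res_mult[OF mu] res_mult[OF mv] res_graded[OF mu gu] res_graded[OF mv gv] a' b', of \<tau>] that
            by (simp add: weight_space_iff)
          show "corep_action (tens1 u v) x *\<^sub>v kron_vec a b = complex_of_real (torus_eigenvalue q \<alpha> (\<kappa> + \<mu>) i) \<cdot>\<^sub>v kron_vec a b"
            using torus_tensor(1)[OF mu mv gu gv a b, of \<tau>] that by (simp add: weight_space_iff)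
        qed
        from x show ?thesis
        proof (cases rule: gens_cases)
          case (E i)
          let ?Ea = "kron_vec (corep_action u (Eg i) *\<^sub>v a) b" and ?Eb = "kron_vec a (corep_action v (Eg i) *\<^sub>v b)"
          have e: "corep_action (res u) (Eg i) = corep_action u (Eg i)" "corep_action (res v) (Eg i) = corep_action v (Eg i)"
            using res_action[OF mu] res_action[OF mv] x E by simp_all
          have Ea: "?Ea \<in> carrier_vec ?N" and Eb: "?Eb \<in> carrier_vec ?N"
            using W_carrier[OF shu(1)[OF a]] W_carrier[OF shv(1)[OF b]] W_carrier[OF a] W_carrier[OF b] by simp_all
          \<comment> \<open>E_i in the first factor raises \<open>\<kappa>\<close> by a simple root,
            and the twist answers with \<open>\<tau> i \<mu>\<close>, the eigenvalue of C_i on the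
            second factor. In the second factor it raises \<open>\<mu>\<close>, which
            \<open>f\<close> does not see.\<close>
          have ta: "twist u v *\<^sub>v ?Ea = (\<tau> i \<mu> * f \<kappa> \<mu>) \<cdot>\<^sub>v ?Ea"
            using tw[OF P_add[OF \<kappa> P_simple_root] \<mu> shu(1)[OF a] b] f_root[OF \<kappa> \<mu>] by simp
          have tb: "twist u v *\<^sub>v ?Eb = f \<kappa> \<mu> \<cdot>\<^sub>v ?Eb"
            using tw[OF \<kappa> P_add[OF \<mu> P_simple_root] a shv(1)[OF b]] f_root_lattice[OF \<kappa> \<mu> root_lattice_simple] by simp
          have "twist u v *\<^sub>v (?Ea + K_weight i \<kappa> \<cdot>\<^sub>v ?Eb) = (\<tau> i \<mu> * f \<kappa> \<mu>) \<cdot>\<^sub>v ?Ea + (K_weight i \<kappa> * f \<kappa> \<mu>) \<cdot>\<^sub>v ?Eb"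
            using mult_add_distrib_mat_vec[OF Tc Ea] mult_mat_vec[OF Tc Eb] Eb ta tb by (simp add: smult_smult_assoc)
          also have "\<dots> = f \<kappa> \<mu> \<cdot>\<^sub>v (\<tau> i \<mu> \<cdot>\<^sub>v ?Ea + K_weight i \<kappa> \<cdot>\<^sub>v ?Eb)"
            using smult_add_distrib_vec[of "\<tau> i \<mu> \<cdot>\<^sub>v ?Ea" ?N "K_weight i \<kappa> \<cdot>\<^sub>v ?Eb" "f \<kappa> \<mu>"] Ea Eb by (simp add: smult_smult_assoc mult.commute)
          finally show ?thesis
            unfolding E(1) tensor_E_F(1)[OF ru rv a' b' \<kappa> \<mu>] tensor_E_F(1)[OF u v a b \<kappa> \<mu>] e
            by (simp add: C_weight_def)
        next
          case (F i)
          let ?Fa = "kron_vec (corep_action u (Fg i) *\<^sub>v a) b" and ?Fb = "kron_vec a (corep_action v (Fg i) *\<^sub>v b)"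
          let ?k = "inverse (K_weight i \<mu>)"
          have e: "corep_action (res u) (Fg i) = corep_action u (Fg i)" "corep_action (res v) (Fg i) = corep_action v (Fg i)"
            using res_action[OF mu] res_action[OF mv] x F by simp_all
          have Fa: "?Fa \<in> carrier_vec ?N" and Fb: "?Fb \<in> carrier_vec ?N"
            using W_carrier[OF shu(2)[OF a]] W_carrier[OF shv(2)[OF b]] W_carrier[OF a] W_carrier[OF b] by simp_all
          \<comment> \<open>Lowering the first weight divides by \<open>\<tau> i \<mu>\<close>; this
            is the eigenvalue of the C_i^-1 that the coproduct puts next to F_i.\<close>
          have f1: "f (\<kappa> - \<alpha> i) \<mu> = inverse (\<tau> i \<mu>) * f \<kappa> \<mu>"
            using f_root[OF P_diff[OF \<kappa> P_simple_root] \<mu>, of i i] \<tau>_nonzero[OF \<mu>, of i] by simp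
          have f2: "f \<kappa> (\<mu> - \<alpha> i) = f \<kappa> \<mu>"
            using f_root_lattice[OF \<kappa> P_diff[OF \<mu> P_simple_root] root_lattice_simple, of i i] by simp
          have ta: "twist u v *\<^sub>v ?Fa = (inverse (\<tau> i \<mu>) * f \<kappa> \<mu>) \<cdot>\<^sub>v ?Fa"
            using tw[OF P_diff[OF \<kappa> P_simple_root] \<mu> shu(2)[OF a] b] f1 by simp
          have tb: "twist u v *\<^sub>v ?Fb = f \<kappa> \<mu> \<cdot>\<^sub>v ?Fb"
            using tw[OF \<kappa> P_diff[OF \<mu> P_simple_root] a shv(2)[OF b]] f2 by simp
          have "twist u v *\<^sub>v (?k \<cdot>\<^sub>v ?Fa + ?Fb) = (?k * (inverse (\<tau> i \<mu>) * f \<kappa> \<mu>)) \<cdot>\<^sub>v ?Fa + f \<kappa> \<mu> \<cdot>\<^sub>v ?Fb"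
            using mult_add_distrib_mat_vec[OF Tc _ Fb, of "?k \<cdot>\<^sub>v ?Fa"] mult_mat_vec[OF Tc Fa] Fa ta tb by (simp add: smult_smult_assoc)
          also have "\<dots> = f \<kappa> \<mu> \<cdot>\<^sub>v ((inverse (\<tau> i \<mu>) * ?k) \<cdot>\<^sub>v ?Fa + ?Fb)"
            using smult_add_distrib_vec[of "(inverse (\<tau> i \<mu>) * ?k) \<cdot>\<^sub>v ?Fa" ?N ?Fb "f \<kappa> \<mu>"] Fa Fb by (simp add: smult_smult_assoc mult_ac)
          finally show ?thesis
            unfolding F(1) tensor_E_F(2)[OF ru rv a' b' \<kappa> \<mu>] tensor_E_F(2)[OF u v a b \<kappa> \<mu>] e
            by (simp add: C_weight_def)
        next
          case (K i)
          then show ?thesis by (intro torus[of i]) (simp add: torus_gen_def)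
        next
          case (H i)
          then show ?thesis by (intro torus[of i]) (simp add: torus_gen_def)
        next
          case (Kinv i)
          show ?thesis
            by (rule scalar[unfolded Kinv(1), folded Kinv(1), of "inverse (K_weight i \<kappa>) * inverse (K_weight i \<mu>)"])
              (simp_all only: Kinv(1) tensor_Kinv[OF ru rv a' b' \<kappa> \<mu> Kinv(2)] tensor_Kinv[OF u v a b \<kappa> \<mu> Kinv(2)])
        qed simp_all
      qed
      show "(twist u v * corep_action (tens0 (res u) (res v)) x) *\<^sub>v kron_vec a b = (corep_action (tens1 u v) x * twist u v) *\<^sub>v kron_vec a b"
        unfolding assoc_mult_mat_vec[OF Tc c0 ab] assoc_mult_mat_vec[OF c1 Tc ab] tw[OF \<kappa> \<mu> a b] mult_mat_vec[OF c1 ab] * ..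
    qed
    then show "twist u v * corep_action (tens0 (res u) (res v)) x = corep_action (res (tens1 u v)) x * twist u v"
      by (simp only: res_action[OF m1 x])
  qed
qed

text \<open>Intertwiners commute with the torus generators and so preserve weights; both twists
  hence multiply by the same \<open>f \<kappa> \<mu>\<close>.\<close>

lemma twist_natural:
  assumes "graded_corep u" "graded_corep v" "graded_corep u'" "graded_corep v'"
    and S: "S \<in> intertwiners u u'" and T: "T \<in> intertwiners v v'"
  shows "twist u' v' * kron S T = kron S T * twist u v"
proof -
  have sq: "dim_col u = dim_row u" "dim_col v = dim_row v" "dim_col u' = dim_row u'" "dim_col v' = dim_row v'"
    using assms by (simp_all add: graded_corep_def)
  note Sc = intertwiners_action(1)[OF sq(1,3) S] and Tc = intertwiners_action(1)[OF sq(2,4) T]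
  note STc = kron_carrier[OF Sc Tc, of "(*)"]
  note c = twist_props(1)[OF assms(1,2)] and c' = twist_props(1)[OF assms(3,4)]
  show ?thesis
  proof (rule weight_mat_eqI2[OF assms(1,2) mult_carrier_mat[OF c' STc] mult_carrier_mat[OF STc c]])
    fix \<kappa> \<mu> x y assume h: "\<kappa> \<in> P" "\<mu> \<in> P" "x \<in> Wu u \<kappa>" "y \<in> Wu v \<mu>"
    note xc = W_carrier[OF h(3)] and yc = W_carrier[OF h(4)]
    note v = kron_vec_carrier[OF xc yc]
    have "(twist u' v' * kron S T) *\<^sub>v kron_vec x y = f \<kappa> \<mu> \<cdot>\<^sub>v kron_vec (S *\<^sub>v x) (T *\<^sub>v y)"
      unfolding assoc_mult_mat_vec[OF c' STc v] kron_mult_kron_vec[OF Sc Tc xc yc]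
      by (rule twist_props(2)[OF assms(3,4) h(1,2) intertwiner_weight[OF assms(1,3) S h(3)] intertwiner_weight[OF assms(2,4) T h(4)]])
    also have "\<dots> = (kron S T * twist u v) *\<^sub>v kron_vec x y"
      unfolding assoc_mult_mat_vec[OF STc c v] twist_props(2)[OF assms(1,2) h] mult_mat_vec[OF STc v] kron_mult_kron_vec[OF Sc Tc xc yc] ..
    finally show "(twist u' v' * kron S T) *\<^sub>v kron_vec x y = (kron S T * twist u v) *\<^sub>v kron_vec x y" .
  qed
qed

end

lemma coeff_corep_cong:
  assumes "\<And>x. x \<in> X \<Longrightarrow> \<rho> x = \<sigma> x"
  shows "coeff_corep X n \<rho> = coeff_corep X n \<sigma>"
proof -
  have "on_words X (\<lambda>w. word_mat n \<rho> w $$ (i, j)) = on_words X (\<lambda>w. word_mat n \<sigma> w $$ (i, j))" for i j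
  proof
    fix w
    have "word_mat n \<rho> w = word_mat n \<sigma> w" if "w \<in> lists X" using that assms by (intro word_mat_cong) auto
    then show "on_words X (\<lambda>w. word_mat n \<rho> w $$ (i, j)) w = on_words X (\<lambda>w. word_mat n \<sigma> w $$ (i, j)) w"
      by (simp add: on_words_def)
  qed
  then show ?thesis by (simp add: coeff_corep_def)
qed

section \<open>Restriction is surjective on objects and does not change morphisms\<close>

context twist_data
begin

text \<open>C_i^-1 is sent to the adjoint rather than to the inverse matrix, so the condition on
  adjoints holds by construction; that it inverts \<open>T i\<close> then follows from
  \<open>\<tau> i\<close> having modulus 1.\<close>

definition central_ext :: "('r \<Rightarrow> complex mat) \<Rightarrow> ('r gen \<Rightarrow> complex mat) \<Rightarrow> 'r gen \<Rightarrow> complex mat" where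
  "central_ext T \<rho> x = (case x of Cg i \<Rightarrow> T i | Cinv i \<Rightarrow> mat_adjoint (T i) | _ \<Rightarrow> \<rho> x)"

lemma central_ext_eq: "x \<in> X0 \<Longrightarrow> central_ext T \<rho> x = \<rho> x"
  by (elim gens_cases) (simp_all add: central_ext_def)

text \<open>Admissibility leaves no choice for the C_i, and operators with these eigenvalues exist
  by \<open>graded_diagonal_all\<close>. What has to be verified is that they are unitary and
  central. \<open>Y\<close> is then a restriction on the nose, not merely up to isomorphism.\<close>

lemma res_surj:
  assumes Y: "corep_rep False \<tau> Y"
  shows "\<exists>u. corep_rep True \<tau> u \<and> res u = Y"
proof -
  let ?n = "dim_row Y" and ?\<rho> = "corep_action Y"
  have mY: "mult_corep X0 Y" and st: "star_rep (Ux False q \<alpha>) ?n ?\<rho>" and xa: "xadmissible False \<tau> ?n ?\<rho>"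
    using Y by (simp_all add: corep_rep_def)
  note gY = corep_rep_graded[OF Y] and rh = star_rep_rels_hold[OF st]
  have gr: "graded ?n ?\<rho>" using gY by (simp add: graded_corep_def)
  have "\<forall>i. \<exists>T. T \<in> carrier_mat ?n ?n \<and> (\<forall>\<chi>. \<forall>v\<in>Wu Y \<chi>. T *\<^sub>v v = \<tau> i \<chi> \<cdot>\<^sub>v v \<and> mat_adjoint T *\<^sub>v v = cnj (\<tau> i \<chi>) \<cdot>\<^sub>v v)"
  proof
    fix i
    from graded_diagonal_all[OF gr, of "\<tau> i"]
    show "\<exists>T. T \<in> carrier_mat ?n ?n \<and> (\<forall>\<chi>. \<forall>v\<in>Wu Y \<chi>. T *\<^sub>v v = \<tau> i \<chi> \<cdot>\<^sub>v v \<and> mat_adjoint T *\<^sub>v v = cnj (\<tau> i \<chi>) \<cdot>\<^sub>v v)"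
      by (elim bexE) (rule exI, rule conjI)
  qed
  from choice[OF this] obtain T where T: "\<forall>i. T i \<in> carrier_mat ?n ?n \<and>
      (\<forall>\<chi>. \<forall>v\<in>Wu Y \<chi>. T i *\<^sub>v v = \<tau> i \<chi> \<cdot>\<^sub>v v \<and> mat_adjoint (T i) *\<^sub>v v = cnj (\<tau> i \<chi>) \<cdot>\<^sub>v v)" by (elim exE)
  have Tc: "T i \<in> carrier_mat ?n ?n" and Tw: "v \<in> Wu Y \<chi> \<Longrightarrow> T i *\<^sub>v v = \<tau> i \<chi> \<cdot>\<^sub>v v"
    and Ta: "v \<in> Wu Y \<chi> \<Longrightarrow> mat_adjoint (T i) *\<^sub>v v = cnj (\<tau> i \<chi>) \<cdot>\<^sub>v v" for i \<chi> v using T by simp_all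
  define \<sigma> where "\<sigma> = central_ext T ?\<rho>"
  have \<sigma>0: "\<sigma> x = ?\<rho> x" if "x \<in> X0" for x unfolding \<sigma>_def by (rule central_ext_eq[OF that])
  have \<sigma>C: "\<sigma> (Cg i) = T i" "\<sigma> (Cinv i) = mat_adjoint (T i)" for i by (simp_all add: \<sigma>_def central_ext_def)
  have X1_cases: "x \<in> X0 \<or> x \<in> central_gens" if "x \<in> X1" for x using that by (simp add: Gens_Ux)
  have \<sigma>c: "\<sigma> x \<in> carrier_mat ?n ?n" if "x \<in> X1" for x
  proof (cases "x \<in> X0")
    case True
    then show ?thesis using star_rep_carrier[OF st True] by (simp add: \<sigma>0)
  next
    case False
    then have "x \<in> central_gens" using X1_cases[OF that] by simp
    then show ?thesis unfolding central_gens_def using \<sigma>C Tc mat_adjoint_carrier[OF Tc] by auto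
  qed
  \<comment> \<open>\<open>g\<close> is the eigenvalue function of the central generator,
    \<open>\<tau> i\<close> or its conjugate. It is unchanged by simple root shifts since
    \<open>\<tau> i\<close> is trivial on the root lattice.\<close>
  have cg: "\<exists>g. (\<forall>\<chi> v. v \<in> Wu Y \<chi> \<longrightarrow> \<sigma> c *\<^sub>v v = g \<chi> \<cdot>\<^sub>v v) \<and> (\<forall>\<chi>\<in>P. \<forall>j. g (\<chi> + \<alpha> j) = g \<chi> \<and> g (\<chi> - \<alpha> j) = g \<chi>)"
    if c: "c \<in> central_gens" for c
  proof -
    from c obtain i where "c = Cg i \<or> c = Cinv i" unfolding central_gens_def by blast
    then show ?thesis
    proof
      assume "c = Cg i"
      then show ?thesis using Tw \<tau>_root by (intro exI[of _ "\<tau> i"]) (simp add: \<sigma>C)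
    next
      assume "c = Cinv i"
      then show ?thesis using Ta \<tau>_root by (intro exI[of _ "\<lambda>\<chi>. cnj (\<tau> i \<chi>)"]) (simp add: \<sigma>C)
    qed
  qed
  have cc: "\<sigma> c \<in> carrier_mat ?n ?n" if "c \<in> central_gens" for c
    using that by (intro \<sigma>c) (simp add: Gens_Ux)
  have central: "\<sigma> c * \<sigma> x = \<sigma> x * \<sigma> c" if c: "c \<in> central_gens" and x: "x \<in> X1" for c x
  proof -
    note Cc = cc[OF c] and Xc = \<sigma>c[OF x]
    obtain g where g: "\<And>\<chi> v. v \<in> Wu Y \<chi> \<Longrightarrow> \<sigma> c *\<^sub>v v = g \<chi> \<cdot>\<^sub>v v"
      and g': "\<And>\<chi> j. \<chi> \<in> P \<Longrightarrow> g (\<chi> + \<alpha> j) = g \<chi> \<and> g (\<chi> - \<alpha> j) = g \<chi>" using cg[OF c] by (elim exE conjE) simp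
    \<comment> \<open>A generator either moves \<open>v\<close> to a weight differing by a simple
      root, where \<open>c\<close> has the same eigenvalue, or acts on \<open>v\<close> by a
      scalar.\<close>
    have *: "\<sigma> c *\<^sub>v (\<sigma> x *\<^sub>v v) = g \<chi> \<cdot>\<^sub>v (\<sigma> x *\<^sub>v v)" if \<chi>: "\<chi> \<in> P" and v: "v \<in> Wu Y \<chi>" for \<chi> v
    proof -
      have scalar: ?thesis if "\<sigma> x *\<^sub>v v = s \<cdot>\<^sub>v v" for s
        unfolding that mult_mat_vec[OF Cc W_carrier[OF v]] g[OF v] by (simp add: smult_smult_assoc mult.commute)
      show ?thesis
      proof (cases "x \<in> X0")
        case True
        from True show ?thesis
        proof (cases rule: gens_cases)
          case (E i)
          show ?thesis using g[OF weight_shift(1)[OF rh v, of i]] g'[OF \<chi>, of i] \<sigma>0[OF True] by (simp add: E)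
        next
          case (F i)
          show ?thesis using g[OF weight_shift(2)[OF rh v, of i]] g'[OF \<chi>, of i] \<sigma>0[OF True] by (simp add: F)
        next
          case (K i)
          have "?\<rho> (torus_gen q i) *\<^sub>v v = of_real (torus_eigenvalue q \<alpha> \<chi> i) \<cdot>\<^sub>v v" using v by (simp add: weight_space_iff)
          then show ?thesis using \<sigma>0[OF True] K by (intro scalar) (simp add: torus_gen_def)
        next
          case (H i)
          have "?\<rho> (torus_gen q i) *\<^sub>v v = of_real (torus_eigenvalue q \<alpha> \<chi> i) \<cdot>\<^sub>v v" using v by (simp add: weight_space_iff)
          then show ?thesis using \<sigma>0[OF True] H(1) unfolding torus_gen_def if_P[OF H(2)] by (intro scalar) simp
        next
          case (Kinv i)
          have "word_mat ?n ?\<rho> (Kinvw q i) *\<^sub>v v = inverse (K_weight i \<chi>) \<cdot>\<^sub>v v" by (rule corep_rep_words(4)[OF Y v \<chi>])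
          moreover have "word_mat ?n ?\<rho> (Kinvw q i) = \<sigma> x"
            using Kinv(2) \<sigma>0[OF True] right_mult_one_mat[OF \<sigma>c[OF x]] unfolding Kinv(1) by (simp add: Kinvw_def)
          ultimately show ?thesis by (intro scalar) simp
        qed simp_all
      next
        case False
        then have "x \<in> central_gens" using X1_cases[OF x] by simp
        from cg[OF this] obtain h where "\<forall>\<chi> v. v \<in> Wu Y \<chi> \<longrightarrow> \<sigma> x *\<^sub>v v = h \<chi> \<cdot>\<^sub>v v" by (elim exE conjE)
        then have "\<sigma> x *\<^sub>v v = h \<chi> \<cdot>\<^sub>v v" using v by simp
        then show ?thesis by (rule scalar)
      qed
    qed
    show ?thesis
    proof (rule weight_mat_eqI[OF gY mult_carrier_mat[OF Cc Xc] mult_carrier_mat[OF Xc Cc]])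
      fix \<chi> v assume h: "\<chi> \<in> P" "v \<in> Wu Y \<chi>"
      note vc = W_carrier[OF h(2)]
      show "(\<sigma> c * \<sigma> x) *\<^sub>v v = (\<sigma> x * \<sigma> c) *\<^sub>v v"
        unfolding assoc_mult_mat_vec[OF Cc Xc vc] assoc_mult_mat_vec[OF Xc Cc vc] g[OF h(2)] mult_mat_vec[OF Xc vc] by (rule *[OF h])
    qed
  qed
  have CC: "T i * mat_adjoint (T i) = 1\<^sub>m ?n" "mat_adjoint (T i) * T i = 1\<^sub>m ?n" for i
  proof -
    note Ac = mat_adjoint_carrier[OF Tc[of i]]
    have z: "cnj (\<tau> i \<chi>) * \<tau> i \<chi> = 1" if "\<chi> \<in> P" for \<chi>
      using cnj_unit[OF \<tau>_cmod[OF that, of i]] \<tau>_nonzero[OF that, of i] by simp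
    show "T i * mat_adjoint (T i) = 1\<^sub>m ?n"
    proof (rule weight_mat_eqI[OF gY mult_carrier_mat[OF Tc Ac] one_carrier_mat])
      fix \<chi> v assume h: "\<chi> \<in> P" "v \<in> Wu Y \<chi>"
      show "(T i * mat_adjoint (T i)) *\<^sub>v v = 1\<^sub>m ?n *\<^sub>v v"
        unfolding assoc_mult_mat_vec[OF Tc Ac W_carrier[OF h(2)]] Ta[OF h(2)] mult_mat_vec[OF Tc W_carrier[OF h(2)]] Tw[OF h(2)]
        using z[OF h(1)] W_carrier[OF h(2)] by (simp add: smult_smult_assoc)
    qed
    show "mat_adjoint (T i) * T i = 1\<^sub>m ?n"
    proof (rule weight_mat_eqI[OF gY mult_carrier_mat[OF Ac Tc] one_carrier_mat])
      fix \<chi> v assume h: "\<chi> \<in> P" "v \<in> Wu Y \<chi>"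
      show "(mat_adjoint (T i) * T i) *\<^sub>v v = 1\<^sub>m ?n *\<^sub>v v"
        unfolding assoc_mult_mat_vec[OF Ac Tc W_carrier[OF h(2)]] Tw[OF h(2)] mult_mat_vec[OF Ac W_carrier[OF h(2)]] Ta[OF h(2)]
        using z[OF h(1)] W_carrier[OF h(2)] by (simp add: smult_smult_assoc mult.commute)
    qed
  qed
  interpret square_matrices ?n .
  have st1: "star_rep (Ux True q \<alpha>) ?n \<sigma>"
    unfolding star_rep_def
  proof (intro conjI ballI)
    show "\<sigma> x \<in> carrier_mat ?n ?n" if "x \<in> X1" for x by (rule \<sigma>c[OF that])
    fix t assume "t \<in> Rels (Ux True q \<alpha>)"
    then consider "t \<in> Rels (Ux False q \<alpha>)" | "t \<in> central_rels q" by (auto simp: Ux_def Uqt_def)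
    then show "case t of (p, s) \<Rightarrow> lc_mat ?n \<sigma> p = lc_mat ?n \<sigma> s"
    proof cases
      case 1
      obtain p s where t: "t = (p, s)" by (cases t)
      have ps: "lc_in X0 p" "lc_in X0 s" using rels_closed_Ux[OF 1[unfolded t]] by simp_all
      have "lc_mat ?n ?\<rho> p = lc_mat ?n ?\<rho> s" by (rule Ux_rel[OF rh 1[unfolded t]])
      moreover have "lc_mat ?n \<sigma> p = lc_mat ?n ?\<rho> p" by (rule lc_mat_cong[OF ps(1) \<sigma>0])
      moreover have "lc_mat ?n \<sigma> s = lc_mat ?n ?\<rho> s" by (rule lc_mat_cong[OF ps(2) \<sigma>0])
      ultimately show ?thesis by (simp add: t)
    next
      case 2
      then consider (a) i where "t = ([(1, [Cg i, Cinv i])], [(1, [])])" | (b) i where "t = ([(1, [Cinv i, Cg i])], [(1, [])])"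
        | (c) c x where "t = ([(1, [c, x])], [(1, [x, c])])" "c \<in> central_gens" "x \<in> Uq_gens q \<union> central_gens"
        unfolding central_rels_def by blast
      then show ?thesis
      proof cases
        case (a i)
        show ?thesis unfolding a case_prod_conv using CC(1)[of i] Tc mat_adjoint_carrier[OF Tc] by (simp add: \<sigma>C sq_simps)
      next
        case (b i)
        show ?thesis unfolding b case_prod_conv using CC(2)[of i] Tc mat_adjoint_carrier[OF Tc] by (simp add: \<sigma>C sq_simps)
      next
        case (c c x)
        have x: "x \<in> X1" using c(3) by (simp add: Gens_Ux)
        show ?thesis unfolding c(1) case_prod_conv using central[OF c(2) x] cc[OF c(2)] \<sigma>c[OF x] by (simp add: sq_simps)
      qed
    qed
  next
    fix x assume x: "x \<in> X1"
    show "lc_mat ?n \<sigma> (Invol (Ux True q \<alpha>) x) = mat_adjoint (\<sigma> x)"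
    proof (cases "x \<in> X0")
      case True
      have "lc_in X0 (Invol (Ux False q \<alpha>) x)" using hopf_closed_Ux[of False q \<alpha>] True unfolding hopf_closed_def by blast
      from lc_mat_cong[OF this \<sigma>0] have "lc_mat ?n \<sigma> (Uq_invol q x) = lc_mat ?n ?\<rho> (Uq_invol q x)" by simp
      then show ?thesis using st True \<sigma>0[OF True] by (simp add: star_rep_def)
    next
      case False
      then have "x \<in> central_gens" using X1_cases[OF x] by simp
      then show ?thesis unfolding central_gens_def using Tc mat_adjoint_carrier[OF Tc] by (auto simp: \<sigma>C sq_simps)
    qed
  qed
  have \<sigma>t: "\<sigma> (torus_gen q i) = ?\<rho> (torus_gen q i)" for i by (rule \<sigma>0[OF gens_words(7)])
  have xa1: "xadmissible True \<tau> ?n \<sigma>"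
    unfolding xadmissible_def
  proof (intro conjI impI ballI allI)
    have "graded ?n \<sigma>" using graded_cong(1)[of \<sigma> ?\<rho>, OF \<sigma>t] gr by simp
    then show "admissible R \<alpha> q ?n \<sigma>" by (simp add: graded_def)
    fix \<chi> v i assume "v \<in> W ?n \<sigma> \<chi>"
    then have "v \<in> Wu Y \<chi>" using graded_cong(2)[of \<sigma> ?\<rho>, OF \<sigma>t] by simp
    then show "\<sigma> (Cg i) *\<^sub>v v = \<tau> i \<chi> \<cdot>\<^sub>v v" by (simp add: \<sigma>C Tw)
  qed
  define u where "u = coeff_corep X1 ?n \<sigma>"
  have "unitary_rep (Gx True \<tau>) u"
    unfolding Gx_def u_def using st1 xa1 by (intro star_rep_Ux_unitary_rep) simp_all
  moreover have "res u = Y"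
  proof -
    have "corep_action u x = ?\<rho> x" if "x \<in> X0" for x
      unfolding u_def using coeff_corep_action[of X1 \<sigma> ?n, OF \<sigma>c X0_X1[OF that]] \<sigma>0[OF that] by simp
    then have "coeff_corep X0 (dim_row u) (corep_action u) = coeff_corep X0 (dim_row u) ?\<rho>" by (rule coeff_corep_cong)
    then have "res u = coeff_corep X0 ?n ?\<rho>" unfolding res_def by (simp add: u_def)
    then show ?thesis using coeff_corep_corep_action[OF mY] by simp
  qed
  ultimately show ?thesis unfolding corep_rep_unitary by (intro exI conjI)
qed

text \<open>An intertwiner of the restrictions preserves weights, and the central generators act on
  both sides by a scalar depending on the weight alone; so it commutes with them as well.\<close>

lemma res_intertwiners:
  assumes u: "corep_rep True \<tau> u" and v: "corep_rep True \<tau> v"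
  shows "intertwiners (res u) (res v) = intertwiners u v"
proof (rule Set.set_eqI)
  fix T
  have mu: "mult_corep X1 u" and mv: "mult_corep X1 v" using u v by (simp_all add: corep_rep_def)
  note gu = corep_rep_graded[OF u] and gv = corep_rep_graded[OF v]
  note gru = res_graded[OF mu gu] and grv = res_graded[OF mv gv]
  have sq: "dim_col u = dim_row u" "dim_col v = dim_row v" "dim_col (res u) = dim_row (res u)" "dim_col (res v) = dim_row (res v)"
    using gu gv by (simp_all add: graded_corep_def)
  note cu = mult_corep_action_carrier[OF mu] and cv = mult_corep_action_carrier[OF mv]
  show "T \<in> intertwiners (res u) (res v) \<longleftrightarrow> T \<in> intertwiners u v"
  proof
    assume T: "T \<in> intertwiners u v"
    note Tc = intertwiners_action(1)[OF sq(1,2) T]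
    show "T \<in> intertwiners (res u) (res v)"
    proof (rule intertwiners_gensI[OF res_mult[OF mu] res_mult[OF mv]])
      fix x assume x: "x \<in> X0"
      show "T * corep_action (res u) x = corep_action (res v) x * T"
        unfolding res_action[OF mu x] res_action[OF mv x] by (rule intertwiners_action(2)[OF sq(1,2) T])
    qed (use Tc in simp)
  next
    assume T: "T \<in> intertwiners (res u) (res v)"
    have Tc: "T \<in> carrier_mat (dim_row v) (dim_row u)" using intertwiners_action(1)[OF sq(3,4) T] by simp
    have Tw: "T *\<^sub>v x \<in> Wu v \<kappa>" if "x \<in> Wu u \<kappa>" for x \<kappa>
      using intertwiner_weight[OF gru grv T, of x \<kappa>] that unfolding res_weight[OF mu] res_weight[OF mv] by simp
    have scalar: "T * corep_action u c = corep_action v c * T"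
      if "\<And>\<kappa> x. \<kappa> \<in> P \<Longrightarrow> x \<in> Wu u \<kappa> \<Longrightarrow> corep_action u c *\<^sub>v x = g \<kappa> \<cdot>\<^sub>v x"
        "\<And>\<kappa> x. \<kappa> \<in> P \<Longrightarrow> x \<in> Wu v \<kappa> \<Longrightarrow> corep_action v c *\<^sub>v x = g \<kappa> \<cdot>\<^sub>v x" for c g
    proof (rule weight_mat_eqI[OF gu mult_carrier_mat[OF Tc cu] mult_carrier_mat[OF cv Tc]])
      fix \<kappa> x assume h: "\<kappa> \<in> P" "x \<in> Wu u \<kappa>"
      show "(T * corep_action u c) *\<^sub>v x = (corep_action v c * T) *\<^sub>v x"
        unfolding assoc_mult_mat_vec[OF Tc cu W_carrier[OF h(2)]] assoc_mult_mat_vec[OF cv Tc W_carrier[OF h(2)]]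
          that(1)[OF h] that(2)[OF h(1) Tw[OF h(2)]] by (rule mult_mat_vec[OF Tc W_carrier[OF h(2)]])
    qed
    show "T \<in> intertwiners u v"
    proof (rule intertwiners_gensI[OF mu mv Tc])
      fix x assume x: "x \<in> X1"
      have w: "word_mat (dim_row u) (corep_action u) [c] = corep_action u c" "word_mat (dim_row v) (corep_action v) [c] = corep_action v c" for c
        using right_mult_one_mat[OF cu] right_mult_one_mat[OF cv] by simp_all
      show "T * corep_action u x = corep_action v x * T"
      proof (cases "x \<in> X0")
        case True
        show ?thesis using intertwiners_action(2)[OF sq(3,4) T, of x] unfolding res_action[OF mu True] res_action[OF mv True] .
      next
        case False
        then have "x \<in> central_gens" using x by (simp add: Gens_Ux)
        then obtain i where "x = Cg i \<or> x = Cinv i" unfolding central_gens_def by blast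
        then show ?thesis
        proof
          assume x: "x = Cg i"
          show ?thesis
            unfolding x using corep_rep_words(1)[OF u, of _ _ i] corep_rep_words(1)[OF v, of _ _ i]
            by (intro scalar[of _ "C_weight True i"]) (simp_all add: Cw_def w del: word_mat_simps)
        next
          assume x: "x = Cinv i"
          show ?thesis
            unfolding x using corep_rep_words(2)[OF u, of _ _ i] corep_rep_words(2)[OF v, of _ _ i]
            by (intro scalar[of _ "\<lambda>\<kappa>. inverse (C_weight True i \<kappa>)"]) (simp_all add: Cinvw_def w del: word_mat_simps)
        qed
      qed
    qed
  qed
qed

section \<open>The unit object and the coherence conditions\<close>

definition unit_corep :: "bool \<Rightarrow> 'r gen corep" where
  "unit_corep b = mat 1 1 (\<lambda>_. FOne (Gx b \<tau>))"

lemma unit_dim [simp]: "dim_row (unit_corep b) = 1" "dim_col (unit_corep b) = 1"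
  by (simp_all add: unit_corep_def)

lemma unit_eval: "eval_mat (unit_corep b) w =
    (if set w \<subseteq> Gens (Ux b q \<alpha>) then (\<Prod>x\<leftarrow>w. Uq_counit x) \<cdot>\<^sub>m 1\<^sub>m 1 else 0\<^sub>m 1 1)"
  by (cases "set w \<subseteq> Gens (Ux b q \<alpha>)"; rule eq_matI) (simp_all add: unit_corep_def eval_mat_def Gx_def on_words_simps)

lemma unit_mult: "mult_corep (Gens (Ux b q \<alpha>)) (unit_corep b)"
  unfolding mult_corep_def unit_dim
proof (intro conjI allI impI)
  fix v w assume "set v \<subseteq> Gens (Ux b q \<alpha>)" "set w \<subseteq> Gens (Ux b q \<alpha>)"
  then show "eval_mat (unit_corep b) (v @ w) = eval_mat (unit_corep b) v * eval_mat (unit_corep b) w"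
    unfolding unit_eval by (auto intro!: eq_matI simp: scalar_prod_def)
qed (simp_all add: unit_eval)

lemma unit_action: "x \<in> Gens (Ux b q \<alpha>) \<Longrightarrow> corep_action (unit_corep b) x = Uq_counit x \<cdot>\<^sub>m 1\<^sub>m 1"
  unfolding corep_action_eq unit_eval by simp

lemma counit_torus_gen: "Uq_counit (torus_gen q i) = of_real (torus_eigenvalue q \<alpha> 0 i)"
  using q0 unfolding torus_gen_def torus_eigenvalue_def by (cases "q = 1") simp_all

lemma unit_weight: "v \<in> carrier_vec 1 \<Longrightarrow> v \<in> Wu (unit_corep b) 0"
  unfolding weight_space_iff unit_dim unit_action[OF gens_words(7)] counit_torus_gen
  by (simp add: smult_mult_mat_vec[OF one_carrier_mat[of 1]] del: One_nat_def)

lemma unit_graded: "graded_corep (unit_corep b)"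
  unfolding graded_corep_def graded_def
proof (intro conjI allI)
  have c: "corep_action (unit_corep b) (torus_gen q i) = (if q = 1 then 0 else 1) \<cdot>\<^sub>m 1\<^sub>m 1" for i
    unfolding unit_action[OF gens_words(7)] by (simp add: torus_gen_def)
  show "corep_action (unit_corep b) (torus_gen q i) \<in> carrier_mat (dim_row (unit_corep b)) (dim_row (unit_corep b))" for i
    unfolding c by simp
  show "mat_adjoint (corep_action (unit_corep b) (torus_gen q i)) = corep_action (unit_corep b) (torus_gen q i)" for i
    unfolding c by (simp add: mat_adjoint_smult)
  show "admissible R \<alpha> q (dim_row (unit_corep b)) (corep_action (unit_corep b))"
  proof (rule admissibleI)
    show "corep_action (unit_corep b) (torus_gen q i) \<in> carrier_mat (dim_row (unit_corep b)) (dim_row (unit_corep b))" for i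
      unfolding c by simp
    show "carrier_vec (dim_row (unit_corep b)) \<subseteq> vspan (dim_row (unit_corep b)) (\<Union>\<chi>\<in>P. Wu (unit_corep b) \<chi>)"
    proof
      fix v :: "complex vec" assume "v \<in> carrier_vec (dim_row (unit_corep b))"
      then have "v \<in> Wu (unit_corep b) 0" using unit_weight by simp
      then have "v \<in> (\<Union>\<chi>\<in>P. Wu (unit_corep b) \<chi>)" using P_zero by (intro UN_iff[THEN iffD2] bexI)
      then show "v \<in> vspan (dim_row (unit_corep b)) (\<Union>\<chi>\<in>P. Wu (unit_corep b) \<chi>)" by (rule vspan_base)
    qed
  qed
qed simp

text \<open>Every vector of the unit object has weight 0, and some torus generator tells
  \<open>\<kappa>\<close> from 0, so two different eigenvalues act on \<open>v\<close>.\<close>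

lemma unit_weight_zero:
  assumes "v \<in> Wu (unit_corep b) \<kappa>" "\<kappa> \<noteq> 0"
  shows "v = 0\<^sub>v 1"
proof -
  obtain i where i: "torus_eigenvalue q \<alpha> \<kappa> i \<noteq> torus_eigenvalue q \<alpha> 0 i" using torus_eigenvalue_separates[OF assms(2)] by blast
  have vc: "v \<in> carrier_vec 1" using W_carrier[OF assms(1)] by simp
  let ?A = "corep_action (unit_corep b) (torus_gen q i)"
  have "?A *\<^sub>v v = of_real (torus_eigenvalue q \<alpha> \<kappa> i) \<cdot>\<^sub>v v" using assms(1) by (simp add: weight_space_iff)
  moreover have "?A *\<^sub>v v = of_real (torus_eigenvalue q \<alpha> 0 i) \<cdot>\<^sub>v v" using unit_weight[OF vc] by (simp add: weight_space_iff)
  ultimately have e: "of_real (torus_eigenvalue q \<alpha> \<kappa> i) \<cdot>\<^sub>v v = complex_of_real (torus_eigenvalue q \<alpha> 0 i) \<cdot>\<^sub>v v" by simp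
  have "v $ 0 = 0"
    using arg_cong[OF e, of "\<lambda>v. v $ 0"] vc i by simp
  then show ?thesis using vc by (intro eq_vecI) auto
qed

lemma res_unit: "res (unit_corep True) = unit_corep False"
proof -
  have "res (unit_corep True) = coeff_corep X0 (dim_row (unit_corep False)) (corep_action (unit_corep False))"
    unfolding res_def unit_dim by (rule coeff_corep_cong) (simp add: unit_action X0_X1)
  then show ?thesis using coeff_corep_corep_action[OF unit_mult] by simp
qed

text \<open>
  That an operator acting by the cocycle exists at all is seen here: it is the product of the four
  twists in the coherence diagram.
\<close>

lemma hexagon:
  assumes u: "corep_rep True \<tau> u" and v: "corep_rep True \<tau> v" and w: "corep_rep True \<tau> w"
  shows "twist u (tens1 v w) * (kron (1\<^sub>m (dim_row u)) (twist v w) *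
      twisted_assoc R \<alpha> q (twist_cocycle f) (res u) (res v) (res w)) =
    twist (tens1 u v) w * kron (twist u v) (1\<^sub>m (dim_row w))"
proof -
  let ?n = "dim_row u" and ?m = "dim_row v" and ?l = "dim_row w"
  let ?N = "?n * ?m * ?l"
  have N: "?n * (?m * ?l) = ?N" by (simp add: mult.assoc)
  interpret square_matrices ?N .
  have mu: "mult_corep X1 u" and mv: "mult_corep X1 v" and mw: "mult_corep X1 w" using u v w by (simp_all add: corep_rep_def)
  note gu = corep_rep_graded[OF u] and gv = corep_rep_graded[OF v] and gw = corep_rep_graded[OF w]
  note guv = graded_tensor[OF mu mv gu gv, of \<tau>] and gvw = graded_tensor[OF mv mw gv gw, of \<tau>]
  define A where "A = twist u (tens1 v w)"
  define B where "B = kron (1\<^sub>m ?n) (twist v w)"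
  define C where "C = twist (tens1 u v) w"
  define D where "D = kron (twist u v) (1\<^sub>m ?l)"
  have Ac: "A \<in> carrier_mat ?N ?N" using twist_props(1)[OF gu gvw] by (simp add: A_def N)
  have Bc: "B \<in> carrier_mat ?N ?N" using kron_carrier[OF one_carrier_mat[of ?n] twist_props(1)[OF gv gw], of "(*)"] by (simp add: B_def N)
  have Cc: "C \<in> carrier_mat ?N ?N" using twist_props(1)[OF guv gw] by (simp add: C_def)
  have Dc: "D \<in> carrier_mat ?N ?N" using kron_carrier[OF twist_props(1)[OF gu gv] one_carrier_mat[of ?l], of "(*)"] by (simp add: D_def)
  \<comment> \<open>Unitarity of \<open>A\<close> and \<open>B\<close> allows the claimed equation
    to be solved for the associator.\<close>
  have AA: "A * mat_adjoint A = 1\<^sub>m ?N" using twist_unitary(2)[OF gu gvw] by (simp add: A_def N)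
  have Badj: "mat_adjoint B = kron (1\<^sub>m ?n) (mat_adjoint (twist v w))" by (simp add: B_def mat_adjoint_kron)
  have BB: "B * mat_adjoint B = 1\<^sub>m ?N"
    unfolding Badj unfolding B_def
      kron_mult_kron[OF one_carrier_mat twist_props(1)[OF gv gw] one_carrier_mat mat_adjoint_carrier[OF twist_props(1)[OF gv gw]]]
      twist_unitary(2)[OF gv gw] by (simp add: kron_one N)
  have "twisted_assoc R \<alpha> q (twist_cocycle f) (res u) (res v) (res w) = mat_adjoint B * (mat_adjoint A * (C * D))"
  proof (rule twisted_assoc_eqI[OF res_graded[OF mu gu] res_graded[OF mv gv] res_graded[OF mw gw]])
    show "mat_adjoint B * (mat_adjoint A * (C * D)) \<in> carrier_mat (dim_row (res u) * dim_row (res v) * dim_row (res w))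
        (dim_row (res u) * dim_row (res v) * dim_row (res w))" using Ac Bc Cc Dc by simp
    fix \<kappa> \<mu> \<nu> x y z assume \<kappa>: "\<kappa> \<in> P" and \<mu>: "\<mu> \<in> P" and \<nu>: "\<nu> \<in> P"
      and "x \<in> Wu (res u) \<kappa>" "y \<in> Wu (res v) \<mu>" "z \<in> Wu (res w) \<nu>"
    then have x: "x \<in> Wu u \<kappa>" and y: "y \<in> Wu v \<mu>" and z: "z \<in> Wu w \<nu>"
      by (simp_all only: res_weight[OF mu] res_weight[OF mv] res_weight[OF mw])
    note xc = W_carrier[OF x] and yc = W_carrier[OF y] and zc = W_carrier[OF z]
    let ?t = "kron_vec (kron_vec x y) z"
    have tc: "?t \<in> carrier_vec ?N" using xc yc zc by simp
    \<comment> \<open>\<open>A\<close> and \<open>B\<close> belong to the bracketing on the right,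
      \<open>C\<close> and \<open>D\<close> to that on the left; all four are evaluated at this one
      vector.\<close>
    have t': "?t = kron_vec x (kron_vec y z)" by (rule kron_vec_assoc)
    have D: "D *\<^sub>v ?t = f \<kappa> \<mu> \<cdot>\<^sub>v ?t"
      unfolding D_def kron_mult_kron_vec[OF twist_props(1)[OF gu gv] one_carrier_mat kron_vec_carrier[OF xc yc] zc]
        twist_props(2)[OF gu gv \<kappa> \<mu> x y] kron_vec_smult using zc by simp
    have C: "C *\<^sub>v ?t = f (\<kappa> + \<mu>) \<nu> \<cdot>\<^sub>v ?t"
      unfolding C_def by (rule twist_props(2)[OF guv gw P_add[OF \<kappa> \<mu>] \<nu> torus_tensor(1)[OF mu mv gu gv x y] z])
    have A: "mat_adjoint A *\<^sub>v ?t = cnj (f \<kappa> (\<mu> + \<nu>)) \<cdot>\<^sub>v ?t"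
      unfolding A_def t' by (rule twist_props(3)[OF gu gvw \<kappa> P_add[OF \<mu> \<nu>] x torus_tensor(1)[OF mv mw gv gw y z]])
    have B: "mat_adjoint B *\<^sub>v ?t = cnj (f \<mu> \<nu>) \<cdot>\<^sub>v ?t"
      unfolding Badj t' kron_mult_kron_vec[OF one_carrier_mat mat_adjoint_carrier[OF twist_props(1)[OF gv gw]] xc kron_vec_carrier[OF yc zc]]
        twist_props(3)[OF gv gw \<mu> \<nu> y z] kron_vec_smult using xc by simp
    note Ac' = mat_adjoint_carrier[OF Ac] and Bc' = mat_adjoint_carrier[OF Bc]
    have "(mat_adjoint B * (mat_adjoint A * (C * D))) *\<^sub>v ?t =
        (f \<kappa> \<mu> * (f (\<kappa> + \<mu>) \<nu> * (cnj (f \<kappa> (\<mu> + \<nu>)) * cnj (f \<mu> \<nu>)))) \<cdot>\<^sub>v ?t"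
      unfolding assoc_mult_mat_vec[OF Bc' mult_carrier_mat[OF Ac' mult_carrier_mat[OF Cc Dc]] tc]
        assoc_mult_mat_vec[OF Ac' mult_carrier_mat[OF Cc Dc] tc] assoc_mult_mat_vec[OF Cc Dc tc]
        D mult_mat_vec[OF Cc tc] C mult_mat_vec[OF Ac' smult_carrier_vec[THEN iffD2, OF tc]] mult_mat_vec[OF Ac' tc] A
        mult_mat_vec[OF Bc' smult_carrier_vec[THEN iffD2, OF smult_carrier_vec[THEN iffD2, OF tc]]]
        mult_mat_vec[OF Bc' smult_carrier_vec[THEN iffD2, OF tc]] mult_mat_vec[OF Bc' tc] B
      by (simp add: smult_smult_assoc mult_ac)
    also have "f \<kappa> \<mu> * (f (\<kappa> + \<mu>) \<nu> * (cnj (f \<kappa> (\<mu> + \<nu>)) * cnj (f \<mu> \<nu>))) = twist_cocycle f \<kappa> \<mu> \<nu>"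
      using \<kappa> \<mu> \<nu> by (simp add: twist_cocycle_def coboundary_def f_cnj P_add)
    finally show "(mat_adjoint B * (mat_adjoint A * (C * D))) *\<^sub>v ?t = twist_cocycle f \<kappa> \<mu> \<nu> \<cdot>\<^sub>v ?t" .
  qed
  moreover have "A * (B * (mat_adjoint B * (mat_adjoint A * (C * D)))) = C * D"
    using cancel_left[OF BB Bc mat_adjoint_carrier[OF Bc], of "mat_adjoint A * (C * D)"]
      cancel_left[OF AA Ac mat_adjoint_carrier[OF Ac], of "C * D"] Ac Cc Dc by simp
  ultimately show ?thesis by (simp add: A_def B_def C_def D_def)
qed

end

context twist_data
begin

text \<open>At the unit the cocycle collapses: it is \<open>f 0 0 / f 0 \<nu>\<close> at
  \<open>(0, 0, \<nu>)\<close> and \<open>f \<nu> 0 / f 0 0\<close> at \<open>(\<nu>, 0, 0)\<close>.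
  Up to the factor \<open>f 0 0\<close> these are the eigenvalues of the twists with the unit
  object, the first after passing to the adjoint.\<close>

lemma twisted_unit:
  assumes u: "corep_rep True \<tau> u"
  shows "inverse (f 0 0) \<cdot>\<^sub>m twist (unit_corep True) u =
      mat_adjoint (twisted_assoc R \<alpha> q (twist_cocycle f) (unit_corep False) (unit_corep False) (res u))"
    and "inverse (f 0 0) \<cdot>\<^sub>m twist u (unit_corep True) =
      twisted_assoc R \<alpha> q (twist_cocycle f) (res u) (unit_corep False) (unit_corep False)"
proof -
  let ?n = "dim_row u"
  have mu: "mult_corep X1 u" using u by (simp add: corep_rep_def)
  note gu = corep_rep_graded[OF u] and g0 = unit_graded
  note f00 = f_cnj[OF P_zero P_zero] f_nonzero[OF P_zero P_zero]
  have zero: "a = 0\<^sub>v 1 \<or> \<kappa> = 0" if "a \<in> Wu (unit_corep False) \<kappa>" for a \<kappa>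
    using unit_weight_zero[OF that] by blast
  have ab: "kron_vec a b \<in> Wu (unit_corep True) 0" if "a \<in> carrier_vec 1" "b \<in> carrier_vec 1" for a b
    using kron_vec_carrier[OF that] by (intro unit_weight) simp
  have T1: "twist (unit_corep True) u \<in> carrier_mat ?n ?n" using twist_props(1)[OF g0 gu] by simp
  have T2: "twist u (unit_corep True) \<in> carrier_mat ?n ?n" using twist_props(1)[OF gu g0] by simp
  have "twisted_assoc R \<alpha> q (twist_cocycle f) (unit_corep False) (unit_corep False) (res u) =
      f 0 0 \<cdot>\<^sub>m mat_adjoint (twist (unit_corep True) u)"
  proof (rule twisted_assoc_eqI[OF g0 g0 res_graded[OF mu gu]])
    show "f 0 0 \<cdot>\<^sub>m mat_adjoint (twist (unit_corep True) u) \<in>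
        carrier_mat (dim_row (unit_corep False) * dim_row (unit_corep False) * dim_row (res u))
          (dim_row (unit_corep False) * dim_row (unit_corep False) * dim_row (res u))"
      using mat_adjoint_carrier[OF T1] by simp
    fix \<kappa> \<mu> \<nu> a b z assume \<kappa>: "\<kappa> \<in> P" and \<mu>: "\<mu> \<in> P" and \<nu>: "\<nu> \<in> P"
      and a: "a \<in> Wu (unit_corep False) \<kappa>" and b: "b \<in> Wu (unit_corep False) \<mu>" and z: "z \<in> Wu (res u) \<nu>"
    have z': "z \<in> Wu u \<nu>" using z by (simp only: res_weight[OF mu])
    note ac = W_carrier[OF a, unfolded unit_dim] and bc = W_carrier[OF b, unfolded unit_dim] and zc = W_carrier[OF z']
    have tc: "kron_vec (kron_vec a b) z \<in> carrier_vec ?n" using kron_vec_carrier[OF kron_vec_carrier[OF ac bc] zc] by simp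
    show "(f 0 0 \<cdot>\<^sub>m mat_adjoint (twist (unit_corep True) u)) *\<^sub>v kron_vec (kron_vec a b) z =
        twist_cocycle f \<kappa> \<mu> \<nu> \<cdot>\<^sub>v kron_vec (kron_vec a b) z"
    \<comment> \<open>A nonzero vector of the unit object has weight 0, so apart from zero products
      only the value at \<open>(0, 0, \<nu>)\<close> matters.\<close>
    proof (cases "a = 0\<^sub>v 1 \<or> b = 0\<^sub>v 1")
      case True
      then have "kron_vec (kron_vec a b) z = 0\<^sub>v ?n" using ac bc zc by auto
      then show ?thesis using mult_mat_zero_vec[OF smult_carrier_mat[OF mat_adjoint_carrier[OF T1]]] by simp
    next
      case False
      then have 0: "\<kappa> = 0" "\<mu> = 0" using zero[OF a] zero[OF b] by blast+
      have "mat_adjoint (twist (unit_corep True) u) *\<^sub>v kron_vec (kron_vec a b) z = cnj (f 0 \<nu>) \<cdot>\<^sub>v kron_vec (kron_vec a b) z"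
        by (rule twist_props(3)[OF g0 gu P_zero \<nu> ab[OF ac bc] z'])
      moreover have "twist_cocycle f 0 0 \<nu> = f 0 0 * cnj (f 0 \<nu>)"
        using f_cnj[OF P_zero \<nu>] f_nonzero[OF P_zero \<nu>] f00 by (simp add: twist_cocycle_def coboundary_def)
      ultimately show ?thesis
        unfolding smult_mult_mat_vec[OF mat_adjoint_carrier[OF T1] tc] 0 by (simp add: smult_smult_assoc)
    qed
  qed
  then show "inverse (f 0 0) \<cdot>\<^sub>m twist (unit_corep True) u =
      mat_adjoint (twisted_assoc R \<alpha> q (twist_cocycle f) (unit_corep False) (unit_corep False) (res u))"
    by (simp add: mat_adjoint_smult f00)
  show "inverse (f 0 0) \<cdot>\<^sub>m twist u (unit_corep True) =
      twisted_assoc R \<alpha> q (twist_cocycle f) (res u) (unit_corep False) (unit_corep False)"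
  proof (rule twisted_assoc_eqI[OF res_graded[OF mu gu] g0 g0, symmetric])
    show "inverse (f 0 0) \<cdot>\<^sub>m twist u (unit_corep True) \<in>
        carrier_mat (dim_row (res u) * dim_row (unit_corep False) * dim_row (unit_corep False))
          (dim_row (res u) * dim_row (unit_corep False) * dim_row (unit_corep False))"
      using T2 by simp
    fix \<nu> \<kappa> \<mu> z a b assume \<nu>: "\<nu> \<in> P" and \<kappa>: "\<kappa> \<in> P" and \<mu>: "\<mu> \<in> P"
      and z: "z \<in> Wu (res u) \<nu>" and a: "a \<in> Wu (unit_corep False) \<kappa>" and b: "b \<in> Wu (unit_corep False) \<mu>"
    have z': "z \<in> Wu u \<nu>" using z by (simp only: res_weight[OF mu])
    note ac = W_carrier[OF a, unfolded unit_dim] and bc = W_carrier[OF b, unfolded unit_dim] and zc = W_carrier[OF z']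
    have tc: "kron_vec (kron_vec z a) b \<in> carrier_vec ?n" using kron_vec_carrier[OF kron_vec_carrier[OF zc ac] bc] by simp
    show "(inverse (f 0 0) \<cdot>\<^sub>m twist u (unit_corep True)) *\<^sub>v kron_vec (kron_vec z a) b =
        twist_cocycle f \<nu> \<kappa> \<mu> \<cdot>\<^sub>v kron_vec (kron_vec z a) b"
    proof (cases "a = 0\<^sub>v 1 \<or> b = 0\<^sub>v 1")
      case True
      then have "kron_vec (kron_vec z a) b = 0\<^sub>v ?n" using ac bc zc by auto
      then show ?thesis using mult_mat_zero_vec[OF smult_carrier_mat[OF T2]] by simp
    next
      case False
      then have 0: "\<kappa> = 0" "\<mu> = 0" using zero[OF a] zero[OF b] by blast+
      have "twist u (unit_corep True) *\<^sub>v kron_vec (kron_vec z a) b = f \<nu> 0 \<cdot>\<^sub>v kron_vec (kron_vec z a) b"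
        unfolding kron_vec_assoc by (rule twist_props(2)[OF gu g0 \<nu> P_zero z' ab[OF ac bc]])
      moreover have "twist_cocycle f \<nu> 0 0 = inverse (f 0 0) * f \<nu> 0"
        using f_cnj[OF \<nu> P_zero] f_nonzero[OF \<nu> P_zero] f00 by (simp add: twist_cocycle_def coboundary_def)
      ultimately show ?thesis
        unfolding smult_mult_mat_vec[OF T2 tc] 0 by (simp add: smult_smult_assoc)
    qed
  qed
qed

section \<open>Assembling the equivalence\<close>

lemma Rep_simps:
  "Obj (Rep G) = {u. unitary_rep G u}" "Hom (Rep G) = intertwiners" "Idm (Rep G) = (\<lambda>u. 1\<^sub>m (dim_row u))"
  "Comp (Rep G) = (*)" "Add (Rep G) = (+)" "Scale (Rep G) = (\<cdot>\<^sub>m)" "Adj (Rep G) = mat_adjoint"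
  "TensO (Rep G) = kron_with (FMult G)" "TensM (Rep G) = kron" "One (Rep G) = mat 1 1 (\<lambda>_. FOne G)"
  "Assoc (Rep G) = (\<lambda>u v w. 1\<^sub>m (dim_row u * dim_row v * dim_row w))"
  "LUnit (Rep G) = (\<lambda>u. 1\<^sub>m (dim_row u))" "RUnit (Rep G) = (\<lambda>u. 1\<^sub>m (dim_row u))"
  by (simp_all add: Rep_def)

lemma twisted_Rep_simps:
  "Obj (twisted_Rep R \<alpha> q \<Phi>) = {u. unitary_rep (Gq R \<alpha> q) u}" "Hom (twisted_Rep R \<alpha> q \<Phi>) = intertwiners"
  "Idm (twisted_Rep R \<alpha> q \<Phi>) = (\<lambda>u. 1\<^sub>m (dim_row u))"
  "Comp (twisted_Rep R \<alpha> q \<Phi>) = (*)" "Add (twisted_Rep R \<alpha> q \<Phi>) = (+)" "Scale (twisted_Rep R \<alpha> q \<Phi>) = (\<cdot>\<^sub>m)"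
  "Adj (twisted_Rep R \<alpha> q \<Phi>) = mat_adjoint"
  "TensO (twisted_Rep R \<alpha> q \<Phi>) = kron_with (FMult (Gq R \<alpha> q))" "TensM (twisted_Rep R \<alpha> q \<Phi>) = kron"
  "One (twisted_Rep R \<alpha> q \<Phi>) = mat 1 1 (\<lambda>_. FOne (Gq R \<alpha> q))"
  "Assoc (twisted_Rep R \<alpha> q \<Phi>) = twisted_assoc R \<alpha> q \<Phi>"
  "LUnit (twisted_Rep R \<alpha> q \<Phi>) = (\<lambda>u. mat_adjoint (twisted_assoc R \<alpha> q \<Phi> (mat 1 1 (\<lambda>_. FOne (Gq R \<alpha> q))) (mat 1 1 (\<lambda>_. FOne (Gq R \<alpha> q))) u))"
  "RUnit (twisted_Rep R \<alpha> q \<Phi>) = (\<lambda>u. twisted_assoc R \<alpha> q \<Phi> u (mat 1 1 (\<lambda>_. FOne (Gq R \<alpha> q))) (mat 1 1 (\<lambda>_. FOne (Gq R \<alpha> q))))"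
  by (simp_all add: twisted_Rep_def Rep_def Let_def)

abbreviation CC where "CC \<equiv> Rep (Gq_tau R \<alpha> q \<tau>)"
abbreviation DD where "DD \<equiv> twisted_Rep R \<alpha> q (twist_cocycle f)"

lemma unitary_rep_eq: "unitary_rep (Gx b \<tau>) = corep_rep b \<tau>"
  by (rule ext) (rule corep_rep_unitary)

lemma CC_simps: "Obj CC = {u. corep_rep True \<tau> u}" "TensO CC = tens1" "One CC = unit_corep True"
  unfolding Rep_simps by (simp_all only: Gx_simps(2)[of \<tau>, symmetric] unitary_rep_eq unit_corep_def)

lemma DD_simps: "Obj DD = {u. corep_rep False \<tau> u}" "TensO DD = tens0" "One DD = unit_corep False"
  "LUnit DD = (\<lambda>u. mat_adjoint (twisted_assoc R \<alpha> q (twist_cocycle f) (unit_corep False) (unit_corep False) u))"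
  "RUnit DD = (\<lambda>u. twisted_assoc R \<alpha> q (twist_cocycle f) u (unit_corep False) (unit_corep False))"
  unfolding twisted_Rep_simps by (simp_all only: Gx_simps(1)[of \<tau>, symmetric] unitary_rep_eq unit_corep_def)

lemmas cat_simps = CC_simps DD_simps Rep_simps(2-7,9,11-13) twisted_Rep_simps(2-7,9,11)

lemma res_linear_star_functor: "linear_star_functor CC DD res (\<lambda>U V S. S)"
  unfolding linear_star_functor_def cat_simps
  using res_rep res_intertwiners by (simp add: corep_rep_def)

text \<open>Morphism spaces are literally equal by \<open>res_intertwiners\<close>, and every object
  of the target is a restriction, so identity matrices serve as the comparison unitaries.\<close>

lemma res_equivalence_functor: "equivalence_functor CC DD res (\<lambda>U V S. S)"
  unfolding equivalence_functor_def cat_simps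
proof (intro conjI ballI)
  fix u v assume "u \<in> {u. corep_rep True \<tau> u}" "v \<in> {u. corep_rep True \<tau> u}"
  then show "bij_betw (\<lambda>S. S) (intertwiners u v) (intertwiners (res u) (res v))"
    using res_intertwiners[of u v] by (simp add: bij_betw_def)
next
  fix Y assume "Y \<in> {u. corep_rep False \<tau> u}"
  then have Y: "corep_rep False \<tau> Y" by simp
  from res_surj[OF Y] obtain u where u: "corep_rep True \<tau> u" "res u = Y" by (elim exE conjE)
  have mY: "mult_corep X0 Y" using Y by (simp add: corep_rep_def)
  have "1\<^sub>m (dim_row Y) \<in> intertwiners Y Y"
    by (rule intertwiners_gensI[OF mY mY]) (simp_all add: mult_corep_action_carrier[OF mY] left_mult_one_mat[OF mult_corep_action_carrier[OF mY]] right_mult_one_mat[OF mult_corep_action_carrier[OF mY]])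
  then have "unitary_mor DD (res u) Y (1\<^sub>m (dim_row Y))"
    unfolding unitary_mor_def cat_simps u(2) by simp
  then show "\<exists>U\<in>{u. corep_rep True \<tau> u}. \<exists>T. unitary_mor DD (res U) Y T" using u(1) by blast
qed

text \<open>The scalar \<open>inverse (f 0 0)\<close> is unitary because \<open>f\<close> has
  modulus 1, and it is the scalar with which \<open>twisted_unit\<close> yields both unit
  conditions.\<close>

lemma twist_unitary_tensor_structure:
  "unitary_tensor_structure CC DD res (\<lambda>U V S. S) (inverse (f 0 0) \<cdot>\<^sub>m 1\<^sub>m 1) twist"
  unfolding unitary_tensor_structure_def
proof (intro conjI ballI)
  let ?e = "inverse (f 0 0) \<cdot>\<^sub>m 1\<^sub>m 1 :: complex mat"
  note f00 = f_cnj[OF P_zero P_zero] f_nonzero[OF P_zero P_zero]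
  have ec: "?e \<in> carrier_mat 1 1" by simp
  show "unitary_mor DD (One DD) (res (One CC)) ?e"
    unfolding unitary_mor_def cat_simps res_unit
  proof (intro conjI)
    note ac = mult_corep_action_carrier[OF unit_mult, unfolded unit_dim]
    show "?e \<in> intertwiners (unit_corep False) (unit_corep False)"
    proof (rule intertwiners_gensI[OF unit_mult unit_mult])
      fix x
      have A: "corep_action (unit_corep False) x \<in> carrier_mat 1 1" by (rule ac)
      show "?e * corep_action (unit_corep False) x = corep_action (unit_corep False) x * ?e"
        unfolding mult_smult_assoc_mat[OF one_carrier_mat A] mult_smult_distrib[OF A one_carrier_mat]
          left_mult_one_mat[OF A] right_mult_one_mat[OF A] ..
    qed simp
    have "mat_adjoint ?e * ?e = (cnj (inverse (f 0 0)) * inverse (f 0 0)) \<cdot>\<^sub>m 1\<^sub>m 1"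
      "?e * mat_adjoint ?e = (cnj (inverse (f 0 0)) * inverse (f 0 0)) \<cdot>\<^sub>m 1\<^sub>m 1"
      unfolding mat_adjoint_smult mat_adjoint_one by (auto intro!: eq_matI simp: scalar_prod_def)
    moreover have "cnj (inverse (f 0 0)) * inverse (f 0 0) = 1" using f00 by simp
    ultimately show "mat_adjoint ?e * ?e = 1\<^sub>m (dim_row (unit_corep False))" "?e * mat_adjoint ?e = 1\<^sub>m (dim_row (unit_corep False))"
      by simp_all
  qed
  {
    fix U V assume "U \<in> Obj CC" "V \<in> Obj CC"
    then have u: "corep_rep True \<tau> U" and v: "corep_rep True \<tau> V" by (simp_all add: CC_simps)
    show "unitary_mor DD (TensO DD (res U) (res V)) (res (TensO CC U V)) (twist U V)"
      unfolding unitary_mor_def cat_simps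
      using twist_intertwiner[OF u v] twist_unitary[OF corep_rep_graded[OF u] corep_rep_graded[OF v]] by simp
  }
  {
    fix U U' V V' S T assume "U \<in> Obj CC" "U' \<in> Obj CC" "V \<in> Obj CC" "V' \<in> Obj CC" "S \<in> Hom CC U U'" "T \<in> Hom CC V V'"
    then show "Comp DD (twist U' V') (TensM DD S T) = Comp DD (TensM CC S T) (twist U V)"
      unfolding cat_simps by (intro twist_natural) (simp_all add: corep_rep_graded)
  }
  {
    fix U V W assume "U \<in> Obj CC" "V \<in> Obj CC" "W \<in> Obj CC"
    then have u: "corep_rep True \<tau> U" and v: "corep_rep True \<tau> V" and w: "corep_rep True \<tau> W" by (simp_all add: CC_simps)
    have mu: "mult_corep X1 U" and mv: "mult_corep X1 V" using u v by (simp_all add: corep_rep_def)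
    note gu = corep_rep_graded[OF u] and gv = corep_rep_graded[OF v] and gw = corep_rep_graded[OF w]
    have c: "twist (tens1 U V) W * kron (twist U V) (1\<^sub>m (dim_row W)) \<in>
        carrier_mat (dim_row U * dim_row V * dim_row W) (dim_row U * dim_row V * dim_row W)"
      using mult_carrier_mat[OF twist_props(1)[OF graded_tensor[OF mu mv gu gv, of \<tau>] gw, unfolded kron_with_dim]
          kron_carrier[OF twist_props(1)[OF gu gv] one_carrier_mat]] by simp
    show "Comp DD (twist U (TensO CC V W))
          (Comp DD (TensM DD (Idm DD (res U)) (twist V W)) (Assoc DD (res U) (res V) (res W))) =
        Comp DD (Assoc CC U V W)
          (Comp DD (twist (TensO CC U V) W) (TensM DD (twist U V) (Idm DD (res W))))"
      unfolding cat_simps res_dim hexagon[OF u v w] left_mult_one_mat[OF c] ..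
  }
  {
    fix U assume "U \<in> Obj CC"
    then have u: "corep_rep True \<tau> U" by (simp add: CC_simps)
    note gu = corep_rep_graded[OF u]
    have c: "twist (unit_corep True) U \<in> carrier_mat (dim_row U) (dim_row U)" "twist U (unit_corep True) \<in> carrier_mat (dim_row U) (dim_row U)"
      using twist_props(1)[OF unit_graded gu] twist_props(1)[OF gu unit_graded] by simp_all
    have k: "kron ?e (1\<^sub>m (dim_row U)) = inverse (f 0 0) \<cdot>\<^sub>m 1\<^sub>m (dim_row U)" "kron (1\<^sub>m (dim_row U)) ?e = inverse (f 0 0) \<cdot>\<^sub>m 1\<^sub>m (dim_row U)"
      unfolding kron_smult kron_one by simp_all
    have s: "1\<^sub>m (dim_row U) * (T * (inverse (f 0 0) \<cdot>\<^sub>m 1\<^sub>m (dim_row U))) = inverse (f 0 0) \<cdot>\<^sub>m T"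
      if "T \<in> carrier_mat (dim_row U) (dim_row U)" for T
      unfolding mult_smult_distrib[OF that one_carrier_mat] right_mult_one_mat[OF that]
      by (rule left_mult_one_mat[OF smult_carrier_mat[OF that]])
    show "Comp DD (LUnit CC U) (Comp DD (twist (One CC) U) (TensM DD ?e (Idm DD (res U)))) = LUnit DD (res U)"
      unfolding cat_simps res_dim k s[OF c(1)] by (rule twisted_unit(1)[OF u])
    show "Comp DD (RUnit CC U) (Comp DD (twist U (One CC)) (TensM DD (Idm DD (res U)) ?e)) = RUnit DD (res U)"
      unfolding cat_simps res_dim k s[OF c(2)] by (rule twisted_unit(2)[OF u])
  }
qed

end

theorem corollary2p4:
  fixes R :: "'e::euclidean_space set"
    and \<alpha> :: "'r::finite \<Rightarrow> 'e"
    and q :: real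
    and \<tau> :: "'r \<Rightarrow> 'e \<Rightarrow> complex"
    and f :: "'e \<Rightarrow> 'e \<Rightarrow> complex"
  assumes "root_system R" and "simple_roots R \<alpha>" and "normalized_form R"
    and "q > 0"
    and "\<forall>i. \<tau> i \<in> center R \<alpha>"
    and "twist_function R \<alpha> \<tau> f"
  shows "unitarily_monoidally_equivalent
    (Rep (Gq_tau R \<alpha> q \<tau>)) (twisted_Rep R \<alpha> q (twist_cocycle f))"
proof -
  interpret twist_data R \<alpha> q \<tau> f
    by unfold_locales (use assms in auto)
  show ?thesis
    unfolding unitarily_monoidally_equivalent_def
    using res_linear_star_functor res_equivalence_functor twist_unitary_tensor_structure
    by (intro exI conjI)
qed

end
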